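(* Assume $H$ is twice continuously differentiable in a neighborhood of $\beta^*$. Let $W=(W_1,\dots,W_t)$ be exchangeable bootstrap weights with constant $c>0$ (as defined in the context), and let $$\beta^{\mathrm{boot}}_{\mathrm{ex}}=\operatorname*{argmin}_{\beta\in\mathbb R^n_+}\ \frac1t\sum_{\tau=1}^tW_\tau F(\theta^\tau,\beta).$$ Then the conditional distribution of $\sqrt t\,(\beta^{\mathrm{boot}}_{\mathrm{ex}}-\beta^\gamma)$ consistently estimates $c\cdot\mathcal J_{\mathrm{LFM}}$, i.e. the law of $cX$ with $X\sim\mathcal J_{\mathrm{LFM}}$.
   Context: Setting. There are $n$ buyers with budgets $b_i>0$, a measurable item space $\Theta$ with integrating measure $d\theta$, nonnegative integrable valuations $v_i:\Theta\to[0,\infty)$ with $\max_i\sup_\theta v_i(\theta)<\infty$, and a bounded supply function $s\ge 0$ with $\int_\Theta s\,d\theta=1$. Write $\mathbb E[g]=\int g\,s\,d\theta$. Let $\theta^1,\theta^2,\dots$ be i.i.d. draws from the density $s$ and $P_tf=\frac1t\sum_{\tau=1}^tf(\theta^\tau)$. For $\beta\in\mathbb R^n_+$ put $$F(\theta,\beta)=\max_{i}\beta_iv_i(\theta)-\sum_{i=1}^nb_i\log\beta_i,\quad H(\beta)=\mathbb E[F(\cdot,\beta)],\quad H_t(\beta)=P_tF(\cdot,\beta)$$ (with $-\log0=+\infty$). In the linear Fisher market (LFM), the limit equilibrium inverse bang-per-buck vector is $\beta^*=\operatorname{argmin}_{\mathbb R^n_+}H$ and the observed (finite) one is $\beta^\gamma=\operatorname{argmin}_{\mathbb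 R^n_+}H_t$. Let $\mathcal H=\nabla^2H(\beta^* )$ (positive definite); $\nabla F(\theta,\beta^* )$ exists for almost every $\theta$. Define $$\mathcal J_{\mathrm{LFM}}=\mathcal N\big(0,\ \mathcal H^{-1}\,\mathbb E[\nabla F(\cdot,\beta^* )\nabla F(\cdot,\beta^* )^{\top}]\,\mathcal H^{-1}\big).$$ Exchangeable bootstrap weights: for each $t$, $W=(W_1,\dots,W_t)$ is independent of the data $(\theta^\tau)$ and satisfies: (1) the random vector $W$ is exchangeable; (2) $W_\tau\ge0$ and $\sum_{\tau=1}^tW_\tau=t$; (3) $W_1$ has finite $(2+\epsilon)$ moment for some $\epsilon>0$; (4) $\frac1t\sum_{\tau=1}^t(W_\tau-1)^2\to c^2>0$ in probability as $t\to\infty$. Consistency: for random vectors $X_t\in\mathbb R^n$ that are functions of $(\theta^\tau)_{\tau\le t}$ and the weights $W$, the conditional distribution of $X_t$ consistently estimates a law $L$ if $$\sup_{f\in\mathrm{BL}_1}\big|\mathbb E[f(X_t)\mid\theta^1,\dots,\theta^t]-\mathbb E_{X\sim L}[f(X)]\big|\to0\text{ in probability},$$ where $\mathrm{BL}_1$ is the set of $f:\mathbb R^n\to\mathbb R$ with $\sup|f|\le1$ and $|f(x)-f(y)|\le\|x-y\|_2$.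
   Formalization: Condition (3) is required uniformly in t: for one fixed ε>0 the (2+ε) moments of W_1 are bounded over all t. For each single t it is automatic since 0≤W_1≤t, and the claim then fails, e.g. for one weight of size about c√t at a random position and the others equal. *)

theory Defs
  imports "HOL-Probability.Probability"
begin

section \<open>Convergence in probability and conditional laws\<close>

text \<open>Convergence in outer probability.  It is the usual notion when the variables are measurable
  (lemma \<open>converges_in_prob_iff\<close> below).  The outer form is used because \<^const>\<open>measure\<close>
  returns 0 on non-measurable sets.\<close>

definition converges_in_prob :: "'w measure \<Rightarrow> (nat \<Rightarrow> 'w \<Rightarrow> real) \<Rightarrow> real \<Rightarrow> bool" where
  "converges_in_prob P X l \<longleftrightarrow>
     (\<forall>\<epsilon>>0. \<forall>\<delta>>0. \<forall>\<^sub>F t in sequentially.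
        \<exists>A\<in>sets P. {\<omega>\<in>space P. \<bar>X t \<omega> - l\<bar> > \<epsilon>} \<subseteq> A \<and> measure P A < \<delta>)"

lemma converges_in_prob_iff:
  assumes "prob_space P" and X: "\<And>t. X t \<in> borel_measurable P"
  shows "converges_in_prob P X l \<longleftrightarrow>
    (\<forall>\<epsilon>>0. (\<lambda>t. measure P {\<omega>\<in>space P. \<bar>X t \<omega> - l\<bar> > \<epsilon>}) \<longlonglongrightarrow> 0)"
proof -
  interpret prob_space P by fact
  have m: "{\<omega>\<in>space P. \<bar>X t \<omega> - l\<bar> > \<epsilon>} \<in> sets P" for t \<epsilon>
    using X by measurable
  have "(\<exists>A\<in>sets P. {\<omega>\<in>space P. \<bar>X t \<omega> - l\<bar> > \<epsilon>} \<subseteq> A \<and> measure P A < \<delta>)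
      \<longleftrightarrow> measure P {\<omega>\<in>space P. \<bar>X t \<omega> - l\<bar> > \<epsilon>} < \<delta>" for t \<epsilon> \<delta>
    using m[of \<epsilon> t] by (meson finite_measure_mono le_less_trans order_refl)
  then show ?thesis
    by (simp add: converges_in_prob_def tendsto_iff)
qed

definition generated_algebra :: "'w measure \<Rightarrow> 'c measure \<Rightarrow> ('w \<Rightarrow> 'c) \<Rightarrow> 'w measure" where
  "generated_algebra P N X = vimage_algebra (space P) X N"

text \<open>A regular conditional distribution of \<open>X\<close> given the sub-\<open>\<sigma>\<close>-algebra \<open>G\<close>.  For
  variables with values in \<open>\<real>\<^sup>n\<close> it exists and is unique up to a null set.\<close>

definition regular_cond_distr ::
    "'w measure \<Rightarrow> 'w measure \<Rightarrow> ('w \<Rightarrow> 'c::topological_space) \<Rightarrow> ('w \<Rightarrow> 'c measure) \<Rightarrow> bool" where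
  "regular_cond_distr P G X \<kappa> \<longleftrightarrow>
     X \<in> borel_measurable P \<and>
     \<kappa> \<in> measurable G (prob_algebra borel) \<and>
     (\<forall>A\<in>sets borel. AE \<omega> in P. measure (\<kappa> \<omega>) A = real_cond_exp P G (indicator (X -` A)) \<omega>)"

definition BL1 :: "('c::real_normed_vector \<Rightarrow> real) set" where
  "BL1 = {f. (\<forall>x. \<bar>f x\<bar> \<le> 1) \<and> (\<forall>x y. \<bar>f x - f y\<bar> \<le> norm (x - y))}"

definition BL_distance :: "'c::real_normed_vector measure \<Rightarrow> 'c measure \<Rightarrow> real" where
  "BL_distance K L = (SUP f\<in>BL1. \<bar>(\<integral>x. f x \<partial>K) - (\<integral>x. f x \<partial>L)\<bar>)"

text \<open>A supremum over the uncountable class \<^const>\<open>BL1\<close> of conditional expectations, each defined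
  only almost surely, is meaningful only when all of them are computed from one regular conditional
  distribution \<open>\<kappa> t\<close>.  By almost sure uniqueness the choice of \<open>\<kappa>\<close> does not matter.\<close>

definition consistently_estimates ::
    "'w measure \<Rightarrow> (nat \<Rightarrow> 'w measure) \<Rightarrow> (nat \<Rightarrow> 'w \<Rightarrow> 'c::real_normed_vector) \<Rightarrow> 'c measure \<Rightarrow> bool" where
  "consistently_estimates P G X L \<longleftrightarrow>
     (\<exists>\<kappa>. (\<forall>t. regular_cond_distr P (G t) (X t) (\<kappa> t)) \<and>
          converges_in_prob P (\<lambda>t \<omega>. BL_distance (\<kappa> t \<omega>) L) 0)"


section \<open>Calculus and Gaussian laws on \<open>\<real>\<^sup>n\<close>\<close>

definition grad :: "('c::real_inner \<Rightarrow> real) \<Rightarrow> 'c \<Rightarrow> 'c" where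
  "grad f x = (THE D. GDERIV f x :> D)"

definition hessian :: "(real^'n \<Rightarrow> real) \<Rightarrow> real^'n \<Rightarrow> real^'n^'n" where
  "hessian f x = jacobian (grad f) (at x)"

definition C2_near :: "(real^'n \<Rightarrow> real) \<Rightarrow> real^'n \<Rightarrow> bool" where
  "C2_near f x \<longleftrightarrow>
     (\<exists>U. open U \<and> x \<in> U \<and>
        (\<forall>y\<in>U. f differentiable at y \<and> grad f differentiable at y) \<and>
        continuous_on U (hessian f))"

text \<open>The law \<open>\<N>(0, \<Sigma>)\<close> for a positive semidefinite, possibly singular \<open>\<Sigma>\<close>: the law of \<open>A Z\<close>
  with \<open>Z\<close> a standard Gaussian vector and \<open>A A\<^sup>T = \<Sigma>\<close>.  It does not depend on the choice of \<open>A\<close>.\<close>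

definition centered_normal :: "real^'n^'n \<Rightarrow> (real^'n) measure" where
  "centered_normal \<Sigma> =
     (let A = (SOME A :: real^'n^'n. A ** transpose A = \<Sigma>)
      in distr (PiM UNIV (\<lambda>_::'n. density lborel (\<lambda>x. ennreal (std_normal_density x)))) borel
           (\<lambda>z. A *v (\<chi> i. z i)))"


section \<open>The linear Fisher market\<close>

definition orthant :: "(real^'n) set" where
  "orthant = {\<beta>. \<forall>i. 0 \<le> \<beta> $ i}"

definition neg_log :: "real \<Rightarrow> ereal" where
  "neg_log x = (if x \<le> 0 then \<infinity> else ereal (- ln x))"

definition LFM_F :: "('n::finite \<Rightarrow> 'a \<Rightarrow> real) \<Rightarrow> ('n \<Rightarrow> real) \<Rightarrow> 'a \<Rightarrow> real^'n \<Rightarrow> ereal" where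
  "LFM_F v b x \<beta> =
     ereal (Max (range (\<lambda>i. \<beta> $ i * v i x))) + (\<Sum>i\<in>UNIV. ereal (b i) * neg_log (\<beta> $ i))"

definition supply_measure :: "'a measure \<Rightarrow> ('a \<Rightarrow> real) \<Rightarrow> 'a measure" where
  "supply_measure M s = density M (\<lambda>x. ennreal (s x))"

text \<open>Extended-real expectation, as the integral of the positive part minus that of the negative
  part; \<^const>\<open>e2ennreal\<close> truncates negative values to 0.\<close>

definition ext_expectation :: "'a measure \<Rightarrow> ('a \<Rightarrow> ereal) \<Rightarrow> ereal" where
  "ext_expectation N g =
     enn2ereal (\<integral>\<^sup>+x. e2ennreal (g x) \<partial>N) - enn2ereal (\<integral>\<^sup>+x. e2ennreal (- g x) \<partial>N)"

definition LFM_H ::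
    "'a measure \<Rightarrow> ('a \<Rightarrow> real) \<Rightarrow> ('n::finite \<Rightarrow> 'a \<Rightarrow> real) \<Rightarrow> ('n \<Rightarrow> real) \<Rightarrow> real^'n \<Rightarrow> ereal" where
  "LFM_H M s v b \<beta> = ext_expectation (supply_measure M s) (\<lambda>x. LFM_F v b x \<beta>)"

text \<open>Samples and weights are indexed from 0: the first \<open>t\<close> items are \<open>x 0, \<dots>, x (t - 1)\<close>.\<close>

definition LFM_H_emp ::
    "('n::finite \<Rightarrow> 'a \<Rightarrow> real) \<Rightarrow> ('n \<Rightarrow> real) \<Rightarrow> nat \<Rightarrow> (nat \<Rightarrow> 'a) \<Rightarrow> real^'n \<Rightarrow> ereal" where
  "LFM_H_emp v b t x \<beta> = ereal (1 / real t) * (\<Sum>\<tau><t. LFM_F v b (x \<tau>) \<beta>)"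

definition LFM_H_boot ::
    "('n::finite \<Rightarrow> 'a \<Rightarrow> real) \<Rightarrow> ('n \<Rightarrow> real) \<Rightarrow> nat \<Rightarrow> (nat \<Rightarrow> real) \<Rightarrow> (nat \<Rightarrow> 'a) \<Rightarrow> real^'n \<Rightarrow> ereal" where
  "LFM_H_boot v b t w x \<beta> = ereal (1 / real t) * (\<Sum>\<tau><t. ereal (w \<tau>) * LFM_F v b (x \<tau>) \<beta>)"

text \<open>A minimizer is unique when it exists.  None exists if every sampled item of positive weight
  has zero value for some buyer, an event of vanishing probability; there
  \<^const>\<open>arg_min_on\<close> returns a fixed vector not depending on the sample.\<close>

definition beta_emp ::
    "('n::finite \<Rightarrow> 'a \<Rightarrow> real) \<Rightarrow> ('n \<Rightarrow> real) \<Rightarrow> nat \<Rightarrow> (nat \<Rightarrow> 'a) \<Rightarrow> real^'n" where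
  "beta_emp v b t x = arg_min_on (LFM_H_emp v b t x) orthant"

definition beta_boot ::
    "('n::finite \<Rightarrow> 'a \<Rightarrow> real) \<Rightarrow> ('n \<Rightarrow> real) \<Rightarrow> nat \<Rightarrow> (nat \<Rightarrow> real) \<Rightarrow> (nat \<Rightarrow> 'a) \<Rightarrow> real^'n" where
  "beta_boot v b t w x = arg_min_on (LFM_H_boot v b t w x) orthant"

text \<open>\<^const>\<open>LFM_F\<close> and \<^const>\<open>LFM_H\<close> are finite on the open positive orthant, so
  \<^const>\<open>real_of_ereal\<close> changes nothing near an interior point such as the minimizer of
  \<^const>\<open>LFM_H\<close>.\<close>

definition LFM_hessian ::
    "'a measure \<Rightarrow> ('a \<Rightarrow> real) \<Rightarrow> ('n::finite \<Rightarrow> 'a \<Rightarrow> real) \<Rightarrow> ('n \<Rightarrow> real) \<Rightarrow> real^'n \<Rightarrow> real^'n^'n" where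
  "LFM_hessian M s v b \<beta> = hessian (\<lambda>\<beta>. real_of_ereal (LFM_H M s v b \<beta>)) \<beta>"

definition LFM_grad_F ::
    "('n::finite \<Rightarrow> 'a \<Rightarrow> real) \<Rightarrow> ('n \<Rightarrow> real) \<Rightarrow> 'a \<Rightarrow> real^'n \<Rightarrow> real^'n" where
  "LFM_grad_F v b x \<beta> = grad (\<lambda>\<beta>. real_of_ereal (LFM_F v b x \<beta>)) \<beta>"

definition LFM_grad_moment ::
    "'a measure \<Rightarrow> ('a \<Rightarrow> real) \<Rightarrow> ('n::finite \<Rightarrow> 'a \<Rightarrow> real) \<Rightarrow> ('n \<Rightarrow> real) \<Rightarrow> real^'n \<Rightarrow> real^'n^'n" where
  "LFM_grad_moment M s v b \<beta> =
     (\<chi> i j. \<integral>x. LFM_grad_F v b x \<beta> $ i * LFM_grad_F v b x \<beta> $ j \<partial>supply_measure M s)"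

definition J_LFM ::
    "'a measure \<Rightarrow> ('a \<Rightarrow> real) \<Rightarrow> ('n::finite \<Rightarrow> 'a \<Rightarrow> real) \<Rightarrow> ('n \<Rightarrow> real) \<Rightarrow> real^'n \<Rightarrow> (real^'n) measure" where
  "J_LFM M s v b \<beta> =
     centered_normal (matrix_inv (LFM_hessian M s v b \<beta>) ** LFM_grad_moment M s v b \<beta> **
       matrix_inv (LFM_hessian M s v b \<beta>))"


section \<open>Exchangeable bootstrap weights\<close>

text \<open>\<open>W t \<tau> \<omega>\<close> is the weight of item \<open>\<tau> < t\<close> at sample size \<open>t\<close>.  For each fixed \<open>t\<close> the
  weights lie in \<open>[0, t]\<close>, so a moment condition has content only uniformly in \<open>t\<close>.\<close>

definition exchangeable_weights ::
    "'w measure \<Rightarrow> 'a measure \<Rightarrow> (nat \<Rightarrow> 'w \<Rightarrow> 'a) \<Rightarrow> (nat \<Rightarrow> nat \<Rightarrow> 'w \<Rightarrow> real) \<Rightarrow> real \<Rightarrow> bool" where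
  "exchangeable_weights P M \<theta> W c \<longleftrightarrow>
     (\<forall>t\<ge>1. \<forall>\<tau><t. W t \<tau> \<in> borel_measurable P) \<and>
     (\<forall>t\<ge>1. prob_space.indep_set P
        (sets (generated_algebra P (PiM UNIV (\<lambda>_. M)) (\<lambda>\<omega> \<tau>. \<theta> \<tau> \<omega>)))
        (sets (generated_algebra P (PiM {..<t} (\<lambda>_. borel)) (\<lambda>\<omega>. \<lambda>\<tau>\<in>{..<t}. W t \<tau> \<omega>)))) \<and>
     (\<forall>t\<ge>1. \<forall>\<pi>. \<pi> permutes {..<t} \<longrightarrow>
        distr P (PiM {..<t} (\<lambda>_. borel)) (\<lambda>\<omega>. \<lambda>\<tau>\<in>{..<t}. W t (\<pi> \<tau>) \<omega>) =
        distr P (PiM {..<t} (\<lambda>_. borel)) (\<lambda>\<omega>. \<lambda>\<tau>\<in>{..<t}. W t \<tau> \<omega>)) \<and>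
     (\<forall>t\<ge>1. \<forall>\<omega>\<in>space P. (\<forall>\<tau><t. 0 \<le> W t \<tau> \<omega>) \<and> (\<Sum>\<tau><t. W t \<tau> \<omega>) = real t) \<and>
     (\<exists>\<epsilon>>0. (SUP t\<in>{1..}. \<integral>\<^sup>+\<omega>. ennreal (W t 0 \<omega> powr (2 + \<epsilon>)) \<partial>P) < \<infinity>) \<and>
     converges_in_prob P (\<lambda>t \<omega>. 1 / real t * (\<Sum>\<tau><t. (W t \<tau> \<omega> - 1)\<^sup>2)) (c\<^sup>2)"

end

theory Submission
  imports Defs
begin

text \<open>
  The proof linearizes the bootstrap error in the data and the weights, and then proves a
  conditional central limit theorem for the linear term.

  For weights \<open>w\<close> with \<open>w \<ge> 0\<close> and \<open>\<Sum>\<tau><t. w \<tau> = t\<close> put \<open>G h = t (H\<^sub>w (\<beta>* + h / \<surd>t) - H\<^sub>w \<beta>*)\<close>,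
  where \<open>H\<^sub>w\<close> is the weighted empirical objective. An item for which two buyers attain a
  positive maximum of \<open>\<beta>*\<^sub>i v\<^sub>i\<close> is a tie. Twice differentiability of \<open>H\<close> forces ties to have
  probability zero (\<open>tie_null\<close>): a tie makes a second difference of the maximum of order \<open>s\<close>,
  while those of \<open>H\<close> are of order \<open>s\<^sup>2\<close>. Away from ties the maximum is linear near \<open>\<beta>*\<close>, so the
  remainder of its linear expansion vanishes for large \<open>t\<close>, and dominated convergence shows that
  \<open>G h - S\<^sub>w \<bullet> h\<close> has mean converging to \<open>h \<bullet> \<H> h / 2\<close> and variance tending to zero in
  proportion to \<open>(1/t) \<Sum> w\<^sup>2\<close>; here \<open>S\<^sub>w = (1/\<surd>t) \<Sum> w \<tau> \<nabla>F(\<theta>\<^sup>\<tau>, \<beta>*)\<close>. Since \<open>G\<close> is convex,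
  closeness to the quadratic at finitely many fixed points \<open>h\<close> already locates its minimizer
  (\<open>argmin_near_quadratic_argmin\<close>). Hence \<open>\<surd>t (\<beta>\<^sub>w - \<beta>*) = - \<H>\<^sup>-\<^sup>1 S\<^sub>w + o(1)\<close> in probability,
  with a failure probability that is uniform in \<open>w\<close> up to the factor \<open>(1/t) \<Sum> w\<^sup>2\<close>
  (\<open>fixed_weights_linearization\<close>). The moment condition bounds the mean of that factor. Taking
  the random weights and the constant weight \<open>1\<close> and subtracting, the bootstrap error is \<open>-
  \<H>\<^sup>-\<^sup>1 (1/\<surd>t) \<Sum> (W \<tau> - 1) \<nabla>F(\<theta>\<^sup>\<tau>, \<beta>*)\<close> up to a vanishing term (\<open>lin_error_limit\<close>).

  For the conditional central limit theorem, let \<open>\<phi>\<close> be the conditional characteristic function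
  of the linear term at a fixed argument and \<open>l\<close> its Gaussian limit, a number in \<open>[0, 1]\<close>.
  Instead of a central limit theorem for exchangeable arrays with the data fixed, a second
  moment suffices: \<open>\<phi>\<close> is close to \<open>l\<close> in mean square once \<open>E \<phi> \<rightarrow> l\<close> and \<open>E \<bar>\<phi>\<bar>\<^sup>2 \<rightarrow> l\<^sup>2\<close>, and
  \<open>\<bar>\<phi>\<bar>\<^sup>2\<close> is an integral over two independent copies \<open>W, W'\<close> of the weights. Now fix the weights
  and integrate over the data first: the inner integral is the characteristic function of a
  weighted sum of independent bounded variables, hence nearly Gaussian with error \<open>\<Sum> \<bar>u
  \<tau>\<bar>\<^sup>2\<^sup>+\<^sup>e\<close>, where \<open>u\<close> is \<open>(W - 1)/\<surd>t\<close> or \<open>(W - W')/\<surd>t\<close>. The corresponding sums \<open>\<Sum> u\<^sup>2\<close> converge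
  to \<open>c\<^sup>2\<close> and \<open>2 c\<^sup>2\<close>, because the cross term \<open>(1/t) \<Sum> (W \<tau> - 1) (W' \<tau> - 1)\<close> has second moment
  of order \<open>1/t\<close> by exchangeability (\<open>weighted_dev_second_moment\<close>).

  Finally, an average of the distance of characteristic functions under a Gaussian controls all
  bounded Lipschitz test functions at once (\<open>BL1_close_if_char_vec_close\<close>). As the weights are
  independent of the data, a regular conditional distribution is obtained by freezing the data
  and integrating over the law of the weights (\<open>regular_cond_distr_independent\<close>).
\<close>

section \<open>Characteristic functions and bounded Lipschitz test functions\<close>

definition std_gauss :: "(real^'n) measure" where
  "std_gauss = distr (PiM UNIV (\<lambda>_::'n. density lborel (\<lambda>x. ennreal (std_normal_density x)))) borel
     (\<lambda>z. \<chi> i. z i)"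

definition char_vec :: "(real^'n) measure \<Rightarrow> real^'n \<Rightarrow> complex" where
  "char_vec K \<xi> = (\<integral>x. iexp (\<xi> \<bullet> x) \<partial>K)"

lemma vec_lambda_measurable:
  "(\<lambda>z. \<chi> i. z i) \<in> PiM UNIV (\<lambda>_::'n::finite. density lborel (\<lambda>x. ennreal (std_normal_density x)))
     \<rightarrow>\<^sub>M (borel :: (real^'n) measure)"
proof -
  have "(\<lambda>z. \<chi> i. z i) = (\<lambda>z. \<Sum>i\<in>UNIV. z i *\<^sub>R (axis i 1 :: real^'n))"
    by (rule ext) (simp add: vec_eq_iff axis_def if_distrib cong: if_cong)
  then show ?thesis by simp
qed

lemma prob_space_normal_density: "prob_space (density lborel (\<lambda>x. ennreal (std_normal_density x)))"
  by (rule prob_space_normal_density) simp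

lemma prob_space_std_gauss: "prob_space (std_gauss :: (real^'n) measure)"
  and sets_std_gauss [measurable_cong, simp]: "sets (std_gauss :: (real^'n) measure) = sets borel"
  unfolding std_gauss_def
  by (rule prob_space.prob_space_distr[OF prob_space_PiM vec_lambda_measurable],
      rule prob_space_normal_density) simp

lemma space_std_gauss [simp]: "space std_gauss = UNIV"
  using sets_eq_imp_space_eq[OF sets_std_gauss] by simp

lemma char_vec_std_gauss:
  "char_vec std_gauss (u :: real^'n) = complex_of_real (exp (- (norm u)\<^sup>2 / 2))"
proof -
  let ?G = "density lborel (\<lambda>x. ennreal (std_normal_density x))"
  interpret G: prob_space ?G by (rule prob_space_normal_density)
  interpret product_sigma_finite "\<lambda>_::'n. ?G" by standard
  have "char_vec std_gauss u = (\<integral>z. iexp (u \<bullet> (\<chi> i. z i)) \<partial>PiM UNIV (\<lambda>_::'n. ?G))"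
    unfolding char_vec_def std_gauss_def
    by (rule integral_distr[OF vec_lambda_measurable]) measurable
  also have "\<dots> = (\<integral>z. (\<Prod>i\<in>UNIV. iexp (u $ i * z i)) \<partial>PiM UNIV (\<lambda>_::'n. ?G))"
    by (simp add: inner_vec_def exp_sum[symmetric] sum_distrib_left)
  also have "\<dots> = (\<Prod>i\<in>UNIV. \<integral>x. iexp (u $ i * x) \<partial>?G)"
    by (rule product_integral_prod) (auto intro!: G.integrable_const_bound[where B=1])
  also have "\<dots> = (\<Prod>i\<in>UNIV. complex_of_real (exp (- ((u $ i)\<^sup>2) / 2)))"
    using char_std_normal_distribution by (simp add: char_def fun_eq_iff)
  also have "\<dots> = complex_of_real (exp (- (norm u)\<^sup>2 / 2))"
    by (simp add: exp_sum[symmetric] norm_vec_def L2_set_def sum_nonneg sum_negf sum_divide_distrib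
        flip: of_real_prod)
  finally show ?thesis .
qed

text \<open>
  The unnormalized Gaussian density. Only ratios of its integrals matter, so the constant is
  never evaluated.
\<close>
definition gauss_kernel :: "'e::real_normed_vector \<Rightarrow> real" where
  "gauss_kernel u = exp (- (norm u)\<^sup>2 / 2)"

lemma gauss_kernel_measurable [measurable]: "gauss_kernel \<in> borel_measurable borel"
  unfolding gauss_kernel_def by measurable

lemma gauss_kernel_pos: "gauss_kernel u > 0" and gauss_kernel_nonneg: "gauss_kernel u \<ge> 0"
  by (simp_all add: gauss_kernel_def)

lemma integrable_gauss_kernel: "integrable lborel (gauss_kernel :: 'e::euclidean_space \<Rightarrow> real)"
proof (rule integrableI_nonneg)
  have eq: "ennreal (gauss_kernel u) = (\<Prod>b\<in>Basis. ennreal (exp (- (u \<bullet> b)\<^sup>2 / 2)))" for u :: 'e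
  proof -
    have "(norm u)\<^sup>2 = (\<Sum>b\<in>Basis. (u \<bullet> b)\<^sup>2)"
      by (simp only: power2_norm_eq_inner, subst euclidean_inner) (simp add: power2_eq_square)
    then show ?thesis
      by (simp add: gauss_kernel_def prod_ennreal exp_sum[symmetric] sum_negf sum_divide_distrib)
  qed
  have fin: "(\<integral>\<^sup>+x. ennreal (exp (- x\<^sup>2 / 2)) \<partial>lborel) < \<infinity>"
  proof -
    have "integrable lborel (\<lambda>x. sqrt (2 * pi) * std_normal_density x)"
      by simp
    moreover have "sqrt (2 * pi) * std_normal_density x = exp (- x\<^sup>2 / 2)" for x
      by (simp add: std_normal_density_def)
    ultimately have "integrable lborel (\<lambda>x::real. exp (- x\<^sup>2 / 2))" by simp
    then show ?thesis by (simp add: integrable_iff_bounded)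
  qed
  have "(\<integral>\<^sup>+u. ennreal (gauss_kernel (u::'e)) \<partial>lborel) = (\<Prod>b\<in>(Basis::'e set). \<integral>\<^sup>+x. ennreal (exp (- x\<^sup>2 / 2)) \<partial>lborel)"
    unfolding eq using nn_integral_lborel_prod[of "\<lambda>(_::'e) x. ennreal (exp (- x\<^sup>2 / 2))"] by simp
  also have "\<dots> < \<infinity>"
    using fin by (simp add: power_less_top_ennreal)
  finally show "(\<integral>\<^sup>+u. ennreal (gauss_kernel (u::'e)) \<partial>lborel) < \<infinity>" .
qed (auto simp: gauss_kernel_nonneg)

lemma integral_gauss_kernel_pos: "0 < (\<integral>u. gauss_kernel (u::'e::euclidean_space) \<partial>lborel)"
proof -
  have "(\<integral>u. gauss_kernel (u::'e) \<partial>lborel) \<noteq> 0"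
  proof
    assume "(\<integral>u. gauss_kernel (u::'e) \<partial>lborel) = 0"
    then have "AE u in lborel. gauss_kernel (u::'e) = 0"
      by (subst (asm) integral_nonneg_eq_0_iff_AE) (auto simp: integrable_gauss_kernel gauss_kernel_nonneg)
    then have "AE u in (lborel::'e measure). False"
      by eventually_elim (use gauss_kernel_pos in \<open>metis less_irrefl\<close>)
    then have "emeasure lborel (space (lborel::'e measure)) = 0"
      by (subst (asm) AE_iff_measurable[OF _ refl]) auto
    then show False by simp
  qed
  moreover have "0 \<le> (\<integral>u. gauss_kernel (u::'e) \<partial>lborel)"
    by (simp add: gauss_kernel_nonneg)
  ultimately show ?thesis by simp
qed

lemma lborel_integral_affine:
  fixes F :: "'e::euclidean_space \<Rightarrow> real"
  assumes [measurable]: "F \<in> borel_measurable borel" and "\<sigma> > 0"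
  shows "(\<integral>y. F y \<partial>lborel) = \<sigma> ^ DIM('e) * (\<integral>u. F (x + \<sigma> *\<^sub>R u) \<partial>lborel)"
    and "integrable lborel F \<longleftrightarrow> integrable lborel (\<lambda>u. F (x + \<sigma> *\<^sub>R u))"
proof -
  have eq: "lborel = density (distr lborel borel (\<lambda>u. x + \<sigma> *\<^sub>R u)) (\<lambda>_. \<sigma> ^ DIM('e))"
    using lborel_affine[of \<sigma> x] \<open>\<sigma> > 0\<close> by simp
  show "(\<integral>y. F y \<partial>lborel) = \<sigma> ^ DIM('e) * (\<integral>u. F (x + \<sigma> *\<^sub>R u) \<partial>lborel)"
    using \<open>\<sigma> > 0\<close> by (subst eq) (simp add: integral_density integral_distr)
  show "integrable lborel F \<longleftrightarrow> integrable lborel (\<lambda>u. F (x + \<sigma> *\<^sub>R u))"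
    using \<open>\<sigma> > 0\<close> by (subst eq) (simp add: integrable_density integrable_distr_eq)
qed

lemma char_vec_measurable [measurable]:
  assumes "prob_space K" and K [measurable_cong]: "sets K = sets borel"
  shows "char_vec K \<in> borel_measurable borel"
proof -
  interpret prob_space K by fact
  show ?thesis unfolding char_vec_def[abs_def] by measurable
qed

lemma norm_char_vec_le_1:
  assumes "prob_space K" and K [measurable_cong]: "sets K = sets borel"
  shows "cmod (char_vec K \<xi>) \<le> 1"
proof -
  interpret prob_space K by fact
  have "cmod (char_vec K \<xi>) \<le> (\<integral>x. cmod (iexp (\<xi> \<bullet> x)) \<partial>K)"
    unfolding char_vec_def by (rule integral_norm_bound)
  then show ?thesis by (simp add: prob_space)
qed

definition gauss_smoothing :: "(real^'n) measure \<Rightarrow> real \<Rightarrow> real^'n \<Rightarrow> real" where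
  "gauss_smoothing K \<sigma> y = (\<integral>x. gauss_kernel ((1 / \<sigma>) *\<^sub>R (y - x)) \<partial>K)"

lemma gauss_smoothing_measurable [measurable]:
  assumes "prob_space K" and K [measurable_cong]: "sets K = sets borel"
  shows "gauss_smoothing K \<sigma> \<in> borel_measurable borel"
proof -
  interpret prob_space K by fact
  show ?thesis unfolding gauss_smoothing_def[abs_def] by measurable
qed

text \<open>
  A Gaussian is its own Fourier transform; after Fubini, the smoothed density of a law at every
  point is an integral of its characteristic function.
\<close>
lemma gauss_smoothing_char:
  assumes "prob_space K" and K [measurable_cong]: "sets K = sets borel"
  shows "complex_of_real (gauss_smoothing K \<sigma> y)
    = (\<integral>z. iexp (- ((1 / \<sigma>) *\<^sub>R z) \<bullet> y) * char_vec K ((1 / \<sigma>) *\<^sub>R z) \<partial>std_gauss)"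
proof -
  interpret prob_space K by fact
  interpret G: prob_space "std_gauss :: (real^'a) measure" by (rule prob_space_std_gauss)
  interpret pair_sigma_finite K "std_gauss :: (real^'a) measure" ..
  interpret KG: prob_space "K \<Otimes>\<^sub>M (std_gauss :: (real^'a) measure)"
    by (rule prob_space_pair) unfold_locales
  have *: "complex_of_real (gauss_kernel ((1 / \<sigma>) *\<^sub>R (y - x)))
      = (\<integral>z. iexp (((1 / \<sigma>) *\<^sub>R (x - y)) \<bullet> z) \<partial>std_gauss)" for x
  proof -
    have "(\<integral>z. iexp (((1 / \<sigma>) *\<^sub>R (x - y)) \<bullet> z) \<partial>std_gauss)
        = complex_of_real (exp (- (norm ((1 / \<sigma>) *\<^sub>R (x - y)))\<^sup>2 / 2))"
      using char_vec_std_gauss[of "(1 / \<sigma>) *\<^sub>R (x - y)"] unfolding char_vec_def .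
    then show ?thesis by (simp add: gauss_kernel_def norm_minus_commute)
  qed
  have "complex_of_real (gauss_smoothing K \<sigma> y)
      = (\<integral>x. (\<integral>z. iexp (((1 / \<sigma>) *\<^sub>R (x - y)) \<bullet> z) \<partial>std_gauss) \<partial>K)"
    unfolding gauss_smoothing_def integral_complex_of_real[symmetric] * ..
  also have "\<dots> = (\<integral>z. (\<integral>x. iexp (((1 / \<sigma>) *\<^sub>R (x - y)) \<bullet> z) \<partial>K) \<partial>std_gauss)"
    by (rule Fubini_integral[symmetric])
       (auto intro!: KG.integrable_const_bound[where B=1] simp: split_beta)
  also have "\<dots> = (\<integral>z. iexp (- ((1 / \<sigma>) *\<^sub>R z) \<bullet> y) * char_vec K ((1 / \<sigma>) *\<^sub>R z) \<partial>std_gauss)"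
  proof (rule Bochner_Integration.integral_cong[OF refl])
    fix z :: "real^'a"
    have "iexp (((1 / \<sigma>) *\<^sub>R (x - y)) \<bullet> z)
        = iexp (- ((1 / \<sigma>) *\<^sub>R z) \<bullet> y) * iexp (((1 / \<sigma>) *\<^sub>R z) \<bullet> x)" for x
      by (simp add: exp_add[symmetric] algebra_simps inner_commute diff_divide_distrib)
    then show "(\<integral>x. iexp (((1 / \<sigma>) *\<^sub>R (x - y)) \<bullet> z) \<partial>K)
        = iexp (- ((1 / \<sigma>) *\<^sub>R z) \<bullet> y) * char_vec K ((1 / \<sigma>) *\<^sub>R z)"
      unfolding char_vec_def by simp
  qed
  finally show ?thesis .
qed

text \<open>
  The factor that carries the point \<open>y\<close> in \<open>gauss_smoothing_char\<close> has modulus one, so the bound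
  is uniform in \<open>y\<close>.
\<close>
lemma gauss_smoothing_diff_le:
  assumes K: "prob_space K" "sets K = sets borel" and L: "prob_space L" "sets L = sets borel"
  shows "\<bar>gauss_smoothing K \<sigma> y - gauss_smoothing L \<sigma> y\<bar>
    \<le> (\<integral>z. cmod (char_vec K ((1 / \<sigma>) *\<^sub>R z) - char_vec L ((1 / \<sigma>) *\<^sub>R z)) \<partial>std_gauss)"
proof -
  interpret G: prob_space "std_gauss :: (real^'a) measure" by (rule prob_space_std_gauss)
  note [measurable] = char_vec_measurable[OF K] char_vec_measurable[OF L]
  let ?e = "\<lambda>z. iexp (- ((1 / \<sigma>) *\<^sub>R z) \<bullet> y)"
  have int: "integrable std_gauss (\<lambda>z. ?e z * char_vec M ((1 / \<sigma>) *\<^sub>R z))"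
    if M: "prob_space M" "sets M = sets borel" for M
    using char_vec_measurable[OF M] norm_char_vec_le_1[OF M]
    by (intro G.integrable_const_bound[where B=1]) (auto simp: norm_mult)
  have "complex_of_real (gauss_smoothing K \<sigma> y - gauss_smoothing L \<sigma> y)
     = (\<integral>z. ?e z * char_vec K ((1 / \<sigma>) *\<^sub>R z) - ?e z * char_vec L ((1 / \<sigma>) *\<^sub>R z) \<partial>std_gauss)"
    using int[OF K] int[OF L] by (simp add: gauss_smoothing_char[OF K] gauss_smoothing_char[OF L])
  then have "\<bar>gauss_smoothing K \<sigma> y - gauss_smoothing L \<sigma> y\<bar>
     = cmod (\<integral>z. ?e z * char_vec K ((1 / \<sigma>) *\<^sub>R z) - ?e z * char_vec L ((1 / \<sigma>) *\<^sub>R z) \<partial>std_gauss)"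
    by (metis norm_of_real real_norm_def)
  also have "\<dots> \<le> (\<integral>z. cmod (?e z * char_vec K ((1 / \<sigma>) *\<^sub>R z) - ?e z * char_vec L ((1 / \<sigma>) *\<^sub>R z)) \<partial>std_gauss)"
    by (rule integral_norm_bound)
  also have "\<dots> = (\<integral>z. cmod (char_vec K ((1 / \<sigma>) *\<^sub>R z) - char_vec L ((1 / \<sigma>) *\<^sub>R z)) \<partial>std_gauss)"
    by (simp add: norm_mult right_diff_distrib[symmetric] del: norm_exp_eq_Re) (simp add: norm_mult)
  finally show ?thesis .
qed

text \<open>
  Moves the smoothing from the law to the test function, where the Lipschitz bound applies.
\<close>
lemma integral_gauss_smoothing:
  fixes K :: "(real^'n) measure" and f :: "real^'n \<Rightarrow> real"
  assumes K: "prob_space K" and sK: "sets K = sets borel"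
    and f [measurable]: "f \<in> borel_measurable borel" and bound: "\<And>x. \<bar>f x\<bar> \<le> 1" and "\<sigma> > 0"
  shows "integrable lborel (\<lambda>y. f y * gauss_smoothing K \<sigma> y)"
    and "(\<integral>y. f y * gauss_smoothing K \<sigma> y \<partial>lborel)
      = \<sigma> ^ CARD('n) * (\<integral>x. (\<integral>u. f (x + \<sigma> *\<^sub>R u) * gauss_kernel u \<partial>lborel) \<partial>K)"
proof -
  interpret prob_space K by fact
  interpret pair_sigma_finite K "lborel :: (real^'n) measure" ..
  note [measurable_cong] = sK
  let ?h = "\<lambda>x y. f y * gauss_kernel ((1 / \<sigma>) *\<^sub>R (y - x))"
  define C where "C = (\<integral>u. gauss_kernel (u::real^'n) \<partial>lborel)"
  have fk: "integrable lborel (\<lambda>u. f (x + \<sigma> *\<^sub>R u) * gauss_kernel u)" for x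
    by (rule Bochner_Integration.integrable_bound[OF integrable_gauss_kernel])
       (auto simp: abs_mult gauss_kernel_nonneg bound intro!: mult_left_le_one_le)
  have inner: "integrable lborel (?h x)"
    "(\<integral>y. ?h x y \<partial>lborel) = \<sigma> ^ CARD('n) * (\<integral>u. f (x + \<sigma> *\<^sub>R u) * gauss_kernel u \<partial>lborel)" for x
    using \<open>\<sigma> > 0\<close> lborel_integral_affine[of "?h x" \<sigma> x] fk[of x] by auto
  have abs_inner: "(\<integral>y. norm (?h x y) \<partial>lborel) \<le> \<sigma> ^ CARD('n) * C" for x
  proof -
    have "(\<integral>y. norm (?h x y) \<partial>lborel) = \<sigma> ^ CARD('n) * (\<integral>u. norm (f (x + \<sigma> *\<^sub>R u) * gauss_kernel u) \<partial>lborel)"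
      using \<open>\<sigma> > 0\<close> lborel_integral_affine(1)[of "\<lambda>y. norm (?h x y)" \<sigma> x] by auto
    also have "\<dots> \<le> \<sigma> ^ CARD('n) * C" unfolding C_def using \<open>\<sigma> > 0\<close>
      by (intro mult_left_mono integral_mono integrable_norm fk integrable_gauss_kernel)
         (auto simp: abs_mult gauss_kernel_nonneg bound intro!: mult_left_le_one_le)
    finally show ?thesis .
  qed
  have int: "integrable (K \<Otimes>\<^sub>M lborel) (\<lambda>(x, y). ?h x y)"
  proof (rule Fubini_integrable)
    show "integrable K (\<lambda>x. \<integral>y. norm (case (x, y) of (x, y) \<Rightarrow> ?h x y) \<partial>lborel)"
      using abs_inner by (intro integrable_const_bound[where B="\<sigma> ^ CARD('n) * C"]) auto
    show "AE x in K. integrable lborel (\<lambda>y. case (x, y) of (x, y) \<Rightarrow> ?h x y)"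
      using inner(1) by simp
  qed measurable
  have eq: "f y * gauss_smoothing K \<sigma> y = (\<integral>x. ?h x y \<partial>K)" for y
    by (simp add: gauss_smoothing_def)
  show "integrable lborel (\<lambda>y. f y * gauss_smoothing K \<sigma> y)"
    unfolding eq by (rule integrable_snd[OF int])
  show "(\<integral>y. f y * gauss_smoothing K \<sigma> y \<partial>lborel)
      = \<sigma> ^ CARD('n) * (\<integral>x. (\<integral>u. f (x + \<sigma> *\<^sub>R u) * gauss_kernel u \<partial>lborel) \<partial>K)"
    unfolding eq Fubini_integral[OF int] inner(2) by simp
qed

lemma BL1_measurable: "f \<in> BL1 \<Longrightarrow> f \<in> borel_measurable (borel :: (real^'n) measure)"
proof (rule borel_measurable_continuous_onI)
  assume "f \<in> BL1"
  then have "1-lipschitz_on UNIV f"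
    by (auto simp: lipschitz_on_def BL1_def dist_norm)
  then show "continuous_on UNIV f" by (rule lipschitz_on_continuous_on)
qed

text \<open>
  A quantitative continuity theorem for the bounded Lipschitz metric. Both laws are smoothed at
  a scale \<open>\<sigma>\<close> so small that a Lipschitz function hardly notices. The smoothed densities differ
  by at most \<open>\<delta>\<close> pointwise, and have the same total mass; the integral of their difference is
  therefore at most twice the integral of the smaller of \<open>\<delta>\<close> and the density of \<open>L\<close>, which is
  small for small \<open>\<delta>\<close> because that density is integrable. Tightness of \<open>K\<close> is thus inherited
  from \<open>L\<close>.
\<close>
lemma BL1_close_if_char_vec_close:
  fixes L :: "(real^'n) measure"
  assumes L: "prob_space L" "sets L = sets borel" and "\<epsilon> > 0"
  obtains \<sigma> \<delta> :: real where "\<sigma> > 0" "\<delta> > 0"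
    "\<And>K f. prob_space K \<Longrightarrow> sets K = sets borel \<Longrightarrow> f \<in> BL1 \<Longrightarrow>
      (\<integral>z. cmod (char_vec K ((1 / \<sigma>) *\<^sub>R z) - char_vec L ((1 / \<sigma>) *\<^sub>R z)) \<partial>std_gauss) \<le> \<delta> \<Longrightarrow>
      \<bar>(\<integral>x. f x \<partial>K) - (\<integral>x. f x \<partial>L)\<bar> \<le> \<epsilon>"
proof -
  define C where "C = (\<integral>u. gauss_kernel (u::real^'n) \<partial>lborel)"
  have C: "C > 0" unfolding C_def by (rule integral_gauss_kernel_pos)
  \<comment> \<open>\<open>\<omega> \<sigma> / C\<close> bounds the effect on a test function of smoothing at scale \<open>\<sigma>\<close>; it tends to zero
  with \<open>\<sigma>\<close>.\<close>
  define \<omega> where "\<omega> \<sigma> = (\<integral>u. min 2 (\<sigma> * norm u) * gauss_kernel (u::real^'n) \<partial>lborel)" for \<sigma>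
  have \<omega>_int: "integrable lborel (\<lambda>u. min 2 (\<sigma> * norm u) * gauss_kernel (u::real^'n))" if "\<sigma> \<ge> 0" for \<sigma>
    by (rule Bochner_Integration.integrable_bound[OF integrable_mult_right[OF integrable_gauss_kernel, of 2]])
       (use that in \<open>auto simp: abs_mult gauss_kernel_nonneg intro!: mult_right_mono\<close>)
  have "(\<lambda>n. \<omega> (1 / real (Suc n))) \<longlonglongrightarrow> (\<integral>u. 0 \<partial>(lborel::(real^'n) measure))"
    unfolding \<omega>_def
  proof (rule integral_dominated_convergence[where w="\<lambda>u. 2 * gauss_kernel u"])
    show "AE u in (lborel::(real^'n) measure).
        (\<lambda>n. min 2 (1 / real (Suc n) * norm u) * gauss_kernel u) \<longlonglongrightarrow> 0"
    proof (rule AE_I2)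
      fix u :: "real^'n"
      have "(\<lambda>n. 1 / real (Suc n) * norm u) \<longlonglongrightarrow> 0 * norm u"
        by (intro tendsto_mult tendsto_const LIMSEQ_Suc lim_1_over_n)
      then have "(\<lambda>n. min 2 (1 / real (Suc n) * norm u)) \<longlonglongrightarrow> min 2 0"
        by (intro tendsto_min tendsto_const) simp
      then show "(\<lambda>n. min 2 (1 / real (Suc n) * norm u) * gauss_kernel u) \<longlonglongrightarrow> 0"
        by (intro tendsto_mult_left_zero) simp
    qed
    show "AE u in (lborel::(real^'n) measure).
        norm (min 2 (1 / real (Suc n) * norm u) * gauss_kernel u) \<le> 2 * gauss_kernel u" for n
      by (auto simp: abs_mult gauss_kernel_nonneg intro!: mult_right_mono)
  qed (auto intro!: integrable_mult_right integrable_gauss_kernel)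
  then have "\<forall>\<^sub>F n in sequentially. \<omega> (1 / real (Suc n)) < \<epsilon> / 4 * C"
    using C \<open>\<epsilon> > 0\<close> by (intro order_tendstoD(2)) auto
  then obtain n where n: "\<omega> (1 / real (Suc n)) < \<epsilon> / 4 * C" by (auto simp: eventually_sequentially)
  define \<sigma> where "\<sigma> = 1 / real (Suc n)"
  have \<sigma>: "\<sigma> > 0" and \<omega>: "\<omega> \<sigma> \<le> \<epsilon> / 4 * C" using n by (auto simp: \<sigma>_def)
  define D where "D = \<sigma> ^ CARD('n) * C"
  have D: "D > 0" using \<sigma> C by (simp add: D_def)
  have smooth_int: "integrable lborel (gauss_smoothing K \<sigma>)"
    and smooth_total: "(\<integral>y. gauss_smoothing K \<sigma> y \<partial>lborel) = D"
    if K: "prob_space K" "sets K = sets borel" for K :: "(real^'n) measure"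
    using integral_gauss_smoothing[OF K, of "\<lambda>_. 1" \<sigma>] \<sigma> prob_space.prob_space[OF K(1)]
    by (auto simp: D_def C_def)
  have smooth_nonneg: "gauss_smoothing K \<sigma> y \<ge> 0" for K :: "(real^'n) measure" and y
    unfolding gauss_smoothing_def by (simp add: gauss_kernel_nonneg)
  note [measurable] = gauss_smoothing_measurable[OF L]
  have "(\<lambda>n. \<integral>y. min (gauss_smoothing L \<sigma> y) (1 / real (Suc n)) \<partial>lborel)
      \<longlonglongrightarrow> (\<integral>y. 0 \<partial>(lborel::(real^'n) measure))"
  proof (rule integral_dominated_convergence[where w="gauss_smoothing L \<sigma>"])
    show "AE y in lborel. (\<lambda>n. min (gauss_smoothing L \<sigma> y) (1 / real (Suc n))) \<longlonglongrightarrow> 0"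
    proof (rule AE_I2)
      fix y
      have "(\<lambda>n. min (gauss_smoothing L \<sigma> y) (1 / real (Suc n))) \<longlonglongrightarrow> min (gauss_smoothing L \<sigma> y) 0"
        by (intro tendsto_min tendsto_const LIMSEQ_Suc lim_1_over_n)
      then show "(\<lambda>n. min (gauss_smoothing L \<sigma> y) (1 / real (Suc n))) \<longlonglongrightarrow> 0"
        using smooth_nonneg[of L y] by (simp add: min_def split: if_splits)
    qed
  qed (auto simp: smooth_int[OF L] smooth_nonneg)
  then have "\<forall>\<^sub>F n in sequentially. (\<integral>y. min (gauss_smoothing L \<sigma> y) (1 / real (Suc n)) \<partial>lborel) < \<epsilon> / 4 * D"
    using D \<open>\<epsilon> > 0\<close> by (intro order_tendstoD(2)) auto
  then obtain m where m: "(\<integral>y. min (gauss_smoothing L \<sigma> y) (1 / real (Suc m)) \<partial>lborel) < \<epsilon> / 4 * D"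
    by (auto simp: eventually_sequentially)
  define \<delta> where "\<delta> = 1 / real (Suc m)"
  have \<delta>: "\<delta> > 0" by (simp add: \<delta>_def)
  show thesis
  proof (rule that[OF \<sigma> \<delta>])
    fix K :: "(real^'n) measure" and f :: "real^'n \<Rightarrow> real"
    assume K: "prob_space K" "sets K = sets borel" and f: "f \<in> BL1"
      and close: "(\<integral>z. cmod (char_vec K ((1 / \<sigma>) *\<^sub>R z) - char_vec L ((1 / \<sigma>) *\<^sub>R z)) \<partial>std_gauss) \<le> \<delta>"
    note [measurable] = gauss_smoothing_measurable[OF K] BL1_measurable[OF f]
    have f1: "\<bar>f x\<bar> \<le> 1" and fL: "\<bar>f x - f y\<bar> \<le> norm (x - y)" for x y
      using f by (auto simp: BL1_def)
    let ?S = "\<lambda>x. \<integral>u. f (x + \<sigma> *\<^sub>R u) * gauss_kernel u \<partial>lborel"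
    have fk: "integrable lborel (\<lambda>u. f (x + \<sigma> *\<^sub>R u) * gauss_kernel u)" for x
      by (rule Bochner_Integration.integrable_bound[OF integrable_gauss_kernel])
         (auto simp: abs_mult gauss_kernel_nonneg f1 intro!: mult_left_le_one_le)
    have pointwise: "\<bar>?S x - C * f x\<bar> \<le> \<omega> \<sigma>" for x
    proof -
      have "?S x - C * f x = (\<integral>u. (f (x + \<sigma> *\<^sub>R u) - f x) * gauss_kernel u \<partial>lborel)"
        using Bochner_Integration.integral_diff[OF fk[of x]
            integrable_mult_right[OF integrable_gauss_kernel, of "f x"]]
        by (simp add: C_def algebra_simps)
      also have "\<bar>\<dots>\<bar> \<le> \<omega> \<sigma>" unfolding \<omega>_def
      proof (rule integral_abs_bound[THEN order_trans], rule integral_mono)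
        show "integrable lborel (\<lambda>u. \<bar>(f (x + \<sigma> *\<^sub>R u) - f x) * gauss_kernel u\<bar>)"
          using Bochner_Integration.integrable_diff[OF fk[of x]
            integrable_mult_right[OF integrable_gauss_kernel, of "f x"]]
          by (intro integrable_abs) (simp add: left_diff_distrib)
        fix u :: "real^'n"
        have "\<bar>f (x + \<sigma> *\<^sub>R u) - f x\<bar> \<le> 2" using f1[of x] f1[of "x + \<sigma> *\<^sub>R u"] by linarith
        moreover have "\<bar>f (x + \<sigma> *\<^sub>R u) - f x\<bar> \<le> \<sigma> * norm u" using fL[of "x + \<sigma> *\<^sub>R u" x] \<sigma> by simp
        ultimately show "\<bar>(f (x + \<sigma> *\<^sub>R u) - f x) * gauss_kernel u\<bar> \<le> min 2 (\<sigma> * norm u) * gauss_kernel u"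
          by (simp add: abs_mult gauss_kernel_nonneg mult_right_mono)
      qed (use \<omega>_int \<sigma> in auto)
      finally show ?thesis .
    qed
    have smoothed: "\<bar>(\<integral>y. f y * gauss_smoothing M \<sigma> y \<partial>lborel) - D * (\<integral>x. f x \<partial>M)\<bar> \<le> \<sigma> ^ CARD('n) * \<omega> \<sigma>"
      if M: "prob_space M" "sets M = sets borel" for M :: "(real^'n) measure"
    proof -
      interpret M: prob_space M by fact
      note [measurable_cong] = M(2)
      have i1: "integrable M f" using f1 by (intro M.integrable_const_bound[where B=1]) auto
      have "\<bar>?S x\<bar> \<le> \<omega> \<sigma> + C" for x
      proof -
        have "\<bar>C * f x\<bar> \<le> C * 1" using C f1[of x] by (simp add: abs_mult)
        then show ?thesis using pointwise[of x] by linarith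
      qed
      then have i2: "integrable M ?S" by (intro M.integrable_const_bound[where B="\<omega> \<sigma> + C"]) auto
      have "\<bar>(\<integral>x. ?S x \<partial>M) - C * (\<integral>x. f x \<partial>M)\<bar> = \<bar>\<integral>x. ?S x - C * f x \<partial>M\<bar>"
        using i1 i2 by simp
      also have "\<dots> \<le> (\<integral>x. \<bar>?S x - C * f x\<bar> \<partial>M)" by (rule integral_abs_bound)
      also have "\<dots> \<le> (\<integral>x. \<omega> \<sigma> \<partial>M)" by (intro integral_mono) (use i1 i2 pointwise in auto)
      also have "\<dots> = \<omega> \<sigma>" by (simp add: M.prob_space)
      finally have *: "\<bar>(\<integral>x. ?S x \<partial>M) - C * (\<integral>x. f x \<partial>M)\<bar> \<le> \<omega> \<sigma>" .
      have "(\<integral>y. f y * gauss_smoothing M \<sigma> y \<partial>lborel) - D * (\<integral>x. f x \<partial>M)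
         = \<sigma> ^ CARD('n) * ((\<integral>x. ?S x \<partial>M) - C * (\<integral>x. f x \<partial>M))"
        using integral_gauss_smoothing(2)[OF M _ f1 \<sigma>] by (simp add: D_def algebra_simps)
      then show ?thesis using * \<sigma> by (simp add: abs_mult mult_left_mono)
    qed
    let ?k = "gauss_smoothing K \<sigma>" and ?l = "gauss_smoothing L \<sigma>"
    have "\<bar>(\<integral>y. f y * ?k y \<partial>lborel) - (\<integral>y. f y * ?l y \<partial>lborel)\<bar>
        = \<bar>\<integral>y. f y * (?k y - ?l y) \<partial>lborel\<bar>"
      using integral_gauss_smoothing(1)[OF K _ f1 \<sigma>] integral_gauss_smoothing(1)[OF L _ f1 \<sigma>]
      by (simp add: right_diff_distrib)
    also have "\<dots> \<le> (\<integral>y. \<bar>f y * (?k y - ?l y)\<bar> \<partial>lborel)" by (rule integral_abs_bound)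
    also have "\<dots> \<le> (\<integral>y. (?k y - ?l y) + 2 * min (?l y) \<delta> \<partial>lborel)"
    proof (rule integral_mono)
      show "integrable lborel (\<lambda>y. \<bar>f y * (?k y - ?l y)\<bar>)"
        using integral_gauss_smoothing(1)[OF K _ f1 \<sigma>] integral_gauss_smoothing(1)[OF L _ f1 \<sigma>]
        by (simp add: right_diff_distrib)
      have min_int: "integrable lborel (\<lambda>y. min (?l y) \<delta>)"
        by (rule Bochner_Integration.integrable_bound[OF smooth_int[OF L]])
           (use smooth_nonneg[of L] \<delta> in \<open>auto simp: min_def\<close>)
      then show "integrable lborel (\<lambda>y. (?k y - ?l y) + 2 * min (?l y) \<delta>)"
        using smooth_int[OF K] smooth_int[OF L] by simp
      fix y
      have "\<bar>f y * (?k y - ?l y)\<bar> \<le> \<bar>?k y - ?l y\<bar>"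
        using f1[of y] by (simp add: abs_mult mult_left_le_one_le)
      moreover have "\<bar>?k y - ?l y\<bar> \<le> \<delta>"
        using gauss_smoothing_diff_le[OF K L, of \<sigma> y] close by simp
      ultimately show "\<bar>f y * (?k y - ?l y)\<bar> \<le> (?k y - ?l y) + 2 * min (?l y) \<delta>"
        using smooth_nonneg[of K y] smooth_nonneg[of L y] by (auto simp: min_def abs_if split: if_splits)
    qed
    also have "\<dots> = 2 * (\<integral>y. min (?l y) \<delta> \<partial>lborel)"
    proof -
      have min_int: "integrable lborel (\<lambda>y. min (?l y) \<delta>)"
        by (rule Bochner_Integration.integrable_bound[OF smooth_int[OF L]])
           (use smooth_nonneg[of L] \<delta> in \<open>auto simp: min_def\<close>)
      then show ?thesis
        using smooth_int[OF K] smooth_int[OF L] by (simp add: smooth_total[OF K] smooth_total[OF L])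
    qed
    also have "\<dots> \<le> \<epsilon> / 2 * D" using m by (simp add: \<delta>_def)
    finally have mid: "\<bar>(\<integral>y. f y * ?k y \<partial>lborel) - (\<integral>y. f y * ?l y \<partial>lborel)\<bar> \<le> \<epsilon> / 2 * D" .
    have "\<sigma> ^ CARD('n) * \<omega> \<sigma> \<le> \<epsilon> / 4 * D"
      using mult_left_mono[OF \<omega>, of "\<sigma> ^ CARD('n)"] \<sigma> by (simp add: D_def algebra_simps)
    with smoothed[OF K] smoothed[OF L] mid
    have "\<bar>D * (\<integral>x. f x \<partial>K) - D * (\<integral>x. f x \<partial>L)\<bar> \<le> \<epsilon> * D"
      by linarith
    then have "D * \<bar>(\<integral>x. f x \<partial>K) - (\<integral>x. f x \<partial>L)\<bar> \<le> D * \<epsilon>"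
      using D by (simp add: right_diff_distrib[symmetric] abs_mult mult.commute)
    then show "\<bar>(\<integral>x. f x \<partial>K) - (\<integral>x. f x \<partial>L)\<bar> \<le> \<epsilon>"
      using D by simp
  qed
qed

section \<open>Gaussian laws with singular covariance\<close>

text \<open>
  Cholesky factorization by induction on the index set: when the pivot is positive, its Schur
  complement is again positive semidefinite; when it vanishes, so does the whole row.
\<close>
lemma psd_factorization:
  fixes \<Gamma> :: "'i \<Rightarrow> 'i \<Rightarrow> real"
  assumes "finite I" and "\<And>i j. \<Gamma> i j = \<Gamma> j i"
    and "\<And>x. 0 \<le> (\<Sum>i\<in>I. \<Sum>j\<in>I. x i * x j * \<Gamma> i j)"
  shows "\<exists>A :: 'i \<Rightarrow> 'i \<Rightarrow> real. \<forall>i\<in>I. \<forall>j\<in>I. \<Gamma> i j = (\<Sum>k\<in>I. A i k * A j k)"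
  using assms
proof (induction I arbitrary: \<Gamma> rule: finite_induct)
  case empty
  then show ?case by simp
next
  case (insert a I)
  note sym = insert.prems(1) and psd = insert.prems(2)
  have expand: "(\<Sum>i\<in>insert a I. \<Sum>j\<in>insert a I. x i * x j * \<Gamma> i j)
      = (x a)\<^sup>2 * \<Gamma> a a + 2 * x a * (\<Sum>j\<in>I. x j * \<Gamma> a j) + (\<Sum>i\<in>I. \<Sum>j\<in>I. x i * x j * \<Gamma> i j)" for x
  proof -
    have col: "(\<Sum>i\<in>I. x i * x a * \<Gamma> i a) = x a * (\<Sum>j\<in>I. x j * \<Gamma> a j)"
      unfolding sum_distrib_left by (intro sum.cong refl) (metis sym mult.assoc mult.commute)
    have row: "(\<Sum>j\<in>I. x a * x j * \<Gamma> a j) = x a * (\<Sum>j\<in>I. x j * \<Gamma> a j)"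
      by (simp add: sum_distrib_left mult.assoc)
    show ?thesis
      using insert.hyps by (simp add: sum.distrib col row power2_eq_square)
  qed
  show ?case
  proof (cases "\<Gamma> a a = 0")
    case True
    have zero: "\<Gamma> a j = 0" if "j \<in> I" for j
    proof (rule ccontr)
      assume nz: "\<Gamma> a j \<noteq> 0"
      have ja: "j \<noteq> a" using that insert.hyps by auto
      \<comment> \<open>The quadratic form at this vector is \<open>-1\<close>, as it is linear in \<open>s\<close>.\<close>
      define s where "s = - (\<Gamma> j j + 1) / (2 * \<Gamma> a j)"
      define x where "x = (\<lambda>i. if i = a then s else if i = j then 1 else 0 :: real)"
      have xI: "x i = (if i = j then 1 else 0)" if "i \<in> I" for i
        using that insert.hyps by (auto simp: x_def)
      have "(\<Sum>i\<in>I. x i * \<Gamma> a i) = \<Gamma> a j"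
        using that insert.hyps by (simp add: xI if_distrib[of "\<lambda>t. t * _"] cong: if_cong)
      moreover have "(\<Sum>i\<in>I. \<Sum>k\<in>I. x i * x k * \<Gamma> i k) = \<Gamma> j j"
      proof -
        have "(\<Sum>i\<in>I. \<Sum>k\<in>I. x i * x k * \<Gamma> i k)
            = (\<Sum>i\<in>I. if i = j then (\<Sum>k\<in>I. if k = j then \<Gamma> i k else 0) else 0)"
          by (intro sum.cong refl) (auto simp: xI intro!: sum.cong)
        also have "\<dots> = \<Gamma> j j" using that insert.hyps by simp
        finally show ?thesis .
      qed
      ultimately have "0 \<le> 2 * s * \<Gamma> a j + \<Gamma> j j"
        using psd[of x] unfolding expand by (simp add: True x_def)
      also have "\<dots> = -1" using nz by (simp add: s_def field_simps)
      finally show False by simp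
    qed
    have "0 \<le> (\<Sum>i\<in>I. \<Sum>j\<in>I. x i * x j * \<Gamma> i j)" for x
    proof -
      have "(\<Sum>j\<in>I. x j * \<Gamma> a j) = 0" using zero by (intro sum.neutral) simp
      then show ?thesis using psd[of x] unfolding expand by (simp add: True)
    qed
    from insert.IH[OF sym this] obtain A where A: "\<forall>i\<in>I. \<forall>j\<in>I. \<Gamma> i j = (\<Sum>k\<in>I. A i k * A j k)"
      by blast
    define B where "B i k = (if i = a \<or> k = a then 0 else A i k)" for i k
    have "\<Gamma> i j = (\<Sum>k\<in>insert a I. B i k * B j k)" if "i \<in> insert a I" "j \<in> insert a I" for i j
    proof (cases "i = a \<or> j = a")
      case T: True
      then have "\<Gamma> i j = 0" using zero[of i] zero[of j] True that sym[of i j] by auto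
      then show ?thesis using T by (auto simp: B_def intro!: sum.neutral[symmetric])
    next
      case False
      have "(\<Sum>k\<in>insert a I. B i k * B j k) = (\<Sum>k\<in>I. A i k * A j k)"
        using insert.hyps False by (auto simp: B_def intro!: sum.cong)
      then show ?thesis using A that False by auto
    qed
    then show ?thesis by blast
  next
    case False
    define e where "e i = (if i = a then 1 else 0 :: real)" for i
    have eI: "e i = 0" if "i \<in> I" for i using that insert.hyps by (auto simp: e_def)
    have "(\<Sum>j\<in>I. e j * \<Gamma> a j) = 0" "(\<Sum>i\<in>I. \<Sum>j\<in>I. e i * e j * \<Gamma> i j) = 0"
      by (simp_all add: eI)
    with psd[of e] have "\<Gamma> a a \<ge> 0" unfolding expand by (simp add: e_def)
    with False have pos: "\<Gamma> a a > 0" by simp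
    \<comment> \<open>The Schur complement of the pivot; the value of \<open>y\<close> at \<open>a\<close> below minimizes the form.\<close>
    define \<Delta> where "\<Delta> i j = \<Gamma> i j - \<Gamma> a i * \<Gamma> a j / \<Gamma> a a" for i j
    have "0 \<le> (\<Sum>i\<in>I. \<Sum>j\<in>I. x i * x j * \<Delta> i j)" for x
    proof -
      define S where "S = (\<Sum>j\<in>I. x j * \<Gamma> a j)"
      define y where "y = x(a := - S / \<Gamma> a a)"
      have yI: "y i = x i" if "i \<in> I" for i using that insert.hyps by (auto simp: y_def)
      have "(\<Sum>i\<in>insert a I. \<Sum>j\<in>insert a I. y i * y j * \<Gamma> i j)
          = (S / \<Gamma> a a)\<^sup>2 * \<Gamma> a a - 2 * S / \<Gamma> a a * S + (\<Sum>i\<in>I. \<Sum>j\<in>I. x i * x j * \<Gamma> i j)"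
        unfolding expand by (simp add: yI S_def cong: sum.cong) (simp add: y_def S_def)
      also have "\<dots> = (\<Sum>i\<in>I. \<Sum>j\<in>I. x i * x j * \<Gamma> i j) - S * S / \<Gamma> a a"
        using pos by (simp add: field_simps power2_eq_square)
      also have "\<dots> = (\<Sum>i\<in>I. \<Sum>j\<in>I. x i * x j * \<Delta> i j)"
        unfolding S_def sum_product
        by (simp add: \<Delta>_def right_diff_distrib sum_subtractf sum_divide_distrib mult_ac)
      finally show ?thesis using psd[of y] by simp
    qed
    moreover have "\<Delta> i j = \<Delta> j i" for i j using sym[of i j] by (simp add: \<Delta>_def mult.commute)
    ultimately obtain A where A: "\<forall>i\<in>I. \<forall>j\<in>I. \<Delta> i j = (\<Sum>k\<in>I. A i k * A j k)"
      using insert.IH[of \<Delta>] by blast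
    define B where "B i k = (if k = a then \<Gamma> a i / sqrt (\<Gamma> a a) else if i = a then 0 else A i k)" for i k
    have "\<Gamma> i j = (\<Sum>k\<in>insert a I. B i k * B j k)" if "i \<in> insert a I" "j \<in> insert a I" for i j
    proof -
      have "(\<Sum>k\<in>insert a I. B i k * B j k)
          = \<Gamma> a i * \<Gamma> a j / \<Gamma> a a + (\<Sum>k\<in>I. if i = a \<or> j = a then 0 else A i k * A j k)"
        using insert.hyps pos by (auto simp: B_def intro!: sum.cong)
      also have "\<dots> = \<Gamma> i j"
      proof (cases "i = a \<or> j = a")
        case True
        then show ?thesis using pos sym[of i j] by auto
      next
        case F: False
        then have "(\<Sum>k\<in>I. A i k * A j k) = \<Delta> i j" using A that by auto
        then show ?thesis using F by (simp add: \<Delta>_def)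
      qed
      finally show ?thesis by simp
    qed
    then show ?thesis by blast
  qed
qed

lemma psd_matrix_factorization:
  fixes \<Sigma> :: "real^'n^'n"
  assumes "transpose \<Sigma> = \<Sigma>" and "\<And>x. 0 \<le> x \<bullet> (\<Sigma> *v x)"
  shows "\<exists>A :: real^'n^'n. A ** transpose A = \<Sigma>"
proof -
  have "\<exists>A. \<forall>i\<in>UNIV. \<forall>j\<in>UNIV. \<Sigma> $ i $ j = (\<Sum>k\<in>(UNIV::'n set). A i k * A j k)"
  proof (rule psd_factorization)
    show "\<Sigma> $ i $ j = \<Sigma> $ j $ i" for i j
      using assms(1) by (metis transpose_def vec_lambda_beta)
    show "0 \<le> (\<Sum>i\<in>UNIV. \<Sum>j\<in>UNIV. x i * x j * \<Sigma> $ i $ j)" for x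
      using assms(2)[of "\<chi> i. x i"]
      by (simp add: inner_vec_def matrix_vector_mult_def sum_distrib_left mult_ac)
  qed simp
  then obtain A where A: "\<And>i j. \<Sigma> $ i $ j = (\<Sum>k\<in>(UNIV::'n set). A i k * A j k)" by blast
  have "(\<chi> i k. A i k) ** transpose (\<chi> i k. A i k) = \<Sigma>"
    by (simp add: vec_eq_iff matrix_matrix_mult_def transpose_def A)
  then show ?thesis by blast
qed

text \<open>
  \<^const>\<open>centered_normal\<close> picks some factor of the covariance; all that is used of it is that it is
  one whenever a factor exists.
\<close>
lemma prob_space_centered_normal: "prob_space (centered_normal \<Sigma>)"
  and sets_centered_normal: "sets (centered_normal \<Sigma>) = sets borel"
  and centered_normal_eq_distr:
    "\<exists>A :: real^'n^'n. ((\<exists>B :: real^'n^'n. B ** transpose B = \<Sigma>) \<longrightarrow> A ** transpose A = \<Sigma>) \<and>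
       centered_normal \<Sigma> = distr std_gauss borel (\<lambda>z. A *v z)"
proof -
  define A where "A = (SOME A :: real^'n^'n. A ** transpose A = \<Sigma>)"
  have eq: "centered_normal \<Sigma> = distr std_gauss borel (\<lambda>z. A *v z)"
    unfolding centered_normal_def A_def[symmetric] Let_def std_gauss_def
    by (subst distr_distr) (auto simp: vec_lambda_measurable comp_def
        intro!: borel_measurable_continuous_onI continuous_intros linear_continuous_on
          matrix_vector_mul_bounded_linear)
  show "\<exists>A :: real^'n^'n. ((\<exists>B :: real^'n^'n. B ** transpose B = \<Sigma>) \<longrightarrow> A ** transpose A = \<Sigma>) \<and>
       centered_normal \<Sigma> = distr std_gauss borel (\<lambda>z. A *v z)"
  proof (rule exI, intro conjI impI)
    show "centered_normal \<Sigma> = distr std_gauss borel (\<lambda>z. A *v z)" by (rule eq)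
    show "A ** transpose A = \<Sigma>" if "\<exists>B :: real^'n^'n. B ** transpose B = \<Sigma>"
      unfolding A_def using that by (rule someI_ex)
  qed
  show "sets (centered_normal \<Sigma>) = sets borel" by (simp add: eq)
  show "prob_space (centered_normal \<Sigma>)"
    unfolding eq by (rule prob_space.prob_space_distr[OF prob_space_std_gauss])
      (simp add: measurable_cong_sets[OF sets_std_gauss refl] borel_measurable_continuous_onI
        linear_continuous_on matrix_vector_mul_bounded_linear)
qed

lemma inner_matrix_vector: "x \<bullet> (A *v y) = (transpose A *v x) \<bullet> y" for A :: "real^'n^'m"
  by (metis dot_lmul_matrix transpose_matrix_vector)

lemma char_vec_scaled_centered_normal:
  fixes \<Sigma> :: "real^'n^'n"
  assumes "transpose \<Sigma> = \<Sigma>" and "\<And>x. 0 \<le> x \<bullet> (\<Sigma> *v x)"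
  shows "char_vec (distr (centered_normal \<Sigma>) borel (\<lambda>x. c *\<^sub>R x)) \<xi>
    = complex_of_real (exp (- (c\<^sup>2 * (\<xi> \<bullet> (\<Sigma> *v \<xi>))) / 2))"
proof -
  from centered_normal_eq_distr[of \<Sigma>] obtain A :: "real^'n^'n"
    where ex: "(\<exists>B :: real^'n^'n. B ** transpose B = \<Sigma>) \<longrightarrow> A ** transpose A = \<Sigma>"
    and eq: "centered_normal \<Sigma> = distr std_gauss borel (\<lambda>z. A *v z)"
    by (elim exE conjE)
  from ex psd_matrix_factorization[OF assms] have A: "A ** transpose A = \<Sigma>" by (rule mp)
  have [measurable]: "(\<lambda>z. A *v z) \<in> borel_measurable borel"
    by (auto intro!: borel_measurable_continuous_onI linear_continuous_on matrix_vector_mul_bounded_linear)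
  have "char_vec (distr (centered_normal \<Sigma>) borel (\<lambda>x. c *\<^sub>R x)) \<xi>
      = char_vec std_gauss (c *\<^sub>R (transpose A *v \<xi>))"
    unfolding eq char_vec_def by (simp add: integral_distr distr_distr comp_def inner_matrix_vector)
  also have "(norm (c *\<^sub>R (transpose A *v \<xi>)))\<^sup>2 = c\<^sup>2 * (\<xi> \<bullet> (\<Sigma> *v \<xi>))"
  proof -
    have "(norm (transpose A *v \<xi>))\<^sup>2 = (transpose A *v \<xi>) \<bullet> (transpose A *v \<xi>)"
      by (simp add: power2_norm_eq_inner)
    also have "\<dots> = \<xi> \<bullet> (A *v (transpose A *v \<xi>))"
      by (simp add: inner_matrix_vector)
    finally have "(norm (transpose A *v \<xi>))\<^sup>2 = \<xi> \<bullet> (\<Sigma> *v \<xi>)"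
      by (simp only: matrix_vector_mul_assoc A)
    then show ?thesis by (simp add: power_mult_distrib)
  qed
  then show ?thesis unfolding calculation char_vec_std_gauss by simp
qed

section \<open>Convex functions near a quadratic and their minimizers\<close>

text \<open>
  Values on \<open>S\<close> control every convex function on all of \<open>X\<close>: a convex function within \<open>\<eta>\<close> of \<open>Q\<close>
  on \<open>S\<close> is within \<open>\<epsilon> + 3 \<eta>\<close> of \<open>Q\<close> on \<open>X\<close>. Since \<open>S\<close> is chosen before the convex function, it
  may be used for random functions.
\<close>
definition convex_controls :: "'e::real_vector set \<Rightarrow> ('e \<Rightarrow> real) \<Rightarrow> real \<Rightarrow> 'e set \<Rightarrow> 'e set \<Rightarrow> bool" where
  "convex_controls C Q \<epsilon> S X \<longleftrightarrow> (\<forall>f \<eta>. convex_on C f \<longrightarrow> (\<forall>s\<in>S. \<bar>f s - Q s\<bar> \<le> \<eta>) \<longrightarrow>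
     (\<forall>x\<in>X. \<bar>f x - Q x\<bar> \<le> \<epsilon> + 3 * \<eta>))"

text \<open>
  Take for \<open>S\<close> the point \<open>p\<close> and the corners of a small cube around it. Convexity bounds the
  function from above on the cube by its values at the corners, and from below by reflection at
  the center.
\<close>
lemma convex_close_to_continuous_at_point:
  fixes Q :: "'e::euclidean_space \<Rightarrow> real"
  assumes "open C" "p \<in> C" "continuous_on C Q" "\<epsilon> > 0"
  shows "\<exists>S \<rho>. finite S \<and> S \<subseteq> C \<and> \<rho> > 0 \<and> convex_controls C Q \<epsilon> S (ball p \<rho>)"
proof -
  have "isCont Q p" using assms continuous_on_eq_continuous_at by blast
  then obtain e1 where e1: "e1 > 0" "\<And>x. dist x p < e1 \<Longrightarrow> \<bar>Q x - Q p\<bar> < \<epsilon> / 4"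
    using \<open>\<epsilon> > 0\<close> unfolding continuous_at_eps_delta dist_real_def
    by (metis divide_pos_pos zero_less_numeral)
  obtain e2 where e2: "e2 > 0" "ball p e2 \<subseteq> C" using assms open_contains_ball by blast
  define e where "e = min e1 e2"
  have e: "e > 0" "ball p e \<subseteq> C" "\<And>x. x \<in> ball p e \<Longrightarrow> \<bar>Q x - Q p\<bar> < \<epsilon> / 4"
    using e1 e2 by (auto simp: e_def dist_commute)
  define d where "d = e / (2 * DIM('e))"
  have d: "d > 0" using e by (simp add: d_def)
  define B where "B = cbox (p - (\<Sum>i\<in>Basis. d *\<^sub>R i)) (p + (\<Sum>i\<in>Basis. d *\<^sub>R i))"
  have mem_B: "x \<in> B \<longleftrightarrow> (\<forall>i\<in>Basis. \<bar>(x - p) \<bullet> i\<bar> \<le> d)" for x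
    by (auto simp: B_def mem_box inner_add_left inner_diff_left inner_sum_left inner_Basis abs_le_iff
        if_distrib cong: if_cong)
  have B_sub: "B \<subseteq> ball p e"
  proof
    fix x assume "x \<in> B"
    then have "norm (x - p) \<le> (\<Sum>i\<in>(Basis::'e set). d)"
      using mem_B by (intro order_trans[OF norm_le_l1] sum_mono) auto
    also have "\<dots> = e / 2" by (simp add: d_def)
    finally show "x \<in> ball p e" using e(1) by (simp add: dist_norm norm_minus_commute)
  qed
  obtain V where V: "finite V" "B = convex hull V"
    using cube_convex_hull[OF d, of p] unfolding B_def by metis
  have VB: "V \<subseteq> B" unfolding V(2) by (rule hull_subset)
  have ball_B: "ball p d \<subseteq> B"
  proof
    fix x assume "x \<in> ball p d"
    then have "norm (x - p) \<le> d" by (simp add: dist_norm norm_minus_commute)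
    then show "x \<in> B" unfolding mem_B by (meson Basis_le_norm order_trans)
  qed
  have "convex_controls C Q \<epsilon> (insert p V) (ball p d)"
    unfolding convex_controls_def
  proof (intro allI impI ballI)
    fix f \<eta> x
    assume f: "convex_on C f" and near: "\<forall>s\<in>insert p V. \<bar>f s - Q s\<bar> \<le> \<eta>" and x: "x \<in> ball p d"
    have fB: "convex_on (convex hull V) f"
      unfolding V(2)[symmetric] by (rule convex_on_subset[OF f])
        (use B_sub e in \<open>auto simp: B_def\<close>)
    have "\<forall>s\<in>V. f s \<le> Q p + \<epsilon> / 4 + \<eta>"
    proof
      fix s assume "s \<in> V"
      then have "\<bar>Q s - Q p\<bar> < \<epsilon> / 4" "\<bar>f s - Q s\<bar> \<le> \<eta>"
        using VB B_sub e(3) near by blast+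
      then show "f s \<le> Q p + \<epsilon> / 4 + \<eta>" by linarith
    qed
    from convex_on_convex_hull_bound[OF fB this] have up: "f y \<le> Q p + \<epsilon> / 4 + \<eta>" if "y \<in> B" for y
      using that V(2) by blast
    define w where "w = 2 *\<^sub>R p - x"
    have w: "w \<in> ball p d"
      using x by (simp add: w_def dist_norm scaleR_2 norm_minus_commute)
    have mid: "p = (1 - 1/2) *\<^sub>R x + (1/2) *\<^sub>R w"
      by (simp add: w_def scaleR_diff_right)
    have "f p \<le> (1 - 1/2) * f x + (1/2) * f w"
      using convex_onD[OF f, of "1/2" x w] x w ball_B B_sub e(2) mid by (metis atLeastAtMost_iff
          half_gt_zero_iff less_eq_real_def subsetD zero_less_one field_sum_of_halves le_add_same_cancel1 divide_le_eq_1 one_le_numeral zero_le_divide_1_iff zero_le_numeral)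
    then have "f x \<ge> 2 * f p - f w" by simp
    moreover have "f p \<ge> Q p - \<eta>" using near by auto
    moreover have "f w \<le> Q p + \<epsilon> / 4 + \<eta>" "f x \<le> Q p + \<epsilon> / 4 + \<eta>" using up w x ball_B by auto
    moreover have "\<bar>Q x - Q p\<bar> < \<epsilon> / 4" using x ball_B B_sub e(3) by blast
    ultimately show "\<bar>f x - Q x\<bar> \<le> \<epsilon> + 3 * \<eta>" using \<open>\<epsilon> > 0\<close> by linarith
  qed
  moreover have "finite (insert p V)" "insert p V \<subseteq> C" using V VB B_sub e assms(2) by auto
  ultimately show ?thesis using d by blast
qed

lemma convex_close_to_continuous_on_compact:
  fixes Q :: "'e::euclidean_space \<Rightarrow> real"
  assumes "open C" "compact K" "K \<subseteq> C" "continuous_on C Q" "\<epsilon> > 0"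
  shows "\<exists>S. finite S \<and> S \<subseteq> C \<and> convex_controls C Q \<epsilon> S K"
proof -
  have "\<forall>p\<in>K. \<exists>S \<rho>. finite S \<and> S \<subseteq> C \<and> \<rho> > 0 \<and> convex_controls C Q \<epsilon> S (ball p \<rho>)"
    using convex_close_to_continuous_at_point[OF assms(1) _ assms(4,5)] assms(3) by blast
  then obtain S \<rho> where S: "\<And>p. p \<in> K \<Longrightarrow>
      finite (S p) \<and> S p \<subseteq> C \<and> \<rho> p > 0 \<and> convex_controls C Q \<epsilon> (S p) (ball p (\<rho> p))"
    by metis
  obtain K' where K': "K' \<subseteq> K" "finite K'" "K \<subseteq> (\<Union>p\<in>K'. ball p (\<rho> p))"
  proof (rule compactE_image[OF assms(2), of K "\<lambda>p. ball p (\<rho> p)"])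
    show "K \<subseteq> (\<Union>p\<in>K. ball p (\<rho> p))" using S by force
  qed auto
  have "convex_controls C Q \<epsilon> (\<Union>p\<in>K'. S p) K"
    unfolding convex_controls_def
  proof (intro allI impI ballI)
    fix f \<eta> x
    assume f: "convex_on C f" "\<forall>s\<in>(\<Union>p\<in>K'. S p). \<bar>f s - Q s\<bar> \<le> \<eta>" and "x \<in> K"
    then obtain p where p: "p \<in> K'" "x \<in> ball p (\<rho> p)" using K' by blast
    have "convex_controls C Q \<epsilon> (S p) (ball p (\<rho> p))" using S p(1) K'(1) by blast
    moreover have "\<forall>s\<in>S p. \<bar>f s - Q s\<bar> \<le> \<eta>" using f(2) p(1) by blast
    ultimately show "\<bar>f x - Q x\<bar> \<le> \<epsilon> + 3 * \<eta>"
      using f(1) p(2) unfolding convex_controls_def by blast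
  qed
  moreover have "finite (\<Union>p\<in>K'. S p)" "(\<Union>p\<in>K'. S p) \<subseteq> C" using K' S by auto
  ultimately show ?thesis by blast
qed

text \<open>
  The convexity argument of argmin asymptotics in deterministic form. If a convex \<open>G\<close> is close
  to the quadratic \<open>a \<bullet> h + h \<bullet> (A *v h) / 2\<close> at the points of \<open>S\<close>, it is uniformly close on a
  ball. The quadratic grows by \<open>m \<delta>\<^sup>2 / 2\<close> on the sphere of radius \<open>\<delta>\<close> around its minimizer
  \<open>h0\<close>, so \<open>G\<close> is larger there than at \<open>h0\<close>, and by convexity also outside. \<open>S\<close> and \<open>\<eta>\<close> do not
  depend on \<open>G\<close>, \<open>a\<close> and \<open>h0\<close>.
\<close>
lemma argmin_near_quadratic_argmin:
  fixes A :: "real^'n^'n"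
  assumes sym: "transpose A = A" and m: "m > 0" "\<And>h. m * (norm h)\<^sup>2 \<le> h \<bullet> (A *v h)"
    and "r \<ge> 0" "\<delta> > 0"
  obtains S \<eta> where "finite S" "S \<subseteq> ball 0 (r + \<delta> + 1)" "\<eta> > 0"
    "\<And>G D a h0. convex_on D G \<Longrightarrow> ball 0 (r + \<delta> + 1) \<subseteq> D \<Longrightarrow> A *v h0 = - a \<Longrightarrow> norm h0 \<le> r \<Longrightarrow>
       (\<And>s. s \<in> S \<Longrightarrow> \<bar>G s - a \<bullet> s - s \<bullet> (A *v s) / 2\<bar> \<le> \<eta>) \<Longrightarrow>
       (\<exists>h\<in>D. \<forall>y\<in>D. G h \<le> G y) \<and> (\<forall>h\<in>D. \<delta> \<le> dist h h0 \<longrightarrow> G h0 < G h)"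
proof -
  let ?C = "ball 0 (r + \<delta> + 1) :: (real^'n) set"
  define Q where "Q h = h \<bullet> (A *v h) / 2" for h
  \<comment> \<open>On the sphere of radius \<open>\<delta>\<close> the quadratic exceeds its minimum by \<open>8 \<epsilon>\<close>; each of the two
  approximations costs \<open>2 \<epsilon>\<close>.\<close>
  define \<epsilon> where "\<epsilon> = m * \<delta>\<^sup>2 / 16"
  have \<epsilon>: "\<epsilon> > 0" using m \<open>\<delta> > 0\<close> by (simp add: \<epsilon>_def)
  have QC: "continuous_on ?C Q" unfolding Q_def
    by (intro continuous_intros linear_continuous_on matrix_vector_mul_bounded_linear) simp
  have sub: "cball 0 (r + \<delta>) \<subseteq> ?C" by auto
  obtain S where S: "finite S" "S \<subseteq> ?C" "convex_controls ?C Q \<epsilon> S (cball 0 (r + \<delta>))"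
    using convex_close_to_continuous_on_compact[OF open_ball compact_cball sub QC \<epsilon>] by blast
  show thesis
  proof (rule that[of S "\<epsilon> / 3"])
    show "finite S" "S \<subseteq> ?C" "\<epsilon> / 3 > 0" using S \<epsilon> by auto
    fix G :: "real^'n \<Rightarrow> real" and D a h0
    assume G: "convex_on D G" and CD: "?C \<subseteq> D" and h0: "A *v h0 = - a" "norm h0 \<le> r"
      and near: "\<And>s. s \<in> S \<Longrightarrow> \<bar>G s - a \<bullet> s - s \<bullet> (A *v s) / 2\<bar> \<le> \<epsilon> / 3"
    have "convex_on ?C (\<lambda>h. G h + (- a) \<bullet> h)"
    proof (rule convex_on_add)
      show "convex_on ?C G" using G CD by (rule convex_on_subset) simp
      show "convex_on ?C (\<lambda>h. (- a) \<bullet> h)"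
        by (rule convex_onI) (simp_all add: inner_add_right algebra_simps)
    qed
    moreover have "\<forall>s\<in>S. \<bar>(G s + (- a) \<bullet> s) - Q s\<bar> \<le> \<epsilon> / 3"
      using near by (simp add: Q_def)
    ultimately have unif: "\<bar>G h - a \<bullet> h - Q h\<bar> \<le> 2 * \<epsilon>" if "norm h \<le> r + \<delta>" for h
      using S(3) that unfolding convex_controls_def by (fastforce simp: dist_norm)
    have quad: "a \<bullet> h + Q h = Q (h - h0) - Q h0" for h
    proof -
      have "h0 \<bullet> (A *v h) = h \<bullet> (A *v h0)"
        by (metis dot_lmul_matrix inner_commute sym transpose_matrix_vector)
      moreover have "h \<bullet> (A *v h0) = - (a \<bullet> h)" by (simp add: h0 inner_commute)
      ultimately show ?thesis
        by (simp add: Q_def matrix_vector_mult_diff_distrib inner_diff_left inner_diff_right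
            add_divide_distrib diff_divide_distrib)
    qed
    have sphere: "G h0 < G h" if "dist h h0 = \<delta>" for h
    proof -
      have "norm h \<le> r + \<delta>" using that h0(2) norm_triangle_sub[of h h0] by (simp add: dist_norm)
      then have "G h \<ge> Q (h - h0) - Q h0 - 2 * \<epsilon>" using unif[of h] quad[of h] by linarith
      moreover have "G h0 \<le> - Q h0 + 2 * \<epsilon>"
        using unif[of h0] quad[of h0] h0(2) \<open>\<delta> > 0\<close> by (simp add: Q_def)
      moreover have "Q (h - h0) \<ge> m * \<delta>\<^sup>2 / 2" using m(2)[of "h - h0"] that by (simp add: Q_def dist_norm)
      moreover have "m * \<delta>\<^sup>2 / 2 = 8 * \<epsilon>" by (simp add: \<epsilon>_def)
      ultimately show ?thesis using \<epsilon> by linarith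
    qed
    have h0C: "h0 \<in> ?C" using h0(2) \<open>\<delta> > 0\<close> by simp
    have outside: "G h0 < G h" if h: "h \<in> D" "\<delta> \<le> dist h h0" for h
    proof (rule ccontr)
      assume "\<not> G h0 < G h"
      define u where "u = \<delta> / dist h h0"
      have u: "0 < u" "u \<le> 1" using h \<open>\<delta> > 0\<close> by (auto simp: u_def divide_simps)
      define z where "z = (1 - u) *\<^sub>R h0 + u *\<^sub>R h"
      have "z - h0 = u *\<^sub>R (h - h0)" by (simp add: z_def algebra_simps)
      then have "dist z h0 = \<delta>" using u h \<open>\<delta> > 0\<close> by (auto simp: dist_norm u_def)
      then have "G h0 < G z" by (rule sphere)
      also have "G z \<le> (1 - u) * G h0 + u * G h"
        unfolding z_def using convex_onD[OF G, of u h0 h] u h0C CD h by auto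
      also have "\<dots> \<le> (1 - u) * G h0 + u * G h0"
        using \<open>\<not> G h0 < G h\<close> u by (intro add_left_mono mult_left_mono) auto
      finally show False by (simp add: algebra_simps)
    qed
    have cb: "cball h0 \<delta> \<subseteq> ?C"
    proof
      fix x assume "x \<in> cball h0 \<delta>"
      then show "x \<in> ?C" using h0(2) norm_triangle_sub[of x h0] by (simp add: dist_norm norm_minus_commute)
    qed
    have "continuous_on ?C G"
      by (rule convex_on_continuous[OF open_ball]) (rule convex_on_subset[OF G CD], simp)
    then have "continuous_on (cball h0 \<delta>) G" using cb continuous_on_subset by blast
    then obtain h where h: "h \<in> cball h0 \<delta>" "\<And>y. y \<in> cball h0 \<delta> \<Longrightarrow> G h \<le> G y"
      using continuous_attains_inf[OF compact_cball, of h0 \<delta> G] \<open>\<delta> > 0\<close> by auto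
    have "G h \<le> G y" if "y \<in> D" for y
    proof (cases "y \<in> cball h0 \<delta>")
      case False
      then have "G h0 < G y" using outside[OF that] by (simp add: dist_commute)
      moreover have "G h \<le> G h0" using h(2)[of h0] \<open>\<delta> > 0\<close> by simp
      ultimately show ?thesis by simp
    qed (use h in auto)
    then show "(\<exists>h\<in>D. \<forall>y\<in>D. G h \<le> G y) \<and> (\<forall>h\<in>D. \<delta> \<le> dist h h0 \<longrightarrow> G h0 < G h)"
      using h(1) cb CD outside by blast
  qed
qed

section \<open>Measurability of unique minimizers\<close>

text \<open>
  By uniqueness, the minimizer lies in an open set iff some minimizer lies in one of countably
  many closed balls inside it. By continuity, that is expressed through the values of \<open>f\<close> on a
  countable dense set: for every \<open>p\<close> in it and every \<open>k\<close>, some point of the ball in it does at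
  least as well as \<open>p\<close> up to \<open>1 / (k + 1)\<close>. The default \<open>d\<close> is the value of \<^const>\<open>arg_min_on\<close> where
  no minimizer exists.
\<close>
lemma borel_measurable_unique_argmin:
  fixes f :: "'x \<Rightarrow> 'b::euclidean_space \<Rightarrow> real" and g :: "'x \<Rightarrow> 'b"
  assumes U: "open U"
    and cont: "\<And>x. x \<in> space N \<Longrightarrow> continuous_on U (f x)"
    and meas: "\<And>p. p \<in> U \<Longrightarrow> (\<lambda>x. f x p) \<in> borel_measurable N"
    and uniq: "\<And>x p q. x \<in> space N \<Longrightarrow> p \<in> U \<Longrightarrow> q \<in> U \<Longrightarrow> (\<And>y. y \<in> U \<Longrightarrow> f x p \<le> f x y) \<Longrightarrow>
      (\<And>y. y \<in> U \<Longrightarrow> f x q \<le> f x y) \<Longrightarrow> p = q"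
    and argmin: "\<And>x. x \<in> space N \<Longrightarrow> \<exists>p\<in>U. \<forall>y\<in>U. f x p \<le> f x y \<Longrightarrow>
      g x \<in> U \<and> (\<forall>y\<in>U. f x (g x) \<le> f x y)"
    and default: "\<And>x. x \<in> space N \<Longrightarrow> \<not> (\<exists>p\<in>U. \<forall>y\<in>U. f x p \<le> f x y) \<Longrightarrow> g x = d"
  shows "g \<in> borel_measurable N"
proof -
  obtain D :: "'b set" where D: "countable D" "\<And>X. open X \<Longrightarrow> X \<noteq> {} \<Longrightarrow> \<exists>d\<in>D. d \<in> X"
    by (rule countable_dense_setE) blast
  \<comment> \<open>\<open>M K x\<close> says, in terms of the dense set only, that the infimum of \<open>f x\<close> over \<open>U\<close> is
  approached within \<open>K\<close>.\<close>
  define M where "M K x \<longleftrightarrow> (\<forall>p\<in>D \<inter> U. \<forall>k::nat. \<exists>q\<in>D \<inter> U \<inter> K. f x q \<le> f x p + 1 / real (Suc k))" for K x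
  have M_meas: "{x \<in> space N. M K x} \<in> sets N" for K
  proof -
    have "Measurable.pred N (\<lambda>x. f x q \<le> f x p + c)" if "p \<in> D \<inter> U" "q \<in> D \<inter> U \<inter> K" for p q c
    proof -
      have [measurable]: "(\<lambda>x. f x p) \<in> borel_measurable N" "(\<lambda>x. f x q) \<in> borel_measurable N"
        using that meas by auto
      show ?thesis by measurable
    qed
    then show ?thesis
      unfolding M_def
      by (intro sets.sets_Collect_countable_All' sets.sets_Collect_countable_All
            sets.sets_Collect_countable_Ex' countable_Int1 D(1)) (simp add: pred_def)
  qed
  have M_argmin: "\<exists>p\<in>K. \<forall>y\<in>U. f x p \<le> f x y"
    if x: "x \<in> space N" and K: "compact K" "K \<noteq> {}" "K \<subseteq> U" and M: "M K x" for x K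
  proof -
    obtain q0 where q0: "q0 \<in> K" "\<And>y. y \<in> K \<Longrightarrow> f x q0 \<le> f x y"
      using continuous_attains_inf[OF K(1,2) continuous_on_subset[OF cont[OF x] K(3)]] by blast
    have below: "f x q0 \<le> f x p" if "p \<in> D \<inter> U" for p
    proof (rule field_le_epsilon)
      fix e :: real assume "e > 0"
      then obtain k where k: "1 / real (Suc k) < e" using nat_approx_posE by blast
      obtain q where "q \<in> D \<inter> U \<inter> K" "f x q \<le> f x p + 1 / real (Suc k)"
        using M \<open>p \<in> D \<inter> U\<close> unfolding M_def by blast
      then show "f x q0 \<le> f x p + e" using q0(2)[of q] k by auto
    qed
    have "f x q0 \<le> f x y" if y: "y \<in> U" for y
    proof (rule ccontr)
      assume "\<not> f x q0 \<le> f x y"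
      then have "y \<in> U \<inter> f x -` {..<f x q0}" using y by auto
      moreover have "open (U \<inter> f x -` {..<f x q0})"
        by (rule continuous_open_preimage[OF cont[OF x] U]) simp
      ultimately obtain p where "p \<in> D" "p \<in> U \<inter> f x -` {..<f x q0}" using D(2) by blast
      then show False using below[of p] by auto
    qed
    then show ?thesis using q0(1) by blast
  qed
  have argmin_M: "M (cball c r) x"
    if x: "x \<in> space N" and p: "p \<in> U" "p \<in> ball c r" "\<And>y. y \<in> U \<Longrightarrow> f x p \<le> f x y" for x p c r
    unfolding M_def
  proof (intro ballI allI)
    fix p' and k :: nat assume p': "p' \<in> D \<inter> U"
    let ?V = "(U \<inter> f x -` {..<f x p + 1 / real (Suc k)}) \<inter> ball c r"
    have "open ?V"
      by (intro open_Int continuous_open_preimage[OF cont[OF x] U] open_ball open_lessThan)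
    moreover have "p \<in> ?V" using p by auto
    ultimately obtain q where q: "q \<in> D" "q \<in> ?V" using D(2) by blast
    then show "\<exists>q\<in>D \<inter> U \<inter> cball c r. f x q \<le> f x p' + 1 / real (Suc k)"
      using p(3)[of p'] p' by (intro bexI[of _ q]) auto
  qed
  define I where "I O' = {(c, n). c \<in> D \<and> cball c (1 / real (Suc n)) \<subseteq> O' \<inter> U}" for O'
  have I_count: "countable (I O')" for O'
    by (rule countable_subset[of _ "D \<times> (UNIV::nat set)"]) (auto simp: I_def D(1))
  have char: "{x \<in> space N. \<exists>p\<in>O' \<inter> U. \<forall>y\<in>U. f x p \<le> f x y}
      = (\<Union>(c, n)\<in>I O'. {x \<in> space N. M (cball c (1 / real (Suc n))) x})" if O': "open O'" for O'
  proof (intro equalityI subsetI)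
    fix x assume "x \<in> {x \<in> space N. \<exists>p\<in>O' \<inter> U. \<forall>y\<in>U. f x p \<le> f x y}"
    then obtain p where x: "x \<in> space N" and p: "p \<in> O' \<inter> U" "\<And>y. y \<in> U \<Longrightarrow> f x p \<le> f x y" by blast
    obtain e where e: "e > 0" "ball p e \<subseteq> O' \<inter> U" using p(1) O' U open_contains_ball by (metis open_Int)
    obtain n where n: "1 / real (Suc n) < e / 2" using nat_approx_posE[of "e / 2"] e by auto
    obtain c where c: "c \<in> D" "c \<in> ball p (1 / real (Suc n))" using D(2)[of "ball p (1 / real (Suc n))"] by auto
    have "cball c (1 / real (Suc n)) \<subseteq> ball p e"
    proof
      fix y assume "y \<in> cball c (1 / real (Suc n))"
      then show "y \<in> ball p e" using c(2) n dist_triangle[of p y c] by auto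
    qed
    then have "(c, n) \<in> I O'" using e(2) c(1) by (auto simp: I_def)
    moreover have "M (cball c (1 / real (Suc n))) x"
      using argmin_M[OF x, of p c "1 / real (Suc n)"] p c(2) by (auto simp: dist_commute)
    ultimately show "x \<in> (\<Union>(c, n)\<in>I O'. {x \<in> space N. M (cball c (1 / real (Suc n))) x})"
      using x by blast
  next
    fix x assume "x \<in> (\<Union>(c, n)\<in>I O'. {x \<in> space N. M (cball c (1 / real (Suc n))) x})"
    then obtain c n where cn: "cball c (1 / real (Suc n)) \<subseteq> O' \<inter> U" "x \<in> space N" "M (cball c (1 / real (Suc n))) x"
      by (auto simp: I_def)
    then show "x \<in> {x \<in> space N. \<exists>p\<in>O' \<inter> U. \<forall>y\<in>U. f x p \<le> f x y}"
      using M_argmin[of x "cball c (1 / real (Suc n))"] by fastforce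
  qed
  have E_meas: "{x \<in> space N. \<exists>p\<in>O' \<inter> U. \<forall>y\<in>U. f x p \<le> f x y} \<in> sets N" if "open O'" for O'
    unfolding char[OF that] using I_count M_meas by (intro sets.countable_UN') auto
  show ?thesis
  proof (rule borel_measurableI)
    fix O' :: "'b set" assume O': "open O'"
    let ?E = "{x \<in> space N. \<exists>p\<in>UNIV \<inter> U. \<forall>y\<in>U. f x p \<le> f x y}"
    let ?EO = "{x \<in> space N. \<exists>p\<in>O' \<inter> U. \<forall>y\<in>U. f x p \<le> f x y}"
    have "g -` O' \<inter> space N = ?EO \<union> (if d \<in> O' then space N - ?E else {})"
    proof (intro equalityI subsetI)
      fix x assume x: "x \<in> g -` O' \<inter> space N"
      show "x \<in> ?EO \<union> (if d \<in> O' then space N - ?E else {})"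
      proof (cases "\<exists>p\<in>U. \<forall>y\<in>U. f x p \<le> f x y")
        case True then show ?thesis using x argmin[of x] by auto
      next
        case False then show ?thesis using x default[of x] by auto
      qed
    next
      fix x assume x: "x \<in> ?EO \<union> (if d \<in> O' then space N - ?E else {})"
      then have xN: "x \<in> space N" by (auto split: if_splits)
      show "x \<in> g -` O' \<inter> space N"
      proof (cases "x \<in> ?EO")
        case True
        then obtain p where p: "p \<in> O'" "p \<in> U" "\<forall>y\<in>U. f x p \<le> f x y" by blast
        then have "g x = p" using argmin[OF xN] uniq[OF xN, of "g x" p] by blast
        then show ?thesis using p xN by simp
      next
        case False
        then have "d \<in> O'" "x \<notin> ?E" using x by (auto split: if_splits)
        then show ?thesis using default[OF xN] xN by auto
      qed
    qed
    also have "\<dots> \<in> sets N" using E_meas[OF O'] E_meas[OF open_UNIV] by auto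
    finally show "g -` O' \<inter> space N \<in> sets N" .
  qed
qed

section \<open>Weighted sums of independent bounded variables\<close>

text \<open>
  Centered functions of distinct coordinates are orthogonal under a product measure.
\<close>
lemma PiM_weighted_sum_second_moment:
  fixes r :: "'a \<Rightarrow> real"
  assumes N: "prob_space N" and I: "finite I" and [measurable]: "r \<in> borel_measurable N"
    and bound: "\<And>x. x \<in> space N \<Longrightarrow> \<bar>r x\<bar> \<le> B" and mean: "(\<integral>x. r x \<partial>N) = 0"
  shows "integrable (PiM I (\<lambda>_. N)) (\<lambda>x. (\<Sum>\<tau>\<in>I. w \<tau> * r (x \<tau>))\<^sup>2)"
    and "(\<integral>x. (\<Sum>\<tau>\<in>I. w \<tau> * r (x \<tau>))\<^sup>2 \<partial>PiM I (\<lambda>_. N)) = (\<Sum>\<tau>\<in>I. (w \<tau>)\<^sup>2) * (\<integral>x. (r x)\<^sup>2 \<partial>N)"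
proof -
  interpret N: prob_space N by fact
  interpret product_sigma_finite "\<lambda>_. N" by standard
  interpret P: prob_space "PiM I (\<lambda>_. N)" by (rule prob_space_PiM) (rule N)
  let ?P = "PiM I (\<lambda>_. N)"
  have r_int: "integrable N r" "integrable N (\<lambda>x. (r x)\<^sup>2)"
  proof -
    show "integrable N r" by (rule N.integrable_const_bound[where B=B]) (auto simp: bound)
    show "integrable N (\<lambda>x. (r x)\<^sup>2)"
      by (rule N.integrable_const_bound[where B="B\<^sup>2"])
         (auto intro!: AE_I2 power_mono[OF bound abs_ge_zero, of _ 2, simplified power2_abs])
  qed
  have cross: "integrable ?P (\<lambda>x. r (x \<tau>) * r (x \<sigma>)) \<and>
      (\<integral>x. r (x \<tau>) * r (x \<sigma>) \<partial>?P) = (if \<tau> = \<sigma> then (\<integral>x. (r x)\<^sup>2 \<partial>N) else 0)"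
    if "\<tau> \<in> I" "\<sigma> \<in> I" for \<tau> \<sigma>
  proof -
    define f where "f i = (if i = \<tau> then if i = \<sigma> then (\<lambda>x. (r x)\<^sup>2) else r else if i = \<sigma> then r else (\<lambda>_. 1))" for i
    have f_int: "integrable N (f i)" for i using r_int by (auto simp: f_def)
    have prod: "(\<Prod>i\<in>I. f i (x i)) = r (x \<tau>) * r (x \<sigma>)" for x
    proof (cases "\<tau> = \<sigma>")
      case True
      have "(\<Prod>i\<in>I. f i (x i)) = (\<Prod>i\<in>I. if i = \<tau> then (r (x i))\<^sup>2 else 1)"
        by (intro prod.cong) (auto simp: f_def True)
      then show ?thesis using I that True by (simp add: power2_eq_square)
    next
      case False
      have "(\<Prod>i\<in>I. f i (x i)) = (\<Prod>i\<in>I. (if i = \<tau> then r (x i) else 1) * (if i = \<sigma> then r (x i) else 1))"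
        by (intro prod.cong) (use False in \<open>auto simp: f_def\<close>)
      then show ?thesis using I that by (simp add: prod.distrib)
    qed
    have "(\<Prod>i\<in>I. (\<integral>x. f i x \<partial>N)) = (if \<tau> = \<sigma> then (\<integral>x. (r x)\<^sup>2 \<partial>N) else 0)"
    proof (cases "\<tau> = \<sigma>")
      case True
      have "(\<Prod>i\<in>I. (\<integral>x. f i x \<partial>N)) = (\<Prod>i\<in>I. if i = \<tau> then (\<integral>x. (r x)\<^sup>2 \<partial>N) else 1)"
        by (intro prod.cong) (auto simp: f_def True N.prob_space)
      then show ?thesis using I that True by simp
    next
      case False
      then have "(\<integral>x. f \<tau> x \<partial>N) = 0" by (simp add: f_def mean)
      then show ?thesis using I that False by (simp add: prod_zero_iff) blast
    qed
    then show ?thesis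
      using product_integrable_prod[OF I, of f] product_integral_prod[OF I, of f] f_int
      unfolding prod by simp
  qed
  have sq: "(\<Sum>\<tau>\<in>I. w \<tau> * r (x \<tau>))\<^sup>2 = (\<Sum>\<tau>\<in>I. \<Sum>\<sigma>\<in>I. w \<tau> * w \<sigma> * (r (x \<tau>) * r (x \<sigma>)))" for x
    by (simp add: power2_eq_square sum_product mult_ac)
  show "integrable ?P (\<lambda>x. (\<Sum>\<tau>\<in>I. w \<tau> * r (x \<tau>))\<^sup>2)"
    unfolding sq using cross by (intro Bochner_Integration.integrable_sum integrable_mult_right) auto
  have "(\<integral>x. (\<Sum>\<tau>\<in>I. w \<tau> * r (x \<tau>))\<^sup>2 \<partial>?P)
     = (\<Sum>\<tau>\<in>I. \<Sum>\<sigma>\<in>I. w \<tau> * w \<sigma> * (\<integral>x. r (x \<tau>) * r (x \<sigma>) \<partial>?P))"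
    unfolding sq using cross
    by (subst Bochner_Integration.integral_sum, force, intro sum.cong refl,
        subst Bochner_Integration.integral_sum, force, intro sum.cong refl integral_mult_right_zero)
  also have "\<dots> = (\<Sum>\<tau>\<in>I. \<Sum>\<sigma>\<in>I. if \<sigma> = \<tau> then (w \<tau>)\<^sup>2 * (\<integral>x. (r x)\<^sup>2 \<partial>N) else 0)"
    using cross by (intro sum.cong refl) (auto simp: power2_eq_square)
  also have "\<dots> = (\<Sum>\<tau>\<in>I. (w \<tau>)\<^sup>2) * (\<integral>x. (r x)\<^sup>2 \<partial>N)"
    using I by (simp add: sum_distrib_right)
  finally show "(\<integral>x. (\<Sum>\<tau>\<in>I. w \<tau> * r (x \<tau>))\<^sup>2 \<partial>?P) = (\<Sum>\<tau>\<in>I. (w \<tau>)\<^sup>2) * (\<integral>x. (r x)\<^sup>2 \<partial>N)" .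
qed

lemma PiM_weighted_sum_Chebyshev:
  fixes r :: "'a \<Rightarrow> real"
  assumes N: "prob_space N" and I: "finite I" and [measurable]: "r \<in> borel_measurable N"
    and bound: "\<And>x. x \<in> space N \<Longrightarrow> \<bar>r x\<bar> \<le> B" and mean: "(\<integral>x. r x \<partial>N) = 0" and "c > 0"
  shows "measure (PiM I (\<lambda>_. N)) {x \<in> space (PiM I (\<lambda>_. N)). \<bar>\<Sum>\<tau>\<in>I. w \<tau> * r (x \<tau>)\<bar> \<ge> c}
    \<le> (\<Sum>\<tau>\<in>I. (w \<tau>)\<^sup>2) * (\<integral>x. (r x)\<^sup>2 \<partial>N) / c\<^sup>2"
proof -
  interpret P: prob_space "PiM I (\<lambda>_. N)" by (rule prob_space_PiM) (rule N)
  note m = PiM_weighted_sum_second_moment[OF N I assms(3) bound mean]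
  have "measure (PiM I (\<lambda>_. N)) {x \<in> space (PiM I (\<lambda>_. N)). \<bar>\<Sum>\<tau>\<in>I. w \<tau> * r (x \<tau>)\<bar> \<ge> c}
    = measure (PiM I (\<lambda>_. N)) {x \<in> space (PiM I (\<lambda>_. N)). (\<Sum>\<tau>\<in>I. w \<tau> * r (x \<tau>))\<^sup>2 \<ge> c\<^sup>2}"
    using \<open>c > 0\<close> by (intro arg_cong2[where f=measure] refl Collect_cong conj_cong)
      (metis abs_le_square_iff abs_of_pos)
  also have "\<dots> \<le> (\<integral>x. (\<Sum>\<tau>\<in>I. w \<tau> * r (x \<tau>))\<^sup>2 \<partial>PiM I (\<lambda>_. N)) / c\<^sup>2"
    using \<open>c > 0\<close> m(1) by (intro integral_Markov_inequality_measure[where A="{}"]) auto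
  finally show ?thesis using m(2)[of w] by simp
qed

text \<open>
  Taylor expansion of the characteristic function of a centered bounded variable. For \<open>\<bar>u\<bar> \<le> 1\<close>
  the error is at most of third order, for \<open>\<bar>u\<bar> > 1\<close> the trivial second-order bound is smaller
  than the power \<open>2 + e\<close>; this fits the available moment of the weights.
\<close>
lemma char_second_order_bound:
  fixes z :: "'a \<Rightarrow> real"
  assumes N: "prob_space N" and [measurable]: "z \<in> borel_measurable N"
    and bound: "\<And>x. x \<in> space N \<Longrightarrow> \<bar>z x\<bar> \<le> B" and mean: "(\<integral>x. z x \<partial>N) = 0"
    and e: "0 < e" "e \<le> 1"
  obtains K where "K \<ge> 0" "\<And>u. cmod ((\<integral>x. iexp (u * z x) \<partial>N)
      - complex_of_real (exp (- (\<integral>x. (z x)\<^sup>2 \<partial>N) * u\<^sup>2 / 2))) \<le> K * \<bar>u\<bar> powr (2 + e)"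
proof -
  interpret N: prob_space N by fact
  have B: "B \<ge> 0" using bound N.not_empty by (meson abs_ge_zero equals0I order_trans)
  define s where "s = (\<integral>x. (z x)\<^sup>2 \<partial>N)"
  have s: "s \<ge> 0" by (simp add: s_def)
  have z_int: "integrable N z" "integrable N (\<lambda>x. (z x)\<^sup>2)"
  proof -
    show "integrable N z" by (rule N.integrable_const_bound[where B=B]) (auto simp: bound)
    show "integrable N (\<lambda>x. (z x)\<^sup>2)"
      by (rule N.integrable_const_bound[where B="B\<^sup>2"])
         (auto intro!: AE_I2 power_mono[OF bound abs_ge_zero, of _ 2, simplified power2_abs])
  qed
  have small: "\<bar>u\<bar> ^ k \<le> \<bar>u\<bar> powr (2 + e)" if "\<bar>u\<bar> \<le> 1" "k \<ge> 3" for u :: real and k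
  proof (cases "u = 0")
    case False
    then have "\<bar>u\<bar> ^ k = \<bar>u\<bar> powr real k" by (simp add: powr_realpow)
    also have "\<dots> \<le> \<bar>u\<bar> powr (2 + e)" using that e by (intro powr_mono') auto
    finally show ?thesis .
  qed (use that in \<open>simp add: power_0_left\<close>)
  have large: "\<bar>u\<bar> ^ 2 \<le> \<bar>u\<bar> powr (2 + e)" if "\<bar>u\<bar> > 1" for u :: real
  proof -
    have "\<bar>u\<bar> ^ 2 = \<bar>u\<bar> powr 2" using that by (subst powr_numeral) auto
    also have "\<dots> \<le> \<bar>u\<bar> powr (2 + e)" using that e by (intro powr_mono) auto
    finally show ?thesis .
  qed
  have first: "cmod ((\<integral>x. iexp (u * z x) \<partial>N) - complex_of_real (1 - s * u\<^sup>2 / 2))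
      \<le> (B\<^sup>2 + B ^ 3) * \<bar>u\<bar> powr (2 + e)" for u
  proof -
    define T where "T y = iexp y - (1 + \<i> * complex_of_real y - complex_of_real (y\<^sup>2 / 2))" for y
    have T3: "cmod (T y) \<le> \<bar>y\<bar> ^ 3" and T2: "cmod (T y) \<le> \<bar>y\<bar>\<^sup>2" for y
    proof -
      have eq: "(\<Sum>k\<le>2. (\<i> * complex_of_real y) ^ k / fact k) = 1 + \<i> * complex_of_real y - complex_of_real (y\<^sup>2 / 2)"
        by (simp add: numeral_2_eq_2 algebra_simps power2_eq_square)
      have "cmod (T y) \<le> \<bar>y\<bar> ^ 3 / fact 3"
        using iexp_approx1[of y 2] unfolding eq T_def by (simp add: numeral_3_eq_3)
      also have "\<dots> \<le> \<bar>y\<bar> ^ 3" by (simp add: fact_numeral)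
      finally show "cmod (T y) \<le> \<bar>y\<bar> ^ 3" .
      show "cmod (T y) \<le> \<bar>y\<bar>\<^sup>2" using iexp_approx2[of y 2] unfolding eq T_def by simp
    qed
    have T_bound: "cmod (T (u * z x)) \<le> (B\<^sup>2 + B ^ 3) * \<bar>u\<bar> powr (2 + e)" if "x \<in> space N" for x
    proof (cases "\<bar>u\<bar> \<le> 1")
      case True
      have "cmod (T (u * z x)) \<le> \<bar>u\<bar> ^ 3 * \<bar>z x\<bar> ^ 3" using T3[of "u * z x"] by (simp add: abs_mult power_mult_distrib)
      also have "\<dots> \<le> \<bar>u\<bar> powr (2 + e) * B ^ 3"
        using small[OF True, of 3] bound[OF that] by (intro mult_mono power_mono) auto
      also have "\<dots> \<le> (B\<^sup>2 + B ^ 3) * \<bar>u\<bar> powr (2 + e)" by (simp add: algebra_simps)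
      finally show ?thesis .
    next
      case False
      have "cmod (T (u * z x)) \<le> \<bar>u\<bar> ^ 2 * \<bar>z x\<bar> ^ 2" using T2[of "u * z x"] by (simp add: power_mult_distrib abs_mult)
      also have "\<dots> \<le> \<bar>u\<bar> powr (2 + e) * B ^ 2"
        using large[of u] False bound[OF that] by (intro mult_mono power_mono) auto
      also have "\<dots> \<le> (B\<^sup>2 + B ^ 3) * \<bar>u\<bar> powr (2 + e)" using B by (simp add: algebra_simps)
      finally show ?thesis .
    qed
    have [measurable]: "(\<lambda>x. T (u * z x)) \<in> borel_measurable N" unfolding T_def by measurable
    have T_int: "integrable N (\<lambda>x. T (u * z x))"
      using T_bound by (intro N.integrable_const_bound[where B="(B\<^sup>2 + B ^ 3) * \<bar>u\<bar> powr (2 + e)"]) auto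
    have i1: "integrable N (\<lambda>x. iexp (u * z x))" by (intro N.integrable_const_bound[where B=1]) auto
    have i2: "integrable N (\<lambda>x. \<i> * complex_of_real (u * z x))"
      "integrable N (\<lambda>x. complex_of_real ((u * z x)\<^sup>2 / 2))"
    proof -
      have "integrable N (\<lambda>x. (u * z x)\<^sup>2 / 2)" using z_int(2) by (simp add: power_mult_distrib)
      then show "integrable N (\<lambda>x. complex_of_real ((u * z x)\<^sup>2 / 2))" by (rule integrable_of_real)
      have "integrable N (\<lambda>x. u * z x)" using z_int(1) by simp
      then show "integrable N (\<lambda>x. \<i> * complex_of_real (u * z x))"
        using integrable_mult_right[OF integrable_of_real] by blast
    qed
    have "(\<integral>x. iexp (u * z x) \<partial>N) - complex_of_real (1 - s * u\<^sup>2 / 2) = (\<integral>x. T (u * z x) \<partial>N)"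
    proof -
      have "(\<integral>x. T (u * z x) \<partial>N) = (\<integral>x. iexp (u * z x) \<partial>N)
          - ((\<integral>x. 1 \<partial>N) + (\<integral>x. \<i> * complex_of_real (u * z x) \<partial>N) - (\<integral>x. complex_of_real ((u * z x)\<^sup>2 / 2) \<partial>N))"
        unfolding T_def using i1 i2 by (simp add: Bochner_Integration.integral_diff Bochner_Integration.integral_add del: of_real_power of_real_divide of_real_mult)
      moreover have "(\<integral>x. \<i> * complex_of_real (u * z x) \<partial>N) = \<i> * complex_of_real (\<integral>x. u * z x \<partial>N)"
        by (simp only: integral_mult_right_zero integral_complex_of_real)
      moreover have "(\<integral>x. complex_of_real ((u * z x)\<^sup>2 / 2) \<partial>N) = complex_of_real (s * u\<^sup>2 / 2)"
        unfolding integral_complex_of_real by (simp add: s_def power_mult_distrib mult.commute)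
      ultimately show ?thesis by (simp add: mean N.prob_space)
    qed
    also have "cmod \<dots> \<le> (\<integral>x. cmod (T (u * z x)) \<partial>N)" by (rule integral_norm_bound)
    also have "\<dots> \<le> (\<integral>x. (B\<^sup>2 + B ^ 3) * \<bar>u\<bar> powr (2 + e) \<partial>N)"
      using T_int T_bound by (intro integral_mono) auto
    also have "\<dots> = (B\<^sup>2 + B ^ 3) * \<bar>u\<bar> powr (2 + e)" by (simp add: N.prob_space)
    finally show ?thesis .
  qed
  have second: "\<bar>exp (- s * u\<^sup>2 / 2) - (1 - s * u\<^sup>2 / 2)\<bar> \<le> (s + s\<^sup>2) * \<bar>u\<bar> powr (2 + e)" for u
  proof -
    define y where "y = s * u\<^sup>2 / 2"
    have y: "y \<ge> 0" using s by (simp add: y_def)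
    have lo: "exp (- y) - (1 - y) \<ge> 0" using exp_ge_add_one_self[of "-y"] by simp
    have up1: "exp (- y) - (1 - y) \<le> y" using y by simp
    have up2: "exp (- y) - (1 - y) \<le> y\<^sup>2"
    proof -
      have "exp (- y) \<le> 1 / (1 + y)"
        using exp_ge_add_one_self[of y] y by (simp add: exp_minus field_simps)
      also have "\<dots> \<le> 1 - y + y\<^sup>2" using y by (simp add: field_simps power2_eq_square)
      finally show ?thesis by simp
    qed
    have "exp (- y) - (1 - y) \<le> (s + s\<^sup>2) * \<bar>u\<bar> powr (2 + e)"
    proof (cases "\<bar>u\<bar> \<le> 1")
      case True
      have "y\<^sup>2 = s\<^sup>2 * \<bar>u\<bar> ^ 4 / 4"
        by (simp add: y_def power_mult_distrib power_divide flip: power_mult)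
      moreover have "0 \<le> s\<^sup>2 * \<bar>u\<bar> ^ 4" by simp
      ultimately have "y\<^sup>2 \<le> s\<^sup>2 * \<bar>u\<bar> ^ 4" by linarith
      also have "\<dots> \<le> s\<^sup>2 * \<bar>u\<bar> powr (2 + e)" using small[OF True, of 4] by (intro mult_left_mono) auto
      also have "\<dots> \<le> (s + s\<^sup>2) * \<bar>u\<bar> powr (2 + e)" using s by (simp add: algebra_simps)
      finally show ?thesis using up2 by simp
    next
      case False
      have "y \<le> s * \<bar>u\<bar> ^ 2" using s by (simp add: y_def)
      also have "\<dots> \<le> s * \<bar>u\<bar> powr (2 + e)" using large[of u] False s by (intro mult_left_mono) auto
      also have "\<dots> \<le> (s + s\<^sup>2) * \<bar>u\<bar> powr (2 + e)" using s by (simp add: algebra_simps)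
      finally show ?thesis using up1 by linarith
    qed
    then show ?thesis using lo by (simp add: y_def)
  qed
  show thesis
  proof (rule that[of "(B\<^sup>2 + B ^ 3) + (s + s\<^sup>2)"])
    show "(B\<^sup>2 + B ^ 3) + (s + s\<^sup>2) \<ge> 0" using B s by simp
    fix u
    let ?m = "complex_of_real (1 - s * u\<^sup>2 / 2)"
    have "cmod ((\<integral>x. iexp (u * z x) \<partial>N) - complex_of_real (exp (- s * u\<^sup>2 / 2)))
       \<le> cmod ((\<integral>x. iexp (u * z x) \<partial>N) - ?m) + cmod (complex_of_real (exp (- s * u\<^sup>2 / 2)) - ?m)"
      unfolding dist_norm[symmetric] by (rule dist_triangle2)
    also have "cmod (complex_of_real (exp (- s * u\<^sup>2 / 2)) - ?m) = \<bar>exp (- s * u\<^sup>2 / 2) - (1 - s * u\<^sup>2 / 2)\<bar>"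
      by (simp only: of_real_diff[symmetric] norm_of_real)
    finally show "cmod ((\<integral>x. iexp (u * z x) \<partial>N)
      - complex_of_real (exp (- (\<integral>x. (z x)\<^sup>2 \<partial>N) * u\<^sup>2 / 2))) \<le> ((B\<^sup>2 + B ^ 3) + (s + s\<^sup>2)) * \<bar>u\<bar> powr (2 + e)"
      unfolding s_def[symmetric] using first[of u] second[of u] by (simp add: distrib_right)
  qed
qed

text \<open>
  The characteristic function of the sum is a product over the coordinates, and the difference
  of two products of numbers in the unit disc is at most the sum of the differences.
\<close>
lemma char_weighted_sum_bound:
  fixes z :: "'a \<Rightarrow> real"
  assumes N: "prob_space N" and [measurable]: "z \<in> borel_measurable N"
    and bound: "\<And>x. x \<in> space N \<Longrightarrow> \<bar>z x\<bar> \<le> B" and mean: "(\<integral>x. z x \<partial>N) = 0"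
    and e: "0 < e" "e \<le> 1"
  obtains K where "K \<ge> 0" "\<And>I u. finite (I :: 'i set) \<Longrightarrow>
     cmod ((\<integral>x. iexp (\<Sum>\<tau>\<in>I. u \<tau> * z (x \<tau>)) \<partial>PiM I (\<lambda>_. N))
      - complex_of_real (exp (- (\<integral>x. (z x)\<^sup>2 \<partial>N) * (\<Sum>\<tau>\<in>I. (u \<tau>)\<^sup>2) / 2)))
     \<le> K * (\<Sum>\<tau>\<in>I. \<bar>u \<tau>\<bar> powr (2 + e))"
proof -
  interpret N: prob_space N by fact
  interpret product_sigma_finite "\<lambda>_::'i. N" by standard
  obtain K where K: "K \<ge> 0" "\<And>u. cmod ((\<integral>x. iexp (u * z x) \<partial>N)
      - complex_of_real (exp (- (\<integral>x. (z x)\<^sup>2 \<partial>N) * u\<^sup>2 / 2))) \<le> K * \<bar>u\<bar> powr (2 + e)"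
    using char_second_order_bound[OF N assms(2) bound mean e] by metis
  define s where "s = (\<integral>x. (z x)\<^sup>2 \<partial>N)"
  have s: "s \<ge> 0" by (simp add: s_def)
  show thesis
  proof (rule that[OF K(1)])
    fix I :: "'i set" and u assume I: "finite I"
    have "(\<integral>x. iexp (\<Sum>\<tau>\<in>I. u \<tau> * z (x \<tau>)) \<partial>PiM I (\<lambda>_. N))
        = (\<integral>x. (\<Prod>\<tau>\<in>I. iexp (u \<tau> * z (x \<tau>))) \<partial>PiM I (\<lambda>_. N))"
      using I by (simp add: exp_sum[symmetric] sum_distrib_left)
    also have "\<dots> = (\<Prod>\<tau>\<in>I. \<integral>x. iexp (u \<tau> * z x) \<partial>N)"
      by (rule product_integral_prod[OF I]) (auto intro!: N.integrable_const_bound[where B=1])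
    finally have 1: "(\<integral>x. iexp (\<Sum>\<tau>\<in>I. u \<tau> * z (x \<tau>)) \<partial>PiM I (\<lambda>_. N)) = (\<Prod>\<tau>\<in>I. \<integral>x. iexp (u \<tau> * z x) \<partial>N)" .
    have 2: "complex_of_real (exp (- s * (\<Sum>\<tau>\<in>I. (u \<tau>)\<^sup>2) / 2)) = (\<Prod>\<tau>\<in>I. complex_of_real (exp (- s * (u \<tau>)\<^sup>2 / 2)))"
      using I by (simp add: exp_sum[symmetric] sum_distrib_left sum_divide_distrib sum_negf flip: of_real_prod)
    have "cmod ((\<Prod>\<tau>\<in>I. \<integral>x. iexp (u \<tau> * z x) \<partial>N) - (\<Prod>\<tau>\<in>I. complex_of_real (exp (- s * (u \<tau>)\<^sup>2 / 2))))
       \<le> (\<Sum>\<tau>\<in>I. cmod ((\<integral>x. iexp (u \<tau> * z x) \<partial>N) - complex_of_real (exp (- s * (u \<tau>)\<^sup>2 / 2))))"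
    proof (rule norm_prod_diff)
      fix i
      have "cmod (\<integral>x. iexp (u i * z x) \<partial>N) \<le> (\<integral>x. cmod (iexp (u i * z x)) \<partial>N)" by (rule integral_norm_bound)
      then show "cmod (\<integral>x. iexp (u i * z x) \<partial>N) \<le> 1" by (simp add: N.prob_space)
      show "cmod (complex_of_real (exp (- s * (u i)\<^sup>2 / 2))) \<le> 1" using s by simp
    qed
    also have "\<dots> \<le> (\<Sum>\<tau>\<in>I. K * \<bar>u \<tau>\<bar> powr (2 + e))"
      unfolding s_def by (intro sum_mono K)
    finally show "cmod ((\<integral>x. iexp (\<Sum>\<tau>\<in>I. u \<tau> * z (x \<tau>)) \<partial>PiM I (\<lambda>_. N))
      - complex_of_real (exp (- (\<integral>x. (z x)\<^sup>2 \<partial>N) * (\<Sum>\<tau>\<in>I. (u \<tau>)\<^sup>2) / 2)))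
     \<le> K * (\<Sum>\<tau>\<in>I. \<bar>u \<tau>\<bar> powr (2 + e))"
      unfolding 1 s_def[symmetric] 2 by (simp add: sum_distrib_left)
  qed
qed

section \<open>Second moments of exchangeable weights\<close>

text \<open>
  The law of the weight vector at one sample size, with a moment bound \<open>K\<close> meant to be uniform
  in \<open>t\<close>. The exponent is capped by \<open>e \<le> 1\<close>, as higher moments would not improve the Taylor
  bound.
\<close>
locale exchangeable_law = prob_space \<nu> for \<nu> :: "(nat \<Rightarrow> real) measure" +
  fixes t :: nat and e K :: real
  assumes t: "t \<ge> 2" and e: "0 < e" "e \<le> 1" and K: "K \<ge> 0"
    and sets_nu [measurable_cong]: "sets \<nu> = sets (PiM {..<t} (\<lambda>_. borel))"
    and nonneg: "AE w in \<nu>. \<forall>\<tau><t. 0 \<le> w \<tau>"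
    and total: "AE w in \<nu>. (\<Sum>\<tau><t. w \<tau>) = real t"
    and exch: "\<And>\<pi>. \<pi> permutes {..<t} \<Longrightarrow>
      distr \<nu> (PiM {..<t} (\<lambda>_. borel)) (\<lambda>w. \<lambda>\<tau>\<in>{..<t}. w (\<pi> \<tau>)) = \<nu>"
    and moment: "(\<integral>\<^sup>+w. ennreal (w 0 powr (2 + e)) \<partial>\<nu>) \<le> ennreal K"
begin

lemma coord_measurable [measurable]: "\<tau> < t \<Longrightarrow> (\<lambda>w. w \<tau>) \<in> borel_measurable \<nu>"
  by (subst measurable_cong_sets[OF sets_nu refl]) simp

lemma weight_bounds: "AE w in \<nu>. \<forall>\<tau><t. 0 \<le> w \<tau> \<and> w \<tau> \<le> real t"
  using nonneg total
proof eventually_elim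
  case (elim w)
  then show ?case
    using member_le_sum[of _ "{..<t}" w] by auto
qed

lemma dev_bounds: "\<tau> < t \<Longrightarrow> AE w in \<nu>. \<bar>w \<tau> - 1\<bar> \<le> real t"
  using weight_bounds t by (auto simp: abs_le_iff elim!: eventually_mono)

lemma integral_permute:
  assumes \<pi>: "\<pi> permutes {..<t}" and [measurable]: "h \<in> borel_measurable (PiM {..<t} (\<lambda>_. borel))"
  shows "(\<integral>w. h (\<lambda>\<tau>\<in>{..<t}. w (\<pi> \<tau>)) \<partial>\<nu>) = (\<integral>w. h w \<partial>\<nu> :: real)"
    and "(\<integral>\<^sup>+w. ennreal (h (\<lambda>\<tau>\<in>{..<t}. w (\<pi> \<tau>))) \<partial>\<nu>) = (\<integral>\<^sup>+w. ennreal (h w) \<partial>\<nu>)"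
proof -
  have "\<pi> \<tau> < t" if "\<tau> < t" for \<tau> using permutes_in_image[OF \<pi>, of \<tau>] that by simp
  then have [measurable]: "(\<lambda>w. \<lambda>\<tau>\<in>{..<t}. w (\<pi> \<tau>)) \<in> \<nu> \<rightarrow>\<^sub>M PiM {..<t} (\<lambda>_. borel)"
    by (intro measurable_restrict) auto
  show "(\<integral>w. h (\<lambda>\<tau>\<in>{..<t}. w (\<pi> \<tau>)) \<partial>\<nu>) = (\<integral>w. h w \<partial>\<nu>)"
    by (subst (2) exch[OF \<pi>, symmetric]) (simp add: integral_distr)
  show "(\<integral>\<^sup>+w. ennreal (h (\<lambda>\<tau>\<in>{..<t}. w (\<pi> \<tau>))) \<partial>\<nu>) = (\<integral>\<^sup>+w. ennreal (h w) \<partial>\<nu>)"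
    by (subst (2) exch[OF \<pi>, symmetric]) (simp add: nn_integral_distr)
qed

lemma swap_permutes: "a < t \<Longrightarrow> b < t \<Longrightarrow> Transposition.transpose a b permutes {..<t}"
  by (rule permutes_swap_id) auto

lemma moment_each: "\<tau> < t \<Longrightarrow> (\<integral>\<^sup>+w. ennreal (w \<tau> powr (2 + e)) \<partial>\<nu>) \<le> ennreal K"
  using integral_permute(2)[OF swap_permutes[of 0 \<tau>], of "\<lambda>w. w 0 powr (2 + e)"] t moment by simp

lemma powr_integrable: "\<tau> < t \<Longrightarrow> integrable \<nu> (\<lambda>w. w \<tau> powr (2 + e))"
  and powr_integral_le: "\<tau> < t \<Longrightarrow> (\<integral>w. w \<tau> powr (2 + e) \<partial>\<nu>) \<le> K"
proof -
  assume \<tau>: "\<tau> < t"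
  note [measurable] = coord_measurable[OF \<tau>]
  show i: "integrable \<nu> (\<lambda>w. w \<tau> powr (2 + e))"
    using moment_each[OF \<tau>] by (intro integrableI_nonneg) (auto intro: order.strict_trans1)
  show "(\<integral>w. w \<tau> powr (2 + e) \<partial>\<nu>) \<le> K"
    using moment_each[OF \<tau>] K nn_integral_eq_integral[OF i] by simp
qed

lemma powr_ge_square: "(y::real) \<ge> 0 \<Longrightarrow> y\<^sup>2 \<le> 1 + y powr (2 + e)"
proof (cases "y \<le> 1")
  case True
  assume "y \<ge> 0"
  with True have "y\<^sup>2 \<le> 1" by (simp add: power_le_one)
  then show ?thesis by (smt (verit) powr_ge_zero)
next
  case False
  then have "y\<^sup>2 = y powr 2" by simp
  also have "\<dots> \<le> y powr (2 + e)" using False e by (intro powr_mono) auto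
  finally show ?thesis by simp
qed

lemma powr_diff_le:
  assumes "a \<ge> 0" "b \<ge> 0"
  shows "\<bar>a - b\<bar> powr (2 + e) \<le> a powr (2 + e) + b powr (2 + e)"
proof -
  have "\<bar>a - b\<bar> powr (2 + e) \<le> (max a b) powr (2 + e)"
    using assms e by (intro powr_mono2) auto
  also have "\<dots> \<le> a powr (2 + e) + b powr (2 + e)" by (auto simp: max_def)
  finally show ?thesis .
qed

lemma square_integrable: "\<tau> < t \<Longrightarrow> integrable \<nu> (\<lambda>w. (w \<tau>)\<^sup>2)"
  and square_integral_le: "\<tau> < t \<Longrightarrow> (\<integral>w. (w \<tau>)\<^sup>2 \<partial>\<nu>) \<le> 1 + K"
proof -
  assume \<tau>: "\<tau> < t"
  note [measurable] = coord_measurable[OF \<tau>]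
  have b: "AE w in \<nu>. (w \<tau>)\<^sup>2 \<le> 1 + w \<tau> powr (2 + e)"
    using nonneg by eventually_elim (use \<tau> powr_ge_square in auto)
  show i: "integrable \<nu> (\<lambda>w. (w \<tau>)\<^sup>2)"
    by (rule Bochner_Integration.integrable_bound[of _ "\<lambda>w. 1 + w \<tau> powr (2 + e)"])
       (use b powr_integrable[OF \<tau>] in \<open>auto elim!: eventually_mono simp: add_nonneg_nonneg\<close>)
  have "(\<integral>w. (w \<tau>)\<^sup>2 \<partial>\<nu>) \<le> (\<integral>w. 1 + w \<tau> powr (2 + e) \<partial>\<nu>)"
    using i b powr_integrable[OF \<tau>] by (intro integral_mono_AE) auto
  also have "\<dots> \<le> 1 + K" using powr_integrable[OF \<tau>] powr_integral_le[OF \<tau>] by (simp add: prob_space)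
  finally show "(\<integral>w. (w \<tau>)\<^sup>2 \<partial>\<nu>) \<le> 1 + K" .
qed

lemma sum_squares_integrable: "integrable \<nu> (\<lambda>w. \<Sum>\<tau><t. (w \<tau>)\<^sup>2)"
  and sum_squares_le: "(\<integral>w. (\<Sum>\<tau><t. (w \<tau>)\<^sup>2) \<partial>\<nu>) \<le> real t * (1 + K)"
proof -
  show "integrable \<nu> (\<lambda>w. \<Sum>\<tau><t. (w \<tau>)\<^sup>2)"
    by (intro Bochner_Integration.integrable_sum square_integrable) simp
  have "(\<integral>w. (\<Sum>\<tau><t. (w \<tau>)\<^sup>2) \<partial>\<nu>) = (\<Sum>\<tau><t. \<integral>w. (w \<tau>)\<^sup>2 \<partial>\<nu>)"
    by (rule Bochner_Integration.integral_sum) (auto intro: square_integrable)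
  also have "\<dots> \<le> (\<Sum>\<tau><t. 1 + K)" by (intro sum_mono square_integral_le) simp
  finally show "(\<integral>w. (\<Sum>\<tau><t. (w \<tau>)\<^sup>2) \<partial>\<nu>) \<le> real t * (1 + K)" by simp
qed

lemma dev_powr_integrable: "integrable \<nu> (\<lambda>w. \<Sum>\<tau><t. \<bar>w \<tau> - 1\<bar> powr (2 + e))"
  and dev_powr_le: "(\<integral>w. (\<Sum>\<tau><t. \<bar>w \<tau> - 1\<bar> powr (2 + e)) \<partial>\<nu>) \<le> real t * (1 + K)"
proof -
  have each: "integrable \<nu> (\<lambda>w. \<bar>w \<tau> - 1\<bar> powr (2 + e)) \<and> (\<integral>w. \<bar>w \<tau> - 1\<bar> powr (2 + e) \<partial>\<nu>) \<le> 1 + K"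
    if \<tau>: "\<tau> < t" for \<tau>
  proof -
    note [measurable] = coord_measurable[OF \<tau>]
    have b: "AE w in \<nu>. \<bar>w \<tau> - 1\<bar> powr (2 + e) \<le> w \<tau> powr (2 + e) + 1"
      using nonneg by eventually_elim (use \<tau> powr_diff_le[of _ 1] in auto)
    have i: "integrable \<nu> (\<lambda>w. \<bar>w \<tau> - 1\<bar> powr (2 + e))"
      by (rule Bochner_Integration.integrable_bound[of _ "\<lambda>w. w \<tau> powr (2 + e) + 1"])
         (use b powr_integrable[OF \<tau>] in \<open>auto elim!: eventually_mono simp: add_nonneg_nonneg\<close>)
    have "(\<integral>w. \<bar>w \<tau> - 1\<bar> powr (2 + e) \<partial>\<nu>) \<le> (\<integral>w. w \<tau> powr (2 + e) + 1 \<partial>\<nu>)"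
      using i b powr_integrable[OF \<tau>] by (intro integral_mono_AE) auto
    also have "\<dots> \<le> 1 + K" using powr_integrable[OF \<tau>] powr_integral_le[OF \<tau>] by (simp add: prob_space)
    finally show ?thesis using i by simp
  qed
  show "integrable \<nu> (\<lambda>w. \<Sum>\<tau><t. \<bar>w \<tau> - 1\<bar> powr (2 + e))"
    by (intro Bochner_Integration.integrable_sum) (use each in auto)
  have "(\<integral>w. (\<Sum>\<tau><t. \<bar>w \<tau> - 1\<bar> powr (2 + e)) \<partial>\<nu>) = (\<Sum>\<tau><t. \<integral>w. \<bar>w \<tau> - 1\<bar> powr (2 + e) \<partial>\<nu>)"
    by (rule Bochner_Integration.integral_sum) (use each in auto)
  also have "\<dots> \<le> (\<Sum>\<tau><t. 1 + K)" by (intro sum_mono) (use each in auto)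
  finally show "(\<integral>w. (\<Sum>\<tau><t. \<bar>w \<tau> - 1\<bar> powr (2 + e)) \<partial>\<nu>) \<le> real t * (1 + K)" by simp
qed

text \<open>
  The covariance matrix of the weights; their common mean is \<open>1\<close>.
\<close>
definition dev_cov :: "nat \<Rightarrow> nat \<Rightarrow> real" where
  "dev_cov \<tau> \<sigma> = (\<integral>w. (w \<tau> - 1) * (w \<sigma> - 1) \<partial>\<nu>)"

lemma dev_prod_integrable: "\<tau> < t \<Longrightarrow> \<sigma> < t \<Longrightarrow> integrable \<nu> (\<lambda>w. (w \<tau> - 1) * (w \<sigma> - 1))"
proof -
  assume \<tau>: "\<tau> < t" and \<sigma>: "\<sigma> < t"
  note [measurable] = coord_measurable[OF \<tau>] coord_measurable[OF \<sigma>]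
  have "AE w in \<nu>. \<bar>(w \<tau> - 1) * (w \<sigma> - 1)\<bar> \<le> real t * real t"
    using dev_bounds[OF \<tau>] dev_bounds[OF \<sigma>]
    by eventually_elim (simp add: abs_mult mult_mono)
  then show ?thesis by (intro integrable_const_bound[where B="real t * real t"]) auto
qed

lemma dev_cov_diag: "\<tau> < t \<Longrightarrow> dev_cov \<tau> \<tau> = dev_cov 0 0"
  using integral_permute(1)[OF swap_permutes[of 0 \<tau>], of "\<lambda>w. (w 0 - 1) * (w 0 - 1)"] t
  by (simp add: dev_cov_def)

text \<open>
  All off-diagonal covariances agree by exchangeability, and each row of the covariance matrix
  sums to zero because the weights have a constant sum.
\<close>
lemma dev_cov_off:
  assumes "\<tau> < t" "\<sigma> < t" "\<tau> \<noteq> \<sigma>"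
  shows "dev_cov \<tau> \<sigma> = - dev_cov 0 0 / (real t - 1)"
proof -
  have const: "dev_cov \<tau> \<sigma>' = dev_cov \<tau> \<sigma>" if "\<sigma>' < t" "\<sigma>' \<noteq> \<tau>" for \<sigma>'
  proof -
    have "Transposition.transpose \<sigma> \<sigma>' \<tau> = \<tau>" using assms that by (simp add: Transposition.transpose_def)
    then show ?thesis
      using integral_permute(1)[OF swap_permutes[of \<sigma> \<sigma>'], of "\<lambda>w. (w \<tau> - 1) * (w \<sigma> - 1)"] assms that
      by (simp add: dev_cov_def)
  qed
  have "(\<Sum>\<sigma>'<t. dev_cov \<tau> \<sigma>') = (\<integral>w. (w \<tau> - 1) * (\<Sum>\<sigma>'<t. w \<sigma>' - 1) \<partial>\<nu>)"
    unfolding dev_cov_def sum_distrib_left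
    by (rule Bochner_Integration.integral_sum[symmetric]) (use dev_prod_integrable assms in auto)
  also have "\<dots> = (\<integral>w. 0 \<partial>\<nu>)"
    using assms(1) by (intro integral_cong_AE) (use total in \<open>auto simp: sum_subtractf elim!: eventually_mono\<close>)
  finally have "(\<Sum>\<sigma>'<t. dev_cov \<tau> \<sigma>') = 0" by simp
  moreover have "(\<Sum>\<sigma>'<t. dev_cov \<tau> \<sigma>') = dev_cov \<tau> \<tau> + (\<Sum>\<sigma>'\<in>{..<t} - {\<tau>}. dev_cov \<tau> \<sigma>')"
    using assms(1) by (intro sum.remove) auto
  moreover have "(\<Sum>\<sigma>'\<in>{..<t} - {\<tau>}. dev_cov \<tau> \<sigma>') = (\<Sum>\<sigma>'\<in>{..<t} - {\<tau>}. dev_cov \<tau> \<sigma>)"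
    by (intro sum.cong refl const) auto
  moreover have "\<dots> = (real t - 1) * dev_cov \<tau> \<sigma>" using assms(1) t by (simp add: of_nat_diff)
  ultimately show ?thesis using dev_cov_diag[OF assms(1)] t by (simp add: field_simps)
qed

lemma dev_var_bounds: "0 \<le> dev_cov 0 0" "dev_cov 0 0 \<le> 2 * (1 + K)"
proof -
  show "0 \<le> dev_cov 0 0" by (simp add: dev_cov_def)
  have t0: "0 < t" using t by simp
  note [measurable] = coord_measurable[OF t0]
  have "dev_cov 0 0 \<le> (\<integral>w. (w 0)\<^sup>2 + 1 \<partial>\<nu>)" unfolding dev_cov_def
  proof (intro integral_mono_AE)
    show "AE w in \<nu>. (w 0 - 1) * (w 0 - 1) \<le> (w 0)\<^sup>2 + 1"
      using nonneg by eventually_elim (use t0 in \<open>auto simp: power2_eq_square algebra_simps\<close>)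
  qed (use t0 square_integrable dev_prod_integrable in auto)
  also have "\<dots> \<le> 2 * (1 + K)"
    using square_integrable[OF t0] square_integral_le[OF t0] K by (simp add: prob_space)
  finally show "dev_cov 0 0 \<le> 2 * (1 + K)" .
qed

text \<open>
  The covariance matrix is a multiple of the orthogonal projection onto the vectors of sum zero,
  so on coefficients of sum zero it acts as a scalar.
\<close>
lemma weighted_dev_second_moment:
  assumes U: "(\<Sum>\<tau><t. U \<tau>) = 0"
  shows "integrable \<nu> (\<lambda>w. (\<Sum>\<tau><t. U \<tau> * (w \<tau> - 1))\<^sup>2)"
    and "(\<integral>w. (\<Sum>\<tau><t. U \<tau> * (w \<tau> - 1))\<^sup>2 \<partial>\<nu>)
      = dev_cov 0 0 * (real t / (real t - 1)) * (\<Sum>\<tau><t. (U \<tau>)\<^sup>2)"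
proof -
  have sq: "(\<Sum>\<tau><t. U \<tau> * (w \<tau> - 1))\<^sup>2 = (\<Sum>\<tau><t. \<Sum>\<sigma><t. U \<tau> * U \<sigma> * ((w \<tau> - 1) * (w \<sigma> - 1)))" for w
    by (simp add: power2_eq_square sum_product mult_ac)
  show "integrable \<nu> (\<lambda>w. (\<Sum>\<tau><t. U \<tau> * (w \<tau> - 1))\<^sup>2)"
    unfolding sq by (intro Bochner_Integration.integrable_sum integrable_mult_right dev_prod_integrable) auto
  have "(\<integral>w. (\<Sum>\<tau><t. U \<tau> * (w \<tau> - 1))\<^sup>2 \<partial>\<nu>) = (\<Sum>\<tau><t. \<Sum>\<sigma><t. U \<tau> * U \<sigma> * dev_cov \<tau> \<sigma>)"
    unfolding sq dev_cov_def
    by (subst Bochner_Integration.integral_sum,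
          intro Bochner_Integration.integrable_sum integrable_mult_right dev_prod_integrable, force, force,
        intro sum.cong refl, subst Bochner_Integration.integral_sum,
          intro integrable_mult_right dev_prod_integrable, force, force,
        intro sum.cong refl integral_mult_right_zero)
  also have "\<dots> = (\<Sum>\<tau><t. \<Sum>\<sigma><t. U \<tau> * U \<sigma> * (- dev_cov 0 0 / (real t - 1))
      + (if \<sigma> = \<tau> then (U \<tau>)\<^sup>2 * (dev_cov 0 0 * (real t / (real t - 1))) else 0))"
  proof (intro sum.cong refl)
    fix \<tau> \<sigma> assume "\<tau> \<in> {..<t}" "\<sigma> \<in> {..<t}"
    then show "U \<tau> * U \<sigma> * dev_cov \<tau> \<sigma> = U \<tau> * U \<sigma> * (- dev_cov 0 0 / (real t - 1))
      + (if \<sigma> = \<tau> then (U \<tau>)\<^sup>2 * (dev_cov 0 0 * (real t / (real t - 1))) else 0)"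
    proof (cases "\<tau> = \<sigma>")
      case True
      have "real t / (real t - 1) = 1 + 1 / (real t - 1)" using t by (simp add: field_simps)
      then show ?thesis
        using dev_cov_diag[of \<tau>] True \<open>\<tau> \<in> {..<t}\<close> by (simp add: power2_eq_square algebra_simps)
    next
      case False
      then show ?thesis using dev_cov_off[of \<tau> \<sigma>] \<open>\<tau> \<in> {..<t}\<close> \<open>\<sigma> \<in> {..<t}\<close> by simp
    qed
  qed
  also have "\<dots> = (\<Sum>\<tau><t. \<Sum>\<sigma><t. U \<tau> * U \<sigma>) * (- dev_cov 0 0 / (real t - 1))
      + (\<Sum>\<tau><t. (U \<tau>)\<^sup>2 * (dev_cov 0 0 * (real t / (real t - 1))))"
  proof -
    have "(\<Sum>\<tau><t. \<Sum>\<sigma><t. U \<tau> * U \<sigma> * k + (if \<sigma> = \<tau> then (U \<tau>)\<^sup>2 * l else 0))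
        = (\<Sum>\<tau><t. \<Sum>\<sigma><t. U \<tau> * U \<sigma>) * k + (\<Sum>\<tau><t. (U \<tau>)\<^sup>2 * l)" for k l :: real
      by (simp add: sum.distrib sum_distrib_right)
    then show ?thesis .
  qed
  also have "(\<Sum>\<tau><t. \<Sum>\<sigma><t. U \<tau> * U \<sigma>) = 0"
    by (simp add: sum_product[symmetric] U)
  finally show "(\<integral>w. (\<Sum>\<tau><t. U \<tau> * (w \<tau> - 1))\<^sup>2 \<partial>\<nu>)
      = dev_cov 0 0 * (real t / (real t - 1)) * (\<Sum>\<tau><t. (U \<tau>)\<^sup>2)"
    by (simp only: sum_distrib_right[symmetric] mult_zero_left add_0_left mult.commute)
qed

end

section \<open>Second-order calculus at a point\<close>

lemma grad_eqI: "GDERIV f x :> D \<Longrightarrow> grad f x = D"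
  unfolding grad_def
proof (rule the_equality)
  fix D' assume "GDERIV f x :> D'" "GDERIV f x :> D"
  then have "(\<lambda>h. h \<bullet> D') = (\<lambda>h. h \<bullet> D)"
    unfolding gderiv_def by (rule has_derivative_unique)
  then have "\<forall>h. h \<bullet> D' = h \<bullet> D" by (auto dest: fun_cong)
  then show "D' = D" by (simp only: vector_eq_ldot)
qed

lemma gderiv_grad:
  fixes f :: "real^'n \<Rightarrow> real"
  assumes "f differentiable at x"
  shows "GDERIV f x :> grad f x"
proof -
  obtain f' where f': "(f has_derivative f') (at x)" using assms by (auto simp: differentiable_def)
  then interpret linear f' by (rule has_derivative_linear)
  have rep: "f' h = h \<bullet> (\<Sum>b\<in>Basis. f' b *\<^sub>R b)" for h
  proof -
    have "f' h = f' (\<Sum>b\<in>Basis. (h \<bullet> b) *\<^sub>R b)" by (simp add: euclidean_representation)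
    also have "\<dots> = h \<bullet> (\<Sum>b\<in>Basis. f' b *\<^sub>R b)" by (simp add: sum scale inner_sum_right mult.commute)
    finally show ?thesis .
  qed
  have eq: "(\<lambda>h. h \<bullet> (\<Sum>b\<in>Basis. f' b *\<^sub>R b)) = f'" by (rule ext) (rule rep[symmetric])
  have "GDERIV f x :> (\<Sum>b\<in>Basis. f' b *\<^sub>R b)"
    unfolding gderiv_def eq by (rule f')
  then show ?thesis by (simp only: grad_eqI)
qed

lemma grad_local:
  assumes "open U" "x \<in> U" "\<And>y. y \<in> U \<Longrightarrow> f y = g y"
  shows "GDERIV f x :> D \<longleftrightarrow> GDERIV g x :> D"
  unfolding gderiv_def
proof
  show "(g has_derivative (\<lambda>h. h \<bullet> D)) (at x)" if "(f has_derivative (\<lambda>h. h \<bullet> D)) (at x)"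
    by (rule has_derivative_transform_within_open[OF that assms(1,2)]) (rule assms(3))
  show "(f has_derivative (\<lambda>h. h \<bullet> D)) (at x)" if "(g has_derivative (\<lambda>h. h \<bullet> D)) (at x)"
    by (rule has_derivative_transform_within_open[OF that assms(1,2)]) (rule assms(3)[symmetric])
qed

lemma directional_derivative:
  fixes f :: "real^'n \<Rightarrow> real"
  assumes "f differentiable at (p + \<sigma> *\<^sub>R d)"
  shows "((\<lambda>\<sigma>. f (p + \<sigma> *\<^sub>R d)) has_real_derivative d \<bullet> grad f (p + \<sigma> *\<^sub>R d)) (at \<sigma>)"
proof -
  have "((\<lambda>\<sigma>. p + \<sigma> *\<^sub>R d) has_derivative (\<lambda>h. h *\<^sub>R d)) (at \<sigma>)"
    by (auto intro!: derivative_eq_intros)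
  moreover have "(f has_derivative (\<lambda>h. h \<bullet> grad f (p + \<sigma> *\<^sub>R d))) (at (p + \<sigma> *\<^sub>R d))"
    using gderiv_grad[OF assms] unfolding gderiv_def .
  ultimately have "((\<lambda>\<sigma>. f (p + \<sigma> *\<^sub>R d)) has_derivative (\<lambda>h. (h *\<^sub>R d) \<bullet> grad f (p + \<sigma> *\<^sub>R d))) (at \<sigma>)"
    by (rule has_derivative_compose)
  moreover have "(\<lambda>h. (h *\<^sub>R d) \<bullet> grad f (p + \<sigma> *\<^sub>R d)) = (*) (d \<bullet> grad f (p + \<sigma> *\<^sub>R d))"
    by (rule ext) simp
  ultimately show ?thesis unfolding has_field_derivative_def by (simp only:)
qed

context
  fixes f :: "real^'n \<Rightarrow> real" and p :: "real^'n"
  assumes C2: "C2_near f p"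
begin

lemma C2_differentiable: "\<exists>r>0. \<forall>y\<in>ball p r. f differentiable at y"
proof -
  obtain U where U: "open U" "p \<in> U" "\<And>y. y \<in> U \<Longrightarrow> f differentiable at y"
    using C2 unfolding C2_near_def by blast
  then obtain r where "r > 0" "ball p r \<subseteq> U" using open_contains_ball by blast
  then show ?thesis using U(3) by blast
qed

lemma C2_grad_expansion:
  assumes "\<epsilon> > 0"
  shows "\<exists>r>0. \<forall>y\<in>ball p r. norm (grad f y - grad f p - hessian f p *v (y - p)) \<le> \<epsilon> * norm (y - p)"
proof -
  obtain U where "p \<in> U" "\<And>y. y \<in> U \<Longrightarrow> grad f differentiable at y"
    using C2 unfolding C2_near_def by blast
  then have "grad f differentiable at p" by blast
  then have "(grad f has_derivative (\<lambda>h. hessian f p *v h)) (at p)"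
    unfolding hessian_def by (simp add: jacobian_works)
  then obtain r where r: "r > 0"
    "\<And>y. norm (y - p) < r \<Longrightarrow> norm (grad f y - grad f p - hessian f p *v (y - p)) \<le> \<epsilon> * norm (y - p)"
    using assms unfolding has_derivative_at_alt by blast
  then show ?thesis by (intro exI[of _ r]) (auto simp: dist_norm norm_minus_commute)
qed

text \<open>
  The mean value theorem in direction \<open>d\<close>, applied to the increment of \<open>f\<close> in direction \<open>e\<close>,
  turns the mixed second difference into a difference of two gradients.
\<close>
lemma C2_hessian_mixed:
  assumes "\<epsilon> > 0"
  shows "\<exists>\<delta>>0. \<forall>s. 0 < s \<and> s < \<delta> \<longrightarrow>
     \<bar>f (p + s *\<^sub>R d + s *\<^sub>R e) - f (p + s *\<^sub>R d) - f (p + s *\<^sub>R e) + f p - s\<^sup>2 * (d \<bullet> (hessian f p *v e))\<bar> \<le> \<epsilon> * s\<^sup>2"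
proof -
  let ?A = "hessian f p"
  define c where "c = norm d * (2 * norm d + norm e) + 1"
  have c: "c > 0" by (simp add: c_def add_nonneg_pos)
  obtain r1 where r1: "r1 > 0" "\<And>y. y \<in> ball p r1 \<Longrightarrow> f differentiable at y" using C2_differentiable by blast
  obtain r2 where r2: "r2 > 0"
    "\<And>y. y \<in> ball p r2 \<Longrightarrow> norm (grad f y - grad f p - ?A *v (y - p)) \<le> \<epsilon> / c * norm (y - p)"
    using C2_grad_expansion[of "\<epsilon> / c"] assms c by auto
  define r where "r = min r1 r2"
  define \<delta> where "\<delta> = r / (norm d + norm e + 1)"
  have \<delta>: "\<delta> > 0" using r1 r2 by (simp add: \<delta>_def r_def add_nonneg_pos)
  show ?thesis
  proof (intro exI[of _ \<delta>] conjI \<delta> allI impI)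
    fix s assume s: "0 < s \<and> s < \<delta>"
    have inball: "p + \<sigma> *\<^sub>R d + \<tau> *\<^sub>R e \<in> ball p r" if "0 \<le> \<sigma>" "\<sigma> \<le> s" "0 \<le> \<tau>" "\<tau> \<le> s" for \<sigma> \<tau>
    proof -
      have "norm (\<sigma> *\<^sub>R d + \<tau> *\<^sub>R e) \<le> \<sigma> * norm d + \<tau> * norm e"
        using norm_triangle_ineq[of "\<sigma> *\<^sub>R d" "\<tau> *\<^sub>R e"] that by simp
      also have "\<dots> \<le> s * norm d + s * norm e" using that by (intro add_mono mult_right_mono) auto
      also have "\<dots> \<le> s * (norm d + norm e + 1)" using s by (simp add: algebra_simps)
      also have "\<dots> < \<delta> * (norm d + norm e + 1)" using s by (intro mult_strict_right_mono) (auto simp: add_nonneg_pos)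
      also have "\<dots> = r" by (simp add: \<delta>_def add_nonneg_eq_0_iff)
      finally show ?thesis by (simp add: dist_norm algebra_simps norm_minus_commute)
    qed
    define \<psi> where "\<psi> \<sigma> = f ((p + s *\<^sub>R e) + \<sigma> *\<^sub>R d) - f (p + \<sigma> *\<^sub>R d)" for \<sigma>
    have diff: "f differentiable at ((p + s *\<^sub>R e) + \<sigma> *\<^sub>R d)" "f differentiable at (p + \<sigma> *\<^sub>R d)"
      if "0 \<le> \<sigma>" "\<sigma> \<le> s" for \<sigma>
      using inball[of \<sigma> s] inball[of \<sigma> 0] that s r1(2) by (auto simp: r_def add_ac)
    have "\<And>\<sigma>. 0 \<le> \<sigma> \<Longrightarrow> \<sigma> \<le> s \<Longrightarrow> (\<psi> has_real_derivative
        (d \<bullet> grad f ((p + s *\<^sub>R e) + \<sigma> *\<^sub>R d) - d \<bullet> grad f (p + \<sigma> *\<^sub>R d))) (at \<sigma>)"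
      unfolding \<psi>_def by (intro DERIV_diff directional_derivative diff)
    from MVT2[of 0 s \<psi>, OF _ this] s obtain \<sigma> where \<sigma>: "0 < \<sigma>" "\<sigma> < s"
      "\<psi> s - \<psi> 0 = s * (d \<bullet> grad f ((p + s *\<^sub>R e) + \<sigma> *\<^sub>R d) - d \<bullet> grad f (p + \<sigma> *\<^sub>R d))" by auto
    let ?y1 = "(p + s *\<^sub>R e) + \<sigma> *\<^sub>R d" and ?y2 = "p + \<sigma> *\<^sub>R d"
    define R where "R y = grad f y - grad f p - ?A *v (y - p)" for y
    have R: "norm (R y) \<le> \<epsilon> / c * norm (y - p)" if "y \<in> ball p r" for y
      using r2(2)[of y] that by (auto simp: R_def r_def)
    have y12: "?y1 \<in> ball p r" "?y2 \<in> ball p r"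
      using inball[of \<sigma> s] inball[of \<sigma> 0] \<sigma> s by (auto simp: add_ac)
    have g: "grad f ?y1 - grad f ?y2 = s *\<^sub>R (?A *v e) + (R ?y1 - R ?y2)"
      unfolding R_def by (simp add: matrix_vector_right_distrib matrix_vector_mult_scaleR algebra_simps)
    have "norm (R ?y1 - R ?y2) \<le> \<epsilon> / c * norm (?y1 - p) + \<epsilon> / c * norm (?y2 - p)"
      using R[OF y12(1)] R[OF y12(2)] norm_triangle_ineq4[of "R ?y1" "R ?y2"] by linarith
    also have "\<dots> \<le> \<epsilon> / c * (s * norm e + s * norm d) + \<epsilon> / c * (s * norm d)"
    proof (intro add_mono mult_left_mono)
      have sd: "\<sigma> * norm d \<le> s * norm d" using \<sigma> by (intro mult_right_mono) auto
      show "norm (?y1 - p) \<le> s * norm e + s * norm d"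
        using norm_triangle_ineq[of "s *\<^sub>R e" "\<sigma> *\<^sub>R d"] \<sigma> s sd by (simp add: algebra_simps)
      show "norm (?y2 - p) \<le> s * norm d" using sd \<sigma> by simp
    qed (use assms c in auto)
    finally have RR: "norm (R ?y1 - R ?y2) \<le> \<epsilon> / c * s * (2 * norm d + norm e)" by (simp add: algebra_simps)
    have "f (p + s *\<^sub>R d + s *\<^sub>R e) - f (p + s *\<^sub>R d) - f (p + s *\<^sub>R e) + f p - s\<^sup>2 * (d \<bullet> (?A *v e))
        = \<psi> s - \<psi> 0 - s\<^sup>2 * (d \<bullet> (?A *v e))" by (simp add: \<psi>_def add_ac)
    also have "\<dots> = s * (d \<bullet> (R ?y1 - R ?y2))"
    proof -
      have X: "d \<bullet> grad f ?y1 - d \<bullet> grad f ?y2 = s * (d \<bullet> (?A *v e)) + d \<bullet> (R ?y1 - R ?y2)"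
        unfolding inner_diff_right[symmetric] g by (simp add: inner_add_right inner_diff_right)
      show ?thesis unfolding \<sigma>(3) X by (simp add: power2_eq_square algebra_simps)
    qed
    also have "\<bar>\<dots>\<bar> \<le> s * (norm d * (\<epsilon> / c * s * (2 * norm d + norm e)))"
    proof -
      have "\<bar>d \<bullet> (R ?y1 - R ?y2)\<bar> \<le> norm d * (\<epsilon> / c * s * (2 * norm d + norm e))"
        by (rule order_trans[OF Cauchy_Schwarz_ineq2 mult_left_mono[OF RR norm_ge_zero]])
      then have "s * \<bar>d \<bullet> (R ?y1 - R ?y2)\<bar> \<le> s * (norm d * (\<epsilon> / c * s * (2 * norm d + norm e)))"
        using s by (intro mult_left_mono) auto
      then show ?thesis using s by (simp only: abs_mult abs_of_pos)
    qed
    also have "\<dots> = \<epsilon> * s\<^sup>2 * (norm d * (2 * norm d + norm e) / c)" by (simp add: power2_eq_square)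
    also have "\<dots> \<le> \<epsilon> * s\<^sup>2 * 1"
      using assms c by (intro mult_left_mono) (auto simp: c_def)
    finally show "\<bar>f (p + s *\<^sub>R d + s *\<^sub>R e) - f (p + s *\<^sub>R d) - f (p + s *\<^sub>R e) + f p - s\<^sup>2 * (d \<bullet> (?A *v e))\<bar>
      \<le> \<epsilon> * s\<^sup>2" by simp
  qed
qed

text \<open>
  The mixed second difference is symmetric in the two directions.
\<close>
lemma C2_hessian_symmetric: "transpose (hessian f p) = hessian f p"
proof -
  let ?A = "hessian f p"
  have "d \<bullet> (?A *v e) = e \<bullet> (?A *v d)" for d e
  proof (rule ccontr)
    assume ne: "d \<bullet> (?A *v e) \<noteq> e \<bullet> (?A *v d)"
    define \<epsilon> where "\<epsilon> = \<bar>d \<bullet> (?A *v e) - e \<bullet> (?A *v d)\<bar> / 4"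
    have \<epsilon>: "\<epsilon> > 0" using ne by (simp add: \<epsilon>_def)
    obtain \<delta>1 where 1: "\<delta>1 > 0" "\<And>s. 0 < s \<Longrightarrow> s < \<delta>1 \<Longrightarrow>
      \<bar>f (p + s *\<^sub>R d + s *\<^sub>R e) - f (p + s *\<^sub>R d) - f (p + s *\<^sub>R e) + f p - s\<^sup>2 * (d \<bullet> (?A *v e))\<bar> \<le> \<epsilon> * s\<^sup>2"
      using C2_hessian_mixed[OF \<epsilon>, of d e] by blast
    obtain \<delta>2 where 2: "\<delta>2 > 0" "\<And>s. 0 < s \<Longrightarrow> s < \<delta>2 \<Longrightarrow>
      \<bar>f (p + s *\<^sub>R e + s *\<^sub>R d) - f (p + s *\<^sub>R e) - f (p + s *\<^sub>R d) + f p - s\<^sup>2 * (e \<bullet> (?A *v d))\<bar> \<le> \<epsilon> * s\<^sup>2"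
      using C2_hessian_mixed[OF \<epsilon>, of e d] by blast
    define s where "s = min \<delta>1 \<delta>2 / 2"
    have s: "0 < s" "s < \<delta>1" "s < \<delta>2" using 1 2 by (auto simp: s_def)
    have "\<bar>s\<^sup>2 * (d \<bullet> (?A *v e)) - s\<^sup>2 * (e \<bullet> (?A *v d))\<bar> \<le> 2 * \<epsilon> * s\<^sup>2"
      using 1(2)[OF s(1,2)] 2(2)[OF s(1,3)] by (simp add: add_ac)
    then have "s\<^sup>2 * (4 * \<epsilon>) \<le> s\<^sup>2 * (2 * \<epsilon>)"
      by (simp add: \<epsilon>_def right_diff_distrib[symmetric] abs_mult)
    then show False using s \<epsilon> by simp
  qed
  from this[of "axis _ 1" "axis _ 1"] have "?A $ i $ j = ?A $ j $ i" for i j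
    by (simp add: matrix_vector_mult_basis inner_axis' column_def)
  then show ?thesis by (simp add: vec_eq_iff transpose_def)
qed

text \<open>
  The mean value theorem along the segment for \<open>f\<close> minus its quadratic part, whose derivative
  the expansion of the gradient bounds.
\<close>
lemma C2_second_order_expansion:
  assumes stationary: "grad f p = 0" and "\<epsilon> > 0"
  shows "\<exists>\<delta>>0. \<forall>s. 0 < s \<and> s < \<delta> \<longrightarrow>
     \<bar>f (p + s *\<^sub>R d) - f p - s\<^sup>2 * (d \<bullet> (hessian f p *v d)) / 2\<bar> \<le> \<epsilon> * s\<^sup>2"
proof -
  let ?A = "hessian f p"
  define c where "c = norm d * norm d + 1"
  have c: "c > 0" by (simp add: c_def add_nonneg_pos)
  obtain r1 where r1: "r1 > 0" "\<And>y. y \<in> ball p r1 \<Longrightarrow> f differentiable at y" using C2_differentiable by blast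
  obtain r2 where r2: "r2 > 0"
    "\<And>y. y \<in> ball p r2 \<Longrightarrow> norm (grad f y - grad f p - ?A *v (y - p)) \<le> \<epsilon> / c * norm (y - p)"
    using C2_grad_expansion[of "\<epsilon> / c"] assms c by auto
  define r where "r = min r1 r2"
  define \<delta> where "\<delta> = r / (norm d + 1)"
  have \<delta>: "\<delta> > 0" using r1 r2 by (simp add: \<delta>_def r_def add_nonneg_pos)
  show ?thesis
  proof (intro exI[of _ \<delta>] conjI \<delta> allI impI)
    fix s assume s: "0 < s \<and> s < \<delta>"
    have inball: "p + \<sigma> *\<^sub>R d \<in> ball p r" if "0 \<le> \<sigma>" "\<sigma> \<le> s" for \<sigma>
    proof -
      have "norm (\<sigma> *\<^sub>R d) \<le> s * (norm d + 1)" using that s by (simp add: mult_mono)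
      also have "\<dots> < \<delta> * (norm d + 1)" using s by (intro mult_strict_right_mono) (auto simp: add_nonneg_pos)
      also have "\<dots> = r" by (simp add: \<delta>_def add_nonneg_eq_0_iff)
      finally show ?thesis by (simp add: dist_norm)
    qed
    define q where "q = d \<bullet> (?A *v d)"
    define \<psi> where "\<psi> \<sigma> = f (p + \<sigma> *\<^sub>R d) - \<sigma>\<^sup>2 * q / 2" for \<sigma>
    have "\<And>\<sigma>. 0 \<le> \<sigma> \<Longrightarrow> \<sigma> \<le> s \<Longrightarrow> (\<psi> has_real_derivative (d \<bullet> grad f (p + \<sigma> *\<^sub>R d) - \<sigma> * q)) (at \<sigma>)"
      unfolding \<psi>_def
      by (intro DERIV_diff directional_derivative) (use inball r1 in \<open>auto simp: r_def intro!: derivative_eq_intros\<close>)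
    from MVT2[of 0 s \<psi>, OF _ this] s obtain \<sigma> where \<sigma>: "0 < \<sigma>" "\<sigma> < s"
      "\<psi> s - \<psi> 0 = s * (d \<bullet> grad f (p + \<sigma> *\<^sub>R d) - \<sigma> * q)" by auto
    have "norm (grad f (p + \<sigma> *\<^sub>R d) - \<sigma> *\<^sub>R (?A *v d)) \<le> \<epsilon> / c * (\<sigma> * norm d)"
      using r2(2)[of "p + \<sigma> *\<^sub>R d"] inball[of \<sigma>] \<sigma> by (simp add: r_def stationary matrix_vector_mult_scaleR)
    then have "\<bar>d \<bullet> (grad f (p + \<sigma> *\<^sub>R d) - \<sigma> *\<^sub>R (?A *v d))\<bar> \<le> norm d * (\<epsilon> / c * (\<sigma> * norm d))"
      by (rule order_trans[OF Cauchy_Schwarz_ineq2 mult_left_mono[OF _ norm_ge_zero]])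
    moreover have "d \<bullet> (grad f (p + \<sigma> *\<^sub>R d) - \<sigma> *\<^sub>R (?A *v d)) = d \<bullet> grad f (p + \<sigma> *\<^sub>R d) - \<sigma> * q"
      by (simp add: inner_diff_right q_def)
    ultimately have "\<bar>d \<bullet> grad f (p + \<sigma> *\<^sub>R d) - \<sigma> * q\<bar> \<le> norm d * (\<epsilon> / c * (\<sigma> * norm d))" by simp
    also have "\<dots> = \<epsilon> * \<sigma> * (norm d * norm d / c)" by simp
    also have "\<dots> \<le> \<epsilon> * s * 1"
      using \<sigma> assms c by (intro mult_mono) (auto simp: c_def)
    finally have "\<bar>\<psi> s - \<psi> 0\<bar> \<le> s * (\<epsilon> * s)"
      using s unfolding \<sigma>(3) by (simp add: abs_mult)
    then show "\<bar>f (p + s *\<^sub>R d) - f p - s\<^sup>2 * (d \<bullet> (?A *v d)) / 2\<bar> \<le> \<epsilon> * s\<^sup>2"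
      by (simp add: \<psi>_def q_def power2_eq_square algebra_simps)
  qed
qed

end

section \<open>The limit objective, its Hessian and ties\<close>

definition max_bid :: "('n::finite \<Rightarrow> 'a \<Rightarrow> real) \<Rightarrow> 'a \<Rightarrow> real^'n \<Rightarrow> real" where
  "max_bid v x \<beta> = Max (range (\<lambda>i. \<beta> $ i * v i x))"

definition log_term :: "('n::finite \<Rightarrow> real) \<Rightarrow> real^'n \<Rightarrow> real" where
  "log_term b \<beta> = (\<Sum>i\<in>UNIV. b i * (- ln (\<beta> $ i)))"

definition pos_orthant :: "(real^'n) set" where
  "pos_orthant = {\<beta>. \<forall>i. 0 < \<beta> $ i}"

lemma open_pos_orthant: "open (pos_orthant :: (real^'n) set)"
proof -
  have eq: "(pos_orthant :: (real^'n) set) = (\<Inter>i\<in>UNIV. {\<beta>. 0 < \<beta> $ i})" by (auto simp: pos_orthant_def)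
  show ?thesis unfolding eq by (intro open_INT ballI open_Collect_less continuous_intros) auto
qed

lemma convex_pos_orthant: "convex pos_orthant"
proof (rule convexI)
  fix x y :: "real^'n" and u w :: real
  assume "x \<in> pos_orthant" "y \<in> pos_orthant" "0 \<le> u" "0 \<le> w" "u + w = 1"
  moreover from this have "0 < u * x $ i + w * y $ i" for i
    by (cases "u = 0") (auto simp: pos_orthant_def intro!: add_pos_nonneg[OF mult_pos_pos mult_nonneg_nonneg] less_imp_le)
  ultimately show "u *\<^sub>R x + w *\<^sub>R y \<in> pos_orthant" by (simp add: pos_orthant_def)
qed

lemma max_bid_ge: "\<beta> $ i * v i x \<le> max_bid v x \<beta>"
  unfolding max_bid_def by (rule Max_ge) auto

lemma max_bid_le_iff: "max_bid v x \<beta> \<le> c \<longleftrightarrow> (\<forall>i. \<beta> $ i * v i x \<le> c)"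
  unfolding max_bid_def by (subst Max_le_iff) auto

lemma max_bid_eqI: "(\<And>j. \<beta> $ j * v j x \<le> \<beta> $ i * v i x) \<Longrightarrow> max_bid v x \<beta> = \<beta> $ i * v i x"
  by (rule antisym) (auto simp: max_bid_le_iff max_bid_ge)

lemma max_bid_attained: obtains i where "max_bid v x \<beta> = \<beta> $ i * v i x"
proof -
  have "max_bid v x \<beta> \<in> range (\<lambda>i. \<beta> $ i * v i x)" unfolding max_bid_def by (rule Max_in) auto
  then show thesis using that by auto
qed

lemma convex_max_bid: "convex_on S (max_bid v x)" if "convex S"
proof (rule convex_onI)
  fix t :: real and y z assume t: "0 < t" "t < 1"
  show "max_bid v x ((1 - t) *\<^sub>R y + t *\<^sub>R z) \<le> (1 - t) * max_bid v x y + t * max_bid v x z"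
    unfolding max_bid_le_iff
  proof
    fix i
    have "((1 - t) *\<^sub>R y + t *\<^sub>R z) $ i * v i x = (1 - t) * (y $ i * v i x) + t * (z $ i * v i x)"
      by (simp add: algebra_simps)
    also have "\<dots> \<le> (1 - t) * max_bid v x y + t * max_bid v x z"
      using t by (intro add_mono mult_left_mono max_bid_ge) auto
    finally show "((1 - t) *\<^sub>R y + t *\<^sub>R z) $ i * v i x \<le> (1 - t) * max_bid v x y + t * max_bid v x z" .
  qed
qed (rule that)

lemma max_bid_Lipschitz:
  fixes v :: "'n::finite \<Rightarrow> 'a \<Rightarrow> real"
  assumes "\<And>i. \<bar>v i x\<bar> \<le> V"
  shows "\<bar>max_bid v x \<beta> - max_bid v x \<beta>'\<bar> \<le> V * (\<Sum>i\<in>UNIV. \<bar>\<beta> $ i - \<beta>' $ i\<bar>)"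
proof -
  have *: "max_bid v x \<beta> \<le> max_bid v x \<beta>' + V * (\<Sum>i\<in>UNIV. \<bar>\<beta> $ i - \<beta>' $ i\<bar>)" for \<beta> \<beta>' :: "real^'n"
    unfolding max_bid_le_iff
  proof
    fix i
    have "\<beta> $ i * v i x - \<beta>' $ i * v i x = (\<beta> $ i - \<beta>' $ i) * v i x" by (simp add: algebra_simps)
    also have "\<dots> \<le> \<bar>\<beta> $ i - \<beta>' $ i\<bar> * V"
    proof -
      have "(\<beta> $ i - \<beta>' $ i) * v i x \<le> \<bar>\<beta> $ i - \<beta>' $ i\<bar> * \<bar>v i x\<bar>"
        unfolding abs_mult[symmetric] by (rule abs_ge_self)
      also have "\<dots> \<le> \<bar>\<beta> $ i - \<beta>' $ i\<bar> * V" using assms[of i] by (rule mult_left_mono) simp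
      finally show ?thesis .
    qed
    also have "\<dots> \<le> (\<Sum>i\<in>UNIV. \<bar>\<beta> $ i - \<beta>' $ i\<bar>) * V"
      using assms[of i] by (intro mult_right_mono member_le_sum) auto
    finally show "\<beta> $ i * v i x \<le> max_bid v x \<beta>' + V * (\<Sum>i\<in>UNIV. \<bar>\<beta> $ i - \<beta>' $ i\<bar>)"
      using max_bid_ge[of \<beta>' i v x] by (simp add: mult.commute)
  qed
  show ?thesis using *[of \<beta> \<beta>'] *[of \<beta>' \<beta>] by (simp add: abs_minus_commute abs_le_iff)
qed

lemma max_bid_measurable [measurable]:
  assumes [measurable]: "\<And>i. v i \<in> borel_measurable N"
  shows "(\<lambda>x. max_bid v x \<beta>) \<in> borel_measurable N"
  unfolding max_bid_def by measurable

lemma convex_neg_ln: "convex_on {0<..} (\<lambda>y::real. - ln y)"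
  using ln_concave by (simp add: concave_on_def)

lemma convex_log_term:
  fixes b :: "'n::finite \<Rightarrow> real"
  assumes b: "\<And>i. b i > 0" shows "convex_on pos_orthant (log_term b)"
proof (rule convex_onI)
  fix t :: real and y z :: "real^'n"
  assume t: "0 < t" "t < 1" and y: "y \<in> pos_orthant" and z: "z \<in> pos_orthant"
  have "b i * - ln (((1 - t) *\<^sub>R y + t *\<^sub>R z) $ i) \<le> (1 - t) * (b i * - ln (y $ i)) + t * (b i * - ln (z $ i))" for i
  proof -
    have "- ln ((1 - t) *\<^sub>R (y $ i) + t *\<^sub>R (z $ i)) \<le> (1 - t) * - ln (y $ i) + t * - ln (z $ i)"
      using convex_onD[OF convex_neg_ln, of t "y $ i" "z $ i"] t y z by (auto simp: pos_orthant_def)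
    from mult_left_mono[OF this, of "b i"] b[of i] show ?thesis by (simp add: algebra_simps)
  qed
  then show "log_term b ((1 - t) *\<^sub>R y + t *\<^sub>R z) \<le> (1 - t) * log_term b y + t * log_term b z"
    unfolding log_term_def sum_distrib_left sum.distrib[symmetric] by (intro sum_mono) auto
qed (rule convex_pos_orthant)

lemma LFM_F_pos: "\<beta> \<in> pos_orthant \<Longrightarrow> LFM_F v b x \<beta> = ereal (max_bid v x \<beta> + log_term b \<beta>)"
  by (simp add: LFM_F_def max_bid_def log_term_def neg_log_def pos_orthant_def not_le[symmetric])

lemma LFM_F_boundary:
  assumes "\<beta> \<in> orthant" "\<beta> \<notin> pos_orthant" "\<And>i. b i > 0"
  shows "LFM_F v b x \<beta> = \<infinity>"
proof -
  obtain i where i: "\<beta> $ i \<le> 0" using assms(2) by (auto simp: pos_orthant_def not_less)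
  have "(\<Sum>i\<in>UNIV. ereal (b i) * neg_log (\<beta> $ i)) = \<infinity>"
    unfolding sum_Pinfty using i assms(3)[of i] by (auto simp: neg_log_def intro!: exI[of _ i])
  then show ?thesis by (simp add: LFM_F_def)
qed

lemma pos_subset_orthant: "\<beta> \<in> pos_orthant \<Longrightarrow> \<beta> \<in> orthant"
  by (auto simp: pos_orthant_def orthant_def less_imp_le)

lemma one_in_pos_orthant: "(\<chi> i. 1) \<in> pos_orthant"
  by (simp add: pos_orthant_def)

lemma ext_expectation_real:
  assumes "integrable N h"
  shows "ext_expectation N (\<lambda>x. ereal (h x)) = ereal (\<integral>x. h x \<partial>N)"
proof -
  have f: "(\<integral>\<^sup>+x. ennreal (h x) \<partial>N) < \<infinity>" "(\<integral>\<^sup>+x. ennreal (- h x) \<partial>N) < \<infinity>"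
  proof -
    have "(\<integral>\<^sup>+x. ennreal (h x) \<partial>N) \<le> (\<integral>\<^sup>+x. ennreal (norm (h x)) \<partial>N)"
      by (intro nn_integral_mono ennreal_leI) auto
    then show "(\<integral>\<^sup>+x. ennreal (h x) \<partial>N) < \<infinity>" using assms by (auto simp: integrable_iff_bounded)
    have "(\<integral>\<^sup>+x. ennreal (- h x) \<partial>N) \<le> (\<integral>\<^sup>+x. ennreal (norm (h x)) \<partial>N)"
      by (intro nn_integral_mono ennreal_leI) auto
    then show "(\<integral>\<^sup>+x. ennreal (- h x) \<partial>N) < \<infinity>" using assms by (auto simp: integrable_iff_bounded)
  qed
  have e: "enn2ereal y = ereal (enn2real y)" if "y < \<infinity>" for y
    using that by (cases y) (auto simp: enn2ereal_ennreal)
  have "ext_expectation N (\<lambda>x. ereal (h x))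
      = ereal (enn2real (\<integral>\<^sup>+x. ennreal (h x) \<partial>N)) - ereal (enn2real (\<integral>\<^sup>+x. ennreal (- h x) \<partial>N))"
    unfolding ext_expectation_def by (simp add: e[OF f(1)] e[OF f(2)])
  then show ?thesis by (simp add: real_lebesgue_integral_def[OF assms])
qed

text \<open>
  The negative part contributes zero, so the value is not of the form \<open>\<infinity> - \<infinity>\<close>.
\<close>
lemma ext_expectation_infty:
  assumes "prob_space N" shows "ext_expectation N (\<lambda>x. \<infinity>) = \<infinity>"
proof -
  interpret prob_space N by fact
  show ?thesis by (simp add: ext_expectation_def emeasure_space_1 e2ennreal_neg)
qed


text \<open>
  The population problem for items with law \<open>N\<close>; \<open>\<beta>s\<close> is the limit equilibrium and \<open>V\<close> a common
  bound of the valuations.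
\<close>
locale fisher_limit = prob_space N for N :: "'a measure" +
  fixes v :: "'n::finite \<Rightarrow> 'a \<Rightarrow> real" and b :: "'n \<Rightarrow> real" and \<beta>s :: "real^'n" and V :: real
  assumes budgets: "\<And>i. b i > 0"
    and v_measurable [measurable]: "\<And>i. v i \<in> borel_measurable N"
    and v_nonneg: "\<And>i x. x \<in> space N \<Longrightarrow> 0 \<le> v i x"
    and v_le: "\<And>i x. x \<in> space N \<Longrightarrow> v i x \<le> V"
    and argmin: "is_arg_min (\<lambda>\<beta>. ext_expectation N (\<lambda>x. LFM_F v b x \<beta>)) (\<lambda>\<beta>. \<beta> \<in> orthant) \<beta>s"
    and C2: "C2_near (\<lambda>\<beta>. real_of_ereal (ext_expectation N (\<lambda>x. LFM_F v b x \<beta>))) \<beta>s"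
begin

lemma V_nonneg: "V \<ge> 0"
proof -
  obtain x where "x \<in> space N" using not_empty by blast
  then show ?thesis using v_nonneg v_le order_trans by blast
qed

lemma v_abs: "x \<in> space N \<Longrightarrow> \<bar>v i x\<bar> \<le> V"
  using v_nonneg v_le by simp

lemma max_bid_bounded:
  assumes "x \<in> space N" shows "\<bar>max_bid v x \<beta>\<bar> \<le> V * (\<Sum>i\<in>UNIV. \<bar>\<beta> $ i\<bar>)"
proof -
  have "max_bid v x 0 = 0" using max_bid_eqI[of 0 v x] by simp
  then show ?thesis using max_bid_Lipschitz[of v x V \<beta> 0] v_abs[OF assms] by simp
qed

lemma max_bid_integrable: "integrable N (\<lambda>x. max_bid v x \<beta>)"
  by (rule integrable_const_bound[where B="V * (\<Sum>i\<in>UNIV. \<bar>\<beta> $ i\<bar>)"]) (auto intro: max_bid_bounded)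

definition objective :: "real^'n \<Rightarrow> real" where
  "objective \<beta> = (\<integral>x. max_bid v x \<beta> \<partial>N) + log_term b \<beta>"

lemma ext_objective_pos:
  assumes "\<beta> \<in> pos_orthant"
  shows "ext_expectation N (\<lambda>x. LFM_F v b x \<beta>) = ereal (objective \<beta>)"
  unfolding LFM_F_pos[OF assms] using max_bid_integrable[of \<beta>]
  by (subst ext_expectation_real) (auto simp: objective_def prob_space)

lemma argmin_orthant: "\<beta>s \<in> orthant"
  and argmin_le: "\<beta> \<in> orthant \<Longrightarrow>
    ext_expectation N (\<lambda>x. LFM_F v b x \<beta>s) \<le> ext_expectation N (\<lambda>x. LFM_F v b x \<beta>)"
  using argmin unfolding is_arg_min_linorder by simp_all

text \<open>
  On the boundary of the orthant the objective is infinite, while it is finite in the interior.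
\<close>
lemma argmin_pos: "\<beta>s \<in> pos_orthant"
proof (rule ccontr)
  assume np: "\<beta>s \<notin> pos_orthant"
  have "LFM_F v b x \<beta>s = \<infinity>" for x
    by (rule LFM_F_boundary[OF argmin_orthant np budgets])
  then have "ext_expectation N (\<lambda>x. LFM_F v b x \<beta>s) = \<infinity>"
    using ext_expectation_infty[OF prob_space_axioms] by simp
  then show False
    using argmin_le[OF pos_subset_orthant[OF one_in_pos_orthant]]
    by (simp add: ext_objective_pos[OF one_in_pos_orthant])
qed

lemma star_pos: "0 < \<beta>s $ i"
  using argmin_pos by (simp add: pos_orthant_def)

lemma objective_min:
  assumes "\<beta> \<in> pos_orthant" shows "objective \<beta>s \<le> objective \<beta>"
  using argmin_le[OF pos_subset_orthant[OF assms]]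
  by (simp add: ext_objective_pos[OF assms] ext_objective_pos[OF argmin_pos])

definition Hess :: "real^'n^'n" where
  "Hess = hessian (\<lambda>\<beta>. real_of_ereal (ext_expectation N (\<lambda>x. LFM_F v b x \<beta>))) \<beta>s"

lemma Hess_symmetric: "transpose Hess = Hess"
  unfolding Hess_def by (rule C2_hessian_symmetric[OF C2])

lemma objective_expansion:
  assumes "\<epsilon> > 0"
  shows "\<exists>\<delta>>0. \<forall>s. 0 < s \<and> s < \<delta> \<longrightarrow> \<beta>s + s *\<^sub>R d \<in> pos_orthant \<and>
    \<bar>objective (\<beta>s + s *\<^sub>R d) - objective \<beta>s - s\<^sup>2 * (d \<bullet> (Hess *v d)) / 2\<bar> \<le> \<epsilon> * s\<^sup>2"
proof -
  let ?h = "\<lambda>\<beta>. real_of_ereal (ext_expectation N (\<lambda>x. LFM_F v b x \<beta>))"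
  have h: "?h \<beta> = objective \<beta>" if "\<beta> \<in> pos_orthant" for \<beta> using ext_objective_pos[OF that] by simp
  have "?h differentiable at \<beta>s" using C2_differentiable[OF C2] by force
  then have "(?h has_derivative (\<lambda>d. d \<bullet> grad ?h \<beta>s)) (at \<beta>s)"
    using gderiv_grad unfolding gderiv_def by blast
  from differential_zero_maxmin[OF argmin_pos open_pos_orthant this]
  have "(\<lambda>d. d \<bullet> grad ?h \<beta>s) = (\<lambda>d. 0)" using objective_min h argmin_pos by simp
  then have "grad ?h \<beta>s \<bullet> grad ?h \<beta>s = 0" by (rule fun_cong)
  then have stat: "grad ?h \<beta>s = 0" by simp
  obtain \<delta> where \<delta>: "\<delta> > 0" "\<And>s. 0 < s \<Longrightarrow> s < \<delta> \<Longrightarrow>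
      \<bar>?h (\<beta>s + s *\<^sub>R d) - ?h \<beta>s - s\<^sup>2 * (d \<bullet> (Hess *v d)) / 2\<bar> \<le> \<epsilon> * s\<^sup>2"
    using C2_second_order_expansion[OF C2 stat assms, of d] unfolding Hess_def by blast
  obtain r where r: "r > 0" "ball \<beta>s r \<subseteq> pos_orthant"
    using open_pos_orthant argmin_pos open_contains_ball by blast
  define \<delta>' where "\<delta>' = min \<delta> (r / (norm d + 1))"
  have n1: "norm d + 1 > 0" by (simp add: add_nonneg_pos)
  show ?thesis
  proof (intro exI[of _ \<delta>'] conjI allI impI)
    show "\<delta>' > 0" using \<delta> r n1 by (simp add: \<delta>'_def)
    fix s assume s: "0 < s \<and> s < \<delta>'"
    have "s * norm d \<le> s * (norm d + 1)" using s by simp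
    also have "\<dots> < r" using s n1 by (simp add: \<delta>'_def pos_less_divide_eq)
    finally show pos: "\<beta>s + s *\<^sub>R d \<in> pos_orthant" using s r(2) by (auto simp: dist_norm)
    show "\<bar>objective (\<beta>s + s *\<^sub>R d) - objective \<beta>s - s\<^sup>2 * (d \<bullet> (Hess *v d)) / 2\<bar> \<le> \<epsilon> * s\<^sup>2"
      using \<delta>(2)[of s] s h[OF pos] h[OF argmin_pos] by (simp add: \<delta>'_def)
  qed
qed

lemma max_bid_second_difference: "2 * max_bid v x \<beta> \<le> max_bid v x (\<beta> + d) + max_bid v x (\<beta> - d)"
proof -
  obtain i where i: "max_bid v x \<beta> = \<beta> $ i * v i x" by (rule max_bid_attained)
  show ?thesis
    using max_bid_ge[of "\<beta> + d" i v x] max_bid_ge[of "\<beta> - d" i v x] unfolding i by (simp add: algebra_simps)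
qed

lemma log_term_second_difference:
  assumes "\<beta> \<in> pos_orthant" "\<beta> + d \<in> pos_orthant" "\<beta> - d \<in> pos_orthant"
  shows "(\<Sum>i\<in>UNIV. b i * (d $ i / \<beta> $ i)\<^sup>2) \<le> log_term b (\<beta> + d) + log_term b (\<beta> - d) - 2 * log_term b \<beta>"
proof -
  have "b i * (d $ i / \<beta> $ i)\<^sup>2 \<le> b i * - ln ((\<beta> + d) $ i) + b i * - ln ((\<beta> - d) $ i) - 2 * (b i * - ln (\<beta> $ i))" for i
  proof -
    have p: "0 < \<beta> $ i" "0 < \<beta> $ i + d $ i" "0 < \<beta> $ i - d $ i" using assms by (auto simp: pos_orthant_def)
    have "ln (\<beta> $ i + d $ i) + ln (\<beta> $ i - d $ i) - 2 * ln (\<beta> $ i) = ln ((\<beta> $ i + d $ i) * (\<beta> $ i - d $ i) / (\<beta> $ i * \<beta> $ i))"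
      using p by (simp add: ln_div ln_mult)
    also have "\<dots> \<le> (\<beta> $ i + d $ i) * (\<beta> $ i - d $ i) / (\<beta> $ i * \<beta> $ i) - 1"
      using p by (intro ln_le_minus_one) simp
    also have "\<dots> = - (d $ i / \<beta> $ i)\<^sup>2" using p by (simp add: field_simps power2_eq_square)
    finally have "(d $ i / \<beta> $ i)\<^sup>2 \<le> - ln (\<beta> $ i + d $ i) - ln (\<beta> $ i - d $ i) + 2 * ln (\<beta> $ i)" by simp
    from mult_left_mono[OF this, of "b i"] show ?thesis using budgets[of i] by (simp add: algebra_simps)
  qed
  then have "(\<Sum>i\<in>UNIV. b i * (d $ i / \<beta> $ i)\<^sup>2)
      \<le> (\<Sum>i\<in>UNIV. b i * - ln ((\<beta> + d) $ i) + b i * - ln ((\<beta> - d) $ i) - 2 * (b i * - ln (\<beta> $ i)))"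
    by (intro sum_mono) auto
  then show ?thesis by (simp add: log_term_def sum.distrib sum_subtractf sum_distrib_left sum_negf)
qed

text \<open>
  Along \<open>\<beta>s \<plusminus> s d\<close> the second difference of the objective is \<open>s\<^sup>2 d \<bullet> (Hess *v d)\<close> up to a small
  error. It splits into the expected second difference of the maximum, which is nonnegative by
  convexity, and that of the logarithmic term, which is explicitly bounded below. Both the
  positive definiteness of the Hessian and the absence of ties are read off from this
  inequality.
\<close>
lemma objective_second_difference:
  assumes "\<epsilon> > 0"
  shows "\<exists>\<delta>>0. \<forall>s. 0 < s \<and> s < \<delta> \<longrightarrow>
    (\<integral>x. max_bid v x (\<beta>s + s *\<^sub>R d) + max_bid v x (\<beta>s - s *\<^sub>R d) - 2 * max_bid v x \<beta>s \<partial>N)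
     + s\<^sup>2 * (\<Sum>i\<in>UNIV. b i * (d $ i / \<beta>s $ i)\<^sup>2) \<le> s\<^sup>2 * (d \<bullet> (Hess *v d) + \<epsilon>)"
proof -
  let ?q = "d \<bullet> (Hess *v d)"
  have e2: "\<epsilon> / 2 > 0" using assms by simp
  obtain \<delta>1 where 1: "\<delta>1 > 0" "\<And>s. 0 < s \<Longrightarrow> s < \<delta>1 \<Longrightarrow> \<beta>s + s *\<^sub>R d \<in> pos_orthant \<and>
    \<bar>objective (\<beta>s + s *\<^sub>R d) - objective \<beta>s - s\<^sup>2 * ?q / 2\<bar> \<le> \<epsilon> / 2 * s\<^sup>2"
    using objective_expansion[OF e2, of d] by blast
  obtain \<delta>2 where 2: "\<delta>2 > 0" "\<And>s. 0 < s \<Longrightarrow> s < \<delta>2 \<Longrightarrow> \<beta>s + s *\<^sub>R (- d) \<in> pos_orthant \<and>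
    \<bar>objective (\<beta>s + s *\<^sub>R (- d)) - objective \<beta>s - s\<^sup>2 * ((- d) \<bullet> (Hess *v (- d))) / 2\<bar> \<le> \<epsilon> / 2 * s\<^sup>2"
    using objective_expansion[OF e2, of "- d"] by blast
  have neg: "(- d) \<bullet> (Hess *v (- d)) = ?q"
    using matrix_vector_mult_scaleR[of Hess "-1" d] by simp
  show ?thesis
  proof (intro exI[of _ "min \<delta>1 \<delta>2"] conjI allI impI)
    show "min \<delta>1 \<delta>2 > 0" using 1 2 by simp
    fix s assume s: "0 < s \<and> s < min \<delta>1 \<delta>2"
    have p: "\<beta>s + s *\<^sub>R d \<in> pos_orthant" "\<beta>s - s *\<^sub>R d \<in> pos_orthant" using 1(2)[of s] 2(2)[of s] s by auto
    have up: "objective (\<beta>s + s *\<^sub>R d) + objective (\<beta>s - s *\<^sub>R d) - 2 * objective \<beta>s \<le> s\<^sup>2 * (?q + \<epsilon>)"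
    proof -
      have A: "0 < s" "s < \<delta>1" "s < \<delta>2" using s by auto
      have "\<bar>objective (\<beta>s - s *\<^sub>R d) - objective \<beta>s - s\<^sup>2 * ?q / 2\<bar> \<le> \<epsilon> / 2 * s\<^sup>2"
        using conjunct2[OF 2(2)[OF A(1,3)]] unfolding neg by (simp only: scaleR_minus_right add_uminus_conv_diff)
      from abs_le_D1[OF this] abs_le_D1[OF conjunct2[OF 1(2)[OF A(1,2)]]]
      have "objective (\<beta>s + s *\<^sub>R d) + objective (\<beta>s - s *\<^sub>R d) - 2 * objective \<beta>s
          \<le> s\<^sup>2 * ?q + \<epsilon> * s\<^sup>2" by linarith
      then show ?thesis by (simp add: algebra_simps)
    qed
    have log: "s\<^sup>2 * (\<Sum>i\<in>UNIV. b i * (d $ i / \<beta>s $ i)\<^sup>2)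
      \<le> log_term b (\<beta>s + s *\<^sub>R d) + log_term b (\<beta>s - s *\<^sub>R d) - 2 * log_term b \<beta>s"
      using log_term_second_difference[OF argmin_pos p]
      by (simp add: sum_distrib_left power_mult_distrib power_divide mult_ac)
    have "(\<integral>x. max_bid v x (\<beta>s + s *\<^sub>R d) + max_bid v x (\<beta>s - s *\<^sub>R d) - 2 * max_bid v x \<beta>s \<partial>N)
       = (\<integral>x. max_bid v x (\<beta>s + s *\<^sub>R d) \<partial>N) + (\<integral>x. max_bid v x (\<beta>s - s *\<^sub>R d) \<partial>N) - 2 * (\<integral>x. max_bid v x \<beta>s \<partial>N)"
      using max_bid_integrable by simp
    then show "(\<integral>x. max_bid v x (\<beta>s + s *\<^sub>R d) + max_bid v x (\<beta>s - s *\<^sub>R d) - 2 * max_bid v x \<beta>s \<partial>N)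
     + s\<^sup>2 * (\<Sum>i\<in>UNIV. b i * (d $ i / \<beta>s $ i)\<^sup>2) \<le> s\<^sup>2 * (?q + \<epsilon>)"
      using up log by (simp add: objective_def)
  qed
qed

lemma Hess_lower_bound: "(\<Sum>i\<in>UNIV. b i * (d $ i / \<beta>s $ i)\<^sup>2) \<le> d \<bullet> (Hess *v d)"
proof (rule field_le_epsilon)
  fix \<epsilon> :: real assume "\<epsilon> > 0"
  then obtain \<delta> where \<delta>: "\<delta> > 0" "\<And>s. 0 < s \<Longrightarrow> s < \<delta> \<Longrightarrow>
    (\<integral>x. max_bid v x (\<beta>s + s *\<^sub>R d) + max_bid v x (\<beta>s - s *\<^sub>R d) - 2 * max_bid v x \<beta>s \<partial>N)
     + s\<^sup>2 * (\<Sum>i\<in>UNIV. b i * (d $ i / \<beta>s $ i)\<^sup>2) \<le> s\<^sup>2 * (d \<bullet> (Hess *v d) + \<epsilon>)"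
    using objective_second_difference by blast
  have nn: "0 \<le> (\<integral>x. max_bid v x (\<beta>s + (\<delta> / 2) *\<^sub>R d) + max_bid v x (\<beta>s - (\<delta> / 2) *\<^sub>R d) - 2 * max_bid v x \<beta>s \<partial>N)"
    using max_bid_second_difference by (intro integral_nonneg_AE) auto
  then have "(\<delta> / 2)\<^sup>2 * (\<Sum>i\<in>UNIV. b i * (d $ i / \<beta>s $ i)\<^sup>2) \<le> (\<delta> / 2)\<^sup>2 * (d \<bullet> (Hess *v d) + \<epsilon>)"
  proof -
    have "0 < \<delta> / 2" "\<delta> / 2 < \<delta>" using \<delta>(1) by auto
    from \<delta>(2)[OF this] nn show ?thesis by linarith
  qed
  then show "(\<Sum>i\<in>UNIV. b i * (d $ i / \<beta>s $ i)\<^sup>2) \<le> d \<bullet> (Hess *v d) + \<epsilon>" using \<delta>(1) by simp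
qed

text \<open>
  The curvature of the logarithmic term alone makes the Hessian positive definite.
\<close>
lemma Hess_posdef: obtains m where "m > 0" "\<And>d. m * (norm d)\<^sup>2 \<le> d \<bullet> (Hess *v d)"
proof -
  define m where "m = Min (range (\<lambda>i. b i / (\<beta>s $ i)\<^sup>2))"
  have "m \<in> range (\<lambda>i. b i / (\<beta>s $ i)\<^sup>2)" unfolding m_def by (rule Min_in) auto
  then have m: "m > 0" using budgets star_pos by (auto simp: zero_less_divide_iff less_imp_neq[OF star_pos, symmetric])
  have "m * (norm d)\<^sup>2 \<le> d \<bullet> (Hess *v d)" for d
  proof -
    have "m * (norm d)\<^sup>2 = (\<Sum>i\<in>UNIV. m * (d $ i)\<^sup>2)"
      by (simp add: norm_vec_def L2_set_def sum_nonneg sum_distrib_left)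
    also have "\<dots> \<le> (\<Sum>i\<in>UNIV. b i / (\<beta>s $ i)\<^sup>2 * (d $ i)\<^sup>2)"
      unfolding m_def by (intro sum_mono mult_right_mono Min_le) auto
    also have "\<dots> = (\<Sum>i\<in>UNIV. b i * (d $ i / \<beta>s $ i)\<^sup>2)" by (simp add: power_divide)
    finally show ?thesis using Hess_lower_bound[of d] by simp
  qed
  with m show thesis by (rule that)
qed

text \<open>
  Buyer \<open>i\<close> shares a positive highest bid. If all bids vanish, the maximum is the zero function
  near \<open>\<beta>s\<close>, and this counts as no tie.
\<close>
definition tie :: "'n \<Rightarrow> 'a \<Rightarrow> bool" where
  "tie i x \<longleftrightarrow> 0 < v i x \<and> max_bid v x \<beta>s = \<beta>s $ i * v i x \<and> (\<exists>j. j \<noteq> i \<and> \<beta>s $ j * v j x = \<beta>s $ i * v i x)"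

lemma tie_measurable [measurable]: "Measurable.pred N (tie i)"
  unfolding tie_def by measurable

text \<open>
  At a tie involving \<open>i\<close>, raising \<open>\<beta> i\<close> by \<open>s\<close> raises the maximum by at least \<open>s * v i x\<close>, while
  lowering it changes nothing, since the other buyer keeps the maximum. The expected second
  difference in direction \<open>i\<close> is thus at least \<open>s\<close> times the mean of \<open>v i\<close> over ties; being of
  order \<open>s\<^sup>2\<close>, it forces that mean to vanish.
\<close>
lemma tie_null: "AE x in N. \<not> tie i x"
proof -
  define J where "J = (\<integral>x. v i x * indicator {x \<in> space N. tie i x} x \<partial>N)"
  have int: "integrable N (\<lambda>x. v i x * indicator {x \<in> space N. tie i x} x)"
    by (rule integrable_const_bound[where B=V]) (auto simp: v_abs V_nonneg split: split_indicator)
  have "J \<le> 0"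
  proof (rule field_le_epsilon)
    fix \<epsilon> :: real assume \<epsilon>: "\<epsilon> > 0"
    let ?d = "axis i 1 :: real^'n"
    obtain \<delta> where \<delta>: "\<delta> > 0" "\<And>s. 0 < s \<Longrightarrow> s < \<delta> \<Longrightarrow>
      (\<integral>x. max_bid v x (\<beta>s + s *\<^sub>R ?d) + max_bid v x (\<beta>s - s *\<^sub>R ?d) - 2 * max_bid v x \<beta>s \<partial>N)
       + s\<^sup>2 * (\<Sum>i\<in>UNIV. b i * (?d $ i / \<beta>s $ i)\<^sup>2) \<le> s\<^sup>2 * (?d \<bullet> (Hess *v ?d) + 1)"
      using objective_second_difference[of 1 ?d] by auto
    define q where "q = \<bar>?d \<bullet> (Hess *v ?d)\<bar> + 1"
    have q: "q > 0" by (simp add: q_def add_nonneg_pos)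
    \<comment> \<open>Small enough that the bound \<open>s\<^sup>2 q\<close> on the second difference is at most \<open>s \<epsilon>\<close>.\<close>
    define s where "s = min (\<delta> / 2) (\<epsilon> / q)"
    have s: "0 < s" "s < \<delta>" "s * q \<le> \<epsilon>"
      using \<delta>(1) \<epsilon> q by (auto simp: s_def min_def field_simps)
    have "s * J = (\<integral>x. s * (v i x * indicator {x \<in> space N. tie i x} x) \<partial>N)" by (simp add: J_def)
    also have "\<dots> \<le> (\<integral>x. max_bid v x (\<beta>s + s *\<^sub>R ?d) + max_bid v x (\<beta>s - s *\<^sub>R ?d) - 2 * max_bid v x \<beta>s \<partial>N)"
    proof (rule integral_mono)
      fix x assume x: "x \<in> space N"
      show "s * (v i x * indicator {x \<in> space N. tie i x} x)
         \<le> max_bid v x (\<beta>s + s *\<^sub>R ?d) + max_bid v x (\<beta>s - s *\<^sub>R ?d) - 2 * max_bid v x \<beta>s"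
      proof (cases "tie i x")
        case True
        then obtain j where j: "j \<noteq> i" "\<beta>s $ j * v j x = max_bid v x \<beta>s" "max_bid v x \<beta>s = \<beta>s $ i * v i x"
          unfolding tie_def by auto
        have "max_bid v x \<beta>s + s * v i x \<le> max_bid v x (\<beta>s + s *\<^sub>R ?d)"
          using max_bid_ge[of "\<beta>s + s *\<^sub>R ?d" i v x] unfolding j(3) by (simp add: algebra_simps)
        moreover have "max_bid v x \<beta>s \<le> max_bid v x (\<beta>s - s *\<^sub>R ?d)"
          using max_bid_ge[of "\<beta>s - s *\<^sub>R ?d" j v x] j(1,2) by (simp add: axis_def)
        ultimately show ?thesis using True x by simp
      next
        case False
        then show ?thesis using max_bid_second_difference[of x \<beta>s "s *\<^sub>R ?d"] by simp
      qed
    qed (use int max_bid_integrable in auto)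
    also have "\<dots> \<le> s\<^sup>2 * (?d \<bullet> (Hess *v ?d) + 1)"
    proof -
      have "0 \<le> s\<^sup>2 * (\<Sum>i\<in>UNIV. b i * (?d $ i / \<beta>s $ i)\<^sup>2)"
        using budgets by (intro mult_nonneg_nonneg sum_nonneg) (auto intro: less_imp_le)
      then show ?thesis using \<delta>(2)[OF s(1,2)] by linarith
    qed
    also have "\<dots> \<le> s * (s * q)"
      unfolding power2_eq_square mult.assoc using s by (intro mult_left_mono) (auto simp: q_def)
    also have "\<dots> \<le> s * \<epsilon>" using s by (intro mult_left_mono) auto
    finally show "J \<le> 0 + \<epsilon>" using s by simp
  qed
  moreover have nn: "AE x in N. 0 \<le> v i x * indicator {x \<in> space N. tie i x} x"
    using v_nonneg by (auto split: split_indicator)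
  moreover have "0 \<le> J" unfolding J_def using nn by (rule integral_nonneg_AE)
  ultimately have "AE x in N. v i x * indicator {x \<in> space N. tie i x} x = 0"
    using integral_nonneg_eq_0_iff_AE[OF int nn] by (simp add: J_def)
  then show ?thesis
    by (rule AE_mp) (auto simp: tie_def intro!: AE_I2 split: split_indicator_asm)
qed

text \<open>
  The gradient of the highest bid at \<open>\<beta>s\<close> where it exists: \<open>v i x\<close> in the coordinate of a unique
  winner \<open>i\<close>, and zero in all others.
\<close>
definition bid_grad :: "'a \<Rightarrow> real^'n" where
  "bid_grad x = (\<chi> i. if \<forall>j. j \<noteq> i \<longrightarrow> \<beta>s $ j * v j x < \<beta>s $ i * v i x then v i x else 0)"

lemma bid_grad_measurable [measurable]: "(\<lambda>x. bid_grad x $ i) \<in> borel_measurable N"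
  unfolding bid_grad_def by simp measurable

lemma bid_grad_bounded: "x \<in> space N \<Longrightarrow> \<bar>bid_grad x $ i\<bar> \<le> V"
  by (simp add: bid_grad_def v_abs V_nonneg)

lemma max_bid_locally_linear:
  assumes x: "x \<in> space N" and no_tie: "\<And>i. \<not> tie i x"
  shows "\<exists>r>0. \<forall>\<beta>\<in>ball \<beta>s r. max_bid v x \<beta> = max_bid v x \<beta>s + bid_grad x \<bullet> (\<beta> - \<beta>s)"
proof -
  obtain i where i: "max_bid v x \<beta>s = \<beta>s $ i * v i x" by (rule max_bid_attained)
  show ?thesis
  proof (cases "v i x = 0")
    case True
    have v0: "v j x = 0" for j
    proof -
      have "\<beta>s $ j * v j x \<le> 0" using max_bid_ge[of \<beta>s j v x] i True by simp
      then show ?thesis using star_pos[of j] v_nonneg[OF x, of j] by (simp add: mult_le_0_iff)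
    qed
    then have "max_bid v x \<beta> = 0" for \<beta> using max_bid_eqI[of \<beta> v x] by simp
    moreover have "bid_grad x = 0" by (simp add: bid_grad_def vec_eq_iff v0)
    ultimately show ?thesis by (intro exI[of _ 1]) auto
  next
    case False
    then have vi: "v i x > 0" using v_nonneg[OF x, of i] by simp
    have strict: "\<beta>s $ j * v j x < \<beta>s $ i * v i x" if "j \<noteq> i" for j
      using no_tie[of i] max_bid_ge[of \<beta>s j v x] vi i that unfolding tie_def by (auto simp: order_le_less)
    have ug: "bid_grad x = v i x *\<^sub>R axis i 1"
    proof -
      have "bid_grad x $ j = (v i x *\<^sub>R axis i 1) $ j" for j
      proof (cases "j = i")
        case False
        then have nall: "\<not> (\<forall>k. k \<noteq> j \<longrightarrow> \<beta>s $ k * v k x < \<beta>s $ j * v j x)"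
          using strict[OF False] by (metis less_asym)
        have "bid_grad x $ j = 0" unfolding bid_grad_def vec_lambda_beta by (rule if_not_P[OF nall])
        then show ?thesis using False by (simp add: axis_def)
      qed (use strict in \<open>simp add: bid_grad_def axis_def\<close>)
      then show ?thesis by (simp add: vec_eq_iff)
    qed
    have "open (\<Inter>j\<in>-{i}. {\<beta>. \<beta> $ j * v j x < \<beta> $ i * v i x})"
      by (intro open_INT ballI open_Collect_less continuous_intros) auto
    moreover have "\<beta>s \<in> (\<Inter>j\<in>-{i}. {\<beta>. \<beta> $ j * v j x < \<beta> $ i * v i x})" using strict by auto
    ultimately obtain r where r: "r > 0" "ball \<beta>s r \<subseteq> (\<Inter>j\<in>-{i}. {\<beta>. \<beta> $ j * v j x < \<beta> $ i * v i x})"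
      using open_contains_ball by blast
    have "max_bid v x \<beta> = max_bid v x \<beta>s + bid_grad x \<bullet> (\<beta> - \<beta>s)" if "\<beta> \<in> ball \<beta>s r" for \<beta>
    proof -
      have "max_bid v x \<beta> = \<beta> $ i * v i x"
      proof (rule max_bid_eqI)
        fix j show "\<beta> $ j * v j x \<le> \<beta> $ i * v i x"
        proof (cases "j = i")
          case False
          then have "\<beta> \<in> {\<beta>. \<beta> $ j * v j x < \<beta> $ i * v i x}" using subsetD[OF r(2) that] by blast
          then show ?thesis by simp
        qed simp
      qed
      then show ?thesis by (simp add: i ug inner_axis' algebra_simps)
    qed
    then show ?thesis using r(1) by blast
  qed
qed

end

section \<open>Local expansion at the equilibrium\<close>

context fisher_limit
begin

text \<open>
  The negative gradient of the logarithmic term at \<open>\<beta>s\<close>; economically, the equilibrium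
  utilities.
\<close>
definition star_util :: "real^'n" where
  "star_util = (\<chi> i. b i / \<beta>s $ i)"

text \<open>
  The gradient of \<^const>\<open>LFM_F\<close> at \<open>\<beta>s\<close> away from ties, extended to ties in a measurable way.
\<close>
definition score :: "'a \<Rightarrow> real^'n" where
  "score x = bid_grad x - star_util"

lemma bid_grad_inner_bounded:
  assumes "x \<in> space N" shows "\<bar>bid_grad x \<bullet> d\<bar> \<le> V * (\<Sum>i\<in>UNIV. \<bar>d $ i\<bar>)"
proof -
  have "\<bar>bid_grad x \<bullet> d\<bar> \<le> (\<Sum>i\<in>UNIV. \<bar>bid_grad x $ i\<bar> * \<bar>d $ i\<bar>)"
    unfolding inner_vec_def abs_mult[symmetric] by (simp add: sum_abs)
  also have "\<dots> \<le> (\<Sum>i\<in>UNIV. V * \<bar>d $ i\<bar>)"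
    using bid_grad_bounded[OF assms] by (intro sum_mono mult_right_mono) auto
  finally show ?thesis by (simp add: sum_distrib_left)
qed

lemma bid_grad_inner_measurable [measurable]: "(\<lambda>x. bid_grad x \<bullet> d) \<in> borel_measurable N"
  unfolding inner_vec_def by measurable

lemma bid_grad_integrable: "integrable N (\<lambda>x. bid_grad x \<bullet> d)"
  by (rule integrable_const_bound[where B="V * (\<Sum>i\<in>UNIV. \<bar>d $ i\<bar>)"]) (auto intro: bid_grad_inner_bounded)

definition remainder :: "real^'n \<Rightarrow> real \<Rightarrow> 'a \<Rightarrow> real" where
  "remainder d s x = max_bid v x (\<beta>s + s *\<^sub>R d) - max_bid v x \<beta>s - s * (bid_grad x \<bullet> d)"

lemma remainder_measurable [measurable]: "remainder d s \<in> borel_measurable N"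
  unfolding remainder_def[abs_def] by measurable

lemma remainder_bounded:
  assumes x: "x \<in> space N" and "s \<ge> 0"
  shows "\<bar>remainder d s x\<bar> \<le> s * (2 * V * (\<Sum>i\<in>UNIV. \<bar>d $ i\<bar>))"
proof -
  have "\<bar>max_bid v x (\<beta>s + s *\<^sub>R d) - max_bid v x \<beta>s\<bar> \<le> s * (V * (\<Sum>i\<in>UNIV. \<bar>d $ i\<bar>))"
    using max_bid_Lipschitz[of v x V "\<beta>s + s *\<^sub>R d" \<beta>s] v_abs[OF x] \<open>s \<ge> 0\<close>
    by (simp add: abs_mult sum_distrib_left mult_ac)
  moreover have "\<bar>s * (bid_grad x \<bullet> d)\<bar> \<le> s * (V * (\<Sum>i\<in>UNIV. \<bar>d $ i\<bar>))"
    using bid_grad_inner_bounded[OF x, of d] \<open>s \<ge> 0\<close> by (simp add: abs_mult mult_left_mono)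
  ultimately show ?thesis unfolding remainder_def by (simp add: algebra_simps)
qed

lemma remainder_integrable: "s \<ge> 0 \<Longrightarrow> integrable N (remainder d s)"
  by (rule integrable_const_bound[where B="s * (2 * V * (\<Sum>i\<in>UNIV. \<bar>d $ i\<bar>))"]) (auto intro: remainder_bounded)

lemma inverse_sqrt_tendsto_0: "(\<lambda>t. 1 / sqrt (real t)) \<longlonglongrightarrow> 0"
  by (rule tendsto_divide_0[OF tendsto_const filterlim_at_top_imp_at_infinity])
     (rule filterlim_compose[OF sqrt_at_top filterlim_real_sequentially])

lemma remainder_eventually_0:
  assumes x: "x \<in> space N" and no_tie: "\<And>i. \<not> tie i x"
  shows "\<forall>\<^sub>F t in sequentially. remainder d (1 / sqrt (real t)) x = 0"
proof -
  obtain r where r: "r > 0" "\<And>\<beta>. \<beta> \<in> ball \<beta>s r \<Longrightarrow> max_bid v x \<beta> = max_bid v x \<beta>s + bid_grad x \<bullet> (\<beta> - \<beta>s)"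
    using max_bid_locally_linear[OF x no_tie] by blast
  have "(\<lambda>t. 1 / sqrt (real t) * norm d) \<longlonglongrightarrow> 0 * norm d"
    by (intro tendsto_mult inverse_sqrt_tendsto_0 tendsto_const)
  then have "\<forall>\<^sub>F t in sequentially. 1 / sqrt (real t) * norm d < r"
    using r(1) by (intro order_tendstoD(2)) auto
  then show ?thesis
  proof eventually_elim
    case (elim t)
    then show ?case using r(2)[of "\<beta>s + (1 / sqrt (real t)) *\<^sub>R d"] by (simp add: remainder_def dist_norm)
  qed
qed

lemma remainder_eventually_0_AE: "AE x in N. \<forall>\<^sub>F t in sequentially. remainder d (1 / sqrt (real t)) x = 0"
proof -
  have "AE x in N. \<forall>i\<in>UNIV. \<not> tie i x"
    by (rule AE_finite_allI) (auto intro: tie_null)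
  then show ?thesis
    by (rule AE_mp) (auto intro!: AE_I2 remainder_eventually_0)
qed

text \<open>
  The remainder is at most of order \<open>1/\<surd>t\<close> and almost surely zero from some \<open>t\<close> on, so dominated
  convergence applies after multiplication by \<open>\<surd>t\<close>; the second moment is treated in the same way
  with the factor \<open>t\<close>.
\<close>
lemma remainder_first_moment: "(\<lambda>t. sqrt (real t) * (\<integral>x. remainder d (1 / sqrt (real t)) x \<partial>N)) \<longlonglongrightarrow> 0"
proof -
  let ?C = "2 * V * (\<Sum>i\<in>UNIV. \<bar>d $ i\<bar>)"
  have "(\<lambda>t. \<integral>x. sqrt (real t) * remainder d (1 / sqrt (real t)) x \<partial>N) \<longlonglongrightarrow> (\<integral>x. 0 \<partial>N)"
  proof (rule integral_dominated_convergence[where w="\<lambda>_. ?C"])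
    show "AE x in N. (\<lambda>t. sqrt (real t) * remainder d (1 / sqrt (real t)) x) \<longlonglongrightarrow> 0"
      using remainder_eventually_0_AE[of d]
      by eventually_elim (auto intro!: tendsto_eventually elim: eventually_mono)
    show "AE x in N. norm (sqrt (real t) * remainder d (1 / sqrt (real t)) x) \<le> ?C" for t
    proof (rule AE_I2)
      fix x assume x: "x \<in> space N"
      show "norm (sqrt (real t) * remainder d (1 / sqrt (real t)) x) \<le> ?C"
      proof (cases "t = 0")
        case True
        then show ?thesis using V_nonneg by (auto intro!: mult_nonneg_nonneg sum_nonneg)
      next
        case False
        then show ?thesis
          using mult_left_mono[OF remainder_bounded[OF x, of "1 / sqrt (real t)" d], of "sqrt (real t)"]
          by (simp add: abs_mult)
      qed
    qed
  qed auto
  then show ?thesis by simp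
qed

lemma remainder_second_moment: "(\<lambda>t. real t * (\<integral>x. (remainder d (1 / sqrt (real t)) x)\<^sup>2 \<partial>N)) \<longlonglongrightarrow> 0"
proof -
  let ?C = "2 * V * (\<Sum>i\<in>UNIV. \<bar>d $ i\<bar>)"
  have "(\<lambda>t. \<integral>x. real t * (remainder d (1 / sqrt (real t)) x)\<^sup>2 \<partial>N) \<longlonglongrightarrow> (\<integral>x. 0 \<partial>N)"
  proof (rule integral_dominated_convergence[where w="\<lambda>_. ?C\<^sup>2"])
    show "AE x in N. (\<lambda>t. real t * (remainder d (1 / sqrt (real t)) x)\<^sup>2) \<longlonglongrightarrow> 0"
      using remainder_eventually_0_AE[of d]
      by eventually_elim (auto intro!: tendsto_eventually elim: eventually_mono)
    show "AE x in N. norm (real t * (remainder d (1 / sqrt (real t)) x)\<^sup>2) \<le> ?C\<^sup>2" for t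
    proof (rule AE_I2)
      fix x assume x: "x \<in> space N"
      have "(remainder d (1 / sqrt (real t)) x)\<^sup>2 \<le> (1 / sqrt (real t) * ?C)\<^sup>2"
        using remainder_bounded[OF x, of "1 / sqrt (real t)" d] by (intro power2_le_iff_abs_le[THEN iffD2]) (auto intro: order_trans)
      also have "\<dots> = ?C\<^sup>2 / real t" by (simp add: power_mult_distrib power_divide)
      finally have "real t * (remainder d (1 / sqrt (real t)) x)\<^sup>2 \<le> real t * (?C\<^sup>2 / real t)"
        by (rule mult_left_mono) simp
      also have "\<dots> \<le> ?C\<^sup>2" by (cases "t = 0") auto
      finally show "norm (real t * (remainder d (1 / sqrt (real t)) x)\<^sup>2) \<le> ?C\<^sup>2" by simp
    qed
  qed auto
  then show ?thesis by simp
qed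

lemma objective_quadratic_limit:
  "(\<lambda>t. real t * (objective (\<beta>s + (1 / sqrt (real t)) *\<^sub>R d) - objective \<beta>s)) \<longlonglongrightarrow> d \<bullet> (Hess *v d) / 2"
proof -
  have ev: "\<forall>\<^sub>F t in sequentially.
    \<bar>real t * (objective (\<beta>s + (1 / sqrt (real t)) *\<^sub>R d) - objective \<beta>s) - d \<bullet> (Hess *v d) / 2\<bar> \<le> \<epsilon>"
    if \<epsilon>: "\<epsilon> > 0" for \<epsilon>
  proof -
    obtain \<delta> where \<delta>: "\<delta> > 0" "\<And>s. 0 < s \<Longrightarrow> s < \<delta> \<Longrightarrow> \<beta>s + s *\<^sub>R d \<in> pos_orthant \<and>
      \<bar>objective (\<beta>s + s *\<^sub>R d) - objective \<beta>s - s\<^sup>2 * (d \<bullet> (Hess *v d)) / 2\<bar> \<le> \<epsilon> * s\<^sup>2"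
      using objective_expansion[OF \<epsilon>, of d] by blast
    have "\<forall>\<^sub>F t in sequentially. 1 / sqrt (real t) < \<delta>"
      using inverse_sqrt_tendsto_0 \<delta>(1) by (rule order_tendstoD(2))
    with eventually_gt_at_top[of "0::nat"] show ?thesis
    proof eventually_elim
      case (elim t)
      let ?s = "1 / sqrt (real t)"
      have s: "0 < ?s" "real t * ?s\<^sup>2 = 1" using elim(1) by (auto simp: power_divide)
      have "real t * \<bar>objective (\<beta>s + ?s *\<^sub>R d) - objective \<beta>s - ?s\<^sup>2 * (d \<bullet> (Hess *v d)) / 2\<bar> \<le> real t * (\<epsilon> * ?s\<^sup>2)"
        using \<delta>(2)[OF s(1) elim(2)] by (intro mult_left_mono) auto
      also have "\<dots> = \<epsilon>" by (simp only: mult.left_commute[of "real t"] s(2) mult_1_right)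
      also have "real t * \<bar>objective (\<beta>s + ?s *\<^sub>R d) - objective \<beta>s - ?s\<^sup>2 * (d \<bullet> (Hess *v d)) / 2\<bar>
          = \<bar>real t * (objective (\<beta>s + ?s *\<^sub>R d) - objective \<beta>s) - (real t * ?s\<^sup>2) * (d \<bullet> (Hess *v d)) / 2\<bar>"
      proof -
        have "r * \<bar>y - \<sigma> * q / 2\<bar> = \<bar>r * y - r * \<sigma> * q / 2\<bar>" if "r \<ge> 0" for r y \<sigma> q :: real
        proof -
          have "r * y - r * \<sigma> * q / 2 = r * (y - \<sigma> * q / 2)" by (simp add: algebra_simps)
          then show ?thesis using that by (simp only: abs_mult abs_of_nonneg)
        qed
        then show ?thesis by simp
      qed
      finally show ?case using \<delta>(2)[OF s(1) elim(2)] unfolding s(2) by simp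
    qed
  qed
  show "(\<lambda>t. real t * (objective (\<beta>s + (1 / sqrt (real t)) *\<^sub>R d) - objective \<beta>s)) \<longlonglongrightarrow> d \<bullet> (Hess *v d) / 2"
  proof (rule tendstoI)
    fix e :: real assume "e > 0"
    then have "e / 2 > 0" by simp
    from ev[OF this] show "\<forall>\<^sub>F t in sequentially. dist (real t * (objective (\<beta>s + (1 / sqrt (real t)) *\<^sub>R d) - objective \<beta>s))
        (d \<bullet> (Hess *v d) / 2) < e"
      by eventually_elim (use \<open>e > 0\<close> in \<open>auto simp: dist_real_def\<close>)
  qed
qed

lemma gderiv_log_term: "GDERIV (log_term b) \<beta>s :> - star_util"
  unfolding gderiv_def log_term_def[abs_def]
proof (rule has_derivative_eq_rhs)
  show "((\<lambda>\<beta>. \<Sum>i\<in>UNIV. b i * - ln (\<beta> $ i)) has_derivative (\<lambda>h. \<Sum>i\<in>UNIV. b i * - (h $ i * inverse (\<beta>s $ i)))) (at \<beta>s)"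
    using star_pos
    by (intro has_derivative_sum has_derivative_mult_right has_derivative_minus has_derivative_ln
        bounded_linear_imp_has_derivative bounded_linear_vec_nth) auto
  show "(\<lambda>h. \<Sum>i\<in>UNIV. b i * - (h $ i * inverse (\<beta>s $ i))) = (\<lambda>h. h \<bullet> - star_util)"
    by (rule ext) (simp add: star_util_def inner_vec_def field_simps sum_negf)
qed

lemma log_term_linear_limit:
  "(\<lambda>t. sqrt (real t) * (log_term b (\<beta>s + (1 / sqrt (real t)) *\<^sub>R d) - log_term b \<beta>s)) \<longlonglongrightarrow> - (star_util \<bullet> d)"
proof -
  have diff: "log_term b differentiable at \<beta>s"
    using gderiv_log_term unfolding gderiv_def differentiable_def by blast
  have "((\<lambda>\<sigma>. log_term b (\<beta>s + \<sigma> *\<^sub>R d)) has_real_derivative d \<bullet> grad (log_term b) (\<beta>s + 0 *\<^sub>R d)) (at 0)"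
    by (rule directional_derivative) (use diff in simp)
  then have "((\<lambda>h. (log_term b (\<beta>s + h *\<^sub>R d) - log_term b \<beta>s) / h) \<longlongrightarrow> - (star_util \<bullet> d)) (at 0)"
    by (simp add: DERIV_def grad_eqI[OF gderiv_log_term] inner_commute)
  moreover have "filterlim (\<lambda>t. 1 / sqrt (real t)) (at 0) sequentially"
    using inverse_sqrt_tendsto_0 eventually_gt_at_top[of "0::nat"]
    by (auto simp: filterlim_at elim: eventually_mono)
  ultimately have "(\<lambda>t. (log_term b (\<beta>s + (1 / sqrt (real t)) *\<^sub>R d) - log_term b \<beta>s) / (1 / sqrt (real t))) \<longlonglongrightarrow> - (star_util \<bullet> d)"
    by (rule filterlim_compose)
  then show ?thesis by (simp add: mult.commute)
qed

lemma objective_difference: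
  assumes "s \<ge> 0"
  shows "objective (\<beta>s + s *\<^sub>R d) - objective \<beta>s
    = (\<integral>x. remainder d s x \<partial>N) + s * (\<integral>x. bid_grad x \<bullet> d \<partial>N) + (log_term b (\<beta>s + s *\<^sub>R d) - log_term b \<beta>s)"
proof -
  have "(\<integral>x. remainder d s x \<partial>N) = (\<integral>x. max_bid v x (\<beta>s + s *\<^sub>R d) \<partial>N) - (\<integral>x. max_bid v x \<beta>s \<partial>N)
      - s * (\<integral>x. bid_grad x \<bullet> d \<partial>N)"
    unfolding remainder_def using max_bid_integrable bid_grad_integrable[of d] by simp
  then show ?thesis by (simp add: objective_def)
qed

text \<open>
  Stationarity of the limit objective at \<open>\<beta>s\<close>: its increments at distance \<open>1/\<surd>t\<close> are of order
  \<open>1/t\<close>, so their first-order parts cancel.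
\<close>
lemma mean_bid_grad: "(\<integral>x. bid_grad x \<bullet> d \<partial>N) = star_util \<bullet> d"
proof -
  let ?s = "\<lambda>t. 1 / sqrt (real t)"
  have lim1: "(\<lambda>t. sqrt (real t) * (\<integral>x. remainder d (?s t) x \<partial>N) + (\<integral>x. bid_grad x \<bullet> d \<partial>N)
      + sqrt (real t) * (log_term b (\<beta>s + ?s t *\<^sub>R d) - log_term b \<beta>s)) \<longlonglongrightarrow> 0 + (\<integral>x. bid_grad x \<bullet> d \<partial>N) + - (star_util \<bullet> d)"
    by (intro tendsto_add remainder_first_moment tendsto_const log_term_linear_limit)
  have lim2: "(\<lambda>t. ?s t * (real t * (objective (\<beta>s + ?s t *\<^sub>R d) - objective \<beta>s))) \<longlonglongrightarrow> 0 * (d \<bullet> (Hess *v d) / 2)"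
    by (intro tendsto_mult inverse_sqrt_tendsto_0 objective_quadratic_limit)
  have ev: "\<forall>\<^sub>F t in sequentially. ?s t * (real t * (objective (\<beta>s + ?s t *\<^sub>R d) - objective \<beta>s))
      = sqrt (real t) * (\<integral>x. remainder d (?s t) x \<partial>N) + (\<integral>x. bid_grad x \<bullet> d \<partial>N)
      + sqrt (real t) * (log_term b (\<beta>s + ?s t *\<^sub>R d) - log_term b \<beta>s)"
    using eventually_gt_at_top[of "0::nat"]
  proof eventually_elim
    case (elim t)
    have "?s t * (real t * y) = sqrt (real t) * y" for y
      using elim real_sqrt_mult_self[of "real t"] by (simp add: field_simps)
    then show ?case using elim by (simp add: objective_difference distrib_left)
  qed
  show ?thesis using LIMSEQ_unique[OF lim1 Lim_transform_eventually[OF lim2 ev]] by simp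
qed

text \<open>
  By \<open>mean_bid_grad\<close> this is \<open>t\<close> times the increment of the limit objective, whose quadratic
  part is given by the Hessian.
\<close>
lemma mean_process_limit:
  "(\<lambda>t. real t * ((\<integral>x. remainder d (1 / sqrt (real t)) x \<partial>N)
      + (log_term b (\<beta>s + (1 / sqrt (real t)) *\<^sub>R d) - log_term b \<beta>s) + 1 / sqrt (real t) * (star_util \<bullet> d)))
    \<longlonglongrightarrow> d \<bullet> (Hess *v d) / 2"
proof -
  have "real t * (objective (\<beta>s + (1 / sqrt (real t)) *\<^sub>R d) - objective \<beta>s)
      = real t * ((\<integral>x. remainder d (1 / sqrt (real t)) x \<partial>N)
      + (log_term b (\<beta>s + (1 / sqrt (real t)) *\<^sub>R d) - log_term b \<beta>s) + 1 / sqrt (real t) * (star_util \<bullet> d))" for t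
    by (subst objective_difference) (simp_all add: mean_bid_grad)
  then show ?thesis using objective_quadratic_limit[of d] by (simp only:)
qed

lemma score_measurable [measurable]: "(\<lambda>x. score x $ i) \<in> borel_measurable N"
  unfolding score_def by simp

lemma score_inner_measurable [measurable]: "(\<lambda>x. score x \<bullet> d) \<in> borel_measurable N"
  unfolding inner_vec_def by measurable

definition score_bound :: real where
  "score_bound = V + (\<Sum>i\<in>UNIV. \<bar>star_util $ i\<bar>)"

lemma score_bounded: "x \<in> space N \<Longrightarrow> \<bar>score x $ i\<bar> \<le> score_bound"
proof -
  assume x: "x \<in> space N"
  have "\<bar>star_util $ i\<bar> \<le> (\<Sum>i\<in>UNIV. \<bar>star_util $ i\<bar>)" by (rule member_le_sum) auto
  then show ?thesis using bid_grad_bounded[OF x, of i] by (simp add: score_def score_bound_def abs_le_iff)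
qed

lemma score_inner_bounded: "x \<in> space N \<Longrightarrow> \<bar>score x \<bullet> d\<bar> \<le> score_bound * (\<Sum>i\<in>UNIV. \<bar>d $ i\<bar>)"
proof -
  assume x: "x \<in> space N"
  have "\<bar>score x \<bullet> d\<bar> \<le> (\<Sum>i\<in>UNIV. \<bar>score x $ i\<bar> * \<bar>d $ i\<bar>)"
    unfolding inner_vec_def abs_mult[symmetric] by (simp add: sum_abs)
  also have "\<dots> \<le> (\<Sum>i\<in>UNIV. score_bound * \<bar>d $ i\<bar>)"
    using score_bounded[OF x] by (intro sum_mono mult_right_mono) auto
  finally show ?thesis by (simp add: sum_distrib_left)
qed

lemma mean_score: "(\<integral>x. score x \<bullet> d \<partial>N) = 0"
  using bid_grad_integrable[of d] by (simp add: score_def inner_diff_left mean_bid_grad prob_space)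

end

section \<open>The gradient moment matrix\<close>

context fisher_limit
begin

lemma gderiv_LFM_F_iff:
  "GDERIV (\<lambda>\<beta>. real_of_ereal (LFM_F v b x \<beta>)) \<beta>s :> D \<longleftrightarrow> GDERIV (\<lambda>\<beta>. max_bid v x \<beta> + log_term b \<beta>) \<beta>s :> D"
  by (rule grad_local[OF open_pos_orthant argmin_pos]) (simp add: LFM_F_pos)

lemma LFM_grad_F_no_tie:
  assumes x: "x \<in> space N" and no_tie: "\<And>i. \<not> tie i x"
  shows "LFM_grad_F v b x \<beta>s = score x"
proof -
  obtain r where r: "r > 0" "\<And>\<beta>. \<beta> \<in> ball \<beta>s r \<Longrightarrow> max_bid v x \<beta> = max_bid v x \<beta>s + bid_grad x \<bullet> (\<beta> - \<beta>s)"
    using max_bid_locally_linear[OF x no_tie] by blast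
  have "((\<lambda>\<beta>. max_bid v x \<beta>s + bid_grad x \<bullet> (\<beta> - \<beta>s)) has_derivative (\<lambda>h. h \<bullet> bid_grad x)) (at \<beta>s)"
    by (auto intro!: derivative_eq_intros simp: inner_commute)
  then have "GDERIV (\<lambda>\<beta>. max_bid v x \<beta>s + bid_grad x \<bullet> (\<beta> - \<beta>s)) \<beta>s :> bid_grad x" by (simp add: gderiv_def)
  moreover have "GDERIV (max_bid v x) \<beta>s :> bid_grad x
      \<longleftrightarrow> GDERIV (\<lambda>\<beta>. max_bid v x \<beta>s + bid_grad x \<bullet> (\<beta> - \<beta>s)) \<beta>s :> bid_grad x"
    by (rule grad_local[of "ball \<beta>s r"]) (rule open_ball, simp only: centre_in_ball r(1), rule r(2))
  ultimately have "GDERIV (max_bid v x) \<beta>s :> bid_grad x" by (rule iffD2[rotated])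
  from GDERIV_add[OF this gderiv_log_term]
  have "GDERIV (\<lambda>\<beta>. real_of_ereal (LFM_F v b x \<beta>)) \<beta>s :> score x"
    unfolding gderiv_LFM_F_iff by (simp add: score_def)
  then show ?thesis unfolding LFM_grad_F_def by (rule grad_eqI)
qed

text \<open>
  In direction \<open>i\<close> the maximum lies above two lines through its value at \<open>\<beta>s\<close>, one of slope \<open>v i
  x > 0\<close> and one of slope zero; a derivative would have to equal both slopes.
\<close>
lemma no_gderiv_at_tie:
  assumes tie: "tie i x"
  shows "\<not> GDERIV (\<lambda>\<beta>. real_of_ereal (LFM_F v b x \<beta>)) \<beta>s :> D"
proof
  assume "GDERIV (\<lambda>\<beta>. real_of_ereal (LFM_F v b x \<beta>)) \<beta>s :> D"
  from GDERIV_diff[OF this[unfolded gderiv_LFM_F_iff] gderiv_log_term]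
  have "(max_bid v x has_derivative (\<lambda>h. h \<bullet> (D - - star_util))) (at \<beta>s)" by (simp add: gderiv_def)
  then have diff: "max_bid v x differentiable at (\<beta>s + 0 *\<^sub>R axis i 1)" by (auto simp: differentiable_def)
  obtain j where j: "j \<noteq> i" "\<beta>s $ j * v j x = max_bid v x \<beta>s" "max_bid v x \<beta>s = \<beta>s $ i * v i x" and vi: "0 < v i x"
    using tie unfolding tie_def by auto
  define \<phi> where "\<phi> s = max_bid v x (\<beta>s + s *\<^sub>R axis i 1)" for s
  define c where "c = axis i 1 \<bullet> grad (max_bid v x) (\<beta>s + 0 *\<^sub>R axis i 1)"
  have der: "(\<phi> has_real_derivative c) (at 0)"
    unfolding \<phi>_def c_def by (rule directional_derivative[OF diff])
  have up: "\<phi> 0 + s * v i x \<le> \<phi> s" for s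
    using max_bid_ge[of "\<beta>s + s *\<^sub>R axis i 1" i v x] j(3) by (simp add: \<phi>_def algebra_simps)
  have low: "\<phi> 0 \<le> \<phi> s" for s
    using max_bid_ge[of "\<beta>s + s *\<^sub>R axis i 1" j v x] j(1,2) by (simp add: \<phi>_def axis_def)
  have "c = 0" by (rule DERIV_local_min[OF der zero_less_one]) (use low in simp)
  have "((\<lambda>s. \<phi> s - s * v i x) has_real_derivative c - v i x) (at 0)"
    by (auto intro!: derivative_eq_intros der)
  from DERIV_local_min[OF this zero_less_one] have "c - v i x = 0"
    using up by (simp add: algebra_simps)
  with \<open>c = 0\<close> vi show False by simp
qed

text \<open>
  Where no gradient exists, \<^const>\<open>grad\<close> is the definite description of an empty predicate and so a
  fixed vector; this makes the gradient a measurable function of the item.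
\<close>
lemma LFM_grad_F_at_tie:
  assumes "tie i x"
  shows "LFM_grad_F v b x \<beta>s = (THE D. False)"
proof -
  have "gderiv (\<lambda>\<beta>. real_of_ereal (LFM_F v b x \<beta>)) \<beta>s = (\<lambda>D. False)"
    by (intro ext iffI) (erule notE[OF no_gderiv_at_tie[OF assms]], erule FalseE)
  then show ?thesis unfolding LFM_grad_F_def grad_def by (rule arg_cong)
qed

lemma LFM_grad_F_measurable: "(\<lambda>x. LFM_grad_F v b x \<beta>s $ i) \<in> borel_measurable N"
proof -
  have "(\<lambda>x. if \<exists>j. tie j x then (THE D. False) $ i else score x $ i) \<in> borel_measurable N" by measurable
  then show ?thesis
    by (rule measurable_cong[THEN iffD2, rotated]) (auto simp: LFM_grad_F_at_tie LFM_grad_F_no_tie)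
qed

text \<open>
  The two integrands agree off ties, that is almost everywhere.
\<close>
lemma LFM_grad_moment_eq:
  "(\<integral>x. LFM_grad_F v b x \<beta>s $ i * LFM_grad_F v b x \<beta>s $ j \<partial>N) = (\<integral>x. score x $ i * score x $ j \<partial>N)"
proof (rule integral_cong_AE)
  show "(\<lambda>x. LFM_grad_F v b x \<beta>s $ i * LFM_grad_F v b x \<beta>s $ j) \<in> borel_measurable N"
    by (intro borel_measurable_times LFM_grad_F_measurable)
  show "(\<lambda>x. score x $ i * score x $ j) \<in> borel_measurable N"
    by (intro borel_measurable_times score_measurable)
  have "AE x in N. \<forall>i\<in>UNIV. \<not> tie i x"
    by (rule AE_finite_allI) (auto intro: tie_null)
  then show "AE x in N. LFM_grad_F v b x \<beta>s $ i * LFM_grad_F v b x \<beta>s $ j = score x $ i * score x $ j"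
    by (rule AE_mp) (auto intro!: AE_I2 simp: LFM_grad_F_no_tie)
qed

definition score_moment :: "real^'n^'n" where
  "score_moment = (\<chi> i j. \<integral>x. score x $ i * score x $ j \<partial>N)"

lemma score_moment_symmetric: "transpose score_moment = score_moment"
proof -
  have "(\<integral>x. score x $ j * score x $ i \<partial>N) = (\<integral>x. score x $ i * score x $ j \<partial>N)" for i j
    by (rule Bochner_Integration.integral_cong[OF refl]) (rule mult.commute)
  then show ?thesis unfolding score_moment_def transpose_def vec_eq_iff by simp
qed

lemma score_moment_quadratic: "d \<bullet> (score_moment *v d) = (\<integral>x. (score x \<bullet> d)\<^sup>2 \<partial>N)"
proof -
  have int: "integrable N (\<lambda>x. score x $ i * score x $ j)" for i j
  proof (rule integrable_const_bound[where B="score_bound * score_bound"])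
    show "AE x in N. norm (score x $ i * score x $ j) \<le> score_bound * score_bound"
    proof (rule AE_I2)
      fix x assume x: "x \<in> space N"
      have "\<bar>score x $ i\<bar> * \<bar>score x $ j\<bar> \<le> score_bound * score_bound"
        using score_bounded[OF x, of i] score_bounded[OF x, of j] by (intro mult_mono) auto
      then show "norm (score x $ i * score x $ j) \<le> score_bound * score_bound" by (simp add: abs_mult)
    qed
  qed measurable
  have "(\<integral>x. (score x \<bullet> d)\<^sup>2 \<partial>N) = (\<integral>x. (\<Sum>i\<in>UNIV. \<Sum>j\<in>UNIV. d $ i * d $ j * (score x $ i * score x $ j)) \<partial>N)"
    by (simp add: inner_vec_def power2_eq_square sum_product mult_ac)
  also have "\<dots> = (\<Sum>i\<in>UNIV. \<Sum>j\<in>UNIV. d $ i * d $ j * (\<integral>x. score x $ i * score x $ j \<partial>N))"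
    using int by simp
  also have "\<dots> = d \<bullet> (score_moment *v d)"
    by (simp add: inner_vec_def matrix_vector_mult_def score_moment_def sum_distrib_left mult_ac)
  finally show ?thesis ..
qed

end

section \<open>Weighted objectives and their minimizers\<close>

definition good_weights :: "nat \<Rightarrow> (nat \<Rightarrow> real) \<Rightarrow> bool" where
  "good_weights t w \<longleftrightarrow> (\<forall>\<tau><t. 0 \<le> w \<tau>) \<and> (\<Sum>\<tau><t. w \<tau>) = real t"

text \<open>
  The real-valued form of \<^const>\<open>LFM_H_boot\<close> on the open orthant. The logarithmic term comes with
  factor one because the weights average to one.
\<close>
definition boot_objective ::
    "('n::finite \<Rightarrow> 'a \<Rightarrow> real) \<Rightarrow> ('n \<Rightarrow> real) \<Rightarrow> nat \<Rightarrow> (nat \<Rightarrow> real) \<Rightarrow> (nat \<Rightarrow> 'a) \<Rightarrow> real^'n \<Rightarrow> real" where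
  "boot_objective v b t w x \<beta> = 1 / real t * (\<Sum>\<tau><t. w \<tau> * max_bid v (x \<tau>) \<beta>) + log_term b \<beta>"

lemma LFM_H_boot_pos:
  assumes w: "good_weights t w" and t: "t > 0" and \<beta>: "\<beta> \<in> pos_orthant"
  shows "LFM_H_boot v b t w x \<beta> = ereal (boot_objective v b t w x \<beta>)"
proof -
  have "LFM_H_boot v b t w x \<beta> = ereal (1 / real t * (\<Sum>\<tau><t. w \<tau> * (max_bid v (x \<tau>) \<beta> + log_term b \<beta>)))"
    by (simp add: LFM_H_boot_def LFM_F_pos[OF \<beta>])
  also have "(\<Sum>\<tau><t. w \<tau> * (max_bid v (x \<tau>) \<beta> + log_term b \<beta>))
      = (\<Sum>\<tau><t. w \<tau> * max_bid v (x \<tau>) \<beta>) + real t * log_term b \<beta>"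
    using w by (simp add: good_weights_def distrib_left sum.distrib sum_distrib_right[symmetric])
  also have "1 / real t * \<dots> = boot_objective v b t w x \<beta>"
    using t by (simp add: boot_objective_def field_simps)
  finally show ?thesis .
qed

lemma LFM_H_boot_boundary:
  assumes w: "good_weights t w" and t: "t > 0" and b: "\<And>i. b i > 0"
    and \<beta>: "\<beta> \<in> orthant" "\<beta> \<notin> pos_orthant"
  shows "LFM_H_boot v b t w x \<beta> = \<infinity>"
proof -
  have "\<exists>\<tau><t. 0 < w \<tau>"
  proof (rule ccontr)
    assume "\<not> (\<exists>\<tau><t. 0 < w \<tau>)"
    then have "(\<Sum>\<tau><t. w \<tau>) \<le> 0" by (intro sum_nonpos) (metis lessThan_iff not_less)
    then show False using w t by (simp add: good_weights_def)
  qed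
  then have "(\<Sum>\<tau><t. ereal (w \<tau>) * LFM_F v b (x \<tau>) \<beta>) = \<infinity>"
    unfolding sum_Pinfty by (auto simp: LFM_F_boundary[OF \<beta> b])
  then show ?thesis using t by (simp add: LFM_H_boot_def)
qed

lemma beta_emp_eq_beta_boot: "beta_emp v b t x = beta_boot v b t (\<lambda>_. 1) x"
proof -
  have "ereal 1 * y = y" for y by (simp flip: one_ereal_def)
  then show ?thesis by (simp add: beta_emp_def beta_boot_def LFM_H_emp_def[abs_def] LFM_H_boot_def[abs_def])
qed

lemma is_arg_min_boot_iff:
  assumes w: "good_weights t w" and t: "t > 0" and b: "\<And>i. b i > 0"
  shows "is_arg_min (LFM_H_boot v b t w x) (\<lambda>\<beta>. \<beta> \<in> orthant) p \<longleftrightarrow>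
    p \<in> pos_orthant \<and> (\<forall>y\<in>pos_orthant. boot_objective v b t w x p \<le> boot_objective v b t w x y)"
    (is "?L \<longleftrightarrow> ?R")
proof
  assume ?L
  then have p: "p \<in> orthant" and min: "\<And>y. y \<in> orthant \<Longrightarrow> LFM_H_boot v b t w x p \<le> LFM_H_boot v b t w x y"
    unfolding is_arg_min_linorder by auto
  have pos: "p \<in> pos_orthant"
  proof (rule ccontr)
    assume "p \<notin> pos_orthant"
    then show False
      using min[OF pos_subset_orthant[OF one_in_pos_orthant]] LFM_H_boot_boundary[OF w t b p, where v = v and x = x]
      by (simp add: LFM_H_boot_pos[OF w t one_in_pos_orthant])
  qed
  then show ?R
    using min[OF pos_subset_orthant] by (simp add: LFM_H_boot_pos[OF w t])
next
  assume R: ?R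
  have "LFM_H_boot v b t w x p \<le> LFM_H_boot v b t w x y" if "y \<in> orthant" for y
  proof (cases "y \<in> pos_orthant")
    case True
    then show ?thesis using R by (simp add: LFM_H_boot_pos[OF w t])
  next
    case False
    then show ?thesis by (simp add: LFM_H_boot_boundary[OF w t b that])
  qed
  then show ?L unfolding is_arg_min_linorder using R pos_subset_orthant by auto
qed

lemma beta_boot_minimizes:
  assumes w: "good_weights t w" and t: "t > 0" and b: "\<And>i. b i > 0"
    and ex: "\<exists>p\<in>pos_orthant. \<forall>y\<in>pos_orthant. boot_objective v b t w x p \<le> boot_objective v b t w x y"
  shows "beta_boot v b t w x \<in> pos_orthant \<and>
    (\<forall>y\<in>pos_orthant. boot_objective v b t w x (beta_boot v b t w x) \<le> boot_objective v b t w x y)"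
proof -
  have "\<exists>p. is_arg_min (LFM_H_boot v b t w x) (\<lambda>\<beta>. \<beta> \<in> orthant) p"
    unfolding is_arg_min_boot_iff[OF w t b] using ex by blast
  then have "is_arg_min (LFM_H_boot v b t w x) (\<lambda>\<beta>. \<beta> \<in> orthant) (beta_boot v b t w x)"
    unfolding beta_boot_def arg_min_on_def arg_min_def by (rule someI_ex)
  then show ?thesis unfolding is_arg_min_boot_iff[OF w t b] .
qed

text \<open>
  Without a minimizer, \<^const>\<open>arg_min_on\<close> chooses from an empty predicate, hence the same vector for
  all samples and weights.
\<close>
lemma beta_boot_default:
  assumes w: "good_weights t w" and t: "t > 0" and b: "\<And>i. b i > 0"
    and nex: "\<not> (\<exists>p\<in>pos_orthant. \<forall>y\<in>pos_orthant. boot_objective v b t w x p \<le> boot_objective v b t w x y)"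
  shows "beta_boot v b t w x = (SOME p. False)"
proof -
  have "(\<lambda>p. is_arg_min (LFM_H_boot v b t w x) (\<lambda>\<beta>. \<beta> \<in> orthant) p) = (\<lambda>p. False)"
    by (rule ext) (use nex in \<open>auto simp: is_arg_min_boot_iff[OF w t b]\<close>)
  then show ?thesis unfolding beta_boot_def arg_min_on_def arg_min_def by (rule arg_cong)
qed

lemma convex_boot_objective:
  fixes v :: "'n::finite \<Rightarrow> 'a \<Rightarrow> real"
  assumes w: "good_weights t w" and b: "\<And>i. b i > 0"
  shows "convex_on pos_orthant (boot_objective v b t w x)"
  unfolding boot_objective_def
proof (intro convex_on_add convex_on_cmul convex_log_term b)
  show "convex_on pos_orthant (\<lambda>\<beta>. \<Sum>\<tau><t. w \<tau> * max_bid v (x \<tau>) \<beta>)"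
  proof (rule convex_onI[OF _ convex_pos_orthant])
    fix u :: real and y z :: "real^'n"
    assume u: "0 < u" "u < 1"
    have "w \<tau> * max_bid v (x \<tau>) ((1 - u) *\<^sub>R y + u *\<^sub>R z)
        \<le> (1 - u) * (w \<tau> * max_bid v (x \<tau>) y) + u * (w \<tau> * max_bid v (x \<tau>) z)" if "\<tau> < t" for \<tau>
    proof -
      have "max_bid v (x \<tau>) ((1 - u) *\<^sub>R y + u *\<^sub>R z) \<le> (1 - u) * max_bid v (x \<tau>) y + u * max_bid v (x \<tau>) z"
        using convex_onD[OF convex_max_bid[OF convex_UNIV], of u y z v "x \<tau>"] u by simp
      from mult_left_mono[OF this, of "w \<tau>"] w that show ?thesis
        by (simp add: good_weights_def algebra_simps)
    qed
    then show "(\<Sum>\<tau><t. w \<tau> * max_bid v (x \<tau>) ((1 - u) *\<^sub>R y + u *\<^sub>R z))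
        \<le> (1 - u) * (\<Sum>\<tau><t. w \<tau> * max_bid v (x \<tau>) y) + u * (\<Sum>\<tau><t. w \<tau> * max_bid v (x \<tau>) z)"
      unfolding sum_distrib_left sum.distrib[symmetric] by (intro sum_mono) auto
  qed
qed simp

lemma continuous_boot_objective:
  assumes "good_weights t w" and "\<And>i. b i > 0"
  shows "continuous_on pos_orthant (boot_objective v b t w x)"
  by (rule convex_on_continuous[OF open_pos_orthant convex_boot_objective[OF assms]])

context fisher_limit
begin

text \<open>
  The logarithmic term is strictly convex: at the midpoint of two distinct minimizers the
  objective would be strictly smaller.
\<close>
lemma boot_minimizer_unique:
  assumes w: "good_weights t w" and p: "p \<in> pos_orthant" and q: "q \<in> pos_orthant"
    and minp: "\<And>y. y \<in> pos_orthant \<Longrightarrow> boot_objective v b t w x p \<le> boot_objective v b t w x y"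
    and minq: "\<And>y. y \<in> pos_orthant \<Longrightarrow> boot_objective v b t w x q \<le> boot_objective v b t w x y"
  shows "p = q"
proof (rule ccontr)
  assume "p \<noteq> q"
  define m where "m = (1/2) *\<^sub>R (p + q)"
  define d where "d = (1/2) *\<^sub>R (p - q)"
  have md: "m + d = p" "m - d = q" by (simp_all add: m_def d_def scaleR_left_distrib[symmetric] algebra_simps flip: scaleR_2)
  have m: "m \<in> pos_orthant" using p q by (auto simp: pos_orthant_def m_def add_pos_pos)
  obtain i where i: "d $ i \<noteq> 0"
    using \<open>p \<noteq> q\<close> by (auto simp: d_def vec_eq_iff)
  have "0 < (\<Sum>i\<in>UNIV. b i * (d $ i / m $ i)\<^sup>2)"
  proof (rule sum_pos2[of _ i])
    have "m $ i > 0" using m by (simp add: pos_orthant_def)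
    then show "0 < b i * (d $ i / m $ i)\<^sup>2" using i budgets[of i] by simp
    show "0 \<le> b j * (d $ j / m $ j)\<^sup>2" for j using budgets[of j] by simp
  qed auto
  also have "\<dots> \<le> log_term b p + log_term b q - 2 * log_term b m"
    using log_term_second_difference[of m d] m p q unfolding md by blast
  finally have log: "2 * log_term b m < log_term b p + log_term b q" by simp
  have "2 * (\<Sum>\<tau><t. w \<tau> * max_bid v (x \<tau>) m)
      \<le> (\<Sum>\<tau><t. w \<tau> * max_bid v (x \<tau>) p) + (\<Sum>\<tau><t. w \<tau> * max_bid v (x \<tau>) q)"
    unfolding sum.distrib[symmetric] sum_distrib_left
  proof (rule sum_mono)
    fix \<tau> assume "\<tau> \<in> {..<t}"
    then have "w \<tau> * (2 * max_bid v (x \<tau>) m) \<le> w \<tau> * (max_bid v (x \<tau>) p + max_bid v (x \<tau>) q)"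
      using max_bid_second_difference[of "x \<tau>" m d] w unfolding md
      by (intro mult_left_mono) (auto simp: good_weights_def)
    then show "2 * (w \<tau> * max_bid v (x \<tau>) m) \<le> w \<tau> * max_bid v (x \<tau>) p + w \<tau> * max_bid v (x \<tau>) q"
      by (simp add: algebra_simps)
  qed
  from mult_left_mono[OF this, of "1 / real t"]
  have "2 * (1 / real t * (\<Sum>\<tau><t. w \<tau> * max_bid v (x \<tau>) m))
     \<le> 1 / real t * (\<Sum>\<tau><t. w \<tau> * max_bid v (x \<tau>) p) + 1 / real t * (\<Sum>\<tau><t. w \<tau> * max_bid v (x \<tau>) q)"
    by (simp add: distrib_left)
  then have "2 * boot_objective v b t w x m < boot_objective v b t w x p + boot_objective v b t w x q"
    using log by (simp add: boot_objective_def)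
  then show False using minp[OF m] minq[OF m] by linarith
qed

lemma Hess_inverse: "Hess ** matrix_inv Hess = mat 1" "matrix_inv Hess ** Hess = mat 1"
proof -
  obtain m where m: "m > 0" "\<And>d. m * (norm d)\<^sup>2 \<le> d \<bullet> (Hess *v d)" by (rule Hess_posdef) (rule that)
  have "d = 0" if "Hess *v d = 0" for d
  proof -
    have "m * (norm d)\<^sup>2 \<le> 0" using m(2)[of d] that by simp
    then show ?thesis using m(1) by (simp add: mult_le_0_iff)
  qed
  then have "\<exists>B :: real^'n^'n. B ** Hess = mat 1" unfolding matrix_left_invertible_ker by blast
  then have "\<exists>B. Hess ** B = mat 1 \<and> B ** Hess = mat 1"
    unfolding invertible_left_inverse[symmetric] invertible_def .
  then have "Hess ** matrix_inv Hess = mat 1 \<and> matrix_inv Hess ** Hess = mat 1"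
    unfolding matrix_inv_def by (rule someI_ex)
  then show "Hess ** matrix_inv Hess = mat 1" "matrix_inv Hess ** Hess = mat 1" by auto
qed

lemma Hess_inverse_apply: "Hess *v (matrix_inv Hess *v a) = a"
  by (simp only: matrix_vector_mul_assoc Hess_inverse matrix_vector_mul_lid)

lemma Hess_inverse_symmetric: "transpose (matrix_inv Hess) = matrix_inv Hess"
proof -
  have "transpose (matrix_inv Hess) ** Hess = mat 1"
    using Hess_inverse(1) Hess_symmetric by (metis matrix_transpose_mul transpose_mat)
  then have "transpose (matrix_inv Hess) ** (Hess ** matrix_inv Hess) = matrix_inv Hess"
    by (simp only: matrix_mul_assoc matrix_mul_lid)
  then show ?thesis by (simp only: Hess_inverse(1) matrix_mul_rid)
qed

lemma inner_Hess_inverse: "x \<bullet> (matrix_inv Hess *v y) = (matrix_inv Hess *v x) \<bullet> y"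
  using inner_matrix_vector[of x "matrix_inv Hess" y] by (simp only: Hess_inverse_symmetric)

definition weighted_score :: "nat \<Rightarrow> (nat \<Rightarrow> real) \<Rightarrow> (nat \<Rightarrow> 'a) \<Rightarrow> real^'n" where
  "weighted_score t w x = (1 / sqrt (real t)) *\<^sub>R (\<Sum>\<tau><t. w \<tau> *\<^sub>R score (x \<tau>))"

definition local_objective :: "nat \<Rightarrow> (nat \<Rightarrow> real) \<Rightarrow> (nat \<Rightarrow> 'a) \<Rightarrow> real^'n \<Rightarrow> real" where
  "local_objective t w x h = real t * (boot_objective v b t w x (\<beta>s + (1 / sqrt (real t)) *\<^sub>R h) - boot_objective v b t w x \<beta>s)"

definition local_mean :: "nat \<Rightarrow> real^'n \<Rightarrow> real" where
  "local_mean t h = real t * ((\<integral>x. remainder h (1 / sqrt (real t)) x \<partial>N)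
      + (log_term b (\<beta>s + (1 / sqrt (real t)) *\<^sub>R h) - log_term b \<beta>s) + 1 / sqrt (real t) * (star_util \<bullet> h))"

definition centered_remainder :: "real^'n \<Rightarrow> nat \<Rightarrow> 'a \<Rightarrow> real" where
  "centered_remainder h t x = remainder h (1 / sqrt (real t)) x - (\<integral>x. remainder h (1 / sqrt (real t)) x \<partial>N)"

lemma weighted_score_inner: "weighted_score t w x \<bullet> h = 1 / sqrt (real t) * (\<Sum>\<tau><t. w \<tau> * (score (x \<tau>) \<bullet> h))"
  by (simp add: weighted_score_def inner_sum_left)

text \<open>
  The linear part is \<open>weighted_score\<close>. What remains is a centered weighted sum of independent
  remainders and a deterministic part; the constant sum of the weights is what makes the latter
  free of \<open>w\<close>.
\<close>
lemma local_objective_decomposition: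
  assumes w: "good_weights t w" and t: "t > 0"
  shows "local_objective t w x h - weighted_score t w x \<bullet> h
    = (\<Sum>\<tau><t. w \<tau> * centered_remainder h t (x \<tau>)) + local_mean t h"
proof -
  define s where "s = 1 / sqrt (real t)"
  define E where "E = (\<integral>x. remainder h s x \<partial>N)"
  define L where "L = log_term b (\<beta>s + s *\<^sub>R h) - log_term b \<beta>s"
  have tot: "(\<Sum>\<tau><t. w \<tau>) = real t" using w by (simp add: good_weights_def)
  have "local_objective t w x h
      = (\<Sum>\<tau><t. w \<tau> * max_bid v (x \<tau>) (\<beta>s + s *\<^sub>R h)) - (\<Sum>\<tau><t. w \<tau> * max_bid v (x \<tau>) \<beta>s) + real t * L"
    using t by (simp add: local_objective_def boot_objective_def s_def[symmetric] L_def field_simps)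
  also have "\<dots> = (\<Sum>\<tau><t. w \<tau> * remainder h s (x \<tau>)) + s * (\<Sum>\<tau><t. w \<tau> * (bid_grad (x \<tau>) \<bullet> h)) + real t * L"
    by (simp add: remainder_def sum_subtractf[symmetric] sum.distrib[symmetric] sum_distrib_left algebra_simps)
  finally have 1: "local_objective t w x h = \<dots>" .
  have 2: "weighted_score t w x \<bullet> h = s * (\<Sum>\<tau><t. w \<tau> * (bid_grad (x \<tau>) \<bullet> h)) - s * (real t * (star_util \<bullet> h))"
  proof -
    have "(\<Sum>\<tau><t. w \<tau> * (score (x \<tau>) \<bullet> h)) = (\<Sum>\<tau><t. w \<tau> * (bid_grad (x \<tau>) \<bullet> h)) - real t * (star_util \<bullet> h)"
      by (simp add: score_def inner_diff_left right_diff_distrib sum_subtractf sum_distrib_right[symmetric] tot)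
    then show ?thesis unfolding weighted_score_inner s_def[symmetric] by (simp only: right_diff_distrib)
  qed
  have 3: "(\<Sum>\<tau><t. w \<tau> * centered_remainder h t (x \<tau>)) = (\<Sum>\<tau><t. w \<tau> * remainder h s (x \<tau>)) - real t * E"
    unfolding centered_remainder_def s_def[symmetric] E_def[symmetric]
    by (simp add: right_diff_distrib sum_subtractf sum_distrib_right[symmetric] tot)
  have 4: "local_mean t h = real t * (E + L + s * (star_util \<bullet> h))"
    by (simp add: local_mean_def s_def E_def L_def)
  show ?thesis unfolding 1 2 3 4 by (simp add: algebra_simps)
qed

lemma convex_local_objective:
  assumes w: "good_weights t w"
  shows "convex_on {h. \<beta>s + (1 / sqrt (real t)) *\<^sub>R h \<in> pos_orthant} (local_objective t w x)"
proof -
  let ?s = "1 / sqrt (real t)"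
  have "\<beta>s + s *\<^sub>R ((1 - u) *\<^sub>R y + u *\<^sub>R z) = (1 - u) *\<^sub>R (\<beta>s + s *\<^sub>R y) + u *\<^sub>R (\<beta>s + s *\<^sub>R z)" for s u y z
    by (simp add: algebra_simps)
  note comb = this[of ?s]
  note conv = convex_boot_objective[OF w budgets, where v = v and x = x]
  show ?thesis
  proof (rule convex_onI)
    fix u y z assume u: "0 < (u::real)" "u < 1"
      and y: "y \<in> {h. \<beta>s + ?s *\<^sub>R h \<in> pos_orthant}" and z: "z \<in> {h. \<beta>s + ?s *\<^sub>R h \<in> pos_orthant}"
    have "boot_objective v b t w x (\<beta>s + ?s *\<^sub>R ((1 - u) *\<^sub>R y + u *\<^sub>R z)) - boot_objective v b t w x \<beta>s
       \<le> (1 - u) * (boot_objective v b t w x (\<beta>s + ?s *\<^sub>R y) - boot_objective v b t w x \<beta>s)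
        + u * (boot_objective v b t w x (\<beta>s + ?s *\<^sub>R z) - boot_objective v b t w x \<beta>s)"
      unfolding comb using convex_onD[OF conv, of u "\<beta>s + ?s *\<^sub>R y" "\<beta>s + ?s *\<^sub>R z"] u y z
      by (simp add: algebra_simps)
    from mult_left_mono[OF this, of "real t"]
    show "local_objective t w x ((1 - u) *\<^sub>R y + u *\<^sub>R z) \<le> (1 - u) * local_objective t w x y + u * local_objective t w x z"
      unfolding local_objective_def by (simp add: distrib_left mult.left_commute)
  next
    show "convex {h. \<beta>s + ?s *\<^sub>R h \<in> pos_orthant}"
    proof (rule convexI)
      fix y z and u w :: real
      assume a: "y \<in> {h. \<beta>s + ?s *\<^sub>R h \<in> pos_orthant}" "z \<in> {h. \<beta>s + ?s *\<^sub>R h \<in> pos_orthant}"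
        "0 \<le> u" "0 \<le> w" "u + w = 1"
      then have u: "u = 1 - w" by simp
      show "u *\<^sub>R y + w *\<^sub>R z \<in> {h. \<beta>s + ?s *\<^sub>R h \<in> pos_orthant}"
        using convexD[OF convex_pos_orthant, of "\<beta>s + ?s *\<^sub>R y" "\<beta>s + ?s *\<^sub>R z" u w] a
        unfolding u mem_Collect_eq comb by simp
    qed
  qed
qed

text \<open>
  Translates a statement on the rescaled objective into one on \<^const>\<open>beta_boot\<close>.
\<close>
lemma linearization_on_good_event:
  assumes w: "good_weights t w" and t: "t > 0"
    and min: "(\<exists>h\<in>{h. \<beta>s + (1 / sqrt (real t)) *\<^sub>R h \<in> pos_orthant}.
        \<forall>y\<in>{h. \<beta>s + (1 / sqrt (real t)) *\<^sub>R h \<in> pos_orthant}. local_objective t w x h \<le> local_objective t w x y) \<and>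
      (\<forall>h\<in>{h. \<beta>s + (1 / sqrt (real t)) *\<^sub>R h \<in> pos_orthant}. \<delta> \<le> dist h h0 \<longrightarrow>
        local_objective t w x h0 < local_objective t w x h)"
    and h0: "\<beta>s + (1 / sqrt (real t)) *\<^sub>R h0 \<in> pos_orthant"
  shows "norm (sqrt (real t) *\<^sub>R (beta_boot v b t w x - \<beta>s) - h0) < \<delta>"
proof -
  have "\<exists>p\<in>pos_orthant. \<forall>y\<in>pos_orthant. boot_objective v b t w x p \<le> boot_objective v b t w x y"
  proof -
    obtain h where h: "\<beta>s + (1 / sqrt (real t)) *\<^sub>R h \<in> pos_orthant"
      "\<And>y. \<beta>s + (1 / sqrt (real t)) *\<^sub>R y \<in> pos_orthant \<Longrightarrow> local_objective t w x h \<le> local_objective t w x y"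
      using min by auto
    have "boot_objective v b t w x (\<beta>s + (1 / sqrt (real t)) *\<^sub>R h) \<le> boot_objective v b t w x y" if "y \<in> pos_orthant" for y
    proof -
      have "\<beta>s + (1 / sqrt (real t)) *\<^sub>R (sqrt (real t) *\<^sub>R (y - \<beta>s)) = y" using t by simp
      then show ?thesis using h(2)[of "sqrt (real t) *\<^sub>R (y - \<beta>s)"] that t
        by (simp add: local_objective_def)
    qed
    then show ?thesis using h(1) by blast
  qed
  from beta_boot_minimizes[OF w t budgets this]
  have B: "beta_boot v b t w x \<in> pos_orthant"
    "\<And>y. y \<in> pos_orthant \<Longrightarrow> boot_objective v b t w x (beta_boot v b t w x) \<le> boot_objective v b t w x y" by auto
  let ?h = "sqrt (real t) *\<^sub>R (beta_boot v b t w x - \<beta>s)"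
  have eq: "\<beta>s + (1 / sqrt (real t)) *\<^sub>R ?h = beta_boot v b t w x" using t by simp
  have "local_objective t w x ?h \<le> local_objective t w x h0"
    unfolding local_objective_def eq using B(2)[OF h0] by (intro mult_left_mono) auto
  moreover have "?h \<in> {h. \<beta>s + (1 / sqrt (real t)) *\<^sub>R h \<in> pos_orthant}" unfolding mem_Collect_eq eq by (rule B(1))
  ultimately have "\<not> \<delta> \<le> dist ?h h0" using conjunct2[OF min] by (meson not_le)
  then show ?thesis by (simp add: dist_norm)
qed

end

section \<open>Linearization of the minimizer for fixed weights\<close>

context fisher_limit
begin

lemma PiM_prob_space: "prob_space (PiM I (\<lambda>_. N))"
  by (rule prob_space_PiM) (rule prob_space_axioms)

lemma centered_remainder_measurable [measurable]: "centered_remainder h t \<in> borel_measurable N"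
  unfolding centered_remainder_def[abs_def] by measurable

lemma centered_remainder_bounded:
  "\<exists>B. \<forall>x\<in>space N. \<bar>centered_remainder h t x\<bar> \<le> B"
proof -
  let ?s = "1 / sqrt (real t)"
  let ?c = "?s * (2 * V * (\<Sum>i\<in>UNIV. \<bar>h $ i\<bar>))"
  have "\<bar>centered_remainder h t x\<bar> \<le> ?c + \<bar>\<integral>x. remainder h ?s x \<partial>N\<bar>" if "x \<in> space N" for x
    using remainder_bounded[OF that, of ?s h] unfolding centered_remainder_def by simp
  then show ?thesis by blast
qed

lemma centered_remainder_mean: "(\<integral>x. centered_remainder h t x \<partial>N) = 0"
  unfolding centered_remainder_def using remainder_integrable[of "1 / sqrt (real t)" h] by (simp add: prob_space)

lemma centered_remainder_variance:
  "(\<integral>x. (centered_remainder h t x)\<^sup>2 \<partial>N) \<le> (\<integral>x. (remainder h (1 / sqrt (real t)) x)\<^sup>2 \<partial>N)"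
proof -
  let ?r = "remainder h (1 / sqrt (real t))"
  let ?c = "1 / sqrt (real t) * (2 * V * (\<Sum>i\<in>UNIV. \<bar>h $ i\<bar>))"
  have i1: "integrable N ?r" by (rule remainder_integrable) simp
  have i2: "integrable N (\<lambda>x. (?r x)\<^sup>2)"
  proof (rule integrable_const_bound[where B="?c\<^sup>2"])
    show "AE x in N. norm ((?r x)\<^sup>2) \<le> ?c\<^sup>2"
    proof (rule AE_I2)
      fix x assume "x \<in> space N"
      from power_mono[OF remainder_bounded[OF this, of "1 / sqrt (real t)" h] abs_ge_zero, of 2]
      show "norm ((?r x)\<^sup>2) \<le> ?c\<^sup>2" by simp
    qed
  qed measurable
  have "(\<integral>x. (centered_remainder h t x)\<^sup>2 \<partial>N) = variance ?r" by (simp add: centered_remainder_def)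
  also have "\<dots> = expectation (\<lambda>x. (?r x)\<^sup>2) - (expectation ?r)\<^sup>2" by (rule variance_eq[OF i1 i2])
  finally show ?thesis by simp
qed

lemma step_ball_in_domain:
  "\<forall>\<^sub>F t in sequentially. ball 0 \<rho> \<subseteq> {h. \<beta>s + (1 / sqrt (real t)) *\<^sub>R h \<in> pos_orthant}"
proof -
  obtain r where r: "r > 0" "ball \<beta>s r \<subseteq> pos_orthant"
    using open_pos_orthant argmin_pos open_contains_ball by blast
  have "(\<lambda>t. 1 / sqrt (real t) * \<rho>) \<longlonglongrightarrow> 0 * \<rho>"
    by (intro tendsto_mult inverse_sqrt_tendsto_0 tendsto_const)
  then have "\<forall>\<^sub>F t in sequentially. 1 / sqrt (real t) * \<rho> < r" using r(1) by (intro order_tendstoD(2)) auto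
  then show ?thesis
  proof eventually_elim
    case (elim t)
    show ?case
    proof
      fix h :: "real^'n" assume "h \<in> ball 0 \<rho>"
      then have "1 / sqrt (real t) * norm h \<le> 1 / sqrt (real t) * \<rho>" by (intro mult_left_mono) auto
      then have "\<beta>s + (1 / sqrt (real t)) *\<^sub>R h \<in> ball \<beta>s r" using elim by (simp add: dist_norm)
      then show "h \<in> {h. \<beta>s + (1 / sqrt (real t)) *\<^sub>R h \<in> pos_orthant}" using r(2) by blast
    qed
  qed
qed

text \<open>
  Chebyshev's inequality in each coordinate.
\<close>
lemma linear_term_tail:
  assumes "t > 0" "R > 0"
  shows "measure (PiM {..<t} (\<lambda>_. N)) {x \<in> space (PiM {..<t} (\<lambda>_. N)). norm (matrix_inv Hess *v weighted_score t w x) > R}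
    \<le> (\<Sum>\<tau><t. (w \<tau>)\<^sup>2) / real t * ((\<Sum>i\<in>UNIV. \<integral>x. (score x \<bullet> (matrix_inv Hess *v axis i 1))\<^sup>2 \<partial>N) * (real CARD('n))\<^sup>2 / R\<^sup>2)"
proof -
  let ?P = "PiM {..<t} (\<lambda>_. N)"
  interpret P: prob_space ?P by (rule PiM_prob_space)
  let ?n = "real CARD('n)"
  let ?c = "\<lambda>i. matrix_inv Hess *v axis i 1"
  define B where "B i = {x \<in> space ?P. \<bar>\<Sum>\<tau><t. w \<tau> * (score (x \<tau>) \<bullet> ?c i)\<bar> \<ge> sqrt (real t) * R / ?n}" for i
  have n: "?n > 0" by simp
  have BM: "B i \<in> sets ?P" for i unfolding B_def by measurable
  have Bprob: "measure ?P (B i) \<le> (\<Sum>\<tau><t. (w \<tau>)\<^sup>2) * (\<integral>x. (score x \<bullet> ?c i)\<^sup>2 \<partial>N) / (sqrt (real t) * R / ?n)\<^sup>2" for i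
    unfolding B_def
    by (rule PiM_weighted_sum_Chebyshev[OF prob_space_axioms _ score_inner_measurable score_inner_bounded mean_score])
       (use assms n in auto)
  have "{x \<in> space ?P. norm (matrix_inv Hess *v weighted_score t w x) > R} \<subseteq> (\<Union>i\<in>UNIV. B i)"
  proof
    fix x assume x: "x \<in> {x \<in> space ?P. norm (matrix_inv Hess *v weighted_score t w x) > R}"
    have "\<exists>i. \<bar>(matrix_inv Hess *v weighted_score t w x) $ i\<bar> \<ge> R / ?n"
    proof (rule ccontr)
      assume "\<not> (\<exists>i. \<bar>(matrix_inv Hess *v weighted_score t w x) $ i\<bar> \<ge> R / ?n)"
      then have "(\<Sum>i\<in>UNIV. \<bar>(matrix_inv Hess *v weighted_score t w x) $ i\<bar>) \<le> (\<Sum>i\<in>(UNIV::'n set). R / ?n)"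
        by (intro sum_mono) (simp add: not_le less_imp_le)
      also have "\<dots> = R" by simp
      finally show False using x norm_le_l1_cart[of "matrix_inv Hess *v weighted_score t w x"] by simp
    qed
    then obtain i where i: "\<bar>(matrix_inv Hess *v weighted_score t w x) $ i\<bar> \<ge> R / ?n" by blast
    have "(matrix_inv Hess *v weighted_score t w x) $ i = weighted_score t w x \<bullet> ?c i"
      using inner_Hess_inverse[of "weighted_score t w x" "axis i 1"] by (simp add: inner_axis)
    then have "R / ?n \<le> \<bar>\<Sum>\<tau><t. w \<tau> * (score (x \<tau>) \<bullet> ?c i)\<bar> / sqrt (real t)"
      using i by (simp add: weighted_score_inner abs_mult)
    then have "x \<in> B i" using x assms by (simp add: B_def pos_le_divide_eq mult.commute)
    then show "x \<in> (\<Union>i\<in>UNIV. B i)" by blast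
  qed
  then have "measure ?P {x \<in> space ?P. norm (matrix_inv Hess *v weighted_score t w x) > R} \<le> measure ?P (\<Union>i\<in>UNIV. B i)"
    by (rule P.finite_measure_mono) (use BM in auto)
  also have "\<dots> \<le> (\<Sum>i\<in>UNIV. measure ?P (B i))"
    by (rule measure_UNION_le) (use BM in auto)
  also have "\<dots> \<le> (\<Sum>i\<in>UNIV. (\<Sum>\<tau><t. (w \<tau>)\<^sup>2) * (\<integral>x. (score x \<bullet> ?c i)\<^sup>2 \<partial>N) / (sqrt (real t) * R / ?n)\<^sup>2)"
    by (intro sum_mono Bprob)
  also have "\<dots> = (\<Sum>i\<in>UNIV. (\<integral>x. (score x \<bullet> ?c i)\<^sup>2 \<partial>N)) * ((\<Sum>\<tau><t. (w \<tau>)\<^sup>2) / (sqrt (real t) * R / ?n)\<^sup>2)"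
  proof -
    have "(\<Sum>i\<in>(UNIV::'n set). A * f i / c) = (\<Sum>i\<in>UNIV. f i) * (A / c)" for A c :: real and f
      by (subst mult.commute) (simp add: sum_distrib_left)
    then show ?thesis .
  qed
  also have "\<dots> = (\<Sum>\<tau><t. (w \<tau>)\<^sup>2) / real t * ((\<Sum>i\<in>UNIV. \<integral>x. (score x \<bullet> ?c i)\<^sup>2 \<partial>N) * ?n\<^sup>2 / R\<^sup>2)"
    using assms by (simp add: power_mult_distrib power_divide mult_ac)
  finally show ?thesis .
qed

lemma Hess_minus: "Hess *v (- y) = - (Hess *v y)"
  using matrix_vector_mult_scaleR[of Hess "-1" y] by simp

text \<open>
  The minimizer for weights \<open>w\<close> is asymptotically linear. Off an exceptional event the linear
  term is bounded by a constant \<open>R\<close>, and the rescaled objective is close to its quadratic limit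
  at the finitely many points that \<open>argmin_near_quadratic_argmin\<close> provides for \<open>R\<close>. Both
  exceptional probabilities come from Chebyshev's inequality and so are proportional to the mean
  square of the weights. That the threshold for \<open>t\<close> is the same for all \<open>w\<close> allows integration
  over random weights later.
\<close>
lemma fixed_weights_linearization:
  assumes "\<delta> > 0" "e > 0"
  shows "\<forall>\<^sub>F t in sequentially. \<forall>w. good_weights t w \<longrightarrow>
    measure (PiM {..<t} (\<lambda>_. N)) {x \<in> space (PiM {..<t} (\<lambda>_. N)).
      norm (sqrt (real t) *\<^sub>R (beta_boot v b t w x - \<beta>s) + matrix_inv Hess *v weighted_score t w x) \<ge> \<delta>}
    \<le> e * ((\<Sum>\<tau><t. (w \<tau>)\<^sup>2) / real t)"
proof -
  define C where "C = (\<Sum>i\<in>UNIV. \<integral>x. (score x \<bullet> (matrix_inv Hess *v axis i 1))\<^sup>2 \<partial>N) * (real CARD('n))\<^sup>2"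
  have C: "C \<ge> 0" unfolding C_def by (intro mult_nonneg_nonneg sum_nonneg) auto
  \<comment> \<open>Chosen so that the tail of the linear term uses half of the budget \<open>e\<close>.\<close>
  define R where "R = sqrt (2 * C / e + 1)"
  have R: "R > 0" "C / R\<^sup>2 \<le> e / 2"
  proof -
    have pos: "2 * C / e + 1 > 0" using C assms by (simp add: add_nonneg_pos)
    then show "R > 0" by (simp add: R_def)
    have R2: "R\<^sup>2 = 2 * C / e + 1" using pos by (simp add: R_def)
    have "C \<le> e / 2 * R\<^sup>2" unfolding R2 using assms by (simp add: field_simps)
    then show "C / R\<^sup>2 \<le> e / 2" using pos unfolding R2[symmetric] by (simp add: pos_divide_le_eq)
  qed
  obtain m where m: "m > 0" "\<And>d. m * (norm d)\<^sup>2 \<le> d \<bullet> (Hess *v d)" by (rule Hess_posdef) (rule that)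
  have R0: "R \<ge> 0" using R(1) by simp
  show ?thesis
  proof (rule argmin_near_quadratic_argmin[OF Hess_symmetric m R0 \<open>\<delta> > 0\<close>])
  fix S :: "(real^'n) set" and \<eta> :: real
  assume S: "finite S" "S \<subseteq> ball 0 (R + \<delta> + 1)" "\<eta> > 0"
    and loc: "\<And>G D a h0. convex_on D G \<Longrightarrow> ball 0 (R + \<delta> + 1) \<subseteq> D \<Longrightarrow> Hess *v h0 = - a \<Longrightarrow> norm h0 \<le> R \<Longrightarrow>
       (\<And>s. s \<in> S \<Longrightarrow> \<bar>G s - a \<bullet> s - s \<bullet> (Hess *v s) / 2\<bar> \<le> \<eta>) \<Longrightarrow>
       (\<exists>h\<in>D. \<forall>y\<in>D. G h \<le> G y) \<and> (\<forall>h\<in>D. \<delta> \<le> dist h h0 \<longrightarrow> G h0 < G h)"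
  \<comment> \<open>The other half is shared among the points of \<open>S\<close>; adding one avoids division by zero.\<close>
  define k where "k = real (card S) + 1"
  have k: "k > 0" by (simp add: k_def add_nonneg_pos)
  have ev_mean: "\<forall>\<^sub>F t in sequentially. \<forall>s\<in>S. \<bar>local_mean t s - s \<bullet> (Hess *v s) / 2\<bar> < \<eta> / 2"
  proof (intro eventually_ball_finite ballI S(1))
    fix s
    have lim: "(\<lambda>t. local_mean t s) \<longlonglongrightarrow> s \<bullet> (Hess *v s) / 2" unfolding local_mean_def by (rule mean_process_limit)
    show "\<forall>\<^sub>F t in sequentially. \<bar>local_mean t s - s \<bullet> (Hess *v s) / 2\<bar> < \<eta> / 2"
      using tendstoD[OF lim half_gt_zero[OF S(3)]] unfolding dist_real_def .
  qed
  have ev_var: "\<forall>\<^sub>F t in sequentially. \<forall>s\<in>S. real t * (\<integral>x. (remainder s (1 / sqrt (real t)) x)\<^sup>2 \<partial>N) < e * \<eta>\<^sup>2 / (8 * k)"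
    using S(3) assms k by (intro eventually_ball_finite ballI S(1) order_tendstoD(2)[OF remainder_second_moment]) auto
  show ?thesis
    using ev_mean ev_var step_ball_in_domain[of "R + \<delta> + 1"] eventually_gt_at_top[of "0::nat"]
  proof eventually_elim
    case (elim t)
    let ?P = "PiM {..<t} (\<lambda>_. N)"
    interpret P: prob_space ?P by (rule PiM_prob_space)
    let ?D = "{h. \<beta>s + (1 / sqrt (real t)) *\<^sub>R h \<in> pos_orthant}"
    show ?case
    proof (intro allI impI)
      fix w assume w: "good_weights t w"
      let ?h = "\<lambda>x. - (matrix_inv Hess *v weighted_score t w x)"
      define W2 where "W2 = (\<Sum>\<tau><t. (w \<tau>)\<^sup>2)"
      have W2: "W2 \<ge> 0" by (simp add: W2_def sum_nonneg)
      define B0 where "B0 = {x \<in> space ?P. norm (matrix_inv Hess *v weighted_score t w x) > R}"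
      define B where "B s = {x \<in> space ?P. \<bar>\<Sum>\<tau><t. w \<tau> * centered_remainder s t (x \<tau>)\<bar> \<ge> \<eta> / 2}" for s
      have lin_meas: "(\<lambda>x. matrix_inv Hess *v weighted_score t w x) \<in> borel_measurable ?P"
      proof -
        have "(\<lambda>x. (matrix_inv Hess *v weighted_score t w x) \<bullet> i) \<in> borel_measurable ?P" for i
          unfolding inner_Hess_inverse[symmetric] inner_commute[of "matrix_inv Hess *v _"]
          by (simp add: inner_commute[of i] inner_Hess_inverse weighted_score_inner flip: inner_Hess_inverse)
             measurable
        then show ?thesis by (subst borel_measurable_euclidean_space) auto
      qed
      have B0M: "B0 \<in> sets ?P" unfolding B0_def using lin_meas by measurable
      have BM: "B s \<in> sets ?P" for s unfolding B_def by measurable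
      have B0p: "measure ?P B0 \<le> W2 / real t * (e / 2)"
      proof -
        have "measure ?P B0 \<le> W2 / real t * (C / R\<^sup>2)"
          unfolding B0_def W2_def C_def by (rule linear_term_tail[OF elim(4) R(1)])
        also have "\<dots> \<le> W2 / real t * (e / 2)" using R(2) W2 by (intro mult_left_mono) auto
        finally show ?thesis .
      qed
      have Bp: "measure ?P (B s) \<le> W2 / real t * (e / (2 * k))" if s: "s \<in> S" for s
      proof -
        obtain Q where Q: "\<And>x. x \<in> space N \<Longrightarrow> \<bar>centered_remainder s t x\<bar> \<le> Q"
          using centered_remainder_bounded by blast
        have "measure ?P (B s) \<le> W2 * (\<integral>x. (centered_remainder s t x)\<^sup>2 \<partial>N) / (\<eta> / 2)\<^sup>2"
          unfolding B_def W2_def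
          by (rule PiM_weighted_sum_Chebyshev[OF prob_space_axioms _ centered_remainder_measurable Q centered_remainder_mean])
             (use S(3) in auto)
        also have "\<dots> \<le> W2 * (\<integral>x. (remainder s (1 / sqrt (real t)) x)\<^sup>2 \<partial>N) / (\<eta> / 2)\<^sup>2"
          using W2 centered_remainder_variance by (intro divide_right_mono mult_left_mono) auto
        also have "\<dots> = W2 / real t * (real t * (\<integral>x. (remainder s (1 / sqrt (real t)) x)\<^sup>2 \<partial>N)) / (\<eta> / 2)\<^sup>2"
          using elim(4) by simp
        also have "\<dots> \<le> W2 / real t * (e * \<eta>\<^sup>2 / (8 * k)) / (\<eta> / 2)\<^sup>2"
          using elim(2) s W2 by (intro divide_right_mono mult_left_mono) (auto intro: less_imp_le)
        also have "\<dots> = W2 / real t * (e / (2 * k))" using S(3) by (simp add: power_divide)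
        finally show ?thesis .
      qed
      have "{x \<in> space ?P. norm (sqrt (real t) *\<^sub>R (beta_boot v b t w x - \<beta>s) + matrix_inv Hess *v weighted_score t w x) \<ge> \<delta>}
          \<subseteq> B0 \<union> (\<Union>s\<in>S. B s)"
      proof
        fix x assume x: "x \<in> {x \<in> space ?P. norm (sqrt (real t) *\<^sub>R (beta_boot v b t w x - \<beta>s) + matrix_inv Hess *v weighted_score t w x) \<ge> \<delta>}"
        show "x \<in> B0 \<union> (\<Union>s\<in>S. B s)"
        proof (rule ccontr)
          assume nB: "x \<notin> B0 \<union> (\<Union>s\<in>S. B s)"
          have h0: "norm (?h x) \<le> R" using nB x by (auto simp: B0_def not_less)
          have "\<bar>local_objective t w x s - weighted_score t w x \<bullet> s - s \<bullet> (Hess *v s) / 2\<bar> \<le> \<eta>" if s: "s \<in> S" for s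
          proof -
            have "\<bar>\<Sum>\<tau><t. w \<tau> * centered_remainder s t (x \<tau>)\<bar> < \<eta> / 2" using nB x s by (auto simp: B_def not_le)
            moreover have "\<bar>local_mean t s - s \<bullet> (Hess *v s) / 2\<bar> < \<eta> / 2" using elim(1) s by blast
            ultimately show ?thesis using local_objective_decomposition[OF w elim(4), of x s] by linarith
          qed
          then have "(\<exists>h\<in>?D. \<forall>y\<in>?D. local_objective t w x h \<le> local_objective t w x y) \<and>
            (\<forall>h\<in>?D. \<delta> \<le> dist h (?h x) \<longrightarrow> local_objective t w x (?h x) < local_objective t w x h)"
            by (intro loc[OF convex_local_objective[OF w] elim(3) _ h0]) (simp_all add: Hess_inverse_apply Hess_minus)
          moreover have "?h x \<in> ball 0 (R + \<delta> + 1)" using h0 \<open>\<delta> > 0\<close> by simp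
          then have "?h x \<in> ?D" by (rule subsetD[OF elim(3)])
          ultimately have "norm (sqrt (real t) *\<^sub>R (beta_boot v b t w x - \<beta>s) - ?h x) < \<delta>"
            by (intro linearization_on_good_event[OF w elim(4)]) auto
          then show False using x by simp
        qed
      qed
      then have "measure ?P {x \<in> space ?P. norm (sqrt (real t) *\<^sub>R (beta_boot v b t w x - \<beta>s) + matrix_inv Hess *v weighted_score t w x) \<ge> \<delta>}
          \<le> measure ?P (B0 \<union> (\<Union>s\<in>S. B s))"
        by (rule P.finite_measure_mono) (use B0M BM S(1) in auto)
      also have "\<dots> \<le> measure ?P B0 + measure ?P (\<Union>s\<in>S. B s)"
        by (rule measure_Un_le) (use B0M BM S(1) in auto)
      also have "measure ?P (\<Union>s\<in>S. B s) \<le> (\<Sum>s\<in>S. measure ?P (B s))"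
        by (rule measure_UNION_le) (use BM S(1) in auto)
      also have "\<dots> \<le> (\<Sum>s\<in>S. W2 / real t * (e / (2 * k)))" by (intro sum_mono Bp)
      also have "\<dots> \<le> W2 / real t * (e / 2)"
      proof -
        have "real (card S) * (W2 / real t * (e / (2 * k))) = (W2 / real t * (e / 2)) * (real (card S) / k)"
          using k by (simp add: mult_ac)
        also have "\<dots> \<le> (W2 / real t * (e / 2)) * 1"
          using W2 assms k by (intro mult_left_mono) (auto simp: k_def)
        finally show ?thesis by simp
      qed
      finally have f1: "measure ?P {x \<in> space ?P. norm (sqrt (real t) *\<^sub>R (beta_boot v b t w x - \<beta>s) + matrix_inv Hess *v weighted_score t w x) \<ge> \<delta>}
          \<le> measure ?P B0 + W2 / real t * (e / 2)" by simp
      have f2: "W2 / real t * (e / 2) + W2 / real t * (e / 2) = e * ((\<Sum>\<tau><t. (w \<tau>)\<^sup>2) / real t)"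
        by (simp add: W2_def)
      show "measure ?P {x \<in> space ?P. norm (sqrt (real t) *\<^sub>R (beta_boot v b t w x - \<beta>s) + matrix_inv Hess *v weighted_score t w x) \<ge> \<delta>}
          \<le> e * ((\<Sum>\<tau><t. (w \<tau>)\<^sup>2) / real t)"
        by (rule order_trans[OF f1, OF order_trans[OF add_right_mono[OF B0p]]]) (simp only: f2 order_refl)
    qed
  qed
  qed
qed

end

section \<open>Averaging over two copies of the weights\<close>

text \<open>
  Write \<open>\<phi> x\<close> for the inner integral over \<open>w\<close>. Then \<open>\<bar>\<phi> - l\<bar>\<^sup>2 = \<bar>\<phi>\<bar>\<^sup>2 - 2 l Re \<phi> + l\<^sup>2\<close>, and
  \<open>\<bar>\<phi> x\<bar>\<^sup>2\<close> is an integral over two independent copies of \<open>w\<close>. Fubini moves the integral over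
  \<open>x\<close> inside, so that only laws of \<open>x\<close> at fixed \<open>w\<close> and \<open>w'\<close> remain.
\<close>
lemma conditional_char_second_moment:
  assumes \<mu>: "prob_space \<mu>" and \<nu>: "prob_space \<nu>"
    and \<Phi> [measurable]: "(\<lambda>(x, w). \<Phi> x w) \<in> borel_measurable (\<mu> \<Otimes>\<^sub>M \<nu>)" and l: "0 \<le> l" "l \<le> 1"
  shows "(\<integral>x. (cmod ((\<integral>w. iexp (\<Phi> x w) \<partial>\<nu>) - complex_of_real l))\<^sup>2 \<partial>\<mu>)
    \<le> cmod ((\<integral>w. (\<integral>w'. (\<integral>x. iexp (\<Phi> x w - \<Phi> x w') \<partial>\<mu>) \<partial>\<nu>) \<partial>\<nu>) - complex_of_real (l\<^sup>2))
      + 2 * cmod ((\<integral>w. (\<integral>x. iexp (\<Phi> x w) \<partial>\<mu>) \<partial>\<nu>) - complex_of_real l)"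
proof -
  interpret \<mu>: prob_space \<mu> by fact
  interpret \<nu>: prob_space \<nu> by fact
  interpret pair_sigma_finite \<mu> \<nu> ..
  interpret J: prob_space "\<mu> \<Otimes>\<^sub>M \<nu>" by (rule prob_space_pair) unfold_locales
  define \<phi> where "\<phi> x = (\<integral>w. iexp (\<Phi> x w) \<partial>\<nu>)" for x
  have [measurable]: "cnj \<in> borel_measurable borel"
    by (intro borel_measurable_continuous_onI continuous_intros)
  have [measurable]: "\<phi> \<in> borel_measurable \<mu>" unfolding \<phi>_def[abs_def] by measurable
  have \<phi>_le: "cmod (\<phi> x) \<le> 1" for x
  proof -
    have "cmod (\<phi> x) \<le> (\<integral>w. cmod (iexp (\<Phi> x w)) \<partial>\<nu>)" unfolding \<phi>_def by (rule integral_norm_bound)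
    then show ?thesis by (simp add: \<nu>.prob_space)
  qed
  have i1: "integrable \<mu> \<phi>" by (rule \<mu>.integrable_const_bound[where B=1]) (auto simp: \<phi>_le)
  have i2: "integrable \<mu> (\<lambda>x. \<phi> x * cnj (\<phi> x))"
    by (rule \<mu>.integrable_const_bound[where B=1]) (auto simp: norm_mult \<phi>_le intro!: mult_le_one)
  have E1: "(\<integral>x. \<phi> x \<partial>\<mu>) = (\<integral>w. (\<integral>x. iexp (\<Phi> x w) \<partial>\<mu>) \<partial>\<nu>)"
    unfolding \<phi>_def
    by (rule Fubini_integral[symmetric]) (auto intro!: J.integrable_const_bound[where B=1] simp: split_beta')
  have E2: "(\<integral>x. \<phi> x * cnj (\<phi> x) \<partial>\<mu>) = (\<integral>w. (\<integral>w'. (\<integral>x. iexp (\<Phi> x w - \<Phi> x w') \<partial>\<mu>) \<partial>\<nu>) \<partial>\<nu>)"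
  proof -
    have "(\<integral>x. \<phi> x * cnj (\<phi> x) \<partial>\<mu>) = (\<integral>x. (\<integral>w. iexp (\<Phi> x w) * cnj (\<phi> x) \<partial>\<nu>) \<partial>\<mu>)"
      by (simp add: \<phi>_def)
    also have "\<dots> = (\<integral>w. (\<integral>x. iexp (\<Phi> x w) * cnj (\<phi> x) \<partial>\<mu>) \<partial>\<nu>)"
      by (rule Fubini_integral[symmetric])
         (auto intro!: J.integrable_const_bound[where B=1] simp: split_beta' norm_mult \<phi>_le)
    also have "\<dots> = (\<integral>w. (\<integral>w'. (\<integral>x. iexp (\<Phi> x w - \<Phi> x w') \<partial>\<mu>) \<partial>\<nu>) \<partial>\<nu>)"
    proof (rule Bochner_Integration.integral_cong[OF refl])
      fix w assume [measurable]: "w \<in> space \<nu>"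
      have "iexp (\<Phi> x w) * cnj (\<phi> x) = (\<integral>w'. iexp (\<Phi> x w - \<Phi> x w') \<partial>\<nu>)" for x
      proof -
        have c1: "cnj (\<phi> x) = (\<integral>w'. cnj (iexp (\<Phi> x w')) \<partial>\<nu>)" unfolding \<phi>_def by (simp only: Bochner_Integration.integral_cnj)
        have c2: "iexp (\<Phi> x w) * cnj (iexp (\<Phi> x w')) = iexp (\<Phi> x w - \<Phi> x w')" for w'
          by (simp add: exp_cnj exp_add[symmetric] algebra_simps)
        show ?thesis by (simp only: c1 c2 integral_mult_right_zero[symmetric])
      qed
      then have "(\<integral>x. iexp (\<Phi> x w) * cnj (\<phi> x) \<partial>\<mu>) = (\<integral>x. (\<integral>w'. iexp (\<Phi> x w - \<Phi> x w') \<partial>\<nu>) \<partial>\<mu>)" by simp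
      also have "\<dots> = (\<integral>w'. (\<integral>x. iexp (\<Phi> x w - \<Phi> x w') \<partial>\<mu>) \<partial>\<nu>)"
        by (rule Fubini_integral[symmetric]) (auto intro!: J.integrable_const_bound[where B=1] simp: split_beta')
      finally show "(\<integral>x. iexp (\<Phi> x w) * cnj (\<phi> x) \<partial>\<mu>) = (\<integral>w'. (\<integral>x. iexp (\<Phi> x w - \<Phi> x w') \<partial>\<mu>) \<partial>\<nu>)" .
    qed
    finally show ?thesis .
  qed
  have sq: "(cmod (\<phi> x - complex_of_real l))\<^sup>2 = Re (\<phi> x * cnj (\<phi> x)) - 2 * l * Re (\<phi> x) + l\<^sup>2" for x
    by (simp only: cmod_power2) (simp add: power2_eq_square algebra_simps)
  have "(\<integral>x. (cmod (\<phi> x - complex_of_real l))\<^sup>2 \<partial>\<mu>)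
      = (\<integral>x. Re (\<phi> x * cnj (\<phi> x)) \<partial>\<mu>) - 2 * l * (\<integral>x. Re (\<phi> x) \<partial>\<mu>) + l\<^sup>2"
    unfolding sq using integrable_Re[OF i1] integrable_Re[OF i2] by (simp add: \<mu>.prob_space del: complex_mult_cnj)
  also have "\<dots> = Re ((\<integral>x. \<phi> x * cnj (\<phi> x) \<partial>\<mu>) - complex_of_real (l\<^sup>2))
      - 2 * l * Re ((\<integral>x. \<phi> x \<partial>\<mu>) - complex_of_real l)"
    by (simp only: integral_Re[OF i1] integral_Re[OF i2] minus_complex.sel Re_complex_of_real)
       (simp add: power2_eq_square algebra_simps)
  also have "\<dots> \<le> cmod ((\<integral>x. \<phi> x * cnj (\<phi> x) \<partial>\<mu>) - complex_of_real (l\<^sup>2)) + 2 * cmod ((\<integral>x. \<phi> x \<partial>\<mu>) - complex_of_real l)"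
  proof -
    let ?z = "(\<integral>x. \<phi> x \<partial>\<mu>) - complex_of_real l"
    have "- (2 * l * Re ?z) \<le> 2 * l * cmod ?z"
    proof -
      have "- Re ?z \<le> cmod ?z" using abs_Re_le_cmod[of ?z] by linarith
      then have "2 * l * (- Re ?z) \<le> 2 * l * cmod ?z" using l by (intro mult_left_mono) auto
      then show ?thesis by (simp only: mult_minus_right)
    qed
    also have "\<dots> \<le> 2 * 1 * cmod ?z" using l by (intro mult_right_mono mult_left_mono) auto
    finally show ?thesis using complex_Re_le_cmod[of "(\<integral>x. \<phi> x * cnj (\<phi> x) \<partial>\<mu>) - complex_of_real (l\<^sup>2)"] by linarith
  qed
  finally show ?thesis unfolding E1 E2 unfolding \<phi>_def .
qed

lemma exp_minus_diff_le:
  assumes "0 \<le> (a::real)" "0 \<le> b"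
  shows "\<bar>exp (- a) - exp (- b)\<bar> \<le> min 1 \<bar>a - b\<bar>"
proof -
  have *: "exp (- a) - exp (- b) \<le> min 1 \<bar>a - b\<bar>" "0 \<le> exp (- a) - exp (- b)" if "0 \<le> a" "a \<le> b" for a b :: real
  proof -
    show "0 \<le> exp (- a) - exp (- b)" using that by simp
    have "exp (- a) * (1 - exp (- (b - a))) \<le> 1 * (b - a)"
    proof (rule mult_mono)
      show "1 - exp (- (b - a)) \<le> b - a" using exp_ge_add_one_self[of "- (b - a)"] by linarith
    qed (use that in auto)
    moreover have "exp (- a) * (1 - exp (- (b - a))) = exp (- a) - exp (- b)"
      by (simp add: right_diff_distrib exp_add[symmetric])
    moreover have "exp (- a) - exp (- b) \<le> 1" using that by (smt (verit) exp_gt_zero exp_le_one_iff)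
    ultimately show "exp (- a) - exp (- b) \<le> min 1 \<bar>a - b\<bar>" using that by simp
  qed
  show ?thesis
  proof (cases "a \<le> b")
    case True then show ?thesis using *[of a b] assms by simp
  next
    case False then show ?thesis using *[of b a] assms by (simp add: abs_minus_commute)
  qed
qed

context exchangeable_law
begin

definition scaled_dev :: "(nat \<Rightarrow> real) \<Rightarrow> nat \<Rightarrow> real" where
  "scaled_dev w \<tau> = (1 / sqrt (real t)) * (w \<tau> - 1)"

text \<open>
  Equals \<open>t\<close> to the power \<open>- e / 2\<close>.
\<close>
definition rate :: real where
  "rate = real t * (1 / sqrt (real t)) powr (2 + e)"

definition emp_var :: "(nat \<Rightarrow> real) \<Rightarrow> real" where
  "emp_var w = 1 / real t * (\<Sum>\<tau><t. (w \<tau> - 1)\<^sup>2)"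

lemma emp_var_measurable [measurable]: "emp_var \<in> borel_measurable \<nu>"
  unfolding emp_var_def[abs_def] by measurable

lemma emp_var_eq: "(\<Sum>\<tau><t. (scaled_dev w \<tau>)\<^sup>2) = emp_var w"
  by (simp add: scaled_dev_def emp_var_def power_mult_distrib power_divide sum_distrib_left)

text \<open>
  For fixed weights the squared coefficients sum to \<open>emp_var\<close>, and the Gaussian approximation of
  \<open>\<psi>\<close> costs a sum of powers of the weights that the moment bound controls.
\<close>
lemma char_first_copy:
  fixes \<psi> :: "(nat \<Rightarrow> real) \<Rightarrow> complex"
  assumes [measurable]: "(\<lambda>w. \<psi> (scaled_dev w)) \<in> borel_measurable \<nu>"
    and \<psi>: "\<And>u. cmod (\<psi> u) \<le> 1" "\<And>u. cmod (\<psi> u - complex_of_real (exp (- s * (\<Sum>\<tau><t. (u \<tau>)\<^sup>2) / 2)))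
      \<le> C * (\<Sum>\<tau><t. \<bar>u \<tau>\<bar> powr (2 + e))"
    and "s \<ge> 0" "C \<ge> 0"
  shows "cmod ((\<integral>w. \<psi> (scaled_dev w) \<partial>\<nu>) - complex_of_real (exp (- s * c\<^sup>2 / 2)))
    \<le> C * (1 + K) * rate + (\<integral>w. min 1 (s / 2 * \<bar>emp_var w - c\<^sup>2\<bar>) \<partial>\<nu>)"
proof -
  let ?l = "complex_of_real (exp (- s * c\<^sup>2 / 2))"
  let ?p = "(1 / sqrt (real t)) powr (2 + e)"
  let ?T = "\<lambda>w. \<Sum>\<tau><t. \<bar>w \<tau> - 1\<bar> powr (2 + e)"
  have i: "integrable \<nu> (\<lambda>w. \<psi> (scaled_dev w))"
    by (rule integrable_const_bound[where B=1]) (auto simp: \<psi>)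
  have im: "integrable \<nu> (\<lambda>w. min 1 (s / 2 * \<bar>emp_var w - c\<^sup>2\<bar>))"
    by (rule integrable_const_bound[where B=1]) (use \<open>s \<ge> 0\<close> in auto)
  have pt: "cmod (\<psi> (scaled_dev w) - ?l) \<le> C * ?p * ?T w + min 1 (s / 2 * \<bar>emp_var w - c\<^sup>2\<bar>)" for w
  proof -
    have "(\<Sum>\<tau><t. \<bar>scaled_dev w \<tau>\<bar> powr (2 + e)) = ?p * ?T w"
      by (simp add: scaled_dev_def abs_mult abs_divide powr_mult powr_divide sum_distrib_left sum_divide_distrib)
    then have 1: "cmod (\<psi> (scaled_dev w) - complex_of_real (exp (- s * emp_var w / 2))) \<le> C * (?p * ?T w)"
      using \<psi>(2)[of "scaled_dev w"] unfolding emp_var_eq by simp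
    have ev: "emp_var w \<ge> 0" by (simp add: emp_var_def sum_nonneg)
    have "cmod (complex_of_real (exp (- s * emp_var w / 2)) - ?l) = \<bar>exp (- (s * emp_var w / 2)) - exp (- (s * c\<^sup>2 / 2))\<bar>"
      by (simp flip: of_real_diff)
    also have "\<dots> \<le> min 1 \<bar>s * emp_var w / 2 - s * c\<^sup>2 / 2\<bar>"
      using \<open>s \<ge> 0\<close> ev by (intro exp_minus_diff_le) auto
    also have "\<bar>s * emp_var w / 2 - s * c\<^sup>2 / 2\<bar> = s / 2 * \<bar>emp_var w - c\<^sup>2\<bar>"
      using \<open>s \<ge> 0\<close> by (simp add: abs_mult flip: right_diff_distrib diff_divide_distrib)
    finally have 2: "cmod (complex_of_real (exp (- s * emp_var w / 2)) - ?l) \<le> min 1 (s / 2 * \<bar>emp_var w - c\<^sup>2\<bar>)" .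
    have "cmod (\<psi> (scaled_dev w) - ?l) \<le> cmod (\<psi> (scaled_dev w) - complex_of_real (exp (- s * emp_var w / 2)))
        + cmod (complex_of_real (exp (- s * emp_var w / 2)) - ?l)"
      unfolding dist_norm[symmetric] by (rule dist_triangle)
    then show ?thesis using 1 2 unfolding mult.assoc by linarith
  qed
  have "cmod ((\<integral>w. \<psi> (scaled_dev w) \<partial>\<nu>) - ?l) = cmod (\<integral>w. \<psi> (scaled_dev w) - ?l \<partial>\<nu>)"
    using i by (simp add: prob_space)
  also have "\<dots> \<le> (\<integral>w. cmod (\<psi> (scaled_dev w) - ?l) \<partial>\<nu>)" by (rule integral_norm_bound)
  also have "\<dots> \<le> (\<integral>w. C * ?p * ?T w + min 1 (s / 2 * \<bar>emp_var w - c\<^sup>2\<bar>) \<partial>\<nu>)"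
    using i im dev_powr_integrable pt by (intro integral_mono) auto
  also have "\<dots> = C * ?p * (\<integral>w. ?T w \<partial>\<nu>) + (\<integral>w. min 1 (s / 2 * \<bar>emp_var w - c\<^sup>2\<bar>) \<partial>\<nu>)"
    using im dev_powr_integrable by simp
  also have "C * ?p * (\<integral>w. ?T w \<partial>\<nu>) \<le> C * ?p * (real t * (1 + K))"
    using dev_powr_le \<open>C \<ge> 0\<close> by (intro mult_left_mono) auto
  finally show ?thesis by (simp add: rate_def mult_ac)
qed

text \<open>
  For two copies the squared coefficients sum to \<open>emp_var w + emp_var w' - 2 Cr w w'\<close>. For fixed
  \<open>w\<close> the cross term \<open>Cr w w'\<close> is a weighted sum of \<open>w' - 1\<close> with coefficients of sum zero, so
  its second moment is known exactly and of order \<open>1/t\<close>.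
\<close>
lemma char_two_copies:
  fixes \<psi> :: "(nat \<Rightarrow> real) \<Rightarrow> complex"
  assumes [measurable]: "(\<lambda>(w, w'). \<psi> (\<lambda>\<tau>. scaled_dev w \<tau> - scaled_dev w' \<tau>)) \<in> borel_measurable (\<nu> \<Otimes>\<^sub>M \<nu>)"
    and \<psi>: "\<And>u. cmod (\<psi> u) \<le> 1" "\<And>u. cmod (\<psi> u - complex_of_real (exp (- s * (\<Sum>\<tau><t. (u \<tau>)\<^sup>2) / 2)))
      \<le> C * (\<Sum>\<tau><t. \<bar>u \<tau>\<bar> powr (2 + e))"
    and "s \<ge> 0" "C \<ge> 0"
  shows "cmod ((\<integral>w. (\<integral>w'. \<psi> (\<lambda>\<tau>. scaled_dev w \<tau> - scaled_dev w' \<tau>) \<partial>\<nu>) \<partial>\<nu>) - complex_of_real ((exp (- s * c\<^sup>2 / 2))\<^sup>2))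
    \<le> 2 * C * K * rate + 2 * (\<integral>w. min 1 (s / 2 * \<bar>emp_var w - c\<^sup>2\<bar>) \<partial>\<nu>)
      + s / 2 * (1 / sqrt (real t) + sqrt (real t) * ((2 * (1 + K))\<^sup>2 / (real t - 1)))"
proof -
  let ?l = "complex_of_real ((exp (- s * c\<^sup>2 / 2))\<^sup>2)"
  let ?p = "(1 / sqrt (real t)) powr (2 + e)"
  let ?T = "\<lambda>w. \<Sum>\<tau><t. w \<tau> powr (2 + e)"
  let ?m = "\<lambda>w. min 1 (s / 2 * \<bar>emp_var w - c\<^sup>2\<bar>)"
  let ?D = "\<lambda>w w' \<tau>. scaled_dev w \<tau> - scaled_dev w' \<tau>"
  define Cr where "Cr w w' = 1 / real t * (\<Sum>\<tau><t. (w \<tau> - 1) * (w' \<tau> - 1))" for w w' :: "nat \<Rightarrow> real"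
  define d where "d = dev_cov 0 0"
  have t1: "real t > 1" using t by simp
  interpret pair_sigma_finite \<nu> \<nu> ..
  have im: "integrable \<nu> ?m"
    by (rule integrable_const_bound[where B=1]) (use \<open>s \<ge> 0\<close> in auto)
  have iT: "integrable \<nu> ?T" by (intro Bochner_Integration.integrable_sum powr_integrable) simp
  have ET: "(\<integral>w. ?T w \<partial>\<nu>) \<le> real t * K"
  proof -
    have "(\<integral>w. ?T w \<partial>\<nu>) = (\<Sum>\<tau><t. \<integral>w. w \<tau> powr (2 + e) \<partial>\<nu>)"
      by (rule Bochner_Integration.integral_sum) (auto intro: powr_integrable)
    also have "\<dots> \<le> (\<Sum>\<tau><t. K)" by (intro sum_mono powr_integral_le) simp
    finally show ?thesis by simp
  qed
  have pt: "cmod (\<psi> (?D w w') - ?l) \<le> C * ?p * (?T w + ?T w') + (?m w + ?m w')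
      + s / 2 * (1 / sqrt (real t) + sqrt (real t) * (Cr w w')\<^sup>2)"
    if w: "\<forall>\<tau><t. 0 \<le> w \<tau>" "\<forall>\<tau><t. 0 \<le> w' \<tau>" for w w'
  proof -
    have "(\<Sum>\<tau><t. \<bar>?D w w' \<tau>\<bar> powr (2 + e)) = ?p * (\<Sum>\<tau><t. \<bar>w \<tau> - w' \<tau>\<bar> powr (2 + e))"
      by (simp add: scaled_dev_def abs_divide powr_divide sum_distrib_left sum_divide_distrib flip: diff_divide_distrib)
    also have "\<dots> \<le> ?p * (?T w + ?T w')"
      unfolding sum.distrib[symmetric] using w by (intro mult_left_mono sum_mono powr_diff_le) auto
    finally have "C * (\<Sum>\<tau><t. \<bar>?D w w' \<tau>\<bar> powr (2 + e)) \<le> C * (?p * (?T w + ?T w'))"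
      using \<open>C \<ge> 0\<close> by (rule mult_left_mono)
    then have 1: "cmod (\<psi> (?D w w') - complex_of_real (exp (- s * (\<Sum>\<tau><t. (?D w w' \<tau>)\<^sup>2) / 2))) \<le> C * ?p * (?T w + ?T w')"
      using \<psi>(2)[of "?D w w'"] by (simp add: mult.assoc)
    let ?V = "\<Sum>\<tau><t. (?D w w' \<tau>)\<^sup>2"
    have V0: "?V \<ge> 0" by (rule sum_nonneg) simp
    have V: "?V = emp_var w + emp_var w' - 2 * Cr w w'"
    proof -
      have "(?D w w' \<tau>)\<^sup>2 = 1 / real t * (w \<tau> - 1)\<^sup>2 + 1 / real t * (w' \<tau> - 1)\<^sup>2 - 2 * (1 / real t * ((w \<tau> - 1) * (w' \<tau> - 1)))" for \<tau>
      proof -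
        have "?D w w' \<tau> = (1 / sqrt (real t)) * ((w \<tau> - 1) - (w' \<tau> - 1))"
          unfolding scaled_dev_def by (rule right_diff_distrib[symmetric])
        then have "(?D w w' \<tau>)\<^sup>2 = 1 / real t * ((w \<tau> - 1) - (w' \<tau> - 1))\<^sup>2"
          by (simp only: power_mult_distrib power_divide real_sqrt_pow2 of_nat_0_le_iff power_one)
        then show ?thesis by (simp only: power2_diff) (simp add: algebra_simps)
      qed
      then show ?thesis
        by (simp only: sum.distrib sum_subtractf sum_distrib_left emp_var_def Cr_def)
    qed
    have "(exp (- s * c\<^sup>2 / 2))\<^sup>2 = exp (- (s * c\<^sup>2))" by (simp add: power2_eq_square flip: exp_add)
    then have "cmod (complex_of_real (exp (- s * ?V / 2)) - ?l) = \<bar>exp (- (s * ?V / 2)) - exp (- (s * c\<^sup>2))\<bar>"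
      by (simp flip: of_real_diff)
    also have "\<dots> \<le> min 1 \<bar>s * ?V / 2 - s * c\<^sup>2\<bar>"
      using \<open>s \<ge> 0\<close> V0 by (intro exp_minus_diff_le) auto
    also have "\<dots> \<le> (?m w + ?m w') + s * \<bar>Cr w w'\<bar>"
    proof -
      have "s * ?V / 2 - s * c\<^sup>2 = s / 2 * (emp_var w - c\<^sup>2) + s / 2 * (emp_var w' - c\<^sup>2) - s * Cr w w'"
        unfolding V by (simp add: field_simps)
      also have "\<bar>\<dots>\<bar> \<le> s / 2 * \<bar>emp_var w - c\<^sup>2\<bar> + s / 2 * \<bar>emp_var w' - c\<^sup>2\<bar> + s * \<bar>Cr w w'\<bar>"
      proof -
        have eq: "s / 2 * \<bar>y\<bar> = \<bar>s / 2 * y\<bar>" "s * \<bar>y\<bar> = \<bar>s * y\<bar>" for y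
          using \<open>s \<ge> 0\<close> by (simp_all add: abs_mult)
        have "\<bar>p + q - r\<bar> \<le> \<bar>p\<bar> + \<bar>q\<bar> + \<bar>r\<bar>" for p q r :: real by linarith
        then show ?thesis unfolding eq .
      qed
      finally have a: "\<bar>s * ?V / 2 - s * c\<^sup>2\<bar> \<le> s / 2 * \<bar>emp_var w - c\<^sup>2\<bar> + s / 2 * \<bar>emp_var w' - c\<^sup>2\<bar> + s * \<bar>Cr w w'\<bar>" .
      have m3: "min 1 (y1 + y2 + y3) \<le> (min 1 y1 + min 1 y2) + y3" if "0 \<le> y1" "0 \<le> y2" "0 \<le> y3" for y1 y2 y3 :: real
        using that by (auto simp: min_def)
      show ?thesis
        by (rule order_trans[OF min.mono[OF order_refl a] m3]) (use \<open>s \<ge> 0\<close> in auto)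
    qed
    also have "s * \<bar>Cr w w'\<bar> \<le> s / 2 * (1 / sqrt (real t) + sqrt (real t) * (Cr w w')\<^sup>2)"
    proof -
      have r: "sqrt (real t) > 0" using t1 by simp
      \<comment> \<open>Linearizes \<open>\<bar>Cr\<bar>\<close> by its square, whose integral is known, with the weight \<open>\<surd>t\<close> that
      balances the two terms.\<close>
      have "0 \<le> (1 - sqrt (real t) * \<bar>Cr w w'\<bar>)\<^sup>2" by simp
      then have "2 * (sqrt (real t) * \<bar>Cr w w'\<bar>) \<le> 1 + (sqrt (real t))\<^sup>2 * (Cr w w')\<^sup>2"
        by (simp add: power2_diff power_mult_distrib)
      then have "2 * \<bar>Cr w w'\<bar> \<le> (1 + (sqrt (real t))\<^sup>2 * (Cr w w')\<^sup>2) / sqrt (real t)"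
        using r by (simp add: pos_le_divide_eq mult_ac)
      also have "\<dots> = 1 / sqrt (real t) + sqrt (real t) * (Cr w w')\<^sup>2"
      proof -
        have "(1 + q\<^sup>2 * y) / q = 1 / q + q * y" if "q > 0" for q y :: real
          using that by (simp add: add_divide_distrib power2_eq_square)
        then show ?thesis using r by (simp only:)
      qed
      finally have "s / 2 * (2 * \<bar>Cr w w'\<bar>) \<le> s / 2 * (1 / sqrt (real t) + sqrt (real t) * (Cr w w')\<^sup>2)"
        using \<open>s \<ge> 0\<close> by (intro mult_left_mono) auto
      then show ?thesis by simp
    qed
    finally have 2: "cmod (complex_of_real (exp (- s * ?V / 2)) - ?l)
      \<le> (?m w + ?m w') + s / 2 * (1 / sqrt (real t) + sqrt (real t) * (Cr w w')\<^sup>2)" by simp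
    have "cmod (\<psi> (?D w w') - ?l) \<le> cmod (\<psi> (?D w w') - complex_of_real (exp (- s * ?V / 2)))
        + cmod (complex_of_real (exp (- s * ?V / 2)) - ?l)"
      unfolding dist_norm[symmetric] by (rule dist_triangle)
    then show ?thesis using 1 2 by linarith
  qed
  have CrM [measurable]: "(\<lambda>w'. Cr w w') \<in> borel_measurable \<nu>" for w unfolding Cr_def by measurable
  have Cr2: "integrable \<nu> (\<lambda>w'. (Cr w w')\<^sup>2)"
    "(\<integral>w'. (Cr w w')\<^sup>2 \<partial>\<nu>) = d * (real t / (real t - 1)) * ((1 / real t)\<^sup>2 * (\<Sum>\<tau><t. (w \<tau> - 1)\<^sup>2))"
    if "(\<Sum>\<tau><t. w \<tau>) = real t" for w
  proof -
    have "(\<Sum>\<tau><t. w \<tau> - 1) = 0" using that by (simp add: sum_subtractf)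
    note m = weighted_dev_second_moment[OF this]
    show "integrable \<nu> (\<lambda>w'. (Cr w w')\<^sup>2)"
      using integrable_mult_right[OF m(1), of "(1 / real t)\<^sup>2"] by (simp add: Cr_def power_mult_distrib power_divide)
    have "(\<integral>w'. (Cr w w')\<^sup>2 \<partial>\<nu>) = (\<integral>w'. (1 / real t)\<^sup>2 * (\<Sum>\<tau><t. (w \<tau> - 1) * (w' \<tau> - 1))\<^sup>2 \<partial>\<nu>)"
      by (simp only: Cr_def power_mult_distrib)
    also have "\<dots> = (1 / real t)\<^sup>2 * (\<integral>w'. (\<Sum>\<tau><t. (w \<tau> - 1) * (w' \<tau> - 1))\<^sup>2 \<partial>\<nu>)" by (rule integral_mult_right_zero)
    finally show "(\<integral>w'. (Cr w w')\<^sup>2 \<partial>\<nu>) = d * (real t / (real t - 1)) * ((1 / real t)\<^sup>2 * (\<Sum>\<tau><t. (w \<tau> - 1)\<^sup>2))"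
      unfolding m(2) d_def by (simp only: mult_ac)
  qed
  have \<psi>M: "(\<lambda>w'. \<psi> (?D w w')) \<in> borel_measurable \<nu>" if [measurable]: "w \<in> space \<nu>" for w by measurable
  have i\<psi>: "integrable \<nu> (\<lambda>w'. \<psi> (?D w w'))" if "w \<in> space \<nu>" for w
    by (rule integrable_const_bound[where B=1]) (use \<psi>M[OF that] \<psi>(1) in auto)
  define g where "g w = (\<integral>w'. cmod (\<psi> (?D w w') - ?l) \<partial>\<nu>)" for w
  have gM [measurable]: "g \<in> borel_measurable \<nu>" unfolding g_def[abs_def] by measurable
  \<comment> \<open>\<open>A w\<close> is the integral over \<open>w'\<close> of the pointwise bound, with \<open>?T w'\<close> replaced by its moment
  bound.\<close>
  define A where "A w = C * ?p * (?T w + real t * K) + (?m w + (\<integral>w. ?m w \<partial>\<nu>))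
      + s / 2 * (1 / sqrt (real t) + sqrt (real t) * (d * (real t / (real t - 1)) * ((1 / real t)\<^sup>2 * (\<Sum>\<tau><t. (w \<tau> - 1)\<^sup>2))))" for w
  have gA: "AE w in \<nu>. g w \<le> A w"
    using nonneg total AE_space
  proof eventually_elim
    case (elim w)
    have "g w \<le> (\<integral>w'. C * ?p * (?T w + ?T w') + (?m w + ?m w')
      + s / 2 * (1 / sqrt (real t) + sqrt (real t) * (Cr w w')\<^sup>2) \<partial>\<nu>)"
      unfolding g_def
    proof (rule integral_mono_AE)
      show "integrable \<nu> (\<lambda>w'. cmod (\<psi> (?D w w') - ?l))" using i\<psi>[OF elim(3)] by simp
      show "integrable \<nu> (\<lambda>w'. C * ?p * (?T w + ?T w') + (?m w + ?m w')
        + s / 2 * (1 / sqrt (real t) + sqrt (real t) * (Cr w w')\<^sup>2))"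
        using iT im Cr2(1)[OF elim(2)] by simp
      show "AE w' in \<nu>. cmod (\<psi> (?D w w') - ?l) \<le> C * ?p * (?T w + ?T w') + (?m w + ?m w')
        + s / 2 * (1 / sqrt (real t) + sqrt (real t) * (Cr w w')\<^sup>2)"
        using nonneg by eventually_elim (rule pt[OF elim(1)])
    qed
    also have "\<dots> = C * ?p * (?T w + (\<integral>w'. ?T w' \<partial>\<nu>)) + (?m w + (\<integral>w'. ?m w' \<partial>\<nu>))
      + s / 2 * (1 / sqrt (real t) + sqrt (real t) * (\<integral>w'. (Cr w w')\<^sup>2 \<partial>\<nu>))"
      using iT im Cr2(1)[OF elim(2)] by (simp add: prob_space)
    also have "\<dots> \<le> A w"
      unfolding A_def Cr2(2)[OF elim(2)]
      using ET \<open>C \<ge> 0\<close> by (intro add_mono mult_left_mono order_refl) auto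
    finally show ?case .
  qed
  have sqdev: "integrable \<nu> (\<lambda>w. \<Sum>\<tau><t. (w \<tau> - 1)\<^sup>2)" "(\<integral>w. (\<Sum>\<tau><t. (w \<tau> - 1)\<^sup>2) \<partial>\<nu>) = real t * d"
  proof -
    have sq: "integrable \<nu> (\<lambda>w. (w \<tau> - 1)\<^sup>2)" if "\<tau> < t" for \<tau>
      using dev_prod_integrable[OF that that] by (simp add: power2_eq_square)
    then show "integrable \<nu> (\<lambda>w. \<Sum>\<tau><t. (w \<tau> - 1)\<^sup>2)" by (intro Bochner_Integration.integrable_sum) simp
    have "(\<integral>w. (\<Sum>\<tau><t. (w \<tau> - 1)\<^sup>2) \<partial>\<nu>) = (\<Sum>\<tau><t. \<integral>w. (w \<tau> - 1)\<^sup>2 \<partial>\<nu>)"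
      by (rule Bochner_Integration.integral_sum) (use sq in auto)
    also have "\<dots> = (\<Sum>\<tau><t. d)"
    proof (intro sum.cong refl)
      fix \<tau> assume "\<tau> \<in> {..<t}"
      then have "dev_cov \<tau> \<tau> = d" unfolding d_def by (intro dev_cov_diag) simp
      then show "(\<integral>w. (w \<tau> - 1)\<^sup>2 \<partial>\<nu>) = d" unfolding dev_cov_def by (simp only: power2_eq_square)
    qed
    finally show "(\<integral>w. (\<Sum>\<tau><t. (w \<tau> - 1)\<^sup>2) \<partial>\<nu>) = real t * d" by simp
  qed
  have gb: "cmod (\<psi> (?D w w') - ?l) \<le> 2" for w w'
  proof -
    have "cmod ?l \<le> 1" using \<open>s \<ge> 0\<close> by (simp add: norm_power power_le_one)
    then show ?thesis using \<psi>(1)[of "?D w w'"] norm_triangle_ineq4[of "\<psi> (?D w w')" ?l] by linarith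
  qed
  have ig: "integrable \<nu> g"
  proof (rule integrable_const_bound[where B=2])
    show "AE w in \<nu>. norm (g w) \<le> 2"
    proof (rule AE_I2)
      fix w assume w: "w \<in> space \<nu>"
      have "g w \<le> (\<integral>w'. 2 \<partial>\<nu>)" unfolding g_def using i\<psi>[OF w] gb by (intro integral_mono) auto
      moreover have "0 \<le> g w" unfolding g_def by simp
      ultimately show "norm (g w) \<le> 2" by (simp add: prob_space)
    qed
  qed measurable
  have iA: "integrable \<nu> A" unfolding A_def using iT im sqdev(1) by simp
  have "cmod ((\<integral>w. (\<integral>w'. \<psi> (?D w w') \<partial>\<nu>) \<partial>\<nu>) - ?l) = cmod (\<integral>w. (\<integral>w'. \<psi> (?D w w') \<partial>\<nu>) - ?l \<partial>\<nu>)"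
  proof -
    have "integrable \<nu> (\<lambda>w. \<integral>w'. \<psi> (?D w w') \<partial>\<nu>)"
    proof (rule integrable_const_bound[where B=1])
      show "AE w in \<nu>. norm (\<integral>w'. \<psi> (?D w w') \<partial>\<nu>) \<le> 1"
      proof (rule AE_I2)
        fix w assume w: "w \<in> space \<nu>"
        have "norm (\<integral>w'. \<psi> (?D w w') \<partial>\<nu>) \<le> (\<integral>w'. cmod (\<psi> (?D w w')) \<partial>\<nu>)" by (rule integral_norm_bound)
        also have "\<dots> \<le> (\<integral>w'. 1 \<partial>\<nu>)" using i\<psi>[OF w] \<psi>(1) by (intro integral_mono) auto
        finally show "norm (\<integral>w'. \<psi> (?D w w') \<partial>\<nu>) \<le> 1" by (simp add: prob_space)
      qed
    qed measurable
    then show ?thesis by (simp add: prob_space)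
  qed
  also have "\<dots> \<le> (\<integral>w. cmod ((\<integral>w'. \<psi> (?D w w') \<partial>\<nu>) - ?l) \<partial>\<nu>)" by (rule integral_norm_bound)
  also have "\<dots> \<le> (\<integral>w. A w \<partial>\<nu>)"
  proof (rule integral_mono_AE')
    show "AE w in \<nu>. cmod ((\<integral>w'. \<psi> (?D w w') \<partial>\<nu>) - ?l) \<le> A w"
      using gA AE_space
    proof eventually_elim
      case (elim w)
      have "cmod ((\<integral>w'. \<psi> (?D w w') \<partial>\<nu>) - ?l) = cmod (\<integral>w'. \<psi> (?D w w') - ?l \<partial>\<nu>)"
        using i\<psi>[OF elim(2)] by (simp add: prob_space)
      also have "\<dots> \<le> g w" unfolding g_def by (rule integral_norm_bound)
      finally show ?case using elim(1) by simp
    qed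
    have "0 \<le> g w" for w unfolding g_def by simp
    then show "AE w in \<nu>. 0 \<le> A w" using gA by (auto elim!: eventually_mono intro: order_trans)
  qed (rule iA)
  also have "(\<integral>w. A w \<partial>\<nu>) = C * ?p * ((\<integral>w. ?T w \<partial>\<nu>) + real t * K) + ((\<integral>w. ?m w \<partial>\<nu>) + (\<integral>w. ?m w \<partial>\<nu>))
      + s / 2 * (1 / sqrt (real t) + sqrt (real t) * (d * (real t / (real t - 1)) * ((1 / real t)\<^sup>2 * (real t * d))))"
    unfolding A_def using iT im sqdev by (simp add: prob_space)
  also have "\<dots> \<le> C * ?p * (real t * K + real t * K) + ((\<integral>w. ?m w \<partial>\<nu>) + (\<integral>w. ?m w \<partial>\<nu>))
      + s / 2 * (1 / sqrt (real t) + sqrt (real t) * ((2 * (1 + K))\<^sup>2 / (real t - 1)))"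
  proof (intro add_mono mult_left_mono ET order_refl)
    have "d * (real t / (real t - 1)) * ((1 / real t)\<^sup>2 * (real t * d)) = d\<^sup>2 / (real t - 1)"
      using t1 by (simp add: power2_eq_square)
    also have "\<dots> \<le> (2 * (1 + K))\<^sup>2 / (real t - 1)"
      using dev_var_bounds t1 by (intro divide_right_mono power_mono) (auto simp: d_def)
    finally show "d * (real t / (real t - 1)) * ((1 / real t)\<^sup>2 * (real t * d)) \<le> (2 * (1 + K))\<^sup>2 / (real t - 1)" .
  qed (use \<open>C \<ge> 0\<close> \<open>s \<ge> 0\<close> in auto)
  finally show ?thesis by (simp add: rate_def algebra_simps)
qed

end

section \<open>The bootstrap error and its linearization\<close>

text \<open>
  Deduces first-moment from second-moment convergence without square roots of integrals, through
  \<open>y \<le> a / 2 + y\<^sup>2 / (2 a)\<close>.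
\<close>
lemma LIMSEQ_0_if_bounded_by_small:
  fixes p q :: "nat \<Rightarrow> real"
  assumes q: "q \<longlonglongrightarrow> 0" and p: "\<And>t. 0 \<le> p t"
    and bound: "\<And>a t. 0 < a \<Longrightarrow> p t \<le> a / 2 + q t / (2 * a)"
  shows "p \<longlonglongrightarrow> 0"
proof (rule tendstoI)
  fix r :: real assume r: "0 < r"
  have lim: "(\<lambda>t. q t / (2 * r)) \<longlonglongrightarrow> 0" by (rule tendsto_divide_zero[OF q])
  have "\<forall>\<^sub>F t in sequentially. q t / (2 * r) < r / 2" by (rule order_tendstoD(2)[OF lim]) (use r in simp)
  then show "\<forall>\<^sub>F t in sequentially. dist (p t) 0 < r"
  proof eventually_elim
    case (elim t)
    have "p t < r" using bound[OF r, of t] elim by linarith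
    then show ?case using p[of t] by simp
  qed
qed

lemma coord_borel: "\<tau> < t \<Longrightarrow> (\<lambda>w. w \<tau>) \<in> borel_measurable (PiM {..<t} (\<lambda>_. borel :: real measure))"
  by (rule measurable_component_singleton) simp

lemma pred_good_weights: "Measurable.pred (PiM {..<t} (\<lambda>_. borel)) (good_weights t)"
proof -
  note [measurable] = coord_borel
  have eq: "good_weights t = (\<lambda>w. (\<forall>\<tau>\<in>{..<t}. 0 \<le> w \<tau>) \<and> (\<Sum>\<tau><t. w \<tau>) = real t)"
    by (rule ext) (simp add: good_weights_def Ball_def)
  show ?thesis unfolding eq by measurable
qed

text \<open>
  \<open>\<nu> t\<close> is the law of the weight vector at sample size \<open>t\<close>. The exchangeability laws start at \<open>t
  = 2\<close>, as the covariance of two distinct weights carries the factor \<open>1 / (t - 1)\<close>.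
\<close>
locale fisher_bootstrap = fisher_limit N v b \<beta>s V
  for N :: "'a measure" and v :: "'n::finite \<Rightarrow> 'a \<Rightarrow> real" and b :: "'n \<Rightarrow> real" and \<beta>s :: "real^'n" and V :: real +
  fixes \<nu> :: "nat \<Rightarrow> (nat \<Rightarrow> real) measure" and c e K :: real
  assumes laws: "\<And>t. t \<ge> 2 \<Longrightarrow> exchangeable_law (\<nu> t) t e K"
    and var_conv: "\<And>\<epsilon>. \<epsilon> > 0 \<Longrightarrow>
      (\<lambda>t. measure (\<nu> t) {w \<in> space (\<nu> t). \<bar>1 / real t * (\<Sum>\<tau><t. (w \<tau> - 1)\<^sup>2) - c\<^sup>2\<bar> > \<epsilon>}) \<longlonglongrightarrow> 0"
begin

abbreviation \<mu> :: "nat \<Rightarrow> (nat \<Rightarrow> 'a) measure" where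
  "\<mu> t \<equiv> PiM {..<t} (\<lambda>_. N)"

text \<open>
  Replaces weight vectors outside the simplex by the constant weight. The actual weights never
  leave it, but a measurable function of all vectors is needed to form conditional laws.
\<close>
definition clip :: "nat \<Rightarrow> (nat \<Rightarrow> real) \<Rightarrow> nat \<Rightarrow> real" where
  "clip t w = (if good_weights t w then w else (\<lambda>_. 1))"

definition boot_error :: "nat \<Rightarrow> (nat \<Rightarrow> 'a) \<Rightarrow> (nat \<Rightarrow> real) \<Rightarrow> real^'n" where
  "boot_error t x w = sqrt (real t) *\<^sub>R (beta_boot v b t (clip t w) x - beta_emp v b t x)"

text \<open>
  The linearization of \<open>boot_error\<close>.
\<close>
definition boot_linear :: "nat \<Rightarrow> (nat \<Rightarrow> 'a) \<Rightarrow> (nat \<Rightarrow> real) \<Rightarrow> real^'n" where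
  "boot_linear t x w = - (matrix_inv Hess *v weighted_score t (\<lambda>\<tau>. w \<tau> - 1) x)"

lemma good_weights_1: "good_weights t (\<lambda>_. 1)"
  by (simp add: good_weights_def)

lemma good_weights_clip: "good_weights t (clip t w)"
  by (simp add: clip_def good_weights_1)

text \<open>
  On the simplex of weights the objective is continuous with at most one minimizer, and the
  value without a minimizer is constant, as \<open>borel_measurable_unique_argmin\<close> requires.
\<close>
lemma beta_boot_measurable:
  assumes t: "t > 0" and X: "X \<in> M' \<rightarrow>\<^sub>M \<mu> t"
    and W: "\<And>\<tau>. \<tau> < t \<Longrightarrow> (\<lambda>\<omega>. W \<omega> \<tau>) \<in> borel_measurable M'" and good: "\<And>\<omega>. good_weights t (W \<omega>)"
  shows "(\<lambda>\<omega>. beta_boot v b t (W \<omega>) (X \<omega>)) \<in> borel_measurable M'"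
proof (rule borel_measurable_unique_argmin[OF open_pos_orthant, where f = "\<lambda>\<omega>. boot_objective v b t (W \<omega>) (X \<omega>)"])
  show "continuous_on pos_orthant (boot_objective v b t (W \<omega>) (X \<omega>))" for \<omega>
    by (rule continuous_boot_objective[OF good budgets])
  show "(\<lambda>\<omega>. boot_objective v b t (W \<omega>) (X \<omega>) p) \<in> borel_measurable M'" for p
  proof -
    have "(\<lambda>\<omega>. W \<omega> \<tau> * max_bid v (X \<omega> \<tau>) p) \<in> borel_measurable M'" if \<tau>: "\<tau> < t" for \<tau>
    proof (rule borel_measurable_times[OF W[OF \<tau>]])
      have "(\<lambda>\<omega>. X \<omega> \<tau>) \<in> M' \<rightarrow>\<^sub>M N" using measurable_compose[OF X measurable_component_singleton, of \<tau>] \<tau> by simp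
      then show "(\<lambda>\<omega>. max_bid v (X \<omega> \<tau>) p) \<in> borel_measurable M'"
        by (rule measurable_compose) measurable
    qed
    then have "(\<lambda>\<omega>. \<Sum>\<tau><t. W \<omega> \<tau> * max_bid v (X \<omega> \<tau>) p) \<in> borel_measurable M'"
      by (intro borel_measurable_sum) simp
    then show ?thesis unfolding boot_objective_def
      by (rule borel_measurable_add[OF borel_measurable_times[OF borel_measurable_const] borel_measurable_const])
  qed
  show "p = q" if "p \<in> pos_orthant" "q \<in> pos_orthant"
    "\<And>y. y \<in> pos_orthant \<Longrightarrow> boot_objective v b t (W \<omega>) (X \<omega>) p \<le> boot_objective v b t (W \<omega>) (X \<omega>) y"
    "\<And>y. y \<in> pos_orthant \<Longrightarrow> boot_objective v b t (W \<omega>) (X \<omega>) q \<le> boot_objective v b t (W \<omega>) (X \<omega>) y" for \<omega> p q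
    by (rule boot_minimizer_unique[OF good that])
  show "beta_boot v b t (W \<omega>) (X \<omega>) \<in> pos_orthant \<and>
      (\<forall>y\<in>pos_orthant. boot_objective v b t (W \<omega>) (X \<omega>) (beta_boot v b t (W \<omega>) (X \<omega>)) \<le> boot_objective v b t (W \<omega>) (X \<omega>) y)"
    if "\<exists>p\<in>pos_orthant. \<forall>y\<in>pos_orthant. boot_objective v b t (W \<omega>) (X \<omega>) p \<le> boot_objective v b t (W \<omega>) (X \<omega>) y" for \<omega>
    by (rule beta_boot_minimizes[OF good t budgets that])
  show "beta_boot v b t (W \<omega>) (X \<omega>) = (SOME p. False)"
    if "\<not> (\<exists>p\<in>pos_orthant. \<forall>y\<in>pos_orthant. boot_objective v b t (W \<omega>) (X \<omega>) p \<le> boot_objective v b t (W \<omega>) (X \<omega>) y)" for \<omega>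
    by (rule beta_boot_default[OF good t budgets that])
qed

lemma sets_nu: "t \<ge> 2 \<Longrightarrow> sets (\<nu> t) = sets (PiM {..<t} (\<lambda>_. borel))"
  using exchangeable_law.sets_nu[OF laws] .

lemma clip_measurable: "\<tau> < t \<Longrightarrow> (\<lambda>w. clip t w \<tau>) \<in> borel_measurable (PiM {..<t} (\<lambda>_. borel))"
proof -
  assume \<tau>: "\<tau> < t"
  note [measurable] = coord_borel pred_good_weights
  have "(\<lambda>w. if good_weights t w then w \<tau> else 1) \<in> borel_measurable (PiM {..<t} (\<lambda>_. borel))"
    using coord_borel[OF \<tau>] by measurable
  moreover have "(\<lambda>w. clip t w \<tau>) = (\<lambda>w. if good_weights t w then w \<tau> else 1)" by (auto simp: clip_def)
  ultimately show ?thesis by simp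
qed

lemma boot_error_measurable:
  assumes t: "t > 0"
  shows "(\<lambda>(x, w). boot_error t x w) \<in> borel_measurable (\<mu> t \<Otimes>\<^sub>M PiM {..<t} (\<lambda>_. borel))"
proof -
  have "(\<lambda>p. beta_boot v b t (clip t (snd p)) (fst p)) \<in> borel_measurable (\<mu> t \<Otimes>\<^sub>M PiM {..<t} (\<lambda>_. borel))"
    by (rule beta_boot_measurable[OF t measurable_fst]) (auto intro: good_weights_clip measurable_compose[OF measurable_snd clip_measurable])
  moreover have "(\<lambda>p. beta_boot v b t (\<lambda>_. 1) (fst p)) \<in> borel_measurable (\<mu> t \<Otimes>\<^sub>M PiM {..<t} (\<lambda>_. borel))"
    by (rule beta_boot_measurable[OF t measurable_fst]) (auto intro: good_weights_1)
  ultimately show ?thesis unfolding boot_error_def beta_emp_eq_beta_boot split_beta'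
    by (intro borel_measurable_scaleR borel_measurable_diff) auto
qed

lemma boot_linear_inner:
  "\<xi> \<bullet> boot_linear t x w = (\<Sum>\<tau><t. (1 / sqrt (real t)) * (w \<tau> - 1) * (score (x \<tau>) \<bullet> (- (matrix_inv Hess *v \<xi>))))"
proof -
  have "\<xi> \<bullet> boot_linear t x w = - (weighted_score t (\<lambda>\<tau>. w \<tau> - 1) x \<bullet> (matrix_inv Hess *v \<xi>))"
    unfolding boot_linear_def inner_minus_right by (rule arg_cong[OF trans[OF inner_Hess_inverse inner_commute]])
  then show ?thesis by (simp add: weighted_score_inner sum_distrib_left sum_negf mult.assoc)
qed

lemma boot_linear_inner_measurable:
  "(\<lambda>(x, w). \<xi> \<bullet> boot_linear t x w) \<in> borel_measurable (\<mu> t \<Otimes>\<^sub>M PiM {..<t} (\<lambda>_. borel))"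
proof -
  have "(\<lambda>p. (1 / sqrt (real t)) * (snd p \<tau> - 1) * (score (fst p \<tau>) \<bullet> (- (matrix_inv Hess *v \<xi>))))
      \<in> borel_measurable (\<mu> t \<Otimes>\<^sub>M PiM {..<t} (\<lambda>_. borel))" if \<tau>: "\<tau> < t" for \<tau>
  proof (intro borel_measurable_times borel_measurable_diff borel_measurable_const)
    show "(\<lambda>p. snd p \<tau>) \<in> borel_measurable (\<mu> t \<Otimes>\<^sub>M PiM {..<t} (\<lambda>_. borel :: real measure))"
      using measurable_compose[OF measurable_snd[of "\<mu> t" "PiM {..<t} (\<lambda>_. borel :: real measure)"] coord_borel[OF \<tau>]] by simp
    have "(\<lambda>p. fst p \<tau>) \<in> (\<mu> t \<Otimes>\<^sub>M PiM {..<t} (\<lambda>_. borel :: real measure)) \<rightarrow>\<^sub>M N"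
      using measurable_compose[OF measurable_fst measurable_component_singleton, of \<tau>] \<tau> by simp
    then show "(\<lambda>p. score (fst p \<tau>) \<bullet> (- (matrix_inv Hess *v \<xi>))) \<in> borel_measurable (\<mu> t \<Otimes>\<^sub>M PiM {..<t} (\<lambda>_. borel :: real measure))"
      by (rule measurable_compose) (rule score_inner_measurable)
  qed
  then show ?thesis unfolding split_beta' boot_linear_inner by (intro borel_measurable_sum) auto
qed

lemma boot_linear_measurable:
  "(\<lambda>(x, w). boot_linear t x w) \<in> borel_measurable (\<mu> t \<Otimes>\<^sub>M PiM {..<t} (\<lambda>_. borel))"
  using boot_linear_inner_measurable
  by (subst borel_measurable_euclidean_space) (simp add: split_beta' inner_commute)

lemma boot_pair_measurable_nu:
  assumes t: "t \<ge> 2"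
  shows "(\<lambda>(x, w). boot_error t x w) \<in> borel_measurable (\<mu> t \<Otimes>\<^sub>M \<nu> t)"
    and "(\<lambda>(x, w). boot_linear t x w) \<in> borel_measurable (\<mu> t \<Otimes>\<^sub>M \<nu> t)"
    and "(\<lambda>(x, w). \<xi> \<bullet> boot_linear t x w) \<in> borel_measurable (\<mu> t \<Otimes>\<^sub>M \<nu> t)"
  using t boot_error_measurable[of t] boot_linear_measurable[of t] boot_linear_inner_measurable[of \<xi> t]
  by (simp_all add: measurable_cong_sets[OF sets_pair_measure_cong[OF refl sets_nu[OF t]] refl])

definition lin_error :: "nat \<Rightarrow> (nat \<Rightarrow> 'a) \<Rightarrow> real" where
  "lin_error t x = (\<integral>w. min 2 (norm (boot_error t x w - boot_linear t x w)) \<partial>\<nu> t)"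

lemma weighted_score_diff: "weighted_score t (\<lambda>\<tau>. w \<tau> - w' \<tau>) x = weighted_score t w x - weighted_score t w' x"
  by (simp add: weighted_score_def scaleR_diff_left sum_subtractf scaleR_diff_right)

text \<open>
  \<open>fixed_weights_linearization\<close> for the random and for the constant weights, integrated over the
  weights: the factor \<open>(1/t) \<Sum> w\<^sup>2\<close> has mean at most \<open>1 + K\<close>.
\<close>
lemma lin_error_limit: "(\<lambda>t. \<integral>x. lin_error t x \<partial>\<mu> t) \<longlonglongrightarrow> 0"
proof (rule tendstoI)
  fix r :: real assume r: "r > 0"
  have K: "K \<ge> 0" using exchangeable_law.K[OF laws[of 2]] by simp
  define \<delta> where "\<delta> = r / 4"
  define \<epsilon> where "\<epsilon> = r / 4 / (2 + K)"
  have de: "\<delta> / 2 > 0" "\<epsilon> > 0" using r K by (auto simp: \<delta>_def \<epsilon>_def)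
  have "(2 + K) * \<epsilon> = r / 4"
  proof -
    have "a * (y / a) = y" if "a \<noteq> 0" for a y :: real using that by simp
    note cancel = this
    have "2 + K \<noteq> 0" using K by simp
    then show ?thesis unfolding \<epsilon>_def by (rule cancel)
  qed
  then have small: "\<delta> + 2 * \<epsilon> * (1 + K) + 2 * \<epsilon> < r" using r by (simp add: \<delta>_def algebra_simps)
  show "\<forall>\<^sub>F t in sequentially. dist (\<integral>x. lin_error t x \<partial>\<mu> t) 0 < r"
    using fixed_weights_linearization[OF de] eventually_ge_at_top[of 2]
  proof eventually_elim
    case (elim t)
    interpret E: exchangeable_law "\<nu> t" t e K by (rule laws[OF elim(2)])
    interpret P: prob_space "\<mu> t" by (rule PiM_prob_space)
    interpret pair_sigma_finite "\<mu> t" "\<nu> t" ..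
    interpret J: prob_space "\<mu> t \<Otimes>\<^sub>M \<nu> t" by (rule prob_space_pair) unfold_locales
    note [measurable] = boot_pair_measurable_nu(1,2)[OF elim(2)]
    have t0: "t > 0" using elim(2) by simp
    let ?D = "\<lambda>x w. min 2 (norm (boot_error t x w - boot_linear t x w))"
    have DM [measurable]: "(\<lambda>(x, w). ?D x w) \<in> borel_measurable (\<mu> t \<Otimes>\<^sub>M \<nu> t)" by measurable
    define R where "R w x = sqrt (real t) *\<^sub>R (beta_boot v b t w x - \<beta>s) + matrix_inv Hess *v weighted_score t w x" for w x
    have R: "measure (\<mu> t) {x \<in> space (\<mu> t). norm (R w x) \<ge> \<delta> / 2} \<le> \<epsilon> * ((\<Sum>\<tau><t. (w \<tau>)\<^sup>2) / real t)" if "good_weights t w" for w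
      using elim(1) that unfolding R_def by blast
    have RM: "{x \<in> space (\<mu> t). norm (R w x) \<ge> \<delta> / 2} \<in> sets (\<mu> t)" if w: "good_weights t w" for w
    proof -
      have [measurable]: "(\<lambda>x. beta_boot v b t w x) \<in> borel_measurable (\<mu> t)"
        using beta_boot_measurable[OF t0, of "\<lambda>x. x" "\<mu> t" "\<lambda>_. w"] w by simp
      have "(\<lambda>x. (matrix_inv Hess *v weighted_score t w x) \<bullet> i) \<in> borel_measurable (\<mu> t)" for i
        by (simp only: inner_Hess_inverse[symmetric] weighted_score_inner) measurable
      then have [measurable]: "(\<lambda>x. matrix_inv Hess *v weighted_score t w x) \<in> borel_measurable (\<mu> t)"
        by (subst borel_measurable_euclidean_space) auto
      show ?thesis unfolding R_def by measurable
    qed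
    have inner: "(\<integral>x. ?D x w \<partial>\<mu> t) \<le> \<delta> + 2 * \<epsilon> * ((\<Sum>\<tau><t. (w \<tau>)\<^sup>2) / real t) + 2 * \<epsilon>"
      if w: "good_weights t w" and ws [measurable]: "w \<in> space (\<nu> t)" for w
    proof -
      define SA where "SA = {x \<in> space (\<mu> t). norm (R w x) \<ge> \<delta> / 2}"
      define SB where "SB = {x \<in> space (\<mu> t). norm (R (\<lambda>_. 1) x) \<ge> \<delta> / 2}"
      have S [measurable]: "SA \<in> sets (\<mu> t)" "SB \<in> sets (\<mu> t)"
        unfolding SA_def SB_def by (rule RM[OF w], rule RM[OF good_weights_1])
      have ind: "integrable (\<mu> t) (indicator S' :: _ \<Rightarrow> real)" if "S' \<in> sets (\<mu> t)" for S'
        by (intro integrable_real_indicator that) (simp add: less_top[symmetric])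
      have "?D x w \<le> \<delta> + 2 * indicator SA x + 2 * indicator SB x" if x: "x \<in> space (\<mu> t)" for x
      proof (cases "x \<in> SA \<or> x \<in> SB")
        case True
        then show ?thesis using de(1) by (auto split: split_indicator)
      next
        case False
        have "boot_error t x w - boot_linear t x w = R w x - R (\<lambda>_. 1) x"
          unfolding boot_error_def boot_linear_def R_def clip_def weighted_score_diff beta_emp_eq_beta_boot using w
          by (simp add: matrix_vector_mult_diff_distrib algebra_simps)
        then have "norm (boot_error t x w - boot_linear t x w) \<le> norm (R w x) + norm (R (\<lambda>_. 1) x)" by (simp add: norm_triangle_ineq4)
        also have "\<dots> \<le> \<delta>" using False x by (simp add: SA_def SB_def)
        finally show ?thesis using False by simp
      qed
      moreover have "integrable (\<mu> t) (\<lambda>x. ?D x w)"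
        by (rule P.integrable_const_bound[where B=2]) auto
      ultimately have "(\<integral>x. ?D x w \<partial>\<mu> t) \<le> (\<integral>x. \<delta> + 2 * indicator SA x + 2 * indicator SB x \<partial>\<mu> t)"
      proof (intro integral_mono)
        show "integrable (\<mu> t) (\<lambda>x. \<delta> + 2 * indicator SA x + 2 * indicator SB x)"
          by (intro Bochner_Integration.integrable_add integrable_mult_right ind S P.integrable_const)
      qed auto
      also have "\<dots> = \<delta> + 2 * measure (\<mu> t) SA + 2 * measure (\<mu> t) SB"
        using ind[OF S(1)] ind[OF S(2)] by (simp add: P.prob_space)
      also have "\<dots> \<le> \<delta> + 2 * (\<epsilon> * ((\<Sum>\<tau><t. (w \<tau>)\<^sup>2) / real t)) + 2 * (\<epsilon> * ((\<Sum>\<tau><t. 1\<^sup>2) / real t))"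
        using R[OF w] R[OF good_weights_1] unfolding SA_def SB_def by (intro add_mono mult_left_mono) auto
      finally show ?thesis using t0 by simp
    qed
    have "(\<integral>x. lin_error t x \<partial>\<mu> t) = (\<integral>w. (\<integral>x. ?D x w \<partial>\<mu> t) \<partial>\<nu> t)"
      unfolding lin_error_def
      by (rule Fubini_integral[symmetric]) (auto intro!: J.integrable_const_bound[where B=2] simp: split_beta')
    also have "\<dots> \<le> (\<integral>w. \<delta> + 2 * \<epsilon> * ((\<Sum>\<tau><t. (w \<tau>)\<^sup>2) / real t) + 2 * \<epsilon> \<partial>\<nu> t)"
    proof (rule integral_mono_AE')
      show "AE w in \<nu> t. (\<integral>x. ?D x w \<partial>\<mu> t) \<le> \<delta> + 2 * \<epsilon> * ((\<Sum>\<tau><t. (w \<tau>)\<^sup>2) / real t) + 2 * \<epsilon>"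
        using E.nonneg E.total AE_space
      proof eventually_elim
        case (elim w)
        then show ?case by (intro inner) (auto simp: good_weights_def)
      qed
      show "AE w in \<nu> t. 0 \<le> \<delta> + 2 * \<epsilon> * ((\<Sum>\<tau><t. (w \<tau>)\<^sup>2) / real t) + 2 * \<epsilon>"
        using de by (intro AE_I2 add_nonneg_nonneg mult_nonneg_nonneg divide_nonneg_nonneg sum_nonneg) auto
    qed (use E.sum_squares_integrable in auto)
    also have "\<dots> = \<delta> + 2 * \<epsilon> * ((\<integral>w. (\<Sum>\<tau><t. (w \<tau>)\<^sup>2) \<partial>\<nu> t) / real t) + 2 * \<epsilon>"
      using E.sum_squares_integrable by (simp add: E.prob_space)
    also have "\<dots> \<le> \<delta> + 2 * \<epsilon> * (1 + K) + 2 * \<epsilon>"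
    proof -
      have "(\<integral>w. (\<Sum>\<tau><t. (w \<tau>)\<^sup>2) \<partial>\<nu> t) / real t \<le> 1 + K"
        using E.sum_squares_le t0 by (simp add: divide_le_eq mult.commute)
      then show ?thesis using de by (intro add_mono order_refl mult_left_mono) auto
    qed
    finally have "(\<integral>x. lin_error t x \<partial>\<mu> t) < r" using small by simp
    moreover have "0 \<le> (\<integral>x. lin_error t x \<partial>\<mu> t)" unfolding lin_error_def by simp
    ultimately show ?case by simp
  qed
qed

end

section \<open>Conditional characteristic functions\<close>

context fisher_bootstrap
begin

definition limit_cov :: "real^'n^'n" where
  "limit_cov = matrix_inv Hess ** score_moment ** matrix_inv Hess"

definition limit_law :: "(real^'n) measure" where
  "limit_law = distr (centered_normal limit_cov) borel (\<lambda>x. c *\<^sub>R x)"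

lemma limit_cov_quadratic: "\<xi> \<bullet> (limit_cov *v \<xi>) = (\<integral>x. (score x \<bullet> (- (matrix_inv Hess *v \<xi>)))\<^sup>2 \<partial>N)"
proof -
  have "\<xi> \<bullet> (limit_cov *v \<xi>) = (matrix_inv Hess *v \<xi>) \<bullet> (score_moment *v (matrix_inv Hess *v \<xi>))"
    unfolding limit_cov_def matrix_vector_mul_assoc[symmetric] by (rule inner_Hess_inverse)
  then show ?thesis by (simp add: score_moment_quadratic)
qed

lemma limit_cov_symmetric: "transpose limit_cov = limit_cov"
  unfolding limit_cov_def
  by (simp only: matrix_transpose_mul Hess_inverse_symmetric score_moment_symmetric matrix_mul_assoc)

lemma prob_space_limit_law: "prob_space limit_law"
  and sets_limit_law: "sets limit_law = sets borel"
proof -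
  show "prob_space limit_law"
    unfolding limit_law_def
    by (rule prob_space.prob_space_distr[OF prob_space_centered_normal])
       (simp add: measurable_cong_sets[OF sets_centered_normal refl])
qed (simp add: limit_law_def)

definition limit_char :: "real^'n \<Rightarrow> real" where
  "limit_char \<xi> = exp (- (\<integral>x. (score x \<bullet> (- (matrix_inv Hess *v \<xi>)))\<^sup>2 \<partial>N) * c\<^sup>2 / 2)"

lemma char_vec_limit_law: "char_vec limit_law \<xi> = complex_of_real (limit_char \<xi>)"
proof -
  have "0 \<le> x \<bullet> (limit_cov *v x)" for x unfolding limit_cov_quadratic by simp
  from char_vec_scaled_centered_normal[OF limit_cov_symmetric this, of c \<xi>]
  show ?thesis unfolding limit_law_def limit_char_def limit_cov_quadratic by (simp add: mult.commute)
qed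

definition cond_char :: "nat \<Rightarrow> (nat \<Rightarrow> 'a) \<Rightarrow> real^'n \<Rightarrow> complex" where
  "cond_char t x \<xi> = (\<integral>w. iexp (\<xi> \<bullet> boot_linear t x w) \<partial>\<nu> t)"

text \<open>
  Convergence in probability of a quantity truncated at one gives convergence of its mean.
\<close>
lemma emp_var_limit:
  assumes "s \<ge> 0"
  shows "(\<lambda>t. \<integral>w. min 1 (s / 2 * \<bar>1 / real t * (\<Sum>\<tau><t. (w \<tau> - 1)\<^sup>2) - c\<^sup>2\<bar>) \<partial>\<nu> t) \<longlonglongrightarrow> 0"
proof (rule tendstoI)
  fix r :: real assume r: "r > 0"
  define \<epsilon> where "\<epsilon> = r / (s + 1)"
  have s1: "s + 1 > 0" using assms by simp
  have \<epsilon>: "\<epsilon> > 0" "s / 2 * \<epsilon> \<le> r / 2"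
  proof -
    show "\<epsilon> > 0" using r s1 by (simp add: \<epsilon>_def)
    have "s * r \<le> r * (s + 1)" using r by (simp add: algebra_simps)
    then have "s * \<epsilon> \<le> r" using s1 by (simp add: \<epsilon>_def pos_divide_le_eq)
    then show "s / 2 * \<epsilon> \<le> r / 2" by linarith
  qed
  have "\<forall>\<^sub>F t in sequentially.
      measure (\<nu> t) {w \<in> space (\<nu> t). \<bar>1 / real t * (\<Sum>\<tau><t. (w \<tau> - 1)\<^sup>2) - c\<^sup>2\<bar> > \<epsilon>} < r / 2"
    by (rule order_tendstoD(2)[OF var_conv[OF \<epsilon>(1)]]) (use r in simp)
  then show "\<forall>\<^sub>F t in sequentially.
      dist (\<integral>w. min 1 (s / 2 * \<bar>1 / real t * (\<Sum>\<tau><t. (w \<tau> - 1)\<^sup>2) - c\<^sup>2\<bar>) \<partial>\<nu> t) 0 < r"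
    using eventually_ge_at_top[of 2]
  proof eventually_elim
    case (elim t)
    interpret E: exchangeable_law "\<nu> t" t e K by (rule laws[OF elim(2)])
    let ?V = "\<lambda>w. \<bar>1 / real t * (\<Sum>\<tau><t. (w \<tau> - 1)\<^sup>2) - c\<^sup>2\<bar>"
    have VM [measurable]: "?V \<in> borel_measurable (\<nu> t)"
      using E.emp_var_measurable unfolding E.emp_var_def[abs_def] by measurable
    define S where "S = {w \<in> space (\<nu> t). ?V w > \<epsilon>}"
    have SM [measurable]: "S \<in> sets (\<nu> t)" unfolding S_def by measurable
    have iS: "integrable (\<nu> t) (indicat_real S)"
      by (intro integrable_real_indicator SM) (simp add: less_top[symmetric])
    have "(\<integral>w. min 1 (s / 2 * ?V w) \<partial>\<nu> t) \<le> (\<integral>w. r / 2 + indicator S w \<partial>\<nu> t)"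
    proof (rule integral_mono)
      show "integrable (\<nu> t) (\<lambda>w. min 1 (s / 2 * ?V w))"
        by (rule E.integrable_const_bound[where B=1]) (use assms in auto)
      fix w assume w: "w \<in> space (\<nu> t)"
      show "min 1 (s / 2 * ?V w) \<le> r / 2 + indicator S w"
      proof (cases "w \<in> S")
        case True then show ?thesis using r by simp
      next
        case False
        then have "?V w \<le> \<epsilon>" using w by (simp add: S_def not_less)
        then have "s / 2 * ?V w \<le> s / 2 * \<epsilon>" using assms by (intro mult_left_mono) auto
        then have "s / 2 * ?V w \<le> r / 2" using \<epsilon>(2) by (rule order_trans)
        then have "min 1 (s / 2 * ?V w) \<le> r / 2" by (rule min.coboundedI2)
        then show ?thesis using False by simp
      qed
    qed (rule Bochner_Integration.integrable_add[OF E.integrable_const iS])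
    also have "\<dots> = r / 2 + measure (\<nu> t) S"
      using Bochner_Integration.integral_add[OF E.integrable_const iS, of "r / 2"] by (simp add: E.prob_space)
    also have "\<dots> < r" using elim(1) by (simp add: S_def)
    finally have "(\<integral>w. min 1 (s / 2 * ?V w) \<partial>\<nu> t) < r" .
    moreover have "0 \<le> (\<integral>w. min 1 (s / 2 * ?V w) \<partial>\<nu> t)" using assms by simp
    ultimately show ?case by simp
  qed
qed

lemma rate_limit:
  assumes "e > 0"
  shows "(\<lambda>t. real t * (1 / sqrt (real t)) powr (2 + e)) \<longlonglongrightarrow> 0"
proof -
  have "(\<lambda>t. (1 / sqrt (real t)) powr e) \<longlonglongrightarrow> 0"
    by (rule tendsto_zero_powrI[OF inverse_sqrt_tendsto_0 tendsto_const _ assms]) auto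
  moreover have "\<forall>\<^sub>F t in sequentially. (1 / sqrt (real t)) powr e = real t * (1 / sqrt (real t)) powr (2 + e)"
    using eventually_gt_at_top[of "0::nat"]
  proof eventually_elim
    case (elim t)
    have "(1 / sqrt (real t)) powr (2 + e) = (1 / sqrt (real t)) powr 2 * (1 / sqrt (real t)) powr e" by (rule powr_add)
    also have "(1 / sqrt (real t)) powr 2 = 1 / real t" using elim by (simp add: power_divide)
    finally show ?case using elim by simp
  qed
  ultimately show ?thesis by (rule Lim_transform_eventually)
qed

lemma cross_term_limit:
  "(\<lambda>t. s / 2 * (1 / sqrt (real t) + sqrt (real t) * (C / (real t - 1)))) \<longlonglongrightarrow> 0"
proof -
  have "(\<lambda>t. 1 / sqrt (real t) * (1 + 1 / (real t - 1))) \<longlonglongrightarrow> 0 * (1 + 0)"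
  proof (intro tendsto_mult tendsto_add inverse_sqrt_tendsto_0 tendsto_const)
    have "filterlim (\<lambda>t. - 1 + real t) at_top sequentially"
      by (rule filterlim_tendsto_add_at_top[OF tendsto_const filterlim_real_sequentially])
    then have "filterlim (\<lambda>t. real t - 1) at_infinity sequentially"
      by (intro filterlim_at_top_imp_at_infinity) (simp add: add.commute)
    then show "(\<lambda>t. 1 / (real t - 1)) \<longlonglongrightarrow> 0" by (rule tendsto_divide_0[OF tendsto_const])
  qed
  moreover have "\<forall>\<^sub>F t in sequentially. 1 / sqrt (real t) * (1 + 1 / (real t - 1)) = sqrt (real t) / (real t - 1)"
    using eventually_gt_at_top[of "1::nat"]
  proof eventually_elim
    case (elim t)
    have "1 + 1 / (real t - 1) = real t / (real t - 1)" using elim by (simp add: field_simps)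
    also have "1 / sqrt (real t) * \<dots> = (real t / sqrt (real t)) / (real t - 1)" by simp
    also have "real t / sqrt (real t) = sqrt (real t)" by (rule real_div_sqrt) simp
    finally show ?case .
  qed
  ultimately have "(\<lambda>t. sqrt (real t) / (real t - 1)) \<longlonglongrightarrow> 0" using Lim_transform_eventually by fastforce
  then have "(\<lambda>t. s / 2 * (1 / sqrt (real t) + C * (sqrt (real t) / (real t - 1)))) \<longlonglongrightarrow> s / 2 * (0 + C * 0)"
    by (intro tendsto_mult tendsto_add tendsto_const inverse_sqrt_tendsto_0)
  then show ?thesis by (simp add: mult.commute)
qed

lemma e_range: "0 < e" "e \<le> 1" "K \<ge> 0"
  using exchangeable_law.e[OF laws[of 2]] exchangeable_law.K[OF laws[of 2]] by auto

text \<open>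
  The conditional central limit theorem at one argument \<open>\<xi>\<close>, by combining the two-copies bound
  with the Gaussian approximation for fixed weights.
\<close>
lemma cond_char_second_moment:
  "(\<lambda>t. \<integral>x. (cmod (cond_char t x \<xi> - complex_of_real (limit_char \<xi>)))\<^sup>2 \<partial>\<mu> t) \<longlonglongrightarrow> 0"
proof -
  define z where "z x = score x \<bullet> (- (matrix_inv Hess *v \<xi>))" for x
  have zM [measurable]: "z \<in> borel_measurable N" unfolding z_def[abs_def] by (rule score_inner_measurable)
  define s where "s = (\<integral>x. (z x)\<^sup>2 \<partial>N)"
  have s: "s \<ge> 0" by (simp add: s_def)
  define l where "l = exp (- s * c\<^sup>2 / 2)"
  have l: "0 \<le> l" "l \<le> 1" "limit_char \<xi> = l" using s by (auto simp: l_def limit_char_def s_def z_def)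
  have zb: "\<And>x. x \<in> space N \<Longrightarrow> \<bar>z x\<bar> \<le> score_bound * (\<Sum>i\<in>UNIV. \<bar>(- (matrix_inv Hess *v \<xi>)) $ i\<bar>)"
    unfolding z_def by (rule score_inner_bounded)
  have zm: "(\<integral>x. z x \<partial>N) = 0" unfolding z_def by (rule mean_score)
  have "\<exists>C\<ge>0. \<forall>(I :: nat set) u. finite I \<longrightarrow>
     cmod ((\<integral>x. iexp (\<Sum>\<tau>\<in>I. u \<tau> * z (x \<tau>)) \<partial>PiM I (\<lambda>_. N)) - complex_of_real (exp (- s * (\<Sum>\<tau>\<in>I. (u \<tau>)\<^sup>2) / 2)))
     \<le> C * (\<Sum>\<tau>\<in>I. \<bar>u \<tau>\<bar> powr (2 + e))"
    unfolding s_def by (rule char_weighted_sum_bound[OF prob_space_axioms zM zb zm e_range(1,2)]) auto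
  then obtain C where C: "C \<ge> 0" and Cb: "\<And>(I :: nat set) u. finite I \<Longrightarrow>
     cmod ((\<integral>x. iexp (\<Sum>\<tau>\<in>I. u \<tau> * z (x \<tau>)) \<partial>PiM I (\<lambda>_. N)) - complex_of_real (exp (- s * (\<Sum>\<tau>\<in>I. (u \<tau>)\<^sup>2) / 2)))
     \<le> C * (\<Sum>\<tau>\<in>I. \<bar>u \<tau>\<bar> powr (2 + e))" by auto
  define \<Lambda> where "\<Lambda> t = (\<integral>w. min 1 (s / 2 * \<bar>1 / real t * (\<Sum>\<tau><t. (w \<tau> - 1)\<^sup>2) - c\<^sup>2\<bar>) \<partial>\<nu> t)" for t
  define \<rho> where "\<rho> t = real t * (1 / sqrt (real t)) powr (2 + e)" for t
  define \<kappa> where "\<kappa> t = s / 2 * (1 / sqrt (real t) + sqrt (real t) * ((2 * (1 + K))\<^sup>2 / (real t - 1)))" for t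
  define bound where "bound t = 2 * C * K * \<rho> t + 2 * \<Lambda> t + \<kappa> t + 2 * (C * (1 + K) * \<rho> t + \<Lambda> t)" for t
  have "bound \<longlonglongrightarrow> 2 * C * K * 0 + 2 * 0 + 0 + 2 * (C * (1 + K) * 0 + 0)"
    unfolding bound_def \<rho>_def \<Lambda>_def \<kappa>_def
    by (intro tendsto_add tendsto_mult tendsto_const rate_limit emp_var_limit cross_term_limit s e_range)
  then have bl: "bound \<longlonglongrightarrow> 0" by simp
  have "\<forall>\<^sub>F t in sequentially. (\<integral>x. (cmod (cond_char t x \<xi> - complex_of_real (limit_char \<xi>)))\<^sup>2 \<partial>\<mu> t) \<le> bound t"
    using eventually_ge_at_top[of 2]
  proof eventually_elim
    case (elim t)
    interpret E: exchangeable_law "\<nu> t" t e K by (rule laws[OF elim])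
    interpret P: prob_space "\<mu> t" by (rule PiM_prob_space)
    interpret pair_sigma_finite "\<mu> t" "\<nu> t" ..
    note \<Phi>M [measurable] = boot_pair_measurable_nu(3)[OF elim, of \<xi>]
    define \<psi> where "\<psi> u = (\<integral>x. iexp (\<Sum>\<tau><t. u \<tau> * z (x \<tau>)) \<partial>\<mu> t)" for u
    have \<psi>1: "cmod (\<psi> u) \<le> 1" for u
    proof -
      have "cmod (\<psi> u) \<le> (\<integral>x. cmod (iexp (\<Sum>\<tau><t. u \<tau> * z (x \<tau>))) \<partial>\<mu> t)" unfolding \<psi>_def by (rule integral_norm_bound)
      then show ?thesis by (simp add: P.prob_space)
    qed
    have \<psi>2: "cmod (\<psi> u - complex_of_real (exp (- s * (\<Sum>\<tau><t. (u \<tau>)\<^sup>2) / 2))) \<le> C * (\<Sum>\<tau><t. \<bar>u \<tau>\<bar> powr (2 + e))" for u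
      unfolding \<psi>_def by (rule Cb) simp
    have Y: "\<xi> \<bullet> boot_linear t x w = (\<Sum>\<tau><t. E.scaled_dev w \<tau> * z (x \<tau>))" for x w
      unfolding boot_linear_inner E.scaled_dev_def z_def ..
    have e1: "(\<integral>x. iexp (\<xi> \<bullet> boot_linear t x w) \<partial>\<mu> t) = \<psi> (E.scaled_dev w)" for w
      unfolding Y \<psi>_def ..
    have e2: "(\<integral>x. iexp (\<xi> \<bullet> boot_linear t x w - \<xi> \<bullet> boot_linear t x w') \<partial>\<mu> t) = \<psi> (\<lambda>\<tau>. E.scaled_dev w \<tau> - E.scaled_dev w' \<tau>)" for w w'
      unfolding Y \<psi>_def by (simp only: left_diff_distrib sum_subtractf)
    have "(\<lambda>w. \<integral>x. iexp (\<xi> \<bullet> boot_linear t x w) \<partial>\<mu> t) \<in> borel_measurable (\<nu> t)" by measurable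
    then have m1: "(\<lambda>w. \<psi> (E.scaled_dev w)) \<in> borel_measurable (\<nu> t)" unfolding e1 .
    have "(\<lambda>(w, w'). \<integral>x. iexp (\<xi> \<bullet> boot_linear t x w - \<xi> \<bullet> boot_linear t x w') \<partial>\<mu> t) \<in> borel_measurable (\<nu> t \<Otimes>\<^sub>M \<nu> t)" by measurable
    then have m2: "(\<lambda>(w, w'). \<psi> (\<lambda>\<tau>. E.scaled_dev w \<tau> - E.scaled_dev w' \<tau>)) \<in> borel_measurable (\<nu> t \<Otimes>\<^sub>M \<nu> t)" unfolding e2 .
    have "(\<integral>x. (cmod (cond_char t x \<xi> - complex_of_real (limit_char \<xi>)))\<^sup>2 \<partial>\<mu> t)
      \<le> cmod ((\<integral>w. (\<integral>w'. (\<integral>x. iexp (\<xi> \<bullet> boot_linear t x w - \<xi> \<bullet> boot_linear t x w') \<partial>\<mu> t) \<partial>\<nu> t) \<partial>\<nu> t) - complex_of_real (l\<^sup>2))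
        + 2 * cmod ((\<integral>w. (\<integral>x. iexp (\<xi> \<bullet> boot_linear t x w) \<partial>\<mu> t) \<partial>\<nu> t) - complex_of_real l)"
      unfolding cond_char_def l(3)
      by (rule conditional_char_second_moment[OF P.prob_space_axioms E.prob_space_axioms \<Phi>M l(1,2)])
    also have "\<dots> \<le> bound t"
      unfolding e1 e2 bound_def l_def \<rho>_def \<Lambda>_def \<kappa>_def
      using E.char_first_copy[OF m1 \<psi>1 \<psi>2 s C, of c] E.char_two_copies[OF m2 \<psi>1 \<psi>2 s C, of c]
      unfolding E.rate_def E.emp_var_def by simp
    finally show ?case .
  qed
  then show ?thesis
    by (intro tendsto_sandwich[OF always_eventually _ tendsto_const bl]) auto
qed

lemma cond_char_norm: "t \<ge> 2 \<Longrightarrow> cmod (cond_char t x \<xi>) \<le> 1"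
proof -
  assume t: "t \<ge> 2"
  interpret E: exchangeable_law "\<nu> t" t e K by (rule laws[OF t])
  have "cmod (cond_char t x \<xi>) \<le> (\<integral>w. cmod (iexp (\<xi> \<bullet> boot_linear t x w)) \<partial>\<nu> t)"
    unfolding cond_char_def by (rule integral_norm_bound)
  then show ?thesis by (simp add: E.prob_space)
qed

lemma limit_char_range: "0 \<le> limit_char \<xi>" "limit_char \<xi> \<le> 1"
  by (simp_all add: limit_char_def)

lemma cond_char_measurable:
  assumes t: "t \<ge> 2"
  shows "(\<lambda>(x, \<xi>). cond_char t x \<xi>) \<in> borel_measurable (\<mu> t \<Otimes>\<^sub>M borel)"
proof -
  interpret E: exchangeable_law "\<nu> t" t e K by (rule laws[OF t])
  note boot_pair_measurable_nu(2)[OF t, measurable]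
  show ?thesis unfolding cond_char_def by measurable
qed

lemma cond_char_first_moment:
  "(\<lambda>t. \<integral>x. cmod (cond_char t x \<xi> - complex_of_real (limit_char \<xi>)) \<partial>\<mu> t) \<longlonglongrightarrow> 0"
proof -
  let ?d = "\<lambda>t x. cmod (cond_char t x \<xi> - complex_of_real (limit_char \<xi>))"
  define p where "p t = (if t \<ge> 2 then (\<integral>x. ?d t x \<partial>\<mu> t) else 0)" for t
  have "p \<longlonglongrightarrow> 0"
  proof (rule LIMSEQ_0_if_bounded_by_small[OF cond_char_second_moment[of \<xi>]])
    show "0 \<le> p t" for t by (simp add: p_def)
    fix a :: real and t assume a: "a > 0"
    show "p t \<le> a / 2 + (\<integral>x. (?d t x)\<^sup>2 \<partial>\<mu> t) / (2 * a)"
    proof (cases "t \<ge> 2")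
      case False
      then show ?thesis using a by (simp add: p_def)
    next
      case t: True
      interpret P: prob_space "\<mu> t" by (rule PiM_prob_space)
      note cond_char_measurable[OF t, measurable]
      have db: "?d t x \<le> 2" for x
        using cond_char_norm[OF t, of x \<xi>] limit_char_range[of \<xi>]
          norm_triangle_ineq4[of "cond_char t x \<xi>" "complex_of_real (limit_char \<xi>)"] by simp
      have dM [measurable]: "(\<lambda>x. ?d t x) \<in> borel_measurable (\<mu> t)" by measurable
      have i1: "integrable (\<mu> t) (\<lambda>x. ?d t x)" by (rule P.integrable_const_bound[where B=2]) (use db in auto)
      have i2: "integrable (\<mu> t) (\<lambda>x. (?d t x)\<^sup>2)"
        by (rule P.integrable_const_bound[where B="2\<^sup>2"]) (use power_mono[OF db norm_ge_zero, where n=2] in auto)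
      have "(\<integral>x. ?d t x \<partial>\<mu> t) \<le> (\<integral>x. a / 2 + (?d t x)\<^sup>2 / (2 * a) \<partial>\<mu> t)"
      proof (rule integral_mono[OF i1])
        show "integrable (\<mu> t) (\<lambda>x. a / 2 + (?d t x)\<^sup>2 / (2 * a))" using i2 by simp
        fix x
        have "0 \<le> (a - ?d t x)\<^sup>2" by simp
        then have "2 * a * ?d t x \<le> a\<^sup>2 + (?d t x)\<^sup>2" by (simp add: power2_diff)
        then have "?d t x \<le> (a\<^sup>2 + (?d t x)\<^sup>2) / (2 * a)" using a by (simp add: pos_le_divide_eq mult.commute)
        also have "\<dots> = a / 2 + (?d t x)\<^sup>2 / (2 * a)" using a by (simp add: add_divide_distrib power2_eq_square)
        finally show "?d t x \<le> a / 2 + (?d t x)\<^sup>2 / (2 * a)" .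
      qed
      also have "\<dots> = a / 2 + (\<integral>x. (?d t x)\<^sup>2 \<partial>\<mu> t) / (2 * a)" using i2 by (simp add: P.prob_space)
      finally show ?thesis using t by (simp add: p_def)
    qed
  qed
  moreover have "\<forall>\<^sub>F t in sequentially. p t = (\<integral>x. ?d t x \<partial>\<mu> t)"
    using eventually_ge_at_top[of 2] by eventually_elim (simp add: p_def)
  ultimately show ?thesis by (rule Lim_transform_eventually)
qed

definition char_error :: "real \<Rightarrow> nat \<Rightarrow> (nat \<Rightarrow> 'a) \<Rightarrow> real" where
  "char_error \<sigma> t x = (\<integral>z. cmod (cond_char t x ((1 / \<sigma>) *\<^sub>R z) - complex_of_real (limit_char ((1 / \<sigma>) *\<^sub>R z))) \<partial>std_gauss)"

lemma limit_char_measurable [measurable]: "limit_char \<in> borel_measurable borel"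
proof -
  have "limit_char = (\<lambda>\<xi>. Re (char_vec limit_law \<xi>))" by (rule ext) (simp add: char_vec_limit_law)
  then show ?thesis using char_vec_measurable[OF prob_space_limit_law sets_limit_law] by simp
qed

text \<open>
  Pointwise convergence in \<open>\<xi>\<close> and the bound \<open>2\<close> allow dominated convergence under the Gaussian
  average over \<open>\<xi>\<close>.
\<close>
lemma char_error_limit: "(\<lambda>t. \<integral>x. char_error \<sigma> t x \<partial>\<mu> t) \<longlonglongrightarrow> 0"
proof -
  interpret G: prob_space "std_gauss :: (real^'n) measure" by (rule prob_space_std_gauss)
  let ?d = "\<lambda>t x z. cmod (cond_char t x ((1 / \<sigma>) *\<^sub>R z) - complex_of_real (limit_char ((1 / \<sigma>) *\<^sub>R z)))"
  define h where "h t z = (if t \<ge> 2 then (\<integral>x. ?d t x z \<partial>\<mu> t) else 0)" for t z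
  have db: "?d t x z \<le> 2" if "t \<ge> 2" for t x z
    using cond_char_norm[OF that, of x "(1 / \<sigma>) *\<^sub>R z"] limit_char_range[of "(1 / \<sigma>) *\<^sub>R z"]
      norm_triangle_ineq4[of "cond_char t x ((1 / \<sigma>) *\<^sub>R z)" "complex_of_real (limit_char ((1 / \<sigma>) *\<^sub>R z))"] by simp
  have dM: "(\<lambda>(x, z). ?d t x z) \<in> borel_measurable (\<mu> t \<Otimes>\<^sub>M std_gauss)" if t: "t \<ge> 2" for t
    using cond_char_measurable[OF t] by measurable
  have hM [measurable]: "h t \<in> borel_measurable std_gauss" for t
  proof (cases "t \<ge> 2")
    case t: True
    interpret P: prob_space "\<mu> t" by (rule PiM_prob_space)
    note dM[OF t, measurable]
    have "(\<lambda>z. \<integral>x. ?d t x z \<partial>\<mu> t) \<in> borel_measurable std_gauss" by measurable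
    then show ?thesis using t by (simp add: h_def[abs_def])
  qed (simp add: h_def[abs_def])
  have "(\<lambda>t. \<integral>z. h t z \<partial>std_gauss) \<longlonglongrightarrow> (\<integral>z. 0 \<partial>(std_gauss :: (real^'n) measure))"
  proof (rule integral_dominated_convergence[where w="\<lambda>_. 2"])
    show "AE z in std_gauss. (\<lambda>t. h t z) \<longlonglongrightarrow> 0"
    proof (rule AE_I2)
      fix z
      have "\<forall>\<^sub>F t in sequentially. (\<integral>x. ?d t x z \<partial>\<mu> t) = h t z"
        using eventually_ge_at_top[of 2] by eventually_elim (simp add: h_def)
      then show "(\<lambda>t. h t z) \<longlonglongrightarrow> 0" by (rule Lim_transform_eventually[OF cond_char_first_moment])
    qed
    show "AE z in std_gauss. norm (h t z) \<le> 2" for t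
    proof (rule AE_I2)
      fix z
      show "norm (h t z) \<le> 2"
      proof (cases "t \<ge> 2")
        case t: True
        interpret P: prob_space "\<mu> t" by (rule PiM_prob_space)
        note dM[OF t, measurable]
        have "(\<integral>x. ?d t x z \<partial>\<mu> t) \<le> (\<integral>x. 2 \<partial>\<mu> t)"
          by (rule integral_mono) (use db[OF t] in \<open>auto intro!: P.integrable_const_bound[where B=2]\<close>)
        moreover have "0 \<le> (\<integral>x. ?d t x z \<partial>\<mu> t)" by simp
        ultimately show ?thesis using t by (simp add: h_def P.prob_space)
      qed (simp add: h_def)
    qed
  qed auto
  moreover have "\<forall>\<^sub>F t in sequentially. (\<integral>z. h t z \<partial>std_gauss) = (\<integral>x. char_error \<sigma> t x \<partial>\<mu> t)"
    using eventually_ge_at_top[of 2]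
  proof eventually_elim
    case (elim t)
    interpret P: prob_space "\<mu> t" by (rule PiM_prob_space)
    interpret pair_sigma_finite "\<mu> t" "std_gauss :: (real^'n) measure" ..
    interpret J: prob_space "\<mu> t \<Otimes>\<^sub>M (std_gauss :: (real^'n) measure)" by (rule prob_space_pair) unfold_locales
    have "(\<integral>z. (\<integral>x. ?d t x z \<partial>\<mu> t) \<partial>std_gauss) = (\<integral>x. (\<integral>z. ?d t x z \<partial>std_gauss) \<partial>\<mu> t)"
      by (rule Fubini_integral) (use dM[OF elim] db[OF elim] in \<open>auto intro!: J.integrable_const_bound[where B=2]\<close>)
    then show ?case using elim by (simp add: h_def char_error_def)
  qed
  ultimately show ?thesis using Lim_transform_eventually by fastforce
qed

end

section \<open>Conditional law of the bootstrap error\<close>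

context fisher_bootstrap
begin

lemma lin_error_measurable:
  assumes t: "t \<ge> 2"
  shows "lin_error t \<in> borel_measurable (\<mu> t)"
proof -
  interpret E: exchangeable_law "\<nu> t" t e K by (rule laws[OF t])
  note [measurable] = boot_pair_measurable_nu(1,2)[OF t]
  show ?thesis unfolding lin_error_def[abs_def] by measurable
qed

lemma char_error_measurable:
  assumes t: "t \<ge> 2"
  shows "char_error \<sigma> t \<in> borel_measurable (\<mu> t)"
proof -
  interpret G: prob_space "std_gauss :: (real^'n) measure" by (rule prob_space_std_gauss)
  note [measurable] = cond_char_measurable[OF t]
  show ?thesis unfolding char_error_def[abs_def] by measurable
qed

text \<open>
  Markov's inequality turns the two integrated error bounds into a set of data of small
  probability off which the law of \<open>boot_error\<close> is close to the limit: first \<open>boot_error\<close> is replaced by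
  its linearization \<open>boot_linear\<close>, then the law of \<open>boot_linear\<close> is compared with the Gaussian through
  characteristic functions.
\<close>
lemma boot_law_close:
  assumes \<epsilon>: "\<epsilon> > 0" and \<delta>: "\<delta> > 0"
  shows "\<forall>\<^sub>F t in sequentially. \<exists>A\<in>sets (\<mu> t). measure (\<mu> t) A < \<delta> \<and>
    (\<forall>x\<in>space (\<mu> t) - A. \<forall>f\<in>BL1.
       \<bar>(\<integral>y. f y \<partial>distr (\<nu> t) borel (boot_error t x)) - (\<integral>y. f y \<partial>limit_law)\<bar> \<le> \<epsilon>)"
proof -
  have "\<exists>\<sigma>>0. \<exists>d>0. \<forall>L f. prob_space L \<longrightarrow> sets L = sets borel \<longrightarrow> f \<in> BL1 \<longrightarrow>
      (\<integral>z. cmod (char_vec L ((1 / \<sigma>) *\<^sub>R z) - char_vec limit_law ((1 / \<sigma>) *\<^sub>R z)) \<partial>std_gauss) \<le> d \<longrightarrow>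
      \<bar>(\<integral>x. f x \<partial>L) - (\<integral>x. f x \<partial>limit_law)\<bar> \<le> \<epsilon> / 2"
    by (rule BL1_close_if_char_vec_close[OF prob_space_limit_law sets_limit_law half_gt_zero[OF \<epsilon>]]) blast
  then obtain \<sigma> d where \<sigma>: "\<sigma> > 0" and d: "d > 0" and close: "\<And>L f. prob_space L \<Longrightarrow> sets L = sets borel \<Longrightarrow> f \<in> BL1 \<Longrightarrow>
      (\<integral>z. cmod (char_vec L ((1 / \<sigma>) *\<^sub>R z) - char_vec limit_law ((1 / \<sigma>) *\<^sub>R z)) \<partial>std_gauss) \<le> d \<Longrightarrow>
      \<bar>(\<integral>x. f x \<partial>L) - (\<integral>x. f x \<partial>limit_law)\<bar> \<le> \<epsilon> / 2" by auto
  have "\<forall>\<^sub>F t in sequentially. (\<integral>x. lin_error t x \<partial>\<mu> t) < \<epsilon> / 2 * (\<delta> / 2)"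
    by (rule order_tendstoD(2)[OF lin_error_limit]) (use \<epsilon> \<delta> in simp)
  moreover have "\<forall>\<^sub>F t in sequentially. (\<integral>x. char_error \<sigma> t x \<partial>\<mu> t) < d * (\<delta> / 2)"
    by (rule order_tendstoD(2)[OF char_error_limit]) (use d \<delta> in simp)
  ultimately show ?thesis using eventually_ge_at_top[of 2]
  proof eventually_elim
    case (elim t)
    have t0: "t > 0" using elim(3) by simp
    interpret E: exchangeable_law "\<nu> t" t e K by (rule laws[OF elim(3)])
    interpret P: prob_space "\<mu> t" by (rule PiM_prob_space)
    interpret G: prob_space "std_gauss :: (real^'n) measure" by (rule prob_space_std_gauss)
    note [measurable] = lin_error_measurable[OF elim(3)] char_error_measurable[OF elim(3)]
    have le: "0 \<le> lin_error t x" "lin_error t x \<le> 2" for x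
    proof -
      show "0 \<le> lin_error t x" unfolding lin_error_def by simp
      have "lin_error t x \<le> norm (lin_error t x)" by simp
      also have "\<dots> \<le> 2"
      proof (cases "integrable (\<nu> t) (\<lambda>w. min 2 (norm (boot_error t x w - boot_linear t x w)))")
        case True
        have "lin_error t x \<le> (\<integral>w. 2 \<partial>\<nu> t)" unfolding lin_error_def by (rule integral_mono[OF True]) auto
        then show ?thesis using \<open>0 \<le> lin_error t x\<close> by (simp add: E.prob_space)
      qed (simp add: lin_error_def not_integrable_integral_eq)
      finally show "lin_error t x \<le> 2" .
    qed
    let ?k = "\<lambda>x z. cmod (cond_char t x ((1 / \<sigma>) *\<^sub>R z) - complex_of_real (limit_char ((1 / \<sigma>) *\<^sub>R z)))"
    have kb: "?k x z \<le> 2" for x z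
      using cond_char_norm[OF elim(3), of x "(1 / \<sigma>) *\<^sub>R z"] limit_char_range[of "(1 / \<sigma>) *\<^sub>R z"]
        norm_triangle_ineq4[of "cond_char t x ((1 / \<sigma>) *\<^sub>R z)" "complex_of_real (limit_char ((1 / \<sigma>) *\<^sub>R z))"] by simp
    have ce: "0 \<le> char_error \<sigma> t x" "char_error \<sigma> t x \<le> 2" for x
    proof -
      show "0 \<le> char_error \<sigma> t x" unfolding char_error_def by simp
      show "char_error \<sigma> t x \<le> 2"
      proof (cases "integrable (std_gauss :: (real^'n) measure) (\<lambda>z. ?k x z)")
        case True
        have "char_error \<sigma> t x \<le> (\<integral>z. 2 \<partial>(std_gauss :: (real^'n) measure))"
          unfolding char_error_def by (rule integral_mono[OF True]) (auto intro: kb)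
        then show ?thesis using G.prob_space by simp
      qed (simp add: char_error_def not_integrable_integral_eq)
    qed
    define A1 where "A1 = {x \<in> space (\<mu> t). \<epsilon> / 2 \<le> lin_error t x}"
    define A2 where "A2 = {x \<in> space (\<mu> t). d \<le> char_error \<sigma> t x}"
    have AM [measurable]: "A1 \<in> sets (\<mu> t)" "A2 \<in> sets (\<mu> t)" unfolding A1_def A2_def by measurable
    have "measure (\<mu> t) A1 \<le> (\<integral>x. lin_error t x \<partial>\<mu> t) / (\<epsilon> / 2)"
      unfolding A1_def
      by (rule integral_Markov_inequality_measure[where A="space (\<mu> t)", OF _ sets.top])
         (use \<epsilon> le in \<open>auto intro!: P.integrable_const_bound[where B=2]\<close>)
    also have "\<dots> < \<delta> / 2" using elim(1) \<epsilon> by (simp add: pos_divide_less_eq mult.commute)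
    finally have m1: "measure (\<mu> t) A1 < \<delta> / 2" .
    have "measure (\<mu> t) A2 \<le> (\<integral>x. char_error \<sigma> t x \<partial>\<mu> t) / d"
      unfolding A2_def
      by (rule integral_Markov_inequality_measure[where A="space (\<mu> t)", OF _ sets.top])
         (use d ce in \<open>auto intro!: P.integrable_const_bound[where B=2]\<close>)
    also have "\<dots> < \<delta> / 2" using elim(2) d by (simp add: pos_divide_less_eq mult.commute)
    finally have m2: "measure (\<mu> t) A2 < \<delta> / 2" .
    have "measure (\<mu> t) (A1 \<union> A2) \<le> measure (\<mu> t) A1 + measure (\<mu> t) A2"
      by (rule measure_Un_le) (rule AM)+
    then have m: "measure (\<mu> t) (A1 \<union> A2) < \<delta>" using m1 m2 by linarith
    have "\<bar>(\<integral>y. f y \<partial>distr (\<nu> t) borel (boot_error t x)) - (\<integral>y. f y \<partial>limit_law)\<bar> \<le> \<epsilon>"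
      if x: "x \<in> space (\<mu> t)" and xA: "x \<notin> A1 \<union> A2" and f: "f \<in> BL1" for x and f :: "real^'n \<Rightarrow> real"
    proof -
      have fM [measurable]: "f \<in> borel_measurable borel" by (rule BL1_measurable[OF f])
      have f1: "\<bar>f y\<bar> \<le> 1" and f2: "\<bar>f y - f y'\<bar> \<le> norm (y - y')" for y y' using f by (auto simp: BL1_def)
      have XM [measurable]: "boot_error t x \<in> borel_measurable (\<nu> t)"
        using measurable_compose[OF measurable_Pair1'[OF x] boot_pair_measurable_nu(1)[OF elim(3)]] by simp
      have YM [measurable]: "boot_linear t x \<in> borel_measurable (\<nu> t)"
        using measurable_compose[OF measurable_Pair1'[OF x] boot_pair_measurable_nu(2)[OF elim(3)]] by simp
      have cv: "char_vec (distr (\<nu> t) borel (boot_linear t x)) \<xi> = cond_char t x \<xi>" for \<xi>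
        unfolding char_vec_def cond_char_def by (rule integral_distr) measurable
      have Y: "\<bar>(\<integral>y. f y \<partial>distr (\<nu> t) borel (boot_linear t x)) - (\<integral>y. f y \<partial>limit_law)\<bar> \<le> \<epsilon> / 2"
      proof (rule close[OF E.prob_space_distr[OF YM] sets_distr f])
        have "char_error \<sigma> t x \<le> d" using x xA by (simp add: A2_def)
        then show "(\<integral>z. cmod (char_vec (distr (\<nu> t) borel (boot_linear t x)) ((1 / \<sigma>) *\<^sub>R z) - char_vec limit_law ((1 / \<sigma>) *\<^sub>R z)) \<partial>std_gauss) \<le> d"
          by (simp only: cv char_vec_limit_law char_error_def)
      qed
      have iX: "integrable (\<nu> t) (\<lambda>w. f (boot_error t x w))" and iY: "integrable (\<nu> t) (\<lambda>w. f (boot_linear t x w))"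
        by (rule E.integrable_const_bound[where B=1]; use f1 in simp)+
      have "\<bar>(\<integral>w. f (boot_error t x w) \<partial>\<nu> t) - (\<integral>w. f (boot_linear t x w) \<partial>\<nu> t)\<bar> = \<bar>\<integral>w. f (boot_error t x w) - f (boot_linear t x w) \<partial>\<nu> t\<bar>"
        using iX iY by simp
      also have "\<dots> \<le> (\<integral>w. \<bar>f (boot_error t x w) - f (boot_linear t x w)\<bar> \<partial>\<nu> t)" by (rule integral_abs_bound)
      also have "\<dots> \<le> lin_error t x"
        unfolding lin_error_def
      proof (rule integral_mono)
        show "integrable (\<nu> t) (\<lambda>w. \<bar>f (boot_error t x w) - f (boot_linear t x w)\<bar>)" using iX iY by simp
        show "integrable (\<nu> t) (\<lambda>w. min 2 (norm (boot_error t x w - boot_linear t x w)))"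
          by (rule E.integrable_const_bound[where B=2]) auto
        fix w
        have "\<bar>f (boot_error t x w) - f (boot_linear t x w)\<bar> \<le> 2" using f1[of "boot_error t x w"] f1[of "boot_linear t x w"] by linarith
        then show "\<bar>f (boot_error t x w) - f (boot_linear t x w)\<bar> \<le> min 2 (norm (boot_error t x w - boot_linear t x w))" using f2 by simp
      qed
      finally have "\<bar>(\<integral>w. f (boot_error t x w) \<partial>\<nu> t) - (\<integral>w. f (boot_linear t x w) \<partial>\<nu> t)\<bar> \<le> \<epsilon> / 2"
        using x xA by (simp add: A1_def)
      moreover have "(\<integral>y. f y \<partial>distr (\<nu> t) borel (boot_error t x)) = (\<integral>w. f (boot_error t x w) \<partial>\<nu> t)"
        "(\<integral>y. f y \<partial>distr (\<nu> t) borel (boot_linear t x)) = (\<integral>w. f (boot_linear t x w) \<partial>\<nu> t)"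
        by (rule integral_distr; measurable)+
      ultimately show ?thesis using Y by linarith
    qed
    then show ?case using m AM by (intro bexI[of _ "A1 \<union> A2"]) auto
  qed
qed

end

section \<open>Independence and regular conditional distributions\<close>

lemma LFM_H_boot_cong:
  assumes "\<And>\<tau>. \<tau> < t \<Longrightarrow> w \<tau> = w' \<tau>" "\<And>\<tau>. \<tau> < t \<Longrightarrow> x \<tau> = x' \<tau>"
  shows "LFM_H_boot v b t w x = LFM_H_boot v b t w' x'"
  unfolding LFM_H_boot_def using assms by (intro ext arg_cong2[where f="(*)"] refl sum.cong) auto

lemma beta_boot_cong:
  assumes "\<And>\<tau>. \<tau> < t \<Longrightarrow> w \<tau> = w' \<tau>" "\<And>\<tau>. \<tau> < t \<Longrightarrow> x \<tau> = x' \<tau>"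
  shows "beta_boot v b t w x = beta_boot v b t w' x'"
  unfolding beta_boot_def by (simp only: LFM_H_boot_cong[OF assms])

text \<open>
  Covers sample size zero, where the scaled error is zero.
\<close>
lemma regular_cond_distr_const:
  fixes a :: "'c::topological_space"
  assumes "prob_space P" and T: "T \<in> P \<rightarrow>\<^sub>M S"
  shows "regular_cond_distr P (generated_algebra P S T) (\<lambda>_. a) (\<lambda>_. return borel a)"
proof -
  interpret P: prob_space P by fact
  have "subalgebra P (generated_algebra P S T)"
    unfolding subalgebra_def generated_algebra_def
    using measurable_space[OF T] measurable_sets[OF T] by (auto simp: sets_vimage_algebra2 Pi_iff)
  then interpret G: finite_measure_subalgebra P "generated_algebra P S T" by unfold_locales
  have "(\<lambda>_. return borel a) \<in> generated_algebra P S T \<rightarrow>\<^sub>M prob_algebra borel"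
    by (rule measurable_const) (simp add: space_prob_algebra prob_space_return)
  moreover have "AE \<omega> in P. measure (return borel a) A = real_cond_exp P (generated_algebra P S T) (indicator ((\<lambda>_. a) -` A)) \<omega>"
    if A: "A \<in> sets borel" for A
  proof -
    have eq: "indicator ((\<lambda>_::'a. a) -` A) = (\<lambda>_::'a. indicat_real A a)" by (auto split: split_indicator)
    have "AE \<omega> in P. real_cond_exp P (generated_algebra P S T) (\<lambda>_. indicat_real A a) \<omega> = indicat_real A a"
      by (rule G.real_cond_exp_F_meas) auto
    then show ?thesis unfolding eq using A by (simp add: measure_return eq_commute)
  qed
  ultimately show ?thesis unfolding regular_cond_distr_def by simp
qed

text \<open>
  Freezing lemma: for \<open>T\<close> and \<open>U\<close> independent, the conditional law of \<open>g T U\<close> given \<open>T\<close> is the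
  law of \<open>g x U\<close> at \<open>x = T\<close>.
\<close>
lemma regular_cond_distr_independent:
  fixes g :: "'s \<Rightarrow> 'r \<Rightarrow> 'c::topological_space"
  assumes "prob_space P" and T: "T \<in> P \<rightarrow>\<^sub>M S" and U: "U \<in> P \<rightarrow>\<^sub>M R"
    and joint: "distr P (S \<Otimes>\<^sub>M R) (\<lambda>\<omega>. (T \<omega>, U \<omega>)) = distr P S T \<Otimes>\<^sub>M distr P R U"
    and g: "(\<lambda>(x, w). g x w) \<in> borel_measurable (S \<Otimes>\<^sub>M R)"
    and X: "\<And>\<omega>. \<omega> \<in> space P \<Longrightarrow> X \<omega> = g (T \<omega>) (U \<omega>)"
  shows "regular_cond_distr P (generated_algebra P S T) X (\<lambda>\<omega>. distr (distr P R U) borel (g (T \<omega>)))"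
proof -
  interpret P: prob_space P by fact
  interpret DT: prob_space "distr P S T" by (rule P.prob_space_distr[OF T])
  interpret DU: prob_space "distr P R U" by (rule P.prob_space_distr[OF U])
  interpret pair_sigma_finite "distr P S T" "distr P R U" ..
  interpret J: prob_space "distr P S T \<Otimes>\<^sub>M distr P R U" by (rule prob_space_pair) unfold_locales
  note [measurable] = T U
  have TS: "T \<in> space P \<rightarrow> space S" using measurable_space[OF T] by auto
  have sub: "subalgebra P (generated_algebra P S T)"
    unfolding subalgebra_def generated_algebra_def
    using TS measurable_sets[OF T] by (auto simp: sets_vimage_algebra2)
  then interpret G: finite_measure_subalgebra P "generated_algebra P S T" by unfold_locales
  have TU: "(\<lambda>\<omega>. (T \<omega>, U \<omega>)) \<in> P \<rightarrow>\<^sub>M S \<Otimes>\<^sub>M R" by measurable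
  have "(\<lambda>\<omega>. g (T \<omega>) (U \<omega>)) \<in> borel_measurable P" using measurable_compose[OF TU g] by simp
  then have XM [measurable]: "X \<in> borel_measurable P" by (subst measurable_cong[OF X])
  have "(\<lambda>x. distr (distr P R U) borel (g x)) \<in> S \<rightarrow>\<^sub>M prob_algebra borel"
  proof (rule measurable_distr_prob_space2[where M=R])
    show "(\<lambda>_. distr P R U) \<in> S \<rightarrow>\<^sub>M prob_algebra R"
      by (rule measurable_const) (simp add: space_prob_algebra DU.prob_space_axioms)
  qed (rule g)
  moreover have TG: "T \<in> generated_algebra P S T \<rightarrow>\<^sub>M S"
    unfolding generated_algebra_def by (rule measurable_vimage_algebra1[OF TS])
  ultimately have \<kappa>M: "(\<lambda>\<omega>. distr (distr P R U) borel (g (T \<omega>))) \<in> generated_algebra P S T \<rightarrow>\<^sub>M prob_algebra borel"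
    by (rule measurable_compose[rotated])
  have "AE \<omega> in P. measure (distr (distr P R U) borel (g (T \<omega>))) A = real_cond_exp P (generated_algebra P S T) (indicator (X -` A)) \<omega>"
    if A [measurable]: "A \<in> sets borel" for A
  proof -
    define q where "q x = measure (distr (distr P R U) borel (g x)) A" for x
    have qM: "(\<lambda>\<omega>. q (T \<omega>)) \<in> borel_measurable (generated_algebra P S T)"
      unfolding q_def
      by (rule measurable_compose[OF measurable_prob_algebraD[OF \<kappa>M] measurable_measure_subprob_algebra[OF A]])
    have qP: "(\<lambda>\<omega>. q (T \<omega>)) \<in> borel_measurable P" by (rule measurable_from_subalg[OF sub qM])
    have gx: "g x \<in> borel_measurable (distr P R U)" if "x \<in> space S" for x
      using measurable_compose[OF measurable_Pair1'[OF that] g] by simp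
    have q: "q x = (\<integral>w. indicator A (g x w) \<partial>distr P R U)" if x: "x \<in> space S" for x
    proof -
      interpret D: prob_space "distr (distr P R U) borel (g x)" by (rule DU.prob_space_distr[OF gx[OF x]])
      have "q x = (\<integral>y. indicator A y \<partial>distr (distr P R U) borel (g x))" by (simp add: q_def)
      also have "\<dots> = (\<integral>w. indicator A (g x w) \<partial>distr P R U)" by (rule integral_distr[OF gx[OF x]]) measurable
      finally show ?thesis .
    qed
    have q1: "0 \<le> q x" for x by (simp add: q_def)
    have qle: "q x \<le> 1" if x: "x \<in> space S" for x
    proof -
      interpret D: prob_space "distr (distr P R U) borel (g x)" by (rule DU.prob_space_distr[OF gx[OF x]])
      show ?thesis unfolding q_def by (rule D.prob_le_1)
    qed
    have "AE \<omega> in P. real_cond_exp P (generated_algebra P S T) (indicator (X -` A)) \<omega> = q (T \<omega>)"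
    proof (rule G.real_cond_exp_charact[OF _ _ _ qM])
      have iM: "(\<lambda>\<omega>. indicat_real (X -` A) \<omega>) \<in> borel_measurable P"
      proof -
        have "(\<lambda>\<omega>. indicat_real A (X \<omega>)) \<in> borel_measurable P" by measurable
        then show ?thesis by (simp add: indicator_def)
      qed
      show "integrable P (indicat_real (X -` A))"
        by (rule P.integrable_const_bound[where B=1, OF _ iM]) (auto split: split_indicator)
      show "integrable P (\<lambda>\<omega>. q (T \<omega>))"
        by (rule P.integrable_const_bound[where B=1, OF _ qP]) (use q1 qle TS in auto)
      fix B assume "B \<in> sets (generated_algebra P S T)"
      then obtain C where C [measurable]: "C \<in> sets S" and B: "B = T -` C \<inter> space P"
        unfolding generated_algebra_def by (auto simp: sets_vimage_algebra2[OF TS])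
      have "(\<integral>\<omega>\<in>B. indicat_real (X -` A) \<omega> \<partial>P) = (\<integral>\<omega>. indicator C (T \<omega>) * indicator A (g (T \<omega>) (U \<omega>)) \<partial>P)"
        unfolding set_lebesgue_integral_def
        by (rule Bochner_Integration.integral_cong) (auto simp: B X split: split_indicator)
      also have "\<dots> = (\<integral>(x, w). indicator C x * indicator A (g x w) \<partial>distr P (S \<Otimes>\<^sub>M R) (\<lambda>\<omega>. (T \<omega>, U \<omega>)))"
      proof -
        have "(\<lambda>(x, w). indicator C x * indicat_real A (g x w)) \<in> borel_measurable (S \<Otimes>\<^sub>M R)"
          using g by measurable
        from integral_distr[OF TU this] show ?thesis by simp
      qed
      also have "\<dots> = (\<integral>x. (\<integral>w. indicator C x * indicator A (g x w) \<partial>distr P R U) \<partial>distr P S T)"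
        unfolding joint
      proof (rule integral_fst[symmetric])
        have "(\<lambda>(x, w). indicator C x * indicat_real A (g x w)) \<in> borel_measurable (distr P S T \<Otimes>\<^sub>M distr P R U)"
          using g by measurable
        then show "integrable (distr P S T \<Otimes>\<^sub>M distr P R U) (\<lambda>(x, w). indicator C x * indicat_real A (g x w))"
          by (rule J.integrable_const_bound[where B=1, rotated]) (auto split: split_indicator)
      qed
      also have "\<dots> = (\<integral>x. indicator C x * q x \<partial>distr P S T)"
        by (rule Bochner_Integration.integral_cong) (simp_all add: q)
      also have "\<dots> = (\<integral>\<omega>. indicator C (T \<omega>) * q (T \<omega>) \<partial>P)"
      proof (rule integral_distr[OF T])
        have "(\<lambda>x. q x) \<in> borel_measurable S"
          unfolding q_def
          by (rule measurable_compose[OF measurable_prob_algebraD measurable_measure_subprob_algebra[OF A]]) fact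
        then show "(\<lambda>x. indicator C x * q x) \<in> borel_measurable S" by measurable
      qed
      also have "\<dots> = (\<integral>\<omega>\<in>B. q (T \<omega>) \<partial>P)"
        unfolding set_lebesgue_integral_def
        by (rule Bochner_Integration.integral_cong) (auto simp: B split: split_indicator)
      finally show "(\<integral>\<omega>\<in>B. indicat_real (X -` A) \<omega> \<partial>P) = (\<integral>\<omega>\<in>B. q (T \<omega>) \<partial>P)" .
    qed
    then show ?thesis by (simp add: q_def eq_commute)
  qed
  then show ?thesis unfolding regular_cond_distr_def using XM \<kappa>M by simp
qed

text \<open>
  Allows a function \<open>h\<close> of \<open>Y\<close>, since independence is assumed for the whole sequence of items
  while conditioning uses only finitely many of them.
\<close>
lemma distr_Pair_if_indep_set:
  assumes "prob_space P" and Y: "Y \<in> P \<rightarrow>\<^sub>M S'" and U: "U \<in> P \<rightarrow>\<^sub>M R" and h: "h \<in> S' \<rightarrow>\<^sub>M S"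
    and indep: "prob_space.indep_set P (sets (generated_algebra P S' Y)) (sets (generated_algebra P R U))"
  shows "distr P (S \<Otimes>\<^sub>M R) (\<lambda>\<omega>. (h (Y \<omega>), U \<omega>)) = distr P S (\<lambda>\<omega>. h (Y \<omega>)) \<Otimes>\<^sub>M distr P R U"
proof -
  interpret P: prob_space P by fact
  have T: "(\<lambda>\<omega>. h (Y \<omega>)) \<in> P \<rightarrow>\<^sub>M S" by (rule measurable_compose[OF Y h])
  interpret DT: prob_space "distr P S (\<lambda>\<omega>. h (Y \<omega>))" by (rule P.prob_space_distr[OF T])
  interpret DU: prob_space "distr P R U" by (rule P.prob_space_distr[OF U])
  have TU: "(\<lambda>\<omega>. (h (Y \<omega>), U \<omega>)) \<in> P \<rightarrow>\<^sub>M S \<Otimes>\<^sub>M R" by (rule measurable_Pair[OF T U])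
  show ?thesis
  proof (rule pair_measure_eqI[symmetric])
    fix A B assume "A \<in> sets (distr P S (\<lambda>\<omega>. h (Y \<omega>)))" "B \<in> sets (distr P R U)"
    then have A: "A \<in> sets S" and B: "B \<in> sets R" by auto
    let ?a = "(\<lambda>\<omega>. h (Y \<omega>)) -` A \<inter> space P" and ?b = "U -` B \<inter> space P"
    have eq: "?a = Y -` (h -` A \<inter> space S') \<inter> space P" using measurable_space[OF Y] by auto
    have a: "?a \<in> sets (generated_algebra P S' Y)"
      unfolding generated_algebra_def eq by (rule in_vimage_algebra[OF measurable_sets[OF h A]])
    have b: "?b \<in> sets (generated_algebra P R U)"
      unfolding generated_algebra_def using B by (rule in_vimage_algebra)
    have "measure P (?a \<inter> ?b) = measure P ?a * measure P ?b"
      using indep a b unfolding P.indep_sets2_eq by blast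
    moreover have "(\<lambda>\<omega>. (h (Y \<omega>), U \<omega>)) -` (A \<times> B) \<inter> space P = ?a \<inter> ?b" by auto
    ultimately show "emeasure (distr P S (\<lambda>\<omega>. h (Y \<omega>))) A * emeasure (distr P R U) B
        = emeasure (distr P (S \<Otimes>\<^sub>M R) (\<lambda>\<omega>. (h (Y \<omega>), U \<omega>))) (A \<times> B)"
      by (simp add: emeasure_distr[OF T A] emeasure_distr[OF U B] emeasure_distr[OF TU pair_measureI[OF A B]]
          P.emeasure_eq_measure ennreal_mult)
  qed (auto intro: DT.sigma_finite_measure_axioms DU.sigma_finite_measure_axioms sets_pair_measure_cong)
qed

lemma abs_BL_distance_le:
  assumes "\<And>f. f \<in> BL1 \<Longrightarrow> \<bar>(\<integral>x. f x \<partial>K) - (\<integral>x. f x \<partial>L)\<bar> \<le> \<epsilon>"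
  shows "\<bar>BL_distance K L\<bar> \<le> \<epsilon>"
proof -
  have 0: "(\<lambda>_. 0) \<in> BL1" by (simp add: BL1_def)
  have "bdd_above ((\<lambda>f. \<bar>(\<integral>x. f x \<partial>K) - (\<integral>x. f x \<partial>L)\<bar>) ` BL1)" using assms by (intro bdd_aboveI2)
  from cSUP_upper[OF 0 this] have "0 \<le> BL_distance K L" by (simp add: BL_distance_def)
  moreover have "BL_distance K L \<le> \<epsilon>" unfolding BL_distance_def using 0 assms by (intro cSUP_least) auto
  ultimately show ?thesis by simp
qed

text \<open>
  The exponent is lowered to at most three, which costs one in the moment bound because \<open>y powr
  p \<le> 1 + y powr q\<close> for \<open>y \<ge> 0\<close> and \<open>0 < p \<le> q\<close>.
\<close>
lemma exchangeable_law_of_weights: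
  fixes W :: "nat \<Rightarrow> 'w \<Rightarrow> real"
  assumes "prob_space P" and t: "t \<ge> 2"
    and W: "\<And>\<tau>. \<tau> < t \<Longrightarrow> W \<tau> \<in> borel_measurable P"
    and good: "\<And>\<omega>. \<omega> \<in> space P \<Longrightarrow> good_weights t (\<lambda>\<tau>. W \<tau> \<omega>)"
    and exch: "\<And>\<pi>. \<pi> permutes {..<t} \<Longrightarrow>
        distr P (PiM {..<t} (\<lambda>_. borel)) (\<lambda>\<omega>. \<lambda>\<tau>\<in>{..<t}. W (\<pi> \<tau>) \<omega>) =
        distr P (PiM {..<t} (\<lambda>_. borel)) (\<lambda>\<omega>. \<lambda>\<tau>\<in>{..<t}. W \<tau> \<omega>)"
    and \<epsilon>: "\<epsilon> > 0" and C: "C \<ge> 0" and moment: "(\<integral>\<^sup>+\<omega>. ennreal (W 0 \<omega> powr (2 + \<epsilon>)) \<partial>P) \<le> ennreal C"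
  shows "exchangeable_law (distr P (PiM {..<t} (\<lambda>_. borel)) (\<lambda>\<omega>. \<lambda>\<tau>\<in>{..<t}. W \<tau> \<omega>)) t (min \<epsilon> 1) (1 + C)"
proof -
  interpret P: prob_space P by fact
  let ?R = "PiM {..<t} (\<lambda>_. borel :: real measure)" and ?U = "\<lambda>\<omega>. \<lambda>\<tau>\<in>{..<t}. W \<tau> \<omega>"
  have U [measurable]: "?U \<in> P \<rightarrow>\<^sub>M ?R" by (rule measurable_restrict) (simp add: W)
  interpret D: prob_space "distr P ?R ?U" by (rule P.prob_space_distr[OF U])
  have "AE w in distr P ?R ?U. good_weights t w"
  proof (subst AE_distr_iff[OF U])
    show "{w \<in> space ?R. good_weights t w} \<in> sets ?R" using pred_good_weights by simp
    show "AE \<omega> in P. good_weights t (?U \<omega>)" using good by (auto simp: good_weights_def)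
  qed
  then have g: "AE w in distr P ?R ?U. \<forall>\<tau><t. 0 \<le> w \<tau>" "AE w in distr P ?R ?U. (\<Sum>\<tau><t. w \<tau>) = real t"
    by (auto simp: good_weights_def)
  show ?thesis
  proof (intro exchangeable_law.intro exchangeable_law_axioms.intro)
    show "prob_space (distr P ?R ?U)" by unfold_locales
    show "sets (distr P ?R ?U) = sets ?R" by simp
    fix \<pi> :: "nat \<Rightarrow> nat" assume \<pi>: "\<pi> permutes {..<t}"
    have "(\<lambda>w. \<lambda>\<tau>\<in>{..<t}. w (\<pi> \<tau>)) \<in> ?R \<rightarrow>\<^sub>M ?R"
      using permutes_in_image[OF \<pi>] by (intro measurable_restrict measurable_component_singleton) auto
    from distr_distr[OF this U] have "distr (distr P ?R ?U) ?R (\<lambda>w. \<lambda>\<tau>\<in>{..<t}. w (\<pi> \<tau>))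
        = distr P ?R ((\<lambda>w. \<lambda>\<tau>\<in>{..<t}. w (\<pi> \<tau>)) \<circ> ?U)" .
    also have "(\<lambda>w. \<lambda>\<tau>\<in>{..<t}. w (\<pi> \<tau>)) \<circ> ?U = (\<lambda>\<omega>. \<lambda>\<tau>\<in>{..<t}. W (\<pi> \<tau>) \<omega>)"
      using permutes_in_image[OF \<pi>] by (intro ext) (auto simp: restrict_def)
    finally show "distr (distr P ?R ?U) ?R (\<lambda>w. \<lambda>\<tau>\<in>{..<t}. w (\<pi> \<tau>)) = distr P ?R ?U" unfolding exch[OF \<pi>] .
  next
    have [measurable]: "(\<lambda>w. w 0) \<in> borel_measurable ?R" using t by (intro coord_borel) simp
    have [measurable]: "W 0 \<in> borel_measurable P" using t by (intro W) simp
    have "(\<integral>\<^sup>+w. ennreal (w 0 powr (2 + min \<epsilon> 1)) \<partial>distr P ?R ?U) = (\<integral>\<^sup>+\<omega>. ennreal (?U \<omega> 0 powr (2 + min \<epsilon> 1)) \<partial>P)"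
      by (rule nn_integral_distr[OF U]) measurable
    also have "\<dots> \<le> (\<integral>\<^sup>+\<omega>. 1 + ennreal (W 0 \<omega> powr (2 + \<epsilon>)) \<partial>P)"
    proof (rule nn_integral_mono)
      fix \<omega> assume \<omega>: "\<omega> \<in> space P"
      have W0: "W 0 \<omega> \<ge> 0" using good[OF \<omega>] t by (simp add: good_weights_def)
      have "W 0 \<omega> powr (2 + min \<epsilon> 1) \<le> 1 + W 0 \<omega> powr (2 + \<epsilon>)"
      proof (cases "W 0 \<omega> \<le> 1")
        case True
        have "W 0 \<omega> powr (2 + min \<epsilon> 1) \<le> 1 powr (2 + min \<epsilon> 1)" by (rule powr_mono2) (use True W0 \<epsilon> in auto)
        then show ?thesis using powr_ge_zero[of "W 0 \<omega>" "2 + \<epsilon>"] unfolding powr_one_eq_one by linarith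
      next
        case False
        have "W 0 \<omega> powr (2 + min \<epsilon> 1) \<le> W 0 \<omega> powr (2 + \<epsilon>)" by (rule powr_mono) (use False in auto)
        then show ?thesis by simp
      qed
      then have "ennreal (W 0 \<omega> powr (2 + min \<epsilon> 1)) \<le> ennreal (1 + W 0 \<omega> powr (2 + \<epsilon>))" by (rule ennreal_leI)
      also have "\<dots> = 1 + ennreal (W 0 \<omega> powr (2 + \<epsilon>))" by (simp add: ennreal_plus)
      finally show "ennreal (?U \<omega> 0 powr (2 + min \<epsilon> 1)) \<le> 1 + ennreal (W 0 \<omega> powr (2 + \<epsilon>))" using t by simp
    qed
    also have "\<dots> = 1 + (\<integral>\<^sup>+\<omega>. ennreal (W 0 \<omega> powr (2 + \<epsilon>)) \<partial>P)"
      by (subst nn_integral_add) (auto simp: P.emeasure_space_1)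
    also have "\<dots> \<le> 1 + ennreal C" by (rule add_left_mono[OF moment])
    also have "\<dots> = ennreal (1 + C)" using C by (simp add: ennreal_plus)
    finally show "(\<integral>\<^sup>+w. ennreal (w 0 powr (2 + min \<epsilon> 1)) \<partial>distr P ?R ?U) \<le> ennreal (1 + C)" .
  qed (use t \<epsilon> C g in auto)
qed

section \<open>Consistency of the exchangeable bootstrap\<close>

theorem theorem1:
  fixes P :: "'w measure" and M :: "'a measure"
    and s :: "'a \<Rightarrow> real" and v :: "'n::finite \<Rightarrow> 'a \<Rightarrow> real" and b :: "'n \<Rightarrow> real"
    and \<theta> :: "nat \<Rightarrow> 'w \<Rightarrow> 'a" and W :: "nat \<Rightarrow> nat \<Rightarrow> 'w \<Rightarrow> real"
    and \<beta>star :: "real^'n" and c :: real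
  assumes budgets: "\<And>i. b i > 0"
    and v_nonneg: "\<And>i x. x \<in> space M \<Longrightarrow> v i x \<ge> 0"
    and v_integrable: "\<And>i. integrable M (v i)"
    and v_bounded: "\<And>i. bdd_above (v i ` space M)"
    and s_nonneg: "\<And>x. x \<in> space M \<Longrightarrow> s x \<ge> 0"
    and s_bounded: "bdd_above (s ` space M)"
    and s_integral: "has_bochner_integral M s 1"
    and P: "prob_space P"
    and draws: "\<And>\<tau>. distributed P M (\<theta> \<tau>) (\<lambda>x. ennreal (s x))"
    and indep: "prob_space.indep_vars P (\<lambda>_. M) \<theta> UNIV"
    and \<beta>star: "is_arg_min (LFM_H M s v b) (\<lambda>\<beta>. \<beta> \<in> orthant) \<beta>star"
    and C2: "C2_near (\<lambda>\<beta>. real_of_ereal (LFM_H M s v b \<beta>)) \<beta>star"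
    and c_pos: "c > 0"
    and weights: "exchangeable_weights P M \<theta> W c"
  shows "consistently_estimates P
           (\<lambda>t. generated_algebra P (PiM {..<t} (\<lambda>_. M)) (\<lambda>\<omega>. \<lambda>\<tau>\<in>{..<t}. \<theta> \<tau> \<omega>))
           (\<lambda>t \<omega>. sqrt (real t) *\<^sub>R
              (beta_boot v b t (\<lambda>\<tau>. W t \<tau> \<omega>) (\<lambda>\<tau>. \<theta> \<tau> \<omega>) - beta_emp v b t (\<lambda>\<tau>. \<theta> \<tau> \<omega>)))
           (distr (J_LFM M s v b \<beta>star) borel (\<lambda>x. c *\<^sub>R x))"
proof -
  interpret P: prob_space P by (rule P)
  define N where "N = supply_measure M s"
  have setsN [simp, measurable_cong]: "sets N = sets M" and spaceN [simp]: "space N = space M"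
    by (auto simp: N_def supply_measure_def)
  have \<theta>M [measurable]: "\<theta> \<tau> \<in> P \<rightarrow>\<^sub>M M" for \<tau> using draws[of \<tau>] by (rule distributed_measurable)
  have \<theta>N: "distr P M (\<theta> \<tau>) = N" for \<tau>
    unfolding N_def supply_measure_def using draws[of \<tau>] by (rule distributed_distr_eq_density)
  have "prob_space N" using P.prob_space_distr[OF \<theta>M[of 0]] by (simp only: \<theta>N)
  define V where "V = Max (range (\<lambda>i. SUP x\<in>space M. v i x))"
  have vV: "v i x \<le> V" if "x \<in> space M" for i x
  proof -
    have "v i x \<le> (SUP x\<in>space M. v i x)" by (rule cSUP_upper[OF that v_bounded])
    also have "\<dots> \<le> V" unfolding V_def by (rule Max_ge) auto
    finally show ?thesis .
  qed
  have limit: "fisher_limit N v b \<beta>star V"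
  proof (intro fisher_limit.intro fisher_limit_axioms.intro)
    show "v i \<in> borel_measurable N" for i
      using borel_measurable_integrable[OF v_integrable[of i]] by (simp add: measurable_cong_sets[OF setsN refl])
    show "is_arg_min (\<lambda>\<beta>. ext_expectation N (\<lambda>x. LFM_F v b x \<beta>)) (\<lambda>\<beta>. \<beta> \<in> orthant) \<beta>star"
      using \<beta>star unfolding LFM_H_def N_def .
    show "C2_near (\<lambda>\<beta>. real_of_ereal (ext_expectation N (\<lambda>x. LFM_F v b x \<beta>))) \<beta>star"
      using C2 unfolding LFM_H_def N_def .
  qed (use budgets v_nonneg vV \<open>prob_space N\<close> in auto)

  let ?R = "\<lambda>t. PiM {..<t} (\<lambda>_. borel :: real measure)" and ?S = "\<lambda>t. PiM {..<t} (\<lambda>_. M)"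
  define U where "U t \<omega> = (\<lambda>\<tau>\<in>{..<t}. W t \<tau> \<omega>)" for t \<omega>
  define T where "T t \<omega> = (\<lambda>\<tau>\<in>{..<t}. \<theta> \<tau> \<omega>)" for t \<omega>
  define \<nu> where "\<nu> t = distr P (?R t) (U t)" for t
  have wM: "W t \<tau> \<in> borel_measurable P" if "t \<ge> 1" "\<tau> < t" for t \<tau>
    using weights that unfolding exchangeable_weights_def by blast
  have wI: "P.indep_set (sets (generated_algebra P (PiM UNIV (\<lambda>_. M)) (\<lambda>\<omega> \<tau>. \<theta> \<tau> \<omega>))) (sets (generated_algebra P (?R t) (U t)))"
    if "t \<ge> 1" for t
    using weights that unfolding exchangeable_weights_def U_def[abs_def] by blast
  have wX: "distr P (?R t) (\<lambda>\<omega>. \<lambda>\<tau>\<in>{..<t}. W t (\<pi> \<tau>) \<omega>) = distr P (?R t) (\<lambda>\<omega>. \<lambda>\<tau>\<in>{..<t}. W t \<tau> \<omega>)"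
    if "t \<ge> 1" "\<pi> permutes {..<t}" for t \<pi>
    using weights that unfolding exchangeable_weights_def by blast
  have wG: "good_weights t (\<lambda>\<tau>. W t \<tau> \<omega>)" if "t \<ge> 1" "\<omega> \<in> space P" for t \<omega>
    using weights that unfolding exchangeable_weights_def good_weights_def by blast
  have "\<exists>\<epsilon>>0. (SUP t\<in>{1..}. \<integral>\<^sup>+\<omega>. ennreal (W t 0 \<omega> powr (2 + \<epsilon>)) \<partial>P) < \<infinity>"
    using weights unfolding exchangeable_weights_def by blast
  then obtain \<epsilon> where \<epsilon>: "\<epsilon> > 0" and fin: "(SUP t\<in>{1..}. \<integral>\<^sup>+\<omega>. ennreal (W t 0 \<omega> powr (2 + \<epsilon>)) \<partial>P) < \<infinity>" by blast
  define C where "C = enn2real (SUP t\<in>{1..}. \<integral>\<^sup>+\<omega>. ennreal (W t 0 \<omega> powr (2 + \<epsilon>)) \<partial>P)"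
  have C: "C \<ge> 0" "(\<integral>\<^sup>+\<omega>. ennreal (W t 0 \<omega> powr (2 + \<epsilon>)) \<partial>P) \<le> ennreal C" if "t \<ge> 1" for t
  proof -
    show "C \<ge> 0" by (simp add: C_def)
    have "(\<integral>\<^sup>+\<omega>. ennreal (W t 0 \<omega> powr (2 + \<epsilon>)) \<partial>P) \<le> (SUP t\<in>{1..}. \<integral>\<^sup>+\<omega>. ennreal (W t 0 \<omega> powr (2 + \<epsilon>)) \<partial>P)"
      by (rule SUP_upper) (use that in simp)
    also have "\<dots> = ennreal C" unfolding C_def using fin by simp
    finally show "(\<integral>\<^sup>+\<omega>. ennreal (W t 0 \<omega> powr (2 + \<epsilon>)) \<partial>P) \<le> ennreal C" .
  qed
  have wV: "converges_in_prob P (\<lambda>t \<omega>. 1 / real t * (\<Sum>\<tau><t. (W t \<tau> \<omega> - 1)\<^sup>2)) (c\<^sup>2)"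
    using weights unfolding exchangeable_weights_def by blast
  have TM [measurable]: "T t \<in> P \<rightarrow>\<^sub>M ?S t" for t
    unfolding T_def[abs_def] by (rule measurable_restrict) measurable
  have UM: "U t \<in> P \<rightarrow>\<^sub>M ?R t" if "t \<ge> 1" for t
    unfolding U_def[abs_def] by (rule measurable_restrict) (use wM that in auto)

  have boot: "fisher_bootstrap N v b \<beta>star V \<nu> c (min \<epsilon> 1) (1 + C)"
  proof (intro fisher_bootstrap.intro fisher_bootstrap_axioms.intro limit)
    fix t :: nat assume t: "t \<ge> 2"
    then have t1: "t \<ge> 1" by simp
    show "exchangeable_law (\<nu> t) t (min \<epsilon> 1) (1 + C)"
      unfolding \<nu>_def U_def[abs_def]
      by (rule exchangeable_law_of_weights[OF P t wM[OF t1] wG[OF t1] wX[OF t1] \<epsilon> C[OF t1]])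
  next
    fix \<eta> :: real assume \<eta>: "\<eta> > 0"
    show "(\<lambda>t. measure (\<nu> t) {w \<in> space (\<nu> t). \<bar>1 / real t * (\<Sum>\<tau><t. (w \<tau> - 1)\<^sup>2) - c\<^sup>2\<bar> > \<eta>}) \<longlonglongrightarrow> 0"
    proof (rule tendstoI)
      fix r :: real assume r: "r > 0"
      have "\<forall>\<^sub>F t in sequentially. \<exists>A\<in>sets P.
          {\<omega> \<in> space P. \<bar>1 / real t * (\<Sum>\<tau><t. (W t \<tau> \<omega> - 1)\<^sup>2) - c\<^sup>2\<bar> > \<eta>} \<subseteq> A \<and> measure P A < r"
        using wV \<eta> r unfolding converges_in_prob_def by blast
      then show "\<forall>\<^sub>F t in sequentially.
          dist (measure (\<nu> t) {w \<in> space (\<nu> t). \<bar>1 / real t * (\<Sum>\<tau><t. (w \<tau> - 1)\<^sup>2) - c\<^sup>2\<bar> > \<eta>}) 0 < r"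
        using eventually_ge_at_top[of 1]
      proof eventually_elim
        case (elim t)
        then obtain A where A: "A \<in> sets P" "measure P A < r"
          "{\<omega> \<in> space P. \<bar>1 / real t * (\<Sum>\<tau><t. (W t \<tau> \<omega> - 1)\<^sup>2) - c\<^sup>2\<bar> > \<eta>} \<subseteq> A" by blast
        define B where "B = {w \<in> space (\<nu> t). \<bar>1 / real t * (\<Sum>\<tau><t. (w \<tau> - 1)\<^sup>2) - c\<^sup>2\<bar> > \<eta>}"
        note [measurable] = coord_borel
        have "{w \<in> space (?R t). \<bar>1 / real t * (\<Sum>\<tau><t. (w \<tau> - 1)\<^sup>2) - c\<^sup>2\<bar> > \<eta>} \<in> sets (?R t)" by measurable
        then have BM: "B \<in> sets (?R t)" by (simp add: B_def \<nu>_def)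
        have "measure (\<nu> t) B = measure P (U t -` B \<inter> space P)" unfolding \<nu>_def by (rule measure_distr[OF UM[OF elim(2)] BM])
        also have "\<dots> \<le> measure P A"
        proof (rule P.finite_measure_mono[OF _ A(1)])
          have "(\<Sum>\<tau><t. (U t \<omega> \<tau> - 1)\<^sup>2) = (\<Sum>\<tau><t. (W t \<tau> \<omega> - 1)\<^sup>2)" for \<omega> by (rule sum.cong) (auto simp: U_def)
          then show "U t -` B \<inter> space P \<subseteq> A" using A(3) by (auto simp: B_def)
        qed
        finally show ?case using A(2) by (simp add: B_def)
      qed
    qed
  qed
  interpret F: fisher_bootstrap N v b \<beta>star V \<nu> c "min \<epsilon> 1" "1 + C" by (rule boot)
  have L: "F.limit_law = distr (J_LFM M s v b \<beta>star) borel (\<lambda>x. c *\<^sub>R x)"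
  proof -
    have "LFM_hessian M s v b \<beta>star = F.Hess" unfolding LFM_hessian_def F.Hess_def LFM_H_def by (simp only: N_def)
    moreover have "LFM_grad_moment M s v b \<beta>star = F.score_moment"
      unfolding LFM_grad_moment_def F.score_moment_def N_def[symmetric] F.LFM_grad_moment_eq ..
    ultimately show ?thesis unfolding F.limit_law_def F.limit_cov_def J_LFM_def by simp
  qed

  have T_law: "distr P (?S t) (T t) = F.\<mu> t" if "t \<ge> 1" for t
  proof -
    have "P.indep_vars (\<lambda>_. M) \<theta> {..<t}" by (rule P.indep_vars_subset[OF indep]) simp
    then have "distr P (?S t) (T t) = (\<Pi>\<^sub>M \<tau>\<in>{..<t}. distr P M (\<theta> \<tau>))"
      unfolding T_def[abs_def] by (subst (asm) P.indep_vars_iff_distr_eq_PiM) (use that in \<open>auto simp: lessThan_empty_iff\<close>)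
    then show ?thesis by (simp only: \<theta>N)
  qed
  have joint: "distr P (?S t \<Otimes>\<^sub>M ?R t) (\<lambda>\<omega>. (T t \<omega>, U t \<omega>)) = distr P (?S t) (T t) \<Otimes>\<^sub>M distr P (?R t) (U t)" if t: "t \<ge> 1" for t
  proof -
    have \<Theta>M: "(\<lambda>\<omega> \<tau>. \<theta> \<tau> \<omega>) \<in> P \<rightarrow>\<^sub>M PiM UNIV (\<lambda>_. M)" by (rule measurable_PiM_single') (auto simp: space_PiM intro: measurable_space[OF \<theta>M])
    show ?thesis
      using distr_Pair_if_indep_set[OF P \<Theta>M UM[OF t] measurable_restrict_subset[of "{..<t}" UNIV "\<lambda>_. M"] wI[OF t]]
      by (simp add: T_def[abs_def])
  qed

  \<comment> \<open>The conditional law given the data: the law of the error over the weights with the data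
  frozen. At \<open>t = 0\<close> the error is zero.\<close>
  define \<kappa> where "\<kappa> t \<omega> = (if t = 0 then return borel 0 else distr (\<nu> t) borel (F.boot_error t (T t \<omega>)))" for t \<omega>
  have "regular_cond_distr P (generated_algebra P (?S t) (T t))
      (\<lambda>\<omega>. sqrt (real t) *\<^sub>R (beta_boot v b t (\<lambda>\<tau>. W t \<tau> \<omega>) (\<lambda>\<tau>. \<theta> \<tau> \<omega>) - beta_emp v b t (\<lambda>\<tau>. \<theta> \<tau> \<omega>))) (\<kappa> t)" for t
  proof (cases "t = 0")
    case True
    have "regular_cond_distr P (generated_algebra P (?S t) (T t)) (\<lambda>_. 0 :: real^'n) (\<lambda>_. return borel 0)"
      by (rule regular_cond_distr_const[OF P TM])
    then show ?thesis using True by (simp add: \<kappa>_def[abs_def])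
  next
    case False
    then have t: "t \<ge> 1" "t > 0" by auto
    have "regular_cond_distr P (generated_algebra P (?S t) (T t))
      (\<lambda>\<omega>. sqrt (real t) *\<^sub>R (beta_boot v b t (\<lambda>\<tau>. W t \<tau> \<omega>) (\<lambda>\<tau>. \<theta> \<tau> \<omega>) - beta_emp v b t (\<lambda>\<tau>. \<theta> \<tau> \<omega>)))
      (\<lambda>\<omega>. distr (distr P (?R t) (U t)) borel (F.boot_error t (T t \<omega>)))"
    proof (rule regular_cond_distr_independent[OF P TM UM[OF t(1)] joint[OF t(1)]])
      have "sets (F.\<mu> t \<Otimes>\<^sub>M ?R t) = sets (?S t \<Otimes>\<^sub>M ?R t)"
        by (intro sets_pair_measure_cong sets_PiM_cong) auto
      then show "(\<lambda>(x, w). F.boot_error t x w) \<in> borel_measurable (?S t \<Otimes>\<^sub>M ?R t)"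
        using F.boot_error_measurable[OF t(2)] measurable_cong_sets by blast
      fix \<omega> assume \<omega>: "\<omega> \<in> space P"
      have "good_weights t (U t \<omega>)" using wG[OF t(1) \<omega>] by (simp add: good_weights_def U_def)
      then have 1: "beta_boot v b t (F.clip t (U t \<omega>)) (T t \<omega>) = beta_boot v b t (\<lambda>\<tau>. W t \<tau> \<omega>) (\<lambda>\<tau>. \<theta> \<tau> \<omega>)"
        by (intro beta_boot_cong) (auto simp: F.clip_def U_def T_def)
      have 2: "beta_emp v b t (T t \<omega>) = beta_emp v b t (\<lambda>\<tau>. \<theta> \<tau> \<omega>)"
        unfolding beta_emp_eq_beta_boot by (rule beta_boot_cong) (auto simp: T_def)
      show "sqrt (real t) *\<^sub>R (beta_boot v b t (\<lambda>\<tau>. W t \<tau> \<omega>) (\<lambda>\<tau>. \<theta> \<tau> \<omega>) - beta_emp v b t (\<lambda>\<tau>. \<theta> \<tau> \<omega>)) = F.boot_error t (T t \<omega>) (U t \<omega>)"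
        unfolding F.boot_error_def 1 2 ..
    qed
    then show ?thesis using False by (simp add: \<kappa>_def[abs_def] \<nu>_def)
  qed
  moreover have "converges_in_prob P (\<lambda>t \<omega>. BL_distance (\<kappa> t \<omega>) F.limit_law) 0"
    unfolding converges_in_prob_def
  proof (intro allI impI)
    fix \<epsilon>' \<delta> :: real assume "\<epsilon>' > 0" "\<delta> > 0"
    from F.boot_law_close[OF this] eventually_ge_at_top[of 1]
    show "\<forall>\<^sub>F t in sequentially. \<exists>A\<in>sets P. {\<omega> \<in> space P. \<bar>BL_distance (\<kappa> t \<omega>) F.limit_law - 0\<bar> > \<epsilon>'} \<subseteq> A \<and> measure P A < \<delta>"
    proof eventually_elim
      case (elim t)
      then obtain A where A: "A \<in> sets (F.\<mu> t)" "measure (F.\<mu> t) A < \<delta>"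
        and close: "\<And>x f. x \<in> space (F.\<mu> t) - A \<Longrightarrow> f \<in> BL1 \<Longrightarrow>
          \<bar>(\<integral>y. f y \<partial>distr (\<nu> t) borel (F.boot_error t x)) - (\<integral>y. f y \<partial>F.limit_law)\<bar> \<le> \<epsilon>'" by blast
      have AS: "A \<in> sets (?S t)" using A(1) sets_PiM_cong[of "{..<t}" "{..<t}" "\<lambda>_. N" "\<lambda>_. M"] by simp
      have "measure P (T t -` A \<inter> space P) < \<delta>"
        using A(2) unfolding T_law[OF elim(2), symmetric] measure_distr[OF TM AS] .
      moreover have "T t -` A \<inter> space P \<in> sets P" by (rule measurable_sets[OF TM AS])
      moreover have "\<bar>BL_distance (\<kappa> t \<omega>) F.limit_law\<bar> \<le> \<epsilon>'" if "\<omega> \<in> space P" "T t \<omega> \<notin> A" for \<omega>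
      proof (rule abs_BL_distance_le)
        fix f :: "real^'n \<Rightarrow> real" assume f: "f \<in> BL1"
        have "T t \<omega> \<in> space (F.\<mu> t)" using measurable_space[OF TM that(1), of t] by (simp add: space_PiM)
        then show "\<bar>(\<integral>y. f y \<partial>\<kappa> t \<omega>) - (\<integral>y. f y \<partial>F.limit_law)\<bar> \<le> \<epsilon>'"
          using close[of "T t \<omega>" f] that(2) f elim(2) by (simp add: \<kappa>_def)
      qed
      ultimately show ?case by (intro bexI[of _ "T t -` A \<inter> space P"]) force+
    qed
  qed
  ultimately show ?thesis
    unfolding consistently_estimates_def L T_def[abs_def] by blast
qed

end
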